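(* Let $x_1,\dots,x_n\in\mathbb R^d$ be distinct points, let $k$ be a positive definite kernel function on $\mathbb R^d$, let $K(\varepsilon)=[k(\varepsilon x_i,\varepsilon x_l)]_{i,l=1}^n$, and suppose that one of the following holds. (S) (smooth case) $p$ is the smallest integer with $\mathrm{rank}\,V_{\le p}=n$; either $k(x,y)=\psi(\|x-y\|)$ is radial with $\psi$ analytic at $0$ and regularity index $r\ge p+1$ ($r=\infty$ allowed), or $k\in\mathcal C^{p+1,p+1}$ and $K(\varepsilon)$ is analytic near $0$; and $j\le p$. (F) (finitely smooth case) $k(x,y)=\psi(\|x-y\|)$ is radial with $\psi$ analytic at $0$ and finite regularity index $r$; $\mathrm{rank}\,V_{\le r-1}<n$; and $j\le r-1$. Let $Q_i$, $R_{i,i}$ come from the block QR factorisation of $V_{\le p}$ in case (S), of $V_{\le r-1}$ in case (F). Then: 1. If $V_{\le j}$ is column-rank deficient ($\mathrm{rank}\,V_{\le j}<\mathcal P_{j,d}$) but $V_{\le j-1}$ has full column rank $\mathcal P_{j-1,d}$, then there are $\mathrm{rank}\,V_{\le j}-\mathcal P_{j-1,d}$ eigenvalues of $K(\varepsilon)$ of order $\varepsilon^{2j}$, and the corresponding term (coefficient of $\varepsilon^{2j}$) of the asymptotic spectral equivalent of $K$ is $$Q_jS_jQ_j^T=Q_jQ_j^TV_j\left(W_{j,j}-W_{j,<j}(W_{<j,<j})^{-1}W_{<j,j}\right)V_j^TQ_jQ_j^T .$$ 2. If $V_{\le j}$ and $V_{\le j-1}$ are both rank deficient ($\mathrm{rank}\,V_{\le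 j}<\mathcal P_{j,d}$ and $\mathrm{rank}\,V_{\le j-1}<\mathcal P_{j-1,d}$), then there are $\mathrm{rank}\,V_{\le j}-\mathrm{rank}\,V_{\le j-1}$ eigenvalues of $K(\varepsilon)$ of order $\varepsilon^{2j}$, and the matrix $S_j$ in the corresponding term $Q_jS_jQ_j^T$ of the asymptotic spectral equivalent is obtained as the Schur complement, with respect to the last block, of $$H=\begin{pmatrix}R_{0,0}W_{0,0}R_{0,0}^T&\cdots&R_{0,0}W_{0,j}R_{j,j}^T\\ \vdots&&\vdots\\ R_{j,j}W_{j,0}R_{0,0}^T&\cdots&R_{j,j}W_{j,j}R_{j,j}^T\end{pmatrix},$$ i.e. $S_j=H_{j,j}-H_{j,<j}(H_{<j,<j})^{-1}H_{<j,j}$ in the block notation $H_{i,l}=R_{i,i}W_{i,l}R_{l,l}^T$.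
   Context: Vandermonde matrices: for $\alpha\in\mathbb N^d$, $x^\alpha=\prod x_i^{\alpha_i}$, $|\alpha|=\sum\alpha_i$, $\alpha!=\prod\alpha_i!$. $V_s=[x_i^{\alpha}]_{1\le i\le n,\,|\alpha|=s}$, $V_{\le s}=(V_0\cdots V_s)$ (fixed monomial ordering in each degree), $\mathcal H_{s,d}=\binom{s+d-1}{d-1}$ and $\mathcal P_{s,d}=\binom{s+d}{d}$ are the numbers of columns of $V_s$ and $V_{\le s}$; $\mathrm{rank}\,V_{\le-1}=0$. (Since $V_{\le0}$ is a column of ones, both cases force $j\ge1$.) Kernels: a positive definite kernel is a symmetric function on $\mathbb R^d\times\mathbb R^d$ whose kernel matrices at finitely many distinct points are positive definite. For a radial kernel with $\psi(s)=\sum_m\psi_ms^m$, the regularity index $r$ is the integer with $\psi_{2r-1}\ne0$ and $\psi_{2c-1}=0$ for all $1\le c<r$ ($r=\infty$ if all odd coefficients vanish); $K(\varepsilon)=[\psi(\varepsilon\|x_i-x_l\|)]$ is regarded as analytic in $\varepsilon$ via the power series of $\psi$. $k\in\mathcal C^{q,q}$ means that all $\partial_x^\alpha\partial_y^\beta k$ with $|\alpha|,|\beta|\le q$ exist and are continuous near $(0,0)$. Wronskian: $W_{i,l}=\left[\frac{1}{\alpha!\beta!}\partial_x^\alpha\partial_y^\beta k(x,y)|_{x=y=0}\right]_{|\alpha|=i,|\beta|=l}$ (ordering as in $V_i,V_l$). For a symmetric block matrix $M=(M_{i,l})$: $M_{<j,<j}=(M_{i,l})_{i,l<j}$, $M_{j,<j}=(M_{j,0}\cdots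 M_{j,j-1})$, $M_{<j,j}=M_{j,<j}^T$. In both parts $S_j$ is the $j$-th Schur complement of the matrix with blocks $R_{i,i}W_{i,l}R_{l,l}^T$. Block QR of $V_{\le m}$: with $b_i=\mathrm{rank}\,V_{\le i}-\mathrm{rank}\,V_{\le i-1}$, $V_{\le m}=QR$, $Q=(Q_0\cdots Q_m)$ with orthonormal columns, $Q_i\in\mathbb R^{n\times b_i}$, $R$ block upper triangular with blocks $R_{i,l}\in\mathbb R^{b_i\times\mathcal H_{l,d}}$. Spectral asymptotics: for a real symmetric $K(\varepsilon)$ analytic near $0$, take analytic eigenvalues $\lambda_k(\varepsilon)$ and analytic orthonormal eigenvectors $u_k(\varepsilon)$ (Rellich). If $\lambda_k\not\equiv0$, write $\lambda_k=\varepsilon^{a}(\tilde\lambda_k+O(\varepsilon))$, $\tilde\lambda_k\ne0$: $\lambda_k$ is of order $\varepsilon^a$ and $\mathrm{lt}(\lambda_k)=\tilde\lambda_k\varepsilon^a$; if $\lambda_k\equiv0$, $\mathrm{lt}(\lambda_k)=0$. The asymptotic spectral equivalent is $\underline K(\varepsilon)=\sum_k\mathrm{lt}(\lambda_k)(\varepsilon)\,u_k(0)u_k(0)^T$.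
   Formalization: In case (S) H_{<j,<j} (in part 1 equivalently W_{<j,<j}) is assumed invertible, so that S_j is defined, and the eigenvalue counts are claimed only when S_j is invertible; otherwise they can fail, e.g. for k = exp(x·y) − x_1y_1 at (0,0),(1,0),(2,0), j = 1. *)

theory Defs
  imports
    "HOL-Analysis.Analysis"
    "HOL-Library.Landau_Symbols"
    "HOL-Library.Extended_Nat"
    "HOL-Computational_Algebra.Polynomial"
    "Jordan_Normal_Form.Matrix"
    "Jordan_Normal_Form.Gauss_Jordan_Elimination"
    "Jordan_Normal_Form.DL_Rank"
begin

text \<open>
  Matrices and vectors whose sizes depend on natural numbers are those of Jordan_Normal_Form;
  the ambient space of the points is \<open>real ^ 'd\<close>. Indices of points, blocks, rows and columns start
  at 0. The infix index syntax of the finite Cartesian products is switched off, so that it always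
  refers to Jordan_Normal_Form vectors.
\<close>

unbundle no vec_syntax

section \<open>Block matrices\<close>

definition block_indices :: "(nat \<Rightarrow> nat) \<Rightarrow> nat list \<Rightarrow> (nat \<times> nat) list" where
  "block_indices s I = concat (map (\<lambda>i. map (Pair i) [0..<s i]) I)"

text \<open>
  The matrix assembled from the blocks \<open>M i l\<close> with \<open>i\<close> from the list \<open>I\<close> and \<open>l\<close> from the list \<open>J\<close>,
  where \<open>M i l\<close> has size \<open>r i \<times> c l\<close>.
\<close>

definition block_mat ::
  "(nat \<Rightarrow> nat) \<Rightarrow> (nat \<Rightarrow> nat) \<Rightarrow> nat list \<Rightarrow> nat list \<Rightarrow> (nat \<Rightarrow> nat \<Rightarrow> 'a mat) \<Rightarrow> 'a mat" where
  "block_mat r c I J M =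
     (let is = block_indices r I; js = block_indices c J
      in Matrix.mat (length is) (length js)
           (\<lambda>(a, b). M (fst (is ! a)) (fst (js ! b)) $$ (snd (is ! a), snd (js ! b))))"

definition block_row :: "nat \<Rightarrow> (nat \<Rightarrow> nat) \<Rightarrow> nat list \<Rightarrow> (nat \<Rightarrow> 'a mat) \<Rightarrow> 'a mat" where
  "block_row n c J A = block_mat (\<lambda>_. n) c [0] J (\<lambda>_. A)"

text \<open>
  \<open>M\<^bsub><j,<j\<^esub>\<close>, \<open>M\<^bsub>j,<j\<^esub>\<close> and \<open>M\<^bsub><j,j\<^esub>\<close> for a symmetric block matrix with block sizes \<open>s\<close>.
\<close>

definition lead_blocks :: "(nat \<Rightarrow> nat) \<Rightarrow> (nat \<Rightarrow> nat \<Rightarrow> 'a mat) \<Rightarrow> nat \<Rightarrow> 'a mat" where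
  "lead_blocks s M j = block_mat s s [0..<j] [0..<j] M"

definition left_blocks :: "(nat \<Rightarrow> nat) \<Rightarrow> (nat \<Rightarrow> nat \<Rightarrow> 'a mat) \<Rightarrow> nat \<Rightarrow> 'a mat" where
  "left_blocks s M j = block_mat s s [j] [0..<j] M"

definition upper_blocks :: "(nat \<Rightarrow> nat) \<Rightarrow> (nat \<Rightarrow> nat \<Rightarrow> 'a mat) \<Rightarrow> nat \<Rightarrow> 'a mat" where
  "upper_blocks s M j = transpose_mat (left_blocks s M j)"

text \<open>Only meaningful for invertible matrices: otherwise the result is \<open>the None\<close>.\<close>

definition inv_mat :: "'a :: field mat \<Rightarrow> 'a mat" where
  "inv_mat A = the (mat_inverse A)"

definition schur_complement :: "(nat \<Rightarrow> nat) \<Rightarrow> (nat \<Rightarrow> nat \<Rightarrow> 'a :: field mat) \<Rightarrow> nat \<Rightarrow> 'a mat" where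
  "schur_complement s M j =
     M j j - left_blocks s M j * inv_mat (lead_blocks s M j) * upper_blocks s M j"

section \<open>Vandermonde matrices\<close>

text \<open>
  A multi-index is a function \<open>'d \<Rightarrow> nat\<close>. The list \<open>mons s\<close> enumerates the multi-indices of degree
  \<open>s\<close>; this is the fixed ordering of the monomials of each degree, and \<open>length (mons s)\<close> is
  \<open>(s + d - 1) choose (d - 1)\<close>.
\<close>

definition monomial_ordering :: "(nat \<Rightarrow> ('d :: finite \<Rightarrow> nat) list) \<Rightarrow> bool" where
  "monomial_ordering mons \<longleftrightarrow>
     (\<forall>s. distinct (mons s) \<and> set (mons s) = {\<alpha>. (\<Sum>i\<in>UNIV. \<alpha> i) = s})"

definition monomial :: "('d :: finite \<Rightarrow> nat) \<Rightarrow> real ^ 'd \<Rightarrow> real" where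
  "monomial \<alpha> z = (\<Prod>i\<in>UNIV. vec_nth z i ^ \<alpha> i)"

definition vandermonde ::
  "(nat \<Rightarrow> ('d :: finite \<Rightarrow> nat) list) \<Rightarrow> nat \<Rightarrow> (nat \<Rightarrow> real ^ 'd) \<Rightarrow> nat \<Rightarrow> real mat" where
  "vandermonde mons n x s =
     Matrix.mat n (length (mons s)) (\<lambda>(i, c). monomial (mons s ! c) (x i))"

definition vandermonde_le ::
  "(nat \<Rightarrow> ('d :: finite \<Rightarrow> nat) list) \<Rightarrow> nat \<Rightarrow> (nat \<Rightarrow> real ^ 'd) \<Rightarrow> nat \<Rightarrow> real mat" where
  "vandermonde_le mons n x s =
     block_row n (\<lambda>l. length (mons l)) [0..<Suc s] (vandermonde mons n x)"

definition vrank ::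
  "(nat \<Rightarrow> ('d :: finite \<Rightarrow> nat) list) \<Rightarrow> nat \<Rightarrow> (nat \<Rightarrow> real ^ 'd) \<Rightarrow> nat \<Rightarrow> nat" where
  "vrank mons n x s = vec_space.rank n (vandermonde_le mons n x s)"

definition rank_jump ::
  "(nat \<Rightarrow> ('d :: finite \<Rightarrow> nat) list) \<Rightarrow> nat \<Rightarrow> (nat \<Rightarrow> real ^ 'd) \<Rightarrow> nat \<Rightarrow> nat" where
  "rank_jump mons n x i = vrank mons n x i - (if i = 0 then 0 else vrank mons n x (i - 1))"

definition poly_dim :: "'d :: finite itself \<Rightarrow> nat \<Rightarrow> nat" where
  "poly_dim _ s = (s + CARD('d)) choose CARD('d)"

definition block_QR ::
  "(nat \<Rightarrow> ('d :: finite \<Rightarrow> nat) list) \<Rightarrow> nat \<Rightarrow> (nat \<Rightarrow> real ^ 'd) \<Rightarrow> nat \<Rightarrow>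
   (nat \<Rightarrow> real mat) \<Rightarrow> (nat \<Rightarrow> nat \<Rightarrow> real mat) \<Rightarrow> bool" where
  "block_QR mons n x m Q R \<longleftrightarrow>
     (let b = rank_jump mons n x; h = (\<lambda>l. length (mons l));
          Qm = block_row n b [0..<Suc m] Q;
          Rm = block_mat b h [0..<Suc m] [0..<Suc m] R
      in (\<forall>i\<le>m. Q i \<in> carrier_mat n (b i)) \<and>
         (\<forall>i\<le>m. \<forall>l\<le>m. R i l \<in> carrier_mat (b i) (h l)) \<and>
         (\<forall>i\<le>m. \<forall>l<i. R i l = 0\<^sub>m (b i) (h l)) \<and>
         transpose_mat Qm * Qm = 1\<^sub>m (dim_col Qm) \<and>
         vandermonde_le mons n x m = Qm * Rm)"

section \<open>Kernels\<close>

definition positive_definite_mat :: "real mat \<Rightarrow> bool" where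
  "positive_definite_mat A \<longleftrightarrow>
     square_mat A \<and> transpose_mat A = A \<and>
     (\<forall>v \<in> carrier_vec (dim_row A). v \<noteq> 0\<^sub>v (dim_row A) \<longrightarrow> v \<bullet> (A *\<^sub>v v) > 0)"

definition kernel_mat :: "nat \<Rightarrow> (nat \<Rightarrow> 'a) \<Rightarrow> ('a \<Rightarrow> 'a \<Rightarrow> real) \<Rightarrow> real mat" where
  "kernel_mat n x k = Matrix.mat n n (\<lambda>(i, l). k (x i) (x l))"

definition positive_definite_kernel :: "('a \<Rightarrow> 'a \<Rightarrow> real) \<Rightarrow> bool" where
  "positive_definite_kernel k \<longleftrightarrow>
     (\<forall>x y. k x y = k y x) \<and>
     (\<forall>n x. inj_on x {..<n} \<longrightarrow> positive_definite_mat (kernel_mat n x k))"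

definition power_series_at_0 :: "(real \<Rightarrow> real) \<Rightarrow> (nat \<Rightarrow> real) \<Rightarrow> bool" where
  "power_series_at_0 f c \<longleftrightarrow> (\<exists>\<delta>>0. \<forall>s. \<bar>s\<bar> < \<delta> \<longrightarrow> (\<lambda>m. c m * s ^ m) sums f s)"

definition analytic_at_0 :: "(real \<Rightarrow> real) \<Rightarrow> bool" where
  "analytic_at_0 f \<longleftrightarrow> (\<exists>c. power_series_at_0 f c)"

definition regularity_index :: "(nat \<Rightarrow> real) \<Rightarrow> enat" where
  "regularity_index c =
     (if \<exists>r\<ge>1. c (2 * r - 1) \<noteq> 0 then enat (LEAST r. 1 \<le> r \<and> c (2 * r - 1) \<noteq> 0) else \<infinity>)"

text \<open>
  A radial kernel with profile \<open>\<psi>\<close>, Taylor coefficients \<open>c\<close>. The kernel only involves \<open>\<psi>\<close> on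
  the nonnegative reals; the values of \<open>\<psi>\<close> at small negative arguments are those of its power series,
  so that \<open>\<psi> (\<epsilon> * norm (x i - x l))\<close> is analytic in \<open>\<epsilon>\<close>, and equals \<open>k (\<epsilon> x i) (\<epsilon> x l)\<close> for \<open>\<epsilon> \<ge> 0\<close>.
\<close>

definition radial_kernel ::
  "(real ^ 'd :: finite \<Rightarrow> real ^ 'd \<Rightarrow> real) \<Rightarrow> (real \<Rightarrow> real) \<Rightarrow> (nat \<Rightarrow> real) \<Rightarrow> bool" where
  "radial_kernel k \<psi> c \<longleftrightarrow>
     (\<forall>x y. k x y = \<psi> (norm (x - y))) \<and> power_series_at_0 \<psi> c"

definition radial_kernel_mat :: "nat \<Rightarrow> (nat \<Rightarrow> real ^ 'd :: finite) \<Rightarrow> (real \<Rightarrow> real) \<Rightarrow> real \<Rightarrow> real mat" where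
  "radial_kernel_mat n x \<psi> \<epsilon> = Matrix.mat n n (\<lambda>(i, l). \<psi> (\<epsilon> * norm (x i - x l)))"

section \<open>Partial derivatives and the Wronskian\<close>

text \<open>Iterated derivatives along a list of directions; the last direction is applied first.\<close>

fun iter_deriv :: "'a :: real_normed_vector list \<Rightarrow> ('a \<Rightarrow> real) \<Rightarrow> 'a \<Rightarrow> real" where
  "iter_deriv [] f = f"
| "iter_deriv (b # bs) f = (\<lambda>z. deriv (\<lambda>t. iter_deriv bs f (z + t *\<^sub>R b)) 0)"

fun iter_deriv_exists :: "'a :: real_normed_vector set \<Rightarrow> 'a list \<Rightarrow> ('a \<Rightarrow> real) \<Rightarrow> bool" where
  "iter_deriv_exists U [] f = True"
| "iter_deriv_exists U (b # bs) f =
     (iter_deriv_exists U bs f \<and>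
      (\<forall>z\<in>U. (\<lambda>t :: real. iter_deriv bs f (z + t *\<^sub>R b)) differentiable (at 0)))"

definition xy_directions :: "'d list \<Rightarrow> 'd list \<Rightarrow> ((real ^ 'd) \<times> (real ^ 'd :: finite)) list" where
  "xy_directions is js = map (\<lambda>i. (axis i 1, 0)) is @ map (\<lambda>i. (0, axis i 1)) js"

text \<open>
  \<open>k \<in> C\<^sup>q\<^sup>,\<^sup>q\<close>: a list \<open>is\<close> of at most \<open>q\<close> coordinates, in any order, stands for a derivative of
  order at most \<open>q\<close>.
\<close>

definition kernel_C :: "nat \<Rightarrow> (real ^ 'd :: finite \<Rightarrow> real ^ 'd \<Rightarrow> real) \<Rightarrow> bool" where
  "kernel_C q k \<longleftrightarrow>
     (\<exists>U. open U \<and> (0, 0) \<in> U \<and>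
        (\<forall>is js. length is \<le> q \<and> length js \<le> q \<longrightarrow>
           iter_deriv_exists U (xy_directions is js) (case_prod k) \<and>
           continuous_on U (iter_deriv (xy_directions is js) (case_prod k))))"

text \<open>
  A multi-index as a list of coordinates. The chosen order of the coordinates is irrelevant for
  derivatives that are continuous near the point considered.
\<close>

definition coordinates :: "'d :: finite list" where
  "coordinates = (SOME is. distinct is \<and> set is = UNIV)"

definition index_list :: "('d :: finite \<Rightarrow> nat) \<Rightarrow> 'd list" where
  "index_list \<alpha> = concat (map (\<lambda>i. replicate (\<alpha> i) i) coordinates)"

definition index_fact :: "('d :: finite \<Rightarrow> nat) \<Rightarrow> real" where
  "index_fact \<alpha> = (\<Prod>i\<in>UNIV. fact (\<alpha> i))"

definition wronskian ::
  "(nat \<Rightarrow> ('d :: finite \<Rightarrow> nat) list) \<Rightarrow> (real ^ 'd \<Rightarrow> real ^ 'd \<Rightarrow> real) \<Rightarrow> nat \<Rightarrow> nat \<Rightarrow> real mat" where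
  "wronskian mons k i l =
     Matrix.mat (length (mons i)) (length (mons l))
       (\<lambda>(a, b). let \<alpha> = mons i ! a; \<beta> = mons l ! b in
          1 / (index_fact \<alpha> * index_fact \<beta>) *
          iter_deriv (xy_directions (index_list \<alpha>) (index_list \<beta>)) (case_prod k) (0, 0))"

definition RWR :: "(nat \<Rightarrow> nat \<Rightarrow> real mat) \<Rightarrow> (nat \<Rightarrow> nat \<Rightarrow> real mat) \<Rightarrow> nat \<Rightarrow> nat \<Rightarrow> real mat" where
  "RWR R W i l = R i i * W i l * transpose_mat (R l l)"

section \<open>The two cases\<close>

text \<open>
  The conditions on the kernel and the points; \<open>m\<close> is \<open>p\<close> in the smooth case and \<open>r - 1\<close> in the
  finitely smooth case.
\<close>

definition smooth_case ::
  "(nat \<Rightarrow> ('d :: finite \<Rightarrow> nat) list) \<Rightarrow> nat \<Rightarrow> (nat \<Rightarrow> real ^ 'd) \<Rightarrow>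
   (real ^ 'd \<Rightarrow> real ^ 'd \<Rightarrow> real) \<Rightarrow> (real \<Rightarrow> real mat) \<Rightarrow> nat \<Rightarrow> bool" where
  "smooth_case mons n x k K p \<longleftrightarrow>
     vrank mons n x p = n \<and> (\<forall>q<p. vrank mons n x q \<noteq> n) \<and>
     ((\<exists>\<psi> c. radial_kernel k \<psi> c \<and> enat (p + 1) \<le> regularity_index c \<and>
             K = radial_kernel_mat n x \<psi>) \<or>
      (kernel_C (p + 1) k \<and>
       K = (\<lambda>\<epsilon>. kernel_mat n (\<lambda>i. \<epsilon> *\<^sub>R x i) k) \<and>
       (\<forall>i<n. \<forall>l<n. analytic_at_0 (\<lambda>\<epsilon>. K \<epsilon> $$ (i, l)))))"

definition finitely_smooth_case ::
  "(nat \<Rightarrow> ('d :: finite \<Rightarrow> nat) list) \<Rightarrow> nat \<Rightarrow> (nat \<Rightarrow> real ^ 'd) \<Rightarrow>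
   (real ^ 'd \<Rightarrow> real ^ 'd \<Rightarrow> real) \<Rightarrow> (real \<Rightarrow> real mat) \<Rightarrow> nat \<Rightarrow> bool" where
  "finitely_smooth_case mons n x k K m \<longleftrightarrow>
     (\<exists>\<psi> c. radial_kernel k \<psi> c \<and> regularity_index c = enat (m + 1) \<and>
             K = radial_kernel_mat n x \<psi>) \<and>
     vrank mons n x m < n"

section \<open>Spectral asymptotics\<close>

definition analytic_eigendecomposition ::
  "nat \<Rightarrow> (real \<Rightarrow> real mat) \<Rightarrow> (nat \<Rightarrow> real \<Rightarrow> real) \<Rightarrow> (nat \<Rightarrow> real \<Rightarrow> real vec) \<Rightarrow> bool" where
  "analytic_eigendecomposition n K lam u \<longleftrightarrow>
     (\<forall>k<n. analytic_at_0 (lam k) \<and> (\<forall>i<n. analytic_at_0 (\<lambda>\<epsilon>. u k \<epsilon> $ i))) \<and>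
     (\<exists>\<delta>>0. \<forall>\<epsilon>. \<bar>\<epsilon>\<bar> < \<delta> \<longrightarrow>
        (\<forall>k<n. u k \<epsilon> \<in> carrier_vec n \<and> K \<epsilon> *\<^sub>v u k \<epsilon> = lam k \<epsilon> \<cdot>\<^sub>v u k \<epsilon>) \<and>
        (\<forall>k<n. \<forall>l<n. u k \<epsilon> \<bullet> u l \<epsilon> = (if k = l then 1 else 0)))"

text \<open>\<open>f \<epsilon> = \<epsilon>\<^sup>a (c + O(\<epsilon>))\<close> with \<open>c \<noteq> 0\<close>\<close>

definition has_leading_term :: "(real \<Rightarrow> real) \<Rightarrow> nat \<Rightarrow> real \<Rightarrow> bool" where
  "has_leading_term f a c \<longleftrightarrow> c \<noteq> 0 \<and> (\<lambda>\<epsilon>. f \<epsilon> - c * \<epsilon> ^ a) \<in> O[at 0](\<lambda>\<epsilon>. \<epsilon> ^ (a + 1))"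

definition of_order :: "(real \<Rightarrow> real) \<Rightarrow> nat \<Rightarrow> bool" where
  "of_order f a \<longleftrightarrow> (\<exists>c. has_leading_term f a c)"

text \<open>
  Leading terms are monomials in \<open>\<epsilon>\<close> and are represented as polynomials, so that the asymptotic
  spectral equivalent is a matrix of polynomials in \<open>\<epsilon>\<close>.
\<close>

definition lt :: "(real \<Rightarrow> real) \<Rightarrow> real poly" where
  "lt f = (if eventually (\<lambda>\<epsilon>. f \<epsilon> = 0) (nhds 0) then 0
           else (THE q. \<exists>a c. has_leading_term f a c \<and> q = Polynomial.monom c a))"

definition spectral_equivalent ::
  "nat \<Rightarrow> (nat \<Rightarrow> real \<Rightarrow> real) \<Rightarrow> (nat \<Rightarrow> real \<Rightarrow> real vec) \<Rightarrow> real poly mat" where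
  "spectral_equivalent n lam u =
     Matrix.mat n n (\<lambda>(i, l). \<Sum>k<n. Polynomial.smult (u k 0 $ i * u k 0 $ l) (lt (lam k)))"

definition coeff_mat :: "real poly mat \<Rightarrow> nat \<Rightarrow> real mat" where
  "coeff_mat A a = map_mat (\<lambda>q. Polynomial.coeff q a) A"

end

(*
  If y annihilates the polynomials of degree < i at the points x_a, and y' those of degree < l, then
  eps^-(i+l) y^T K(eps) y' tends to y^T V_i W_{i,l} V_l^T y'. For columns of Q_i and Q_l the limit is an
  entry of H. Write a vector as a combination of eps^-i times the columns of Q_i (i < j) and of eps^-j
  times a vector orthogonal to all of these: as eps -> 0, minimising the quadratic form of K(eps) over
  the former gives Q_j S_j Q_j^T, the Schur complement of the leading blocks of H. On the spectral side
  the same limit is the form given by the eps^(2j) leading terms, since eigenvectors of order at least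
  2j have limits orthogonal to the Q_i with i < j.

  A radial kernel of regularity index r is a polynomial of |x - y|^2 plus |x - y|^(2r-1) times an
  analytic function of |x - y|, hence of class C^(r-1,r-1). For finite r the matrix H is positive
  definite: a null vector of H yields, by Cauchy-Schwarz in the native space of k, a polynomial
  differential operator p(D) of degree at most r - 1 that kills psi(|z|) near 0; its leading form then
  kills |z|^(2r-1), and a descent on the degree shows that this form vanishes.
*)

theory Submission
  imports Defs "HOL-Combinatorics.Multiset_Permutations"
begin

section \<open>Directional derivatives\<close>

text \<open>A kernel of class C^(m,m) has at most m derivatives in each variable, so K(\<epsilon>)
  is not expanded entry by entry. Taylor's formula is applied to a whole sum over the points, in the
  second variable and then in the first. Each time one intermediate point serves all terms, so the
  limit needs only continuity of the derivatives at (0, 0). Limits are taken for \<epsilon> > 0,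
  where the matrix of a radial kernel agrees with k(\<epsilon> x_i, \<epsilon> x_l); its power
  series continuation to \<epsilon> < 0 need not. The two quadratic forms are identified by a
  sandwich. Inserting test vectors into K(\<epsilon>) and dropping the nonnegative contributions of
  eigenvalues of order below 2j bounds the spectral form from above. For the reverse bound the
  components along the low eigenvectors are removed at every \<epsilon>, not just in the limit. The
  coefficients of the remaining vector on the scaled columns of Q_i (i < j) might then blow up; they
  stay bounded because the leading blocks of H are invertible, hence coercive.\<close>

lemma real_derivative_shift:
  fixes f :: "'a::real_normed_vector \<Rightarrow> real"
  assumes "((\<lambda>t. f (z + s *\<^sub>R v + t *\<^sub>R v)) has_real_derivative D) (at 0)"
  shows "((\<lambda>t. f (z + t *\<^sub>R v)) has_real_derivative D) (at s)"
proof -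
  have "((\<lambda>t. f (z + (t + s) *\<^sub>R v)) has_real_derivative D) (at 0)"
    using assms by (simp add: algebra_simps)
  then show ?thesis
    using DERIV_shift[of "\<lambda>t. f (z + t *\<^sub>R v)" D 0 s] by simp
qed

text \<open>The intermediate point is given as a fraction s of the step, which treats both signs of
  t and t = 0 alike.\<close>

lemma directional_mvt:
  fixes f :: "'a::real_normed_vector \<Rightarrow> real"
  assumes D: "\<And>z. z \<in> U \<Longrightarrow> ((\<lambda>t. f (z + t *\<^sub>R v)) has_real_derivative D z) (at 0)"
    and seg: "\<And>s. 0 \<le> s \<Longrightarrow> s \<le> 1 \<Longrightarrow> z + (s * t) *\<^sub>R v \<in> U"
  obtains s where "0 \<le> s" "s \<le> 1" "f (z + t *\<^sub>R v) - f z = t * D (z + (s * t) *\<^sub>R v)"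
proof -
  have "((\<lambda>s. f (z + (s * t) *\<^sub>R v)) has_real_derivative D (z + (s * t) *\<^sub>R v) * t) (at s)"
    if "0 \<le> s" "s \<le> 1" for s
  proof -
    have 1: "((\<lambda>r. f (z + r *\<^sub>R v)) has_real_derivative D (z + (s * t) *\<^sub>R v)) (at (s * t))"
      using D[OF seg[OF that]] by (rule real_derivative_shift)
    have "((\<lambda>s. s * t) has_real_derivative t) (at s)"
      by (auto intro!: derivative_eq_intros)
    from DERIV_chain2[OF 1 this] show ?thesis .
  qed
  from MVT2[of 0 1 "\<lambda>s. f (z + (s * t) *\<^sub>R v)" "\<lambda>s. D (z + (s * t) *\<^sub>R v) * t", OF _ this]
  obtain s where "0 < s" "s < 1"
    "f (z + (1 * t) *\<^sub>R v) - f (z + (0 * t) *\<^sub>R v) = (1 - 0) * (D (z + (s * t) *\<^sub>R v) * t)"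
    by auto
  then show ?thesis using that[of s] by (simp add: mult.commute)
qed

lemma open_segment_bound:
  fixes z :: "'a::real_normed_vector"
  assumes "open U" "z \<in> U"
  obtains \<delta> where "\<delta> > 0"
    "\<And>s t. \<bar>s\<bar> < \<delta> \<Longrightarrow> \<bar>t\<bar> < \<delta> \<Longrightarrow> z + s *\<^sub>R v + t *\<^sub>R w \<in> U"
proof -
  obtain r where r: "r > 0" "ball z r \<subseteq> U" using assms openE by blast
  define \<delta> where "\<delta> = r / (norm v + norm w + 1)"
  have pos: "norm v + norm w + 1 > 0" by (smt (verit) norm_ge_zero)
  have "\<delta> > 0" unfolding \<delta>_def using r pos by simp
  moreover have "z + s *\<^sub>R v + t *\<^sub>R w \<in> U" if "\<bar>s\<bar> < \<delta>" "\<bar>t\<bar> < \<delta>" for s t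
  proof -
    have "norm (s *\<^sub>R v + t *\<^sub>R w) \<le> \<bar>s\<bar> * norm v + \<bar>t\<bar> * norm w"
      by (metis norm_scaleR norm_triangle_ineq)
    also have "\<dots> \<le> \<delta> * norm v + \<delta> * norm w"
      using that by (intro add_mono mult_right_mono) auto
    also have "\<dots> < \<delta> * (norm v + norm w + 1)"
      using \<open>\<delta> > 0\<close> by (simp add: algebra_simps)
    also have "\<dots> = r" unfolding \<delta>_def using pos by simp
    finally have "dist z (z + s *\<^sub>R v + t *\<^sub>R w) < r"
      by (metis add.assoc add_diff_cancel_left' dist_commute dist_norm)
    then show ?thesis using r(2) by (meson mem_ball subsetD)
  qed
  ultimately show ?thesis using that by blast
qed

text \<open>The increment is split at z + t v. The first part is governed by the derivative at z;
  the second is t times \<open>Dw\<close> at an intermediate point that moves with t, and continuity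
  of \<open>Dw\<close> gives its limit.\<close>

lemma directional_derivative_add:
  fixes f :: "'a::real_normed_vector \<Rightarrow> real"
  assumes U: "open U" "z \<in> U"
    and Dv: "\<And>z. z \<in> U \<Longrightarrow> ((\<lambda>t. f (z + t *\<^sub>R v)) has_real_derivative Dv z) (at 0)"
    and Dw: "\<And>z. z \<in> U \<Longrightarrow> ((\<lambda>t. f (z + t *\<^sub>R w)) has_real_derivative Dw z) (at 0)"
    and cont: "continuous_on U Dw"
  shows "((\<lambda>t. f (z + t *\<^sub>R (v + w))) has_real_derivative Dv z + Dw z) (at 0)"
proof -
  obtain \<delta> where \<delta>: "\<delta> > 0" "\<And>s t. \<bar>s\<bar> < \<delta> \<Longrightarrow> \<bar>t\<bar> < \<delta> \<Longrightarrow> z + s *\<^sub>R v + t *\<^sub>R w \<in> U"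
    using open_segment_bound[OF U] by blast
  have "\<exists>s. \<bar>t\<bar> < \<delta> \<longrightarrow> 0 \<le> s \<and> s \<le> 1 \<and>
      f (z + t *\<^sub>R v + t *\<^sub>R w) - f (z + t *\<^sub>R v) = t * Dw (z + t *\<^sub>R v + (s * t) *\<^sub>R w)" for t
  proof (cases "\<bar>t\<bar> < \<delta>")
    case True
    have "z + t *\<^sub>R v + (s * t) *\<^sub>R w \<in> U" if "0 \<le> s" "s \<le> 1" for s
    proof (rule \<delta>(2)[OF True])
      have "\<bar>s * t\<bar> \<le> 1 * \<bar>t\<bar>" unfolding abs_mult using that by (intro mult_right_mono) auto
      then show "\<bar>s * t\<bar> < \<delta>" using True by simp
    qed
    from directional_mvt[OF Dw this] show ?thesis by metis
  qed auto
  then obtain s where s: "\<And>t. \<bar>t\<bar> < \<delta> \<Longrightarrow> 0 \<le> s t \<and> s t \<le> 1 \<and>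
      f (z + t *\<^sub>R v + t *\<^sub>R w) - f (z + t *\<^sub>R v) = t * Dw (z + t *\<^sub>R v + (s t * t) *\<^sub>R w)"
    by metis
  have ev: "eventually (\<lambda>t. \<bar>t\<bar> < \<delta>) (at (0::real))"
    using \<delta>(1) unfolding eventually_at by (intro exI[of _ \<delta>]) auto
  have st: "((\<lambda>t. s t * t) \<longlongrightarrow> 0) (at 0)"
  proof (rule Lim_null_comparison[where g = "\<lambda>t::real. \<bar>t\<bar>"])
    show "eventually (\<lambda>t. norm (s t * t) \<le> \<bar>t\<bar>) (at 0)"
      using ev
    proof eventually_elim
      case (elim t)
      then have "\<bar>s t\<bar> * \<bar>t\<bar> \<le> 1 * \<bar>t\<bar>" using s[OF elim] by (intro mult_right_mono) auto
      then show ?case by (simp add: abs_mult)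
    qed
    show "((\<lambda>t::real. \<bar>t\<bar>) \<longlongrightarrow> 0) (at 0)" by (auto intro!: tendsto_eq_intros)
  qed
  have "((\<lambda>t. z + t *\<^sub>R v + (s t * t) *\<^sub>R w) \<longlongrightarrow> z + 0 *\<^sub>R v + 0 *\<^sub>R w) (at 0)"
    by (intro tendsto_intros st)
  then have lim: "((\<lambda>t. Dw (z + t *\<^sub>R v + (s t * t) *\<^sub>R w)) \<longlongrightarrow> Dw z) (at 0)"
    using isCont_tendsto_compose[of z Dw] cont U by (simp add: continuous_on_eq_continuous_at)
  have "((\<lambda>t. (f (z + t *\<^sub>R v) - f z) / t) \<longlongrightarrow> Dv z) (at 0)"
    using Dv[OF U(2)] unfolding has_field_derivative_iff by simp
  then have "((\<lambda>t. (f (z + t *\<^sub>R v) - f z) / t + Dw (z + t *\<^sub>R v + (s t * t) *\<^sub>R w)) \<longlongrightarrow> Dv z + Dw z) (at 0)"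
    by (intro tendsto_add lim)
  moreover have "eventually (\<lambda>t. (f (z + t *\<^sub>R v) - f z) / t + Dw (z + t *\<^sub>R v + (s t * t) *\<^sub>R w)
      = (f (z + t *\<^sub>R (v + w)) - f z) / t) (at 0)"
  proof -
    have "eventually (\<lambda>t::real. t \<noteq> 0) (at 0)" by (simp add: eventually_at_filter)
    with ev show ?thesis
    proof eventually_elim
      case (elim t)
      have e: "f (z + t *\<^sub>R v + t *\<^sub>R w) = f (z + t *\<^sub>R v) + t * Dw (z + t *\<^sub>R v + (s t * t) *\<^sub>R w)"
        using s[of t] elim by simp
      have "z + t *\<^sub>R (v + w) = z + t *\<^sub>R v + t *\<^sub>R w" by (simp add: algebra_simps)
      then have "f (z + t *\<^sub>R (v + w)) = f (z + t *\<^sub>R v) + t * Dw (z + t *\<^sub>R v + (s t * t) *\<^sub>R w)"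
        using e by (simp only:)
      then show ?case using elim by (simp add: field_simps)
    qed
  qed
  ultimately have "((\<lambda>t. (f (z + t *\<^sub>R (v + w)) - f z) / t) \<longlongrightarrow> Dv z + Dw z) (at 0)"
    by (rule Lim_transform_eventually)
  then show ?thesis unfolding has_field_derivative_iff by simp
qed

lemma directional_derivative_scale:
  fixes f :: "'a::real_normed_vector \<Rightarrow> real"
  assumes "((\<lambda>t. f (z + t *\<^sub>R v)) has_real_derivative D) (at 0)"
  shows "((\<lambda>t. f (z + t *\<^sub>R (c *\<^sub>R v))) has_real_derivative c * D) (at 0)"
proof -
  have "((\<lambda>t. t * c) has_real_derivative c) (at 0)"
    by (auto intro!: derivative_eq_intros)
  moreover have "((\<lambda>t. f (z + t *\<^sub>R v)) has_real_derivative D) (at (0 * c))"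
    using assms by simp
  ultimately have "((\<lambda>t. f (z + (t * c) *\<^sub>R v)) has_real_derivative D * c) (at 0)"
    by (rule DERIV_chain2[rotated])
  then show ?thesis by (simp add: mult.commute)
qed

lemma directional_derivative_sum:
  fixes f :: "'a::real_normed_vector \<Rightarrow> real"
  assumes U: "open U" "z \<in> U" and "finite B"
    and D: "\<And>b z. b \<in> B \<Longrightarrow> z \<in> U \<Longrightarrow> ((\<lambda>t. f (z + t *\<^sub>R e b)) has_real_derivative D b z) (at 0)"
    and cont: "\<And>b. b \<in> B \<Longrightarrow> continuous_on U (D b)"
  shows "((\<lambda>t. f (z + t *\<^sub>R (\<Sum>b\<in>B. c b *\<^sub>R e b))) has_real_derivative (\<Sum>b\<in>B. c b * D b z)) (at 0)"
  using \<open>finite B\<close> U D cont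
proof (induction B arbitrary: z rule: finite_induct)
  case empty
  then show ?case by simp
next
  case (insert b B)
  have "((\<lambda>t. f (z + t *\<^sub>R ((\<Sum>b\<in>B. c b *\<^sub>R e b) + c b *\<^sub>R e b)))
      has_real_derivative (\<Sum>b\<in>B. c b * D b z) + c b * D b z) (at 0)"
  proof (rule directional_derivative_add[where Dv = "\<lambda>z. \<Sum>b\<in>B. c b * D b z" and Dw = "\<lambda>z. c b * D b z" and U = U])
    fix z assume "z \<in> U"
    then show "((\<lambda>t. f (z + t *\<^sub>R (\<Sum>b\<in>B. c b *\<^sub>R e b))) has_real_derivative (\<Sum>b\<in>B. c b * D b z)) (at 0)"
      using insert by auto
    show "((\<lambda>t. f (z + t *\<^sub>R (c b *\<^sub>R e b))) has_real_derivative c b * D b z) (at 0)"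
      using insert.prems \<open>z \<in> U\<close> by (intro directional_derivative_scale) auto
  next
    show "continuous_on U (\<lambda>z. c b * D b z)" using insert.prems by (intro continuous_intros) auto
  qed (use insert in auto)
  then show ?case using insert by (simp add: add.commute)
qed

text \<open>The mean value theorem is used twice: for the difference f(y + t w) - f(y) as y moves
  along v, and then for \<open>Dv\<close> along w.\<close>

lemma second_difference_mvt:
  fixes f :: "'a::real_normed_vector \<Rightarrow> real" and t :: real
  assumes Dv: "\<And>z. z \<in> U \<Longrightarrow> ((\<lambda>t. f (z + t *\<^sub>R v)) has_real_derivative Dv z) (at 0)"
    and Dwv: "\<And>z. z \<in> U \<Longrightarrow> ((\<lambda>t. Dv (z + t *\<^sub>R w)) has_real_derivative Dwv z) (at 0)"
    and seg: "\<And>s r. 0 \<le> s \<Longrightarrow> s \<le> t \<Longrightarrow> 0 \<le> r \<Longrightarrow> r \<le> t \<Longrightarrow> z + s *\<^sub>R v + r *\<^sub>R w \<in> U"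
    and t: "0 \<le> t"
  shows "\<exists>s r. 0 \<le> s \<and> s \<le> t \<and> 0 \<le> r \<and> r \<le> t \<and>
    f (z + t *\<^sub>R v + t *\<^sub>R w) - f (z + t *\<^sub>R v) - f (z + t *\<^sub>R w) + f z = t * t * Dwv (z + s *\<^sub>R v + r *\<^sub>R w)"
proof -
  have mul: "0 \<le> s * t \<and> s * t \<le> t" if "0 \<le> s" "s \<le> 1" for s
    using that t mult_right_mono[of s 1 t] by auto
  define U' where "U' = {z. z \<in> U \<and> z + t *\<^sub>R w \<in> U}"
  have "((\<lambda>r. f (y + r *\<^sub>R v + t *\<^sub>R w) - f (y + r *\<^sub>R v)) has_real_derivative Dv (y + t *\<^sub>R w) - Dv y) (at 0)"
    if "y \<in> U'" for y
  proof -
    have eq: "y + r *\<^sub>R v + t *\<^sub>R w = y + t *\<^sub>R w + r *\<^sub>R v" for r by (simp add: add.commute add.left_commute)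
    show ?thesis unfolding eq
      using that Dv[of y] Dv[of "y + t *\<^sub>R w"] unfolding U'_def by (intro DERIV_diff) auto
  qed
  then have d: "((\<lambda>r. (\<lambda>y. f (y + t *\<^sub>R w) - f y) (y + r *\<^sub>R v)) has_real_derivative Dv (y + t *\<^sub>R w) - Dv y) (at 0)"
    if "y \<in> U'" for y using that by simp
  have "z + (s * t) *\<^sub>R v \<in> U'" if "0 \<le> s" "s \<le> 1" for s
    using seg[of "s * t" 0] seg[of "s * t" t] mul[OF that] t unfolding U'_def by auto
  from directional_mvt[where f = "\<lambda>y. f (y + t *\<^sub>R w) - f y", OF d this] obtain s where s: "0 \<le> s" "s \<le> 1"
    "f (z + t *\<^sub>R v + t *\<^sub>R w) - f (z + t *\<^sub>R v) - (f (z + t *\<^sub>R w) - f z) =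
      t * (Dv (z + (s * t) *\<^sub>R v + t *\<^sub>R w) - Dv (z + (s * t) *\<^sub>R v))" by blast
  have "z + (s * t) *\<^sub>R v + (r * t) *\<^sub>R w \<in> U" if "0 \<le> r" "r \<le> 1" for r
    using seg mul[OF s(1,2)] mul[OF that] by auto
  from directional_mvt[OF Dwv this] obtain r where r: "0 \<le> r" "r \<le> 1"
    "Dv (z + (s * t) *\<^sub>R v + t *\<^sub>R w) - Dv (z + (s * t) *\<^sub>R v) = t * Dwv (z + (s * t) *\<^sub>R v + (r * t) *\<^sub>R w)" by blast
  show ?thesis
  proof -
    have eq: "f (z + t *\<^sub>R v + t *\<^sub>R w) - f (z + t *\<^sub>R v) - f (z + t *\<^sub>R w) + f z
        = t * t * Dwv (z + (s * t) *\<^sub>R v + (r * t) *\<^sub>R w)"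
      using s(3) unfolding r(3) by (simp only: mult.assoc)
    show ?thesis
      by (rule exI[of _ "s * t"], rule exI[of _ "r * t"], intro conjI eq) (use mul[OF s(1,2)] mul[OF r(1,2)] in blast)+
  qed
qed

text \<open>Schwarz's theorem: the second difference over the parallelogram with sides t v and t w
  is symmetric in v and w. Dividing by t^2 and letting t tend to 0 from the right, continuity
  identifies the two mixed derivatives.\<close>

lemma mixed_derivatives_commute:
  fixes f :: "'a::real_normed_vector \<Rightarrow> real"
  assumes U: "open U" "z \<in> U"
    and Dv: "\<And>z. z \<in> U \<Longrightarrow> ((\<lambda>t. f (z + t *\<^sub>R v)) has_real_derivative Dv z) (at 0)"
    and Dwv: "\<And>z. z \<in> U \<Longrightarrow> ((\<lambda>t. Dv (z + t *\<^sub>R w)) has_real_derivative Dwv z) (at 0)"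
    and Dw: "\<And>z. z \<in> U \<Longrightarrow> ((\<lambda>t. f (z + t *\<^sub>R w)) has_real_derivative Dw z) (at 0)"
    and Dvw: "\<And>z. z \<in> U \<Longrightarrow> ((\<lambda>t. Dw (z + t *\<^sub>R v)) has_real_derivative Dvw z) (at 0)"
    and cont: "continuous_on U Dwv" "continuous_on U Dvw"
  shows "Dwv z = Dvw z"
proof -
  obtain \<delta> where \<delta>: "\<delta> > 0" "\<And>s t. \<bar>s\<bar> < \<delta> \<Longrightarrow> \<bar>t\<bar> < \<delta> \<Longrightarrow> z + s *\<^sub>R v + t *\<^sub>R w \<in> U"
    using open_segment_bound[OF U] by blast
  have "\<exists>p. 0 < t \<and> t < \<delta> \<longrightarrow> (case p of (s, r, s', r') \<Rightarrow> \<bar>s\<bar> \<le> t \<and> \<bar>r\<bar> \<le> t \<and> \<bar>s'\<bar> \<le> t \<and> \<bar>r'\<bar> \<le> t \<and>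
      Dwv (z + s *\<^sub>R v + r *\<^sub>R w) = Dvw (z + s' *\<^sub>R v + r' *\<^sub>R w))" for t
  proof (cases "0 < t \<and> t < \<delta>")
    case True
    have seg: "z + s *\<^sub>R v + r *\<^sub>R w \<in> U" if "0 \<le> s" "s \<le> t" "0 \<le> r" "r \<le> t" for s r
      using \<delta>(2) that True by auto
    have seg': "z + s *\<^sub>R w + r *\<^sub>R v \<in> U" if "0 \<le> s" "s \<le> t" "0 \<le> r" "r \<le> t" for s r
      using seg[of r s] that by (simp add: algebra_simps)
    obtain s r where 1: "0 \<le> s" "s \<le> t" "0 \<le> r" "r \<le> t"
      "f (z + t *\<^sub>R v + t *\<^sub>R w) - f (z + t *\<^sub>R v) - f (z + t *\<^sub>R w) + f z = t * t * Dwv (z + s *\<^sub>R v + r *\<^sub>R w)"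
      using second_difference_mvt[where t = t and U = U and f = f and z = z, OF Dv Dwv seg] True by (auto dest: less_imp_le)
    obtain r' s' where 2: "0 \<le> r'" "r' \<le> t" "0 \<le> s'" "s' \<le> t"
      "f (z + t *\<^sub>R w + t *\<^sub>R v) - f (z + t *\<^sub>R w) - f (z + t *\<^sub>R v) + f z = t * t * Dvw (z + r' *\<^sub>R w + s' *\<^sub>R v)"
      using second_difference_mvt[where t = t and U = U and f = f and z = z, OF Dw Dvw seg'] True by (auto dest: less_imp_le)
    have e: "z + t *\<^sub>R w + t *\<^sub>R v = z + t *\<^sub>R v + t *\<^sub>R w" "z + r' *\<^sub>R w + s' *\<^sub>R v = z + s' *\<^sub>R v + r' *\<^sub>R w"
      by (simp_all add: algebra_simps)
    have "t * t * Dwv (z + s *\<^sub>R v + r *\<^sub>R w) = t * t * Dvw (z + s' *\<^sub>R v + r' *\<^sub>R w)"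
      using 1(5) 2(5) unfolding e by linarith
    then have "Dwv (z + s *\<^sub>R v + r *\<^sub>R w) = Dvw (z + s' *\<^sub>R v + r' *\<^sub>R w)" using True by simp
    moreover have "\<bar>s\<bar> \<le> t" "\<bar>r\<bar> \<le> t" "\<bar>s'\<bar> \<le> t" "\<bar>r'\<bar> \<le> t" using 1(1-4) 2(1-4) by simp_all
    ultimately show ?thesis by (intro exI[of _ "(s, r, s', r')"]) (simp only: prod.case simp_thms)
  qed auto
  then have "\<forall>t. \<exists>p. 0 < t \<and> t < \<delta> \<longrightarrow> (case p of (s, r, s', r') \<Rightarrow> \<bar>s\<bar> \<le> t \<and> \<bar>r\<bar> \<le> t \<and> \<bar>s'\<bar> \<le> t \<and> \<bar>r'\<bar> \<le> t \<and>
      Dwv (z + s *\<^sub>R v + r *\<^sub>R w) = Dvw (z + s' *\<^sub>R v + r' *\<^sub>R w))" by (rule allI)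
  from choice[OF this] obtain p where p: "\<forall>t. 0 < t \<and> t < \<delta> \<longrightarrow> (case p t of (s, r, s', r') \<Rightarrow> \<bar>s\<bar> \<le> t \<and> \<bar>r\<bar> \<le> t \<and> \<bar>s'\<bar> \<le> t \<and> \<bar>r'\<bar> \<le> t \<and>
      Dwv (z + s *\<^sub>R v + r *\<^sub>R w) = Dvw (z + s' *\<^sub>R v + r' *\<^sub>R w))" by (rule exE)
  define s r s' r' where "s t = fst (p t)" "r t = fst (snd (p t))"
    "s' t = fst (snd (snd (p t)))" "r' t = snd (snd (snd (p t)))" for t
  note defs = this
  have q: "\<bar>s t\<bar> \<le> t \<and> \<bar>r t\<bar> \<le> t \<and> \<bar>s' t\<bar> \<le> t \<and> \<bar>r' t\<bar> \<le> t \<and>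
      Dwv (z + s t *\<^sub>R v + r t *\<^sub>R w) = Dvw (z + s' t *\<^sub>R v + r' t *\<^sub>R w)" if "0 < t" "t < \<delta>" for t
    using spec[OF p, of t] that unfolding defs by (auto split: prod.splits)
  have ev: "eventually (\<lambda>t. 0 < t \<and> t < \<delta>) (at_right (0::real))"
    using \<delta>(1) by (auto simp: eventually_at_right_field intro: exI[of _ \<delta>])
  have l0: "(g \<longlongrightarrow> 0) (at_right 0)" if "\<And>t. 0 < t \<Longrightarrow> t < \<delta> \<Longrightarrow> \<bar>g t\<bar> \<le> t" for g :: "real \<Rightarrow> real"
  proof (rule Lim_null_comparison[where g = "\<lambda>t. t"])
    show "eventually (\<lambda>t. norm (g t) \<le> t) (at_right 0)"
      using ev by eventually_elim (use that in auto)
  qed (auto intro!: tendsto_eq_intros)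
  have lim: "((\<lambda>t. G (z + a t *\<^sub>R v + b t *\<^sub>R w)) \<longlongrightarrow> G z) (at_right 0)"
    if "continuous_on U G" "(a \<longlongrightarrow> 0) (at_right 0)" "(b \<longlongrightarrow> 0) (at_right 0)" for G :: "'a \<Rightarrow> real" and a b :: "real \<Rightarrow> real"
  proof -
    have "((\<lambda>t. z + a t *\<^sub>R v + b t *\<^sub>R w) \<longlongrightarrow> z + 0 *\<^sub>R v + 0 *\<^sub>R w) (at_right 0)"
      by (intro tendsto_intros that)
    then show ?thesis
      using isCont_tendsto_compose[of z G] that(1) U by (simp add: continuous_on_eq_continuous_at)
  qed
  have limw: "((\<lambda>t. Dwv (z + s t *\<^sub>R v + r t *\<^sub>R w)) \<longlongrightarrow> Dwv z) (at_right 0)"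
    by (intro lim cont l0) (use q in auto)
  have "((\<lambda>t. Dvw (z + s' t *\<^sub>R v + r' t *\<^sub>R w)) \<longlongrightarrow> Dvw z) (at_right 0)"
    by (intro lim cont l0) (use q in auto)
  moreover have "eventually (\<lambda>t. Dvw (z + s' t *\<^sub>R v + r' t *\<^sub>R w) = Dwv (z + s t *\<^sub>R v + r t *\<^sub>R w)) (at_right 0)"
    using ev by eventually_elim (use q in auto)
  ultimately have "((\<lambda>t. Dwv (z + s t *\<^sub>R v + r t *\<^sub>R w)) \<longlongrightarrow> Dvw z) (at_right 0)"
    by (rule Lim_transform_eventually)
  with limw show ?thesis by (intro tendsto_unique[OF trivial_limit_at_right_real])
qed

section \<open>Iterated derivatives along a family of directions and Taylor's formula\<close>

text \<open>Differentiability is asked only along the family \<open>e\<close>, so smoothness in one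
  argument of a kernel is the instance \<open>ex\<close> or \<open>ey\<close>.\<close>

definition smooth_along :: "'a::real_normed_vector set \<Rightarrow> ('i \<Rightarrow> 'a) \<Rightarrow> nat \<Rightarrow> ('a \<Rightarrow> real) \<Rightarrow> bool" where
  "smooth_along U e N f \<longleftrightarrow>
     (\<forall>L. length L \<le> N \<longrightarrow> iter_deriv_exists U (map e L) f \<and> continuous_on U (iter_deriv (map e L) f))"

lemma iter_deriv_append: "iter_deriv (bs @ cs) f = iter_deriv bs (iter_deriv cs f)"
  by (induction bs) simp_all

lemma iter_deriv_exists_append:
  "iter_deriv_exists U (bs @ cs) f \<longleftrightarrow> iter_deriv_exists U cs f \<and> iter_deriv_exists U bs (iter_deriv cs f)"
  by (induction bs) (auto simp: iter_deriv_append)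

lemma iter_deriv_has_derivative:
  assumes "iter_deriv_exists U (b # bs) f" "z \<in> U"
  shows "((\<lambda>t. iter_deriv bs f (z + t *\<^sub>R b)) has_real_derivative iter_deriv (b # bs) f z) (at 0)"
  using assms by (simp add: DERIV_deriv_iff_real_differentiable)

lemma smooth_along_derivative:
  assumes "smooth_along U e N f" "length L < N" "z \<in> U"
  shows "((\<lambda>t. iter_deriv (map e L) f (z + t *\<^sub>R e i)) has_real_derivative iter_deriv (map e (i # L)) f z) (at 0)"
proof -
  have "iter_deriv_exists U (map e (i # L)) f"
    using assms(1)[unfolded smooth_along_def, rule_format, of "i # L"] assms(2) by simp
  then show ?thesis using iter_deriv_has_derivative[of U "e i" "map e L" f z] assms(3) by simp
qed

lemma smooth_along_continuous:
  assumes "smooth_along U e N f" "length L \<le> N"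
  shows "continuous_on U (iter_deriv (map e L) f)"
  using assms unfolding smooth_along_def by blast

text \<open>The multinomial formula for the s-th derivative along
  \<open>\<Sum>i. c i *\<^sub>R e i\<close>. The sum runs over words of length s: a multi-index is
  counted once for each of its orderings, which replaces the multinomial coefficient.\<close>

definition multi_deriv :: "('i \<Rightarrow> real) \<Rightarrow> ('i::finite \<Rightarrow> 'a::real_normed_vector) \<Rightarrow> nat \<Rightarrow> ('a \<Rightarrow> real) \<Rightarrow> 'a \<Rightarrow> real" where
  "multi_deriv c e s f z = (\<Sum>L | length L = s. prod_list (map c L) * iter_deriv (map e L) f z)"

lemma finite_lists_eq: "finite {L :: 'i::finite list. length L = s}"
  using finite_lists_length_eq[of "UNIV :: 'i set" s] by simp

lemma sum_lists_Suc:
  fixes g :: "'i::finite list \<Rightarrow> 'b::comm_monoid_add"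
  shows "(\<Sum>L | length L = Suc s. g L) = (\<Sum>L | length L = s. \<Sum>i\<in>UNIV. g (i # L))"
proof -
  have "{L :: 'i list. length L = Suc s} = (\<lambda>(L, i). i # L) ` ({L. length L = s} \<times> UNIV)"
    by (auto simp: image_def length_Suc_conv)
  moreover have "inj_on (\<lambda>(L, i). i # L) ({L :: 'i list. length L = s} \<times> UNIV)"
    by (auto simp: inj_on_def)
  ultimately show ?thesis
    by (simp add: sum.reindex sum.cartesian_product split_def)
qed

lemma multi_deriv_0: "multi_deriv c e 0 f z = f z"
  unfolding multi_deriv_def by simp

lemma multi_deriv_has_derivative:
  fixes e :: "'i::finite \<Rightarrow> 'a::real_normed_vector"
  assumes U: "open U" "z + t *\<^sub>R (\<Sum>i\<in>UNIV. c i *\<^sub>R e i) \<in> U" and f: "smooth_along U e N f" and s: "s < N"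
  shows "((\<lambda>t. multi_deriv c e s f (z + t *\<^sub>R (\<Sum>i\<in>UNIV. c i *\<^sub>R e i))) has_real_derivative
     multi_deriv c e (Suc s) f (z + t *\<^sub>R (\<Sum>i\<in>UNIV. c i *\<^sub>R e i))) (at t)"
proof (rule real_derivative_shift)
  let ?w = "\<Sum>i\<in>UNIV. c i *\<^sub>R e i"
  let ?y = "z + t *\<^sub>R ?w"
  have "((\<lambda>r. iter_deriv (map e L) f (?y + r *\<^sub>R ?w)) has_real_derivative
      (\<Sum>i\<in>UNIV. c i * iter_deriv (map e (i # L)) f ?y)) (at 0)" if "length L = s" for L
    by (rule directional_derivative_sum[OF U])
      (use smooth_along_derivative[OF f] smooth_along_continuous[OF f] that s in \<open>auto simp del: iter_deriv.simps list.map\<close>)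
  then have "((\<lambda>r. multi_deriv c e s f (?y + r *\<^sub>R ?w)) has_real_derivative
      (\<Sum>L | length L = s. prod_list (map c L) * (\<Sum>i\<in>UNIV. c i * iter_deriv (map e (i # L)) f ?y))) (at 0)"
    unfolding multi_deriv_def by (intro DERIV_sum DERIV_cmult) auto
  also have "(\<Sum>L | length L = s. prod_list (map c L) * (\<Sum>i\<in>UNIV. c i * iter_deriv (map e (i # L)) f ?y))
      = multi_deriv c e (Suc s) f ?y"
    unfolding multi_deriv_def sum_lists_Suc by (simp add: sum_distrib_left mult.assoc mult.left_commute)
  finally show "((\<lambda>r. multi_deriv c e s f (?y + r *\<^sub>R ?w)) has_real_derivative multi_deriv c e (Suc s) f ?y) (at 0)" .
qed

lemma iter_deriv_replicate:
  fixes e :: "'i::finite \<Rightarrow> 'a::real_normed_vector"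
  assumes U: "open U" and f: "smooth_along U e N f" and s: "s \<le> N" and z: "z \<in> U"
  shows "iter_deriv (replicate s (\<Sum>i\<in>UNIV. c i *\<^sub>R e i)) f z = multi_deriv c e s f z"
  using s z
proof (induction s arbitrary: z)
  case 0
  then show ?case by (simp add: multi_deriv_0)
next
  case (Suc s)
  let ?w = "\<Sum>i\<in>UNIV. c i *\<^sub>R e i"
  obtain \<delta> where \<delta>: "\<delta> > 0" "\<And>s t. \<bar>s\<bar> < \<delta> \<Longrightarrow> \<bar>t\<bar> < \<delta> \<Longrightarrow> z + s *\<^sub>R ?w + t *\<^sub>R ?w \<in> U"
    using open_segment_bound[OF U Suc.prems(2)] by blast
  have "((\<lambda>t. multi_deriv c e s f (z + t *\<^sub>R ?w)) has_real_derivative multi_deriv c e (Suc s) f z) (at 0)"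
    using multi_deriv_has_derivative[OF U _ f, of z 0 c s] Suc.prems by simp
  moreover have "eventually (\<lambda>t. multi_deriv c e s f (z + t *\<^sub>R ?w) = iter_deriv (replicate s ?w) f (z + t *\<^sub>R ?w)) (nhds 0)"
    unfolding eventually_nhds_metric
    by (intro exI[of _ \<delta>]) (use \<delta>(1) \<delta>(2)[of _ 0] Suc in \<open>auto simp: dist_real_def\<close>)
  ultimately have "((\<lambda>t. iter_deriv (replicate s ?w) f (z + t *\<^sub>R ?w)) has_real_derivative multi_deriv c e (Suc s) f z) (at 0)"
    by (subst (asm) DERIV_cong_ev[OF refl _ refl])
  then show ?case by (simp add: DERIV_imp_deriv)
qed

text \<open>Maclaurin's formula is applied to the weighted sum as one function of t. The lower terms
  cancel only in the sum, and a single intermediate t serves every a.\<close>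

lemma taylor_sum:
  fixes e :: "'i::finite \<Rightarrow> 'a::real_normed_vector" and c :: "'b \<Rightarrow> 'i \<Rightarrow> real"
  assumes U: "open U" and f: "\<And>a. a \<in> A \<Longrightarrow> smooth_along U e N (f a)" and l: "l \<le> N" and h: "0 < h"
    and seg: "\<And>a t. a \<in> A \<Longrightarrow> 0 \<le> t \<Longrightarrow> t \<le> h \<Longrightarrow> z a + t *\<^sub>R (\<Sum>i\<in>UNIV. c a i *\<^sub>R e i) \<in> U"
    and zero: "\<And>s. s < l \<Longrightarrow> (\<Sum>a\<in>A. \<nu> a * multi_deriv (c a) e s (f a) (z a)) = 0"
  shows "\<exists>t. 0 \<le> t \<and> t \<le> h \<and> (\<Sum>a\<in>A. \<nu> a * f a (z a + h *\<^sub>R (\<Sum>i\<in>UNIV. c a i *\<^sub>R e i))) =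
     h ^ l / fact l * (\<Sum>a\<in>A. \<nu> a * multi_deriv (c a) e l (f a) (z a + t *\<^sub>R (\<Sum>i\<in>UNIV. c a i *\<^sub>R e i)))"
proof (cases "l = 0")
  case True
  \<comment> \<open>The version of Maclaurin's formula used below needs a positive order; for order
    0 the intermediate point is h itself.\<close>
  then show ?thesis using h by (intro exI[of _ h]) (simp add: multi_deriv_0)
next
  case False
  define D where "D s t = (\<Sum>a\<in>A. \<nu> a * multi_deriv (c a) e s (f a) (z a + t *\<^sub>R (\<Sum>i\<in>UNIV. c a i *\<^sub>R e i)))" for s t
  have "DERIV (D s) t :> D (Suc s) t" if "s < l" "0 \<le> t" "t \<le> h" for s t
    unfolding D_def
    by (intro DERIV_sum DERIV_cmult multi_deriv_has_derivative[OF U _ f]) (use that l seg in auto)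
  from Maclaurin[of h l D "D 0", OF h _ refl] this False
  obtain t where "0 < t" "t < h" "D 0 h = (\<Sum>s<l. D s 0 / fact s * h ^ s) + D l t / fact l * h ^ l" by auto
  moreover have "(\<Sum>s<l. D s 0 / fact s * h ^ s) = 0"
    using zero by (intro sum.neutral) (auto simp: D_def)
  ultimately show ?thesis
    by (intro exI[of _ t]) (auto simp: D_def multi_deriv_0)
qed

lemma smooth_along_swap:
  fixes e :: "'i \<Rightarrow> 'a::real_normed_vector"
  assumes U: "open U" and f: "smooth_along U e N f" and L: "length L + 2 \<le> N" and z: "z \<in> U"
  shows "iter_deriv (map e (i # j # L)) f z = iter_deriv (map e (j # i # L)) f z"
proof (rule mixed_derivatives_commute[where f = "iter_deriv (map e L) f" and Dv = "iter_deriv (map e (j # L)) f"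
        and Dw = "iter_deriv (map e (i # L)) f" and v = "e j" and w = "e i", OF U z])
  have l: "length L < N" "length (j # L) < N" "length (i # L) < N" using L by simp_all
  fix z assume z: "z \<in> U"
  note d = smooth_along_derivative[OF f _ z]
  show "((\<lambda>t. iter_deriv (map e L) f (z + t *\<^sub>R e j)) has_real_derivative iter_deriv (map e (j # L)) f z) (at 0)"
    using l(1) by (rule d)
  show "((\<lambda>t. iter_deriv (map e L) f (z + t *\<^sub>R e i)) has_real_derivative iter_deriv (map e (i # L)) f z) (at 0)"
    using l(1) by (rule d)
  show "((\<lambda>t. iter_deriv (map e (j # L)) f (z + t *\<^sub>R e i)) has_real_derivative iter_deriv (map e (i # j # L)) f z) (at 0)"
    using l(2) by (rule d)
  show "((\<lambda>t. iter_deriv (map e (i # L)) f (z + t *\<^sub>R e j)) has_real_derivative iter_deriv (map e (j # i # L)) f z) (at 0)"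
    using l(3) by (rule d)
next
  have l: "length (i # j # L) \<le> N" "length (j # i # L) \<le> N" using L by simp_all
  show "continuous_on U (iter_deriv (map e (i # j # L)) f)" "continuous_on U (iter_deriv (map e (j # i # L)) f)"
    using l by (auto intro!: smooth_along_continuous[OF f] simp del: iter_deriv.simps list.map)
qed

lemma iter_deriv_cong:
  assumes U: "open U" and eq: "\<And>z. z \<in> U \<Longrightarrow> f z = g z" and z: "z \<in> U"
  shows "iter_deriv bs f z = iter_deriv bs g z"
  using z
proof (induction bs arbitrary: z)
  case Nil
  then show ?case using eq by simp
next
  case (Cons b bs)
  obtain \<delta> where \<delta>: "\<delta> > 0" "\<And>s t. \<bar>s\<bar> < \<delta> \<Longrightarrow> \<bar>t\<bar> < \<delta> \<Longrightarrow> z + s *\<^sub>R b + t *\<^sub>R b \<in> U"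
    using open_segment_bound[OF U Cons.prems] by blast
  have "eventually (\<lambda>t. iter_deriv bs f (z + t *\<^sub>R b) = iter_deriv bs g (z + t *\<^sub>R b)) (nhds 0)"
    unfolding eventually_nhds_metric
    by (intro exI[of _ \<delta>]) (use \<delta>(1) \<delta>(2)[of _ 0] Cons.IH in \<open>auto simp: dist_real_def\<close>)
  then show ?case by (simp add: deriv_cong_ev)
qed

text \<open>Swaps of the two outermost derivatives suffice: under an outer derivative,
  \<open>iter_deriv_cong\<close> transports the equality of inner ones on U, so any entry can be
  moved to the front.\<close>

lemma smooth_along_mset:
  fixes e :: "'i \<Rightarrow> 'a::real_normed_vector"
  assumes U: "open U" and f: "smooth_along U e N f"
  shows "mset L = mset L' \<Longrightarrow> length L \<le> N \<Longrightarrow> z \<in> U \<Longrightarrow> iter_deriv (map e L) f z = iter_deriv (map e L') f z"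
proof (induction L arbitrary: L' z)
  case Nil
  then show ?case by simp
next
  case (Cons i L)
  have front: "length pre + length post + 1 \<le> N \<Longrightarrow> z \<in> U \<Longrightarrow>
     iter_deriv (map e (pre @ i # post)) f z = iter_deriv (map e (i # pre @ post)) f z" for pre post z
  proof (induction pre arbitrary: z)
    case Nil
    then show ?case by simp
  next
    case (Cons k pre)
    have "iter_deriv [e k] (iter_deriv (map e (pre @ i # post)) f) z = iter_deriv [e k] (iter_deriv (map e (i # pre @ post)) f) z"
      by (rule iter_deriv_cong[OF U]) (use Cons in auto)
    then have "iter_deriv (map e (k # pre @ i # post)) f z = iter_deriv (map e (k # i # pre @ post)) f z"
      by simp
    also have "\<dots> = iter_deriv (map e (i # k # pre @ post)) f z"
      using Cons.prems by (intro smooth_along_swap[OF U f]) auto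
    finally show ?case by simp
  qed
  from Cons.prems(1) have "i \<in> set L'" by (metis list.set_intros(1) set_mset_mset)
  then obtain pre post where L': "L' = pre @ i # post" by (meson split_list)
  with Cons.prems(1) have m: "mset L = mset (pre @ post)" by simp
  then have len: "length L = length pre + length post" by (metis length_append size_mset)
  have "iter_deriv [e i] (iter_deriv (map e L) f) z = iter_deriv [e i] (iter_deriv (map e (pre @ post)) f) z"
    by (rule iter_deriv_cong[OF U]) (use Cons.IH[OF m] Cons.prems in auto)
  then have "iter_deriv (map e (i # L)) f z = iter_deriv (map e (i # pre @ post)) f z" by simp
  also have "\<dots> = iter_deriv (map e L') f z"
    unfolding L'
  proof (rule front[symmetric])
    show "length pre + length post + 1 \<le> N" using Cons.prems(2) len by simp
  qed (rule Cons.prems(3))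
  finally show ?case .
qed

section \<open>Flat limits of the quadratic forms of a kernel\<close>

lemma coordinates: "distinct (coordinates :: 'd::finite list)" "set (coordinates :: 'd list) = UNIV"
proof -
  obtain xs :: "'d list" where "set xs = UNIV \<and> distinct xs"
    using finite_distinct_list[OF finite[of "UNIV :: 'd set"]] by (rule exE)
  then have "distinct (coordinates :: 'd list) \<and> set (coordinates :: 'd list) = UNIV"
    unfolding coordinates_def by (intro someI[of "\<lambda>is. distinct is \<and> set is = UNIV" xs] conjI; elim conjE)
  then show "distinct (coordinates :: 'd list)" "set (coordinates :: 'd list) = UNIV" by auto
qed

lemma count_index_list: "count (mset (index_list \<alpha>)) i = \<alpha> i"
proof -
  have "count (mset (concat (map (\<lambda>i. replicate (\<alpha> i) i) xs))) i = (if i \<in> set xs then \<alpha> i else 0)"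
    if "distinct xs" for xs
    using that by (induction xs) auto
  from this[OF coordinates(1)] show ?thesis unfolding index_list_def coordinates(2) by simp
qed

lemma length_eq_sum_count:
  fixes L :: "'d::finite list"
  shows "length L = (\<Sum>i\<in>UNIV. count (mset L) i)"
proof -
  have "size (mset L) = sum (count (mset L)) (set_mset (mset L))"
    by (rule size_multiset_overloaded_eq)
  also have "\<dots> = (\<Sum>i\<in>UNIV. count (mset L) i)"
    by (rule sum.mono_neutral_left) (auto simp: not_in_iff count_mset_0_iff)
  finally show ?thesis by simp
qed

lemma length_index_list: "length (index_list \<alpha>) = (\<Sum>i\<in>UNIV. \<alpha> i)"
  unfolding length_eq_sum_count count_index_list ..

lemma prod_list_eq_prod_count:
  fixes g :: "'d::finite \<Rightarrow> real"
  shows "prod_list (map g L) = (\<Prod>i\<in>UNIV. g i ^ count (mset L) i)"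
proof (induction L)
  case (Cons a L)
  have "(\<Prod>i\<in>UNIV. g i ^ count (mset (a # L)) i) = (\<Prod>i\<in>UNIV. (if i = a then g i else 1) * g i ^ count (mset L) i)"
    by (intro prod.cong) auto
  also have "\<dots> = g a * (\<Prod>i\<in>UNIV. g i ^ count (mset L) i)"
    by (simp add: prod.distrib)
  finally show ?case using Cons.IH by simp
qed simp

lemma prod_list_monomial: "prod_list (map (vec_nth z) L) = monomial (count (mset L)) z"
  unfolding monomial_def by (rule prod_list_eq_prod_count)

lemma finite_multi_indices: "finite {\<alpha> :: 'd::finite \<Rightarrow> nat. (\<Sum>i\<in>UNIV. \<alpha> i) = s}"
proof -
  have "{\<alpha> :: 'd \<Rightarrow> nat. (\<Sum>i\<in>UNIV. \<alpha> i) = s} \<subseteq> (\<lambda>L. count (mset L)) ` {L. length L = s}"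
  proof
    fix \<alpha> :: "'d \<Rightarrow> nat" assume "\<alpha> \<in> {\<alpha>. (\<Sum>i\<in>UNIV. \<alpha> i) = s}"
    then have "length (index_list \<alpha>) = s" "\<alpha> = count (mset (index_list \<alpha>))"
      by (auto simp: length_index_list count_index_list)
    then show "\<alpha> \<in> (\<lambda>L. count (mset L)) ` {L. length L = s}" by blast
  qed
  then show ?thesis using finite_lists_eq finite_surj by blast
qed

text \<open>A multi-index \<alpha> of degree s is the count function of s!/\<alpha>! words, the
  permutations of one multiset. This turns the factor 1/s! of Taylor's formula over words into
  1/\<alpha>!.\<close>

lemma sum_lists_group:
  fixes G :: "'d::finite list \<Rightarrow> real"
  assumes G: "\<And>L L'. length L = s \<Longrightarrow> mset L = mset L' \<Longrightarrow> G L = G L'"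
  shows "(\<Sum>L | length L = s. G L) / fact s = (\<Sum>\<alpha> | (\<Sum>i\<in>UNIV. \<alpha> i) = s. G (index_list \<alpha>) / index_fact \<alpha>)"
proof -
  have "(\<Sum>L | length L = s. G L)
      = (\<Sum>\<alpha> | (\<Sum>i\<in>UNIV. \<alpha> i) = s. \<Sum>L | L \<in> {L. length L = s} \<and> count (mset L) = \<alpha>. G L)"
    by (rule sum.group[symmetric, OF finite_lists_eq finite_multi_indices]) (auto simp: length_eq_sum_count)
  also have "\<dots> = (\<Sum>\<alpha> | (\<Sum>i\<in>UNIV. \<alpha> i) = s. fact s / index_fact \<alpha> * G (index_list \<alpha>))"
  proof (rule sum.cong[OF refl])
    fix \<alpha> :: "'d \<Rightarrow> nat" assume \<alpha>: "\<alpha> \<in> {\<alpha>. (\<Sum>i\<in>UNIV. \<alpha> i) = s}"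
    let ?M = "mset (index_list \<alpha>)"
    have len: "length (index_list \<alpha>) = s" using \<alpha> by (simp add: length_index_list)
    have eq: "{L. L \<in> {L. length L = s} \<and> count (mset L) = \<alpha>} = permutations_of_multiset ?M"
    proof -
      have "count (mset L) = \<alpha> \<longleftrightarrow> mset L = ?M" for L
        by (auto simp: multiset_eq_iff count_index_list fun_eq_iff)
      moreover have "length L = s" if "mset L = ?M" for L
        using that len by (metis size_mset)
      ultimately show ?thesis unfolding permutations_of_multiset_def by auto
    qed
    have "(\<Sum>L | L \<in> {L. length L = s} \<and> count (mset L) = \<alpha>. G L) = (\<Sum>L\<in>permutations_of_multiset ?M. G (index_list \<alpha>))"
      unfolding eq
    proof (rule sum.cong[OF refl])
      fix L assume "L \<in> permutations_of_multiset ?M"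
      then have m: "mset L = ?M" by (rule permutations_of_multisetD)
      then have "length L = s" using len by (metis size_mset)
      then show "G L = G (index_list \<alpha>)" using m by (rule G)
    qed
    also have "\<dots> = real (card (permutations_of_multiset ?M)) * G (index_list \<alpha>)" by simp
    also have "real (card (permutations_of_multiset ?M)) = fact s / (\<Prod>i\<in>set_mset ?M. fact (count ?M i))"
      unfolding card_permutations_of_multiset(1)
      using card_permutations_of_multiset(2)[of ?M] len
      by (simp add: real_of_nat_div of_nat_prod del: set_mset_mset)
    also have "(\<Prod>i\<in>set_mset ?M. fact (count ?M i)) = (index_fact \<alpha> :: real)"
    proof -
      have "(\<Prod>i\<in>set_mset ?M. fact (count ?M i)) = (\<Prod>i\<in>UNIV. fact (count ?M i) :: real)"
        by (rule prod.mono_neutral_left) (simp_all add: count_mset_0_iff[THEN iffD2])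
      then show ?thesis unfolding index_fact_def count_index_list .
    qed
    finally show "(\<Sum>L | L \<in> {L. length L = s} \<and> count (mset L) = \<alpha>. G L) = fact s / index_fact \<alpha> * G (index_list \<alpha>)" .
  qed
  finally show ?thesis by (simp add: sum_divide_distrib)
qed

section \<open>Weights with vanishing moments and the limit of the kernel form\<close>

text \<open>The inequality is strict: i = 0 is no condition, and passing from i to
  \<open>Suc i\<close> adds the moments of degree exactly i.\<close>

definition annihilates :: "nat \<Rightarrow> (nat \<Rightarrow> real ^ 'd::finite) \<Rightarrow> (nat \<Rightarrow> real) \<Rightarrow> nat \<Rightarrow> bool" where
  "annihilates n x y i \<longleftrightarrow> (\<forall>\<alpha>. (\<Sum>j\<in>UNIV. \<alpha> j) < i \<longrightarrow> (\<Sum>a<n. y a * monomial \<alpha> (x a)) = 0)"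

lemma annihilates_list:
  assumes "annihilates n x y i" "length L < i"
  shows "(\<Sum>a<n. y a * prod_list (map (vec_nth (x a)) L)) = 0"
proof -
  have "(\<Sum>j\<in>UNIV. count (mset L) j) < i" using assms(2) unfolding length_eq_sum_count .
  with assms(1) show ?thesis unfolding annihilates_def prod_list_monomial by blast
qed

lemma axis_sum:
  "(\<Sum>i\<in>UNIV. vec_nth z i *\<^sub>R axis i (1::real)) = z"
  using basis_expansion[of z] unfolding scalar_mult_eq_scaleR .

lemma axis_sum_Pair:
  "(\<Sum>i\<in>UNIV. vec_nth z i *\<^sub>R (axis i (1::real), 0 :: real ^ 'd::finite)) = (z, 0)"
  "(\<Sum>i\<in>UNIV. vec_nth z i *\<^sub>R (0 :: real ^ 'd::finite, axis i (1::real))) = (0, z)"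
proof -
  have "(\<Sum>i\<in>UNIV. vec_nth z i *\<^sub>R (axis i (1::real), 0 :: real ^ 'd::finite)) = (\<Sum>i\<in>UNIV. vec_nth z i *\<^sub>R axis i (1::real), 0)"
    by (simp add: prod_eq_iff fst_sum snd_sum)
  then show "(\<Sum>i\<in>UNIV. vec_nth z i *\<^sub>R (axis i (1::real), 0 :: real ^ 'd::finite)) = (z, 0)" by (simp add: axis_sum)
  have "(\<Sum>i\<in>UNIV. vec_nth z i *\<^sub>R (0 :: real ^ 'd::finite, axis i (1::real))) = (0, \<Sum>i\<in>UNIV. vec_nth z i *\<^sub>R axis i (1::real))"
    by (simp add: prod_eq_iff fst_sum snd_sum)
  then show "(\<Sum>i\<in>UNIV. vec_nth z i *\<^sub>R (0 :: real ^ 'd::finite, axis i (1::real))) = (0, z)" by (simp add: axis_sum)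
qed

abbreviation (input) ex :: "'d::finite \<Rightarrow> (real ^ 'd) \<times> (real ^ 'd)" where "ex i \<equiv> (axis i 1, 0)"
abbreviation (input) ey :: "'d::finite \<Rightarrow> (real ^ 'd) \<times> (real ^ 'd)" where "ey i \<equiv> (0, axis i 1)"

text \<open>\<open>xy_directions\<close> applies the derivatives in y first. So x-smoothness is
  available for every y-derivative of the kernel, which fixes the order of the two Taylor expansions
  below.\<close>

lemma kernel_CE:
  assumes "kernel_C q k"
  obtains U where "open U" "(0, 0) \<in> U"
    "smooth_along U ey q (case_prod k)"
    "\<And>L. length L \<le> q \<Longrightarrow> smooth_along U ex q (iter_deriv (map ey L) (case_prod k))"
    "\<And>L' L. length L' \<le> q \<Longrightarrow> length L \<le> q \<Longrightarrow> continuous_on U (iter_deriv (map ex L') (iter_deriv (map ey L) (case_prod k)))"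
proof -
  obtain U where U: "open U" "(0, 0) \<in> U" and
    d: "\<And>is js. length is \<le> q \<Longrightarrow> length js \<le> q \<Longrightarrow>
           iter_deriv_exists U (xy_directions is js) (case_prod k) \<and>
           continuous_on U (iter_deriv (xy_directions is js) (case_prod k))"
    using assms unfolding kernel_C_def by auto
  show ?thesis
  proof (rule that[OF U])
    show "smooth_along U ey q (case_prod k)"
      unfolding smooth_along_def using d[of "[]"] by (simp add: xy_directions_def)
    show "smooth_along U ex q (iter_deriv (map ey L) (case_prod k))" if "length L \<le> q" for L
      unfolding smooth_along_def using d[of _ L] that
      by (auto simp: xy_directions_def iter_deriv_append iter_deriv_exists_append)
    show "continuous_on U (iter_deriv (map ex L') (iter_deriv (map ey L) (case_prod k)))"
      if "length L' \<le> q" "length L \<le> q" for L L'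
      using d[of L' L] that by (auto simp: xy_directions_def iter_deriv_append iter_deriv_exists_append)
  qed
qed

lemma small_scalings:
  fixes x :: "nat \<Rightarrow> 'a::real_normed_vector"
  assumes "open U" "(0, 0) \<in> U"
  obtains \<delta> where "\<delta> > 0" "\<And>a b s t. a < n \<Longrightarrow> b < n \<Longrightarrow> \<bar>s\<bar> < \<delta> \<Longrightarrow> \<bar>t\<bar> < \<delta> \<Longrightarrow> (s *\<^sub>R x a, t *\<^sub>R x b) \<in> U"
proof -
  obtain r where r: "r > 0" "ball (0, 0) r \<subseteq> U" using assms openE by blast
  define X where "X = 1 + (\<Sum>a<n. norm (x a))"
  have X: "X \<ge> 1" unfolding X_def by (simp add: sum_nonneg)
  have xa: "norm (x a) \<le> X" if "a < n" for a
    unfolding X_def using member_le_sum[of a "{..<n}" "\<lambda>a. norm (x a)"] that by auto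
  have le: "norm (s *\<^sub>R x a) < r / 2" if "a < n" "\<bar>s\<bar> < r / (2 * X)" for a s
  proof -
    have "norm (s *\<^sub>R x a) \<le> \<bar>s\<bar> * X" using xa[OF that(1)] by (simp add: mult_left_mono)
    also have "\<dots> < r / (2 * X) * X" using that X by (intro mult_strict_right_mono) auto
    finally show ?thesis using X by simp
  qed
  show ?thesis
  proof (rule that[of "r / (2 * X)"])
    show "r / (2 * X) > 0" using r X by simp
    fix a b s t assume "a < n" "b < n" "\<bar>s\<bar> < r / (2 * X)" "\<bar>t\<bar> < r / (2 * X)"
    then have "norm (s *\<^sub>R x a) + norm (t *\<^sub>R x b) < r" using le[of a s] le[of b t] by simp
    then have "norm (s *\<^sub>R x a, t *\<^sub>R x b) < r" using norm_Pair_le le_less_trans by blast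
    then have "(s *\<^sub>R x a, t *\<^sub>R x b) \<in> ball (0, 0) r"
      by (simp add: dist_norm norm_Pair)
    then show "(s *\<^sub>R x a, t *\<^sub>R x b) \<in> U" using r by auto
  qed
qed

text \<open>An entry of \<open>wronskian\<close>, addressed by its two multi-indices and thus
  independent of the monomial ordering.\<close>

definition kernel_coeff :: "(real ^ 'd::finite \<Rightarrow> real ^ 'd \<Rightarrow> real) \<Rightarrow> ('d \<Rightarrow> nat) \<Rightarrow> ('d \<Rightarrow> nat) \<Rightarrow> real" where
  "kernel_coeff k \<alpha> \<beta> = 1 / (index_fact \<alpha> * index_fact \<beta>) *
     iter_deriv (xy_directions (index_list \<alpha>) (index_list \<beta>)) (case_prod k) (0, 0)"

text \<open>Taylor's formula in y up to order l, at the base points (\<epsilon> x_a, 0), loses its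
  lower terms through y'; Taylor's formula in x up to order i, at (0, t x_b), loses its lower terms
  through y. What remains is \<epsilon>^(i + l) times mixed derivatives at points that tend to (0,
  0).\<close>

lemma kernel_limit_lists:
  fixes x :: "nat \<Rightarrow> real ^ 'd::finite"
  assumes k: "kernel_C q k" and il: "i \<le> q" "l \<le> q"
    and y: "annihilates n x y i" and y': "annihilates n x y' l"
  defines "D \<equiv> \<lambda>L' L. iter_deriv (map ex L') (iter_deriv (map ey L) (case_prod k))"
    and "\<mu> \<equiv> \<lambda>y L. \<Sum>a<n. y a * prod_list (map (vec_nth (x a)) L)"
  shows "((\<lambda>\<epsilon>. (\<Sum>a<n. \<Sum>b<n. y a * y' b * k (\<epsilon> *\<^sub>R x a) (\<epsilon> *\<^sub>R x b)) / \<epsilon> ^ (i + l)) \<longlongrightarrow>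
     1 / (fact i * fact l) * (\<Sum>L' | length L' = i. \<Sum>L | length L = l. \<mu> y L' * \<mu> y' L * D L' L (0, 0))) (at_right 0)"
proof -
  obtain U where U: "open U" "(0, 0) \<in> U"
    and sy: "smooth_along U ey q (case_prod k)"
    and sx: "\<And>L. length L \<le> q \<Longrightarrow> smooth_along U ex q (iter_deriv (map ey L) (case_prod k))"
    and cont: "\<And>L' L. length L' \<le> q \<Longrightarrow> length L \<le> q \<Longrightarrow> continuous_on U (D L' L)"
    using kernel_CE[OF k] unfolding D_def by metis
  obtain \<delta> where \<delta>: "\<delta> > 0" "\<And>a b s t. a < n \<Longrightarrow> b < n \<Longrightarrow> \<bar>s\<bar> < \<delta> \<Longrightarrow> \<bar>t\<bar> < \<delta> \<Longrightarrow> (s *\<^sub>R x a, t *\<^sub>R x b) \<in> U"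
    using small_scalings[OF U, of n x] by blast
  let ?P = "{..<n} \<times> {..<n}"
  let ?X = "\<lambda>a L. prod_list (map (vec_nth (x a)) L)"
  define T where "T s t = (\<Sum>(a, b)\<in>?P. \<Sum>L | length L = l. \<Sum>L' | length L' = i.
      y a * ?X a L' * (y' b * ?X b L) * D L' L (s *\<^sub>R x a, t *\<^sub>R x b))" for s t
  \<comment> \<open>The pair p consists of the intermediate parameters of the two arguments, both in
    [0, \<epsilon>] and common to all pairs of points.\<close>
  have main: "\<exists>p. 0 \<le> fst p \<and> fst p \<le> \<epsilon> \<and> 0 \<le> snd p \<and> snd p \<le> \<epsilon> \<and>
      (\<Sum>a<n. \<Sum>b<n. y a * y' b * k (\<epsilon> *\<^sub>R x a) (\<epsilon> *\<^sub>R x b)) / \<epsilon> ^ (i + l) = 1 / (fact i * fact l) * T (fst p) (snd p)"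
    if \<epsilon>: "0 < \<epsilon>" "\<epsilon> < \<delta>" for \<epsilon>
  proof -
    have "\<exists>t. 0 \<le> t \<and> t \<le> \<epsilon> \<and>
       (\<Sum>p\<in>?P. (y (fst p) * y' (snd p)) * (case_prod k) ((\<epsilon> *\<^sub>R x (fst p), 0) + \<epsilon> *\<^sub>R (\<Sum>i\<in>UNIV. vec_nth (x (snd p)) i *\<^sub>R ey i))) =
       \<epsilon> ^ l / fact l * (\<Sum>p\<in>?P. (y (fst p) * y' (snd p)) * multi_deriv (vec_nth (x (snd p))) ey l (case_prod k)
          ((\<epsilon> *\<^sub>R x (fst p), 0) + t *\<^sub>R (\<Sum>i\<in>UNIV. vec_nth (x (snd p)) i *\<^sub>R ey i)))"
    proof (rule taylor_sum[OF U(1) sy il(2) \<epsilon>(1)])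
      fix p t assume "p \<in> ?P" "0 \<le> t" "t \<le> \<epsilon>"
      then show "(\<epsilon> *\<^sub>R x (fst p), 0) + t *\<^sub>R (\<Sum>i\<in>UNIV. vec_nth (x (snd p)) i *\<^sub>R ey i) \<in> U"
        using \<delta>(2)[of "fst p" "snd p" \<epsilon> t] \<epsilon> unfolding axis_sum_Pair by auto
    next
      fix s assume s: "s < l"
      have "(\<Sum>p\<in>?P. (y (fst p) * y' (snd p)) * multi_deriv (vec_nth (x (snd p))) ey s (case_prod k) (\<epsilon> *\<^sub>R x (fst p), 0))
         = (\<Sum>a<n. \<Sum>b<n. \<Sum>L | length L = s. (y a * iter_deriv (map ey L) (case_prod k) (\<epsilon> *\<^sub>R x a, 0)) * (y' b * ?X b L))"
        unfolding multi_deriv_def by (simp add: sum_distrib_left sum.cartesian_product' mult_ac)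
      also have "\<dots> = (\<Sum>a<n. \<Sum>L | length L = s. \<Sum>b<n. (y a * iter_deriv (map ey L) (case_prod k) (\<epsilon> *\<^sub>R x a, 0)) * (y' b * ?X b L))"
        by (intro sum.cong refl sum.swap)
      also have "\<dots> = (\<Sum>a<n. \<Sum>L | length L = s. (y a * iter_deriv (map ey L) (case_prod k) (\<epsilon> *\<^sub>R x a, 0)) * \<mu> y' L)"
        unfolding \<mu>_def sum_distrib_left ..
      also have "\<dots> = 0"
        using annihilates_list[OF y'] s by (intro sum.neutral ballI) (auto simp: \<mu>_def)
      finally show "(\<Sum>p\<in>?P. (y (fst p) * y' (snd p)) * multi_deriv (vec_nth (x (snd p))) ey s (case_prod k) (\<epsilon> *\<^sub>R x (fst p), 0)) = 0" .
    qed
    then obtain t where t: "0 \<le> t" "t \<le> \<epsilon>" and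
      eq1: "(\<Sum>p\<in>?P. (y (fst p) * y' (snd p)) * k (\<epsilon> *\<^sub>R x (fst p)) (\<epsilon> *\<^sub>R x (snd p))) =
       \<epsilon> ^ l / fact l * (\<Sum>p\<in>?P. (y (fst p) * y' (snd p)) * multi_deriv (vec_nth (x (snd p))) ey l (case_prod k)
          (\<epsilon> *\<^sub>R x (fst p), t *\<^sub>R x (snd p)))"
      unfolding axis_sum_Pair by auto
    \<comment> \<open>The first expansion has replaced the kernel by its y-derivatives along words L
      of length l. The second one therefore sums over pairs of points together with such
      words.\<close>
    let ?A = "?P \<times> {L :: 'd list. length L = l}"
    have "\<exists>s. 0 \<le> s \<and> s \<le> \<epsilon> \<and>
       (\<Sum>p\<in>?A. (y (fst (fst p)) * y' (snd (fst p)) * ?X (snd (fst p)) (snd p)) *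
           iter_deriv (map ey (snd p)) (case_prod k) ((0, t *\<^sub>R x (snd (fst p))) + \<epsilon> *\<^sub>R (\<Sum>i\<in>UNIV. vec_nth (x (fst (fst p))) i *\<^sub>R ex i))) =
       \<epsilon> ^ i / fact i * (\<Sum>p\<in>?A. (y (fst (fst p)) * y' (snd (fst p)) * ?X (snd (fst p)) (snd p)) *
          multi_deriv (vec_nth (x (fst (fst p)))) ex i (iter_deriv (map ey (snd p)) (case_prod k))
          ((0, t *\<^sub>R x (snd (fst p))) + s *\<^sub>R (\<Sum>i\<in>UNIV. vec_nth (x (fst (fst p))) i *\<^sub>R ex i)))"
    proof (rule taylor_sum[OF U(1) _ il(1) \<epsilon>(1)])
      fix p assume "p \<in> ?A"
      then show "smooth_along U ex q (iter_deriv (map ey (snd p)) (case_prod k))"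
        using il by (intro sx) auto
    next
      fix p s assume "p \<in> ?A" "0 \<le> s" "s \<le> \<epsilon>"
      then show "(0, t *\<^sub>R x (snd (fst p))) + s *\<^sub>R (\<Sum>i\<in>UNIV. vec_nth (x (fst (fst p))) i *\<^sub>R ex i) \<in> U"
        using \<delta>(2)[of "fst (fst p)" "snd (fst p)" s t] \<epsilon> t unfolding axis_sum_Pair by auto
    next
      fix s assume s: "s < i"
      have "(\<Sum>p\<in>?A. (y (fst (fst p)) * y' (snd (fst p)) * ?X (snd (fst p)) (snd p)) *
          multi_deriv (vec_nth (x (fst (fst p)))) ex s (iter_deriv (map ey (snd p)) (case_prod k)) (0, t *\<^sub>R x (snd (fst p))))
         = (\<Sum>a<n. \<Sum>b<n. \<Sum>L | length L = l. \<Sum>L' | length L' = s. (y a * ?X a L') * (y' b * ?X b L * D L' L (0, t *\<^sub>R x b)))"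
        unfolding multi_deriv_def D_def
        by (simp add: sum_distrib_left sum.cartesian_product' mult_ac)
      also have "\<dots> = (\<Sum>b<n. \<Sum>a<n. \<Sum>L | length L = l. \<Sum>L' | length L' = s. (y a * ?X a L') * (y' b * ?X b L * D L' L (0, t *\<^sub>R x b)))"
        by (rule sum.swap)
      also have "\<dots> = (\<Sum>b<n. \<Sum>L | length L = l. \<Sum>a<n. \<Sum>L' | length L' = s. (y a * ?X a L') * (y' b * ?X b L * D L' L (0, t *\<^sub>R x b)))"
        by (intro sum.cong refl sum.swap)
      also have "\<dots> = (\<Sum>b<n. \<Sum>L | length L = l. \<Sum>L' | length L' = s. \<Sum>a<n. (y a * ?X a L') * (y' b * ?X b L * D L' L (0, t *\<^sub>R x b)))"
        by (intro sum.cong refl sum.swap)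
      also have "\<dots> = (\<Sum>b<n. \<Sum>L | length L = l. \<Sum>L' | length L' = s. \<mu> y L' * (y' b * ?X b L * D L' L (0, t *\<^sub>R x b)))"
        unfolding \<mu>_def sum_distrib_right ..
      also have "\<dots> = 0"
        using annihilates_list[OF y] s by (intro sum.neutral ballI) (auto simp: \<mu>_def)
      finally show "(\<Sum>p\<in>?A. (y (fst (fst p)) * y' (snd (fst p)) * ?X (snd (fst p)) (snd p)) *
          multi_deriv (vec_nth (x (fst (fst p)))) ex s (iter_deriv (map ey (snd p)) (case_prod k)) (0, t *\<^sub>R x (snd (fst p)))) = 0" .
    qed
    then obtain s where s: "0 \<le> s" "s \<le> \<epsilon>" and
      eq2: "(\<Sum>p\<in>?A. (y (fst (fst p)) * y' (snd (fst p)) * ?X (snd (fst p)) (snd p)) *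
           iter_deriv (map ey (snd p)) (case_prod k) (\<epsilon> *\<^sub>R x (fst (fst p)), t *\<^sub>R x (snd (fst p)))) =
       \<epsilon> ^ i / fact i * (\<Sum>p\<in>?A. (y (fst (fst p)) * y' (snd (fst p)) * ?X (snd (fst p)) (snd p)) *
          multi_deriv (vec_nth (x (fst (fst p)))) ex i (iter_deriv (map ey (snd p)) (case_prod k))
          (s *\<^sub>R x (fst (fst p)), t *\<^sub>R x (snd (fst p))))"
      unfolding axis_sum_Pair by auto
    have e1: "(\<Sum>p\<in>?P. (y (fst p) * y' (snd p)) * multi_deriv (vec_nth (x (snd p))) ey l (case_prod k)
          (\<epsilon> *\<^sub>R x (fst p), t *\<^sub>R x (snd p))) = (\<Sum>p\<in>?A. (y (fst (fst p)) * y' (snd (fst p)) * ?X (snd (fst p)) (snd p)) *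
           iter_deriv (map ey (snd p)) (case_prod k) (\<epsilon> *\<^sub>R x (fst (fst p)), t *\<^sub>R x (snd (fst p))))"
      unfolding multi_deriv_def by (simp add: sum_distrib_left sum.cartesian_product' mult_ac)
    have e2: "(\<Sum>p\<in>?A. (y (fst (fst p)) * y' (snd (fst p)) * ?X (snd (fst p)) (snd p)) *
          multi_deriv (vec_nth (x (fst (fst p)))) ex i (iter_deriv (map ey (snd p)) (case_prod k))
          (s *\<^sub>R x (fst (fst p)), t *\<^sub>R x (snd (fst p)))) = T s t"
      unfolding multi_deriv_def T_def D_def by (simp add: sum_distrib_left sum.cartesian_product' mult_ac)
    have "(\<Sum>a<n. \<Sum>b<n. y a * y' b * k (\<epsilon> *\<^sub>R x a) (\<epsilon> *\<^sub>R x b)) =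
        (\<Sum>p\<in>?P. (y (fst p) * y' (snd p)) * k (\<epsilon> *\<^sub>R x (fst p)) (\<epsilon> *\<^sub>R x (snd p)))"
      by (simp add: sum.cartesian_product')
    also have "\<dots> = \<epsilon> ^ l / fact l * (\<epsilon> ^ i / fact i * T s t)"
      unfolding eq1 e1 eq2 e2 ..
    finally have "(\<Sum>a<n. \<Sum>b<n. y a * y' b * k (\<epsilon> *\<^sub>R x a) (\<epsilon> *\<^sub>R x b)) / \<epsilon> ^ (i + l) = 1 / (fact i * fact l) * T s t"
      using \<epsilon>(1) by (simp add: power_add field_simps)
    then show ?thesis using s t by (intro exI[of _ "(s, t)"]) simp
  qed
  then have "\<forall>\<epsilon>. \<exists>p. 0 < \<epsilon> \<and> \<epsilon> < \<delta> \<longrightarrow> 0 \<le> fst p \<and> fst p \<le> \<epsilon> \<and> 0 \<le> snd p \<and> snd p \<le> \<epsilon> \<and>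
      (\<Sum>a<n. \<Sum>b<n. y a * y' b * k (\<epsilon> *\<^sub>R x a) (\<epsilon> *\<^sub>R x b)) / \<epsilon> ^ (i + l) = 1 / (fact i * fact l) * T (fst p) (snd p)"
    by blast
  from choice[OF this] obtain p where "\<forall>\<epsilon>. 0 < \<epsilon> \<and> \<epsilon> < \<delta> \<longrightarrow> 0 \<le> fst (p \<epsilon>) \<and> fst (p \<epsilon>) \<le> \<epsilon> \<and> 0 \<le> snd (p \<epsilon>) \<and> snd (p \<epsilon>) \<le> \<epsilon> \<and>
      (\<Sum>a<n. \<Sum>b<n. y a * y' b * k (\<epsilon> *\<^sub>R x a) (\<epsilon> *\<^sub>R x b)) / \<epsilon> ^ (i + l) = 1 / (fact i * fact l) * T (fst (p \<epsilon>)) (snd (p \<epsilon>))"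
    by (rule exE)
  note p = mp[OF spec[OF this]]
  have ev: "eventually (\<lambda>\<epsilon>. 0 < \<epsilon> \<and> \<epsilon> < \<delta>) (at_right (0::real))"
    using \<delta>(1) by (auto simp: eventually_at_right_field intro: exI[of _ \<delta>])
  have l1: "((\<lambda>\<epsilon>. fst (p \<epsilon>)) \<longlongrightarrow> 0) (at_right 0)"
  proof (rule Lim_null_comparison[where g = "\<lambda>t. t"])
    show "eventually (\<lambda>t. norm (fst (p t)) \<le> t) (at_right 0)"
      using ev by eventually_elim (use p in \<open>auto simp: abs_of_nonneg\<close>)
  qed (auto intro!: tendsto_eq_intros)
  have l2: "((\<lambda>\<epsilon>. snd (p \<epsilon>)) \<longlongrightarrow> 0) (at_right 0)"
  proof (rule Lim_null_comparison[where g = "\<lambda>t. t"])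
    show "eventually (\<lambda>t. norm (snd (p t)) \<le> t) (at_right 0)"
      using ev by eventually_elim (use p in \<open>auto simp: abs_of_nonneg\<close>)
  qed (auto intro!: tendsto_eq_intros)
  have lD: "((\<lambda>\<epsilon>. D L' L (fst (p \<epsilon>) *\<^sub>R x a, snd (p \<epsilon>) *\<^sub>R x b)) \<longlongrightarrow> D L' L (0, 0)) (at_right 0)"
    if "length L' = i" "length L = l" for L' L a b
  proof -
    have "isCont (D L' L) (0, 0)" using cont[of L' L] that il U by (simp add: continuous_on_eq_continuous_at)
    moreover have "((\<lambda>\<epsilon>. (fst (p \<epsilon>) *\<^sub>R x a, snd (p \<epsilon>) *\<^sub>R x b)) \<longlongrightarrow> (0 *\<^sub>R x a, 0 *\<^sub>R x b)) (at_right 0)"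
      by (intro tendsto_intros l1 l2)
    ultimately show ?thesis using isCont_tendsto_compose by fastforce
  qed
  have "((\<lambda>\<epsilon>. T (fst (p \<epsilon>)) (snd (p \<epsilon>))) \<longlongrightarrow> (\<Sum>(a, b)\<in>?P. \<Sum>L | length L = l. \<Sum>L' | length L' = i.
      y a * ?X a L' * (y' b * ?X b L) * D L' L (0, 0))) (at_right 0)"
    unfolding T_def split_def by (intro tendsto_sum tendsto_mult tendsto_const lD) auto
  also have "(\<Sum>(a, b)\<in>?P. \<Sum>L | length L = l. \<Sum>L' | length L' = i. y a * ?X a L' * (y' b * ?X b L) * D L' L (0, 0))
     = (\<Sum>L' | length L' = i. \<Sum>L | length L = l. \<mu> y L' * \<mu> y' L * D L' L (0, 0))"
  proof -
    have "(\<Sum>(a, b)\<in>?P. \<Sum>L | length L = l. \<Sum>L' | length L' = i. y a * ?X a L' * (y' b * ?X b L) * D L' L (0, 0))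
       = (\<Sum>L | length L = l. \<Sum>L' | length L' = i. \<Sum>(a, b)\<in>?P. y a * ?X a L' * (y' b * ?X b L) * D L' L (0, 0))"
      unfolding split_def by (subst sum.swap, rule sum.cong[OF refl], rule sum.swap)
    also have "\<dots> = (\<Sum>L | length L = l. \<Sum>L' | length L' = i. \<mu> y L' * \<mu> y' L * D L' L (0, 0))"
      unfolding \<mu>_def sum_product by (simp add: sum_distrib_right sum.cartesian_product')
    also have "\<dots> = (\<Sum>L' | length L' = i. \<Sum>L | length L = l. \<mu> y L' * \<mu> y' L * D L' L (0, 0))"
      by (rule sum.swap)
    finally show ?thesis .
  qed
  finally have "((\<lambda>\<epsilon>. 1 / (fact i * fact l) * T (fst (p \<epsilon>)) (snd (p \<epsilon>))) \<longlongrightarrow>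
      1 / (fact i * fact l) * (\<Sum>L' | length L' = i. \<Sum>L | length L = l. \<mu> y L' * \<mu> y' L * D L' L (0, 0))) (at_right 0)"
    by (intro tendsto_mult tendsto_const)
  moreover have "eventually (\<lambda>\<epsilon>. 1 / (fact i * fact l) * T (fst (p \<epsilon>)) (snd (p \<epsilon>)) =
     (\<Sum>a<n. \<Sum>b<n. y a * y' b * k (\<epsilon> *\<^sub>R x a) (\<epsilon> *\<^sub>R x b)) / \<epsilon> ^ (i + l)) (at_right 0)"
    using ev by eventually_elim (use p in simp)
  ultimately show ?thesis by (rule Lim_transform_eventually)
qed

text \<open>Moments and derivatives depend only on the multiset of a word, so both sums over words
  are grouped into sums over multi-indices. Reordering the y-word takes place under the
  x-derivatives, whence the use of \<open>iter_deriv_cong\<close>.\<close>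

lemma kernel_limit:
  fixes x :: "nat \<Rightarrow> real ^ 'd::finite"
  assumes k: "kernel_C q k" and il: "i \<le> q" "l \<le> q"
    and y: "annihilates n x y i" and y': "annihilates n x y' l"
  shows "((\<lambda>\<epsilon>. (\<Sum>a<n. \<Sum>b<n. y a * y' b * k (\<epsilon> *\<^sub>R x a) (\<epsilon> *\<^sub>R x b)) / \<epsilon> ^ (i + l)) \<longlongrightarrow>
     (\<Sum>\<alpha> | (\<Sum>r\<in>UNIV. \<alpha> r) = i. \<Sum>\<beta> | (\<Sum>r\<in>UNIV. \<beta> r) = l.
       (\<Sum>a<n. y a * monomial \<alpha> (x a)) * kernel_coeff k \<alpha> \<beta> * (\<Sum>a<n. y' a * monomial \<beta> (x a)))) (at_right 0)"
proof -
  obtain U where U: "open U" "(0, 0) \<in> U"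
    and sy: "smooth_along U ey q (case_prod k)"
    and sx: "\<And>L. length L \<le> q \<Longrightarrow> smooth_along U ex q (iter_deriv (map ey L) (case_prod k))"
    using kernel_CE[OF k] by metis
  define D where "D L' L = iter_deriv (map ex L') (iter_deriv (map ey L) (case_prod k)) (0, 0)" for L' L
  define \<mu> where "\<mu> y L = (\<Sum>a<n. y a * prod_list (map (vec_nth (x a)) L))" for y L
  have \<mu>: "\<mu> y L = \<mu> y L'" if "mset L = mset L'" for y L L'
    unfolding \<mu>_def prod_list_monomial that ..
  have \<mu>': "\<mu> y (index_list \<alpha>) = (\<Sum>a<n. y a * monomial \<alpha> (x a))" for y \<alpha>
    unfolding \<mu>_def prod_list_monomial count_index_list ..
  have DL: "D L' L = D L' M" if "length L \<le> q" "mset L = mset M" for L' L M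
    unfolding D_def by (rule iter_deriv_cong[OF U(1) _ U(2)]) (rule smooth_along_mset[OF U(1) sy that(2,1)])
  have DL': "D L' L = D M L" if "length L' \<le> q" "length L \<le> q" "mset L' = mset M" for L' L M
    unfolding D_def by (rule smooth_along_mset[OF U(1) sx[OF that(2)] that(3,1) U(2)])
  have coeff: "kernel_coeff k \<alpha> \<beta> = D (index_list \<alpha>) (index_list \<beta>) / (index_fact \<alpha> * index_fact \<beta>)" for \<alpha> \<beta>
    unfolding kernel_coeff_def D_def xy_directions_def iter_deriv_append by simp
  have "1 / (fact i * fact l) * (\<Sum>L' | length L' = i. \<Sum>L | length L = l. \<mu> y L' * \<mu> y' L * D L' L)
     = (\<Sum>L' | length L' = i. \<mu> y L' * ((\<Sum>L | length L = l. \<mu> y' L * D L' L) / fact l)) / fact i"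
    by (simp add: sum_distrib_left sum_divide_distrib mult_ac)
  also have "\<dots> = (\<Sum>L' | length L' = i. \<mu> y L' * (\<Sum>\<beta> | (\<Sum>r\<in>UNIV. \<beta> r) = l. \<mu> y' (index_list \<beta>) * D L' (index_list \<beta>) / index_fact \<beta>)) / fact i"
  proof -
    have "(\<Sum>L | length L = l. \<mu> y' L * D L' L) / fact l = (\<Sum>\<beta> | (\<Sum>r\<in>UNIV. \<beta> r) = l. \<mu> y' (index_list \<beta>) * D L' (index_list \<beta>) / index_fact \<beta>)" for L'
    proof (rule sum_lists_group)
      fix L M :: "'d list" assume "length L = l" "mset L = mset M"
      then show "\<mu> y' L * D L' L = \<mu> y' M * D L' M" using \<mu>[of L M] DL[of L M] il by simp
    qed
    then show ?thesis by simp
  qed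
  also have "\<dots> = (\<Sum>\<alpha> | (\<Sum>r\<in>UNIV. \<alpha> r) = i. \<mu> y (index_list \<alpha>) * (\<Sum>\<beta> | (\<Sum>r\<in>UNIV. \<beta> r) = l. \<mu> y' (index_list \<beta>) * D (index_list \<alpha>) (index_list \<beta>) / index_fact \<beta>) / index_fact \<alpha>)"
  proof (rule sum_lists_group)
    fix L M :: "'d list" assume LM: "length L = i" "mset L = mset M"
    have "D L (index_list \<beta>) = D M (index_list \<beta>)" if "(\<Sum>r\<in>UNIV. \<beta> r) = l" for \<beta>
      using DL'[of L "index_list \<beta>" M] LM il that by (simp add: length_index_list)
    then have "(\<Sum>\<beta> | (\<Sum>r\<in>UNIV. \<beta> r) = l. \<mu> y' (index_list \<beta>) * D L (index_list \<beta>) / index_fact \<beta>)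
        = (\<Sum>\<beta> | (\<Sum>r\<in>UNIV. \<beta> r) = l. \<mu> y' (index_list \<beta>) * D M (index_list \<beta>) / index_fact \<beta>)"
      by (intro sum.cong) auto
    then show "\<mu> y L * (\<Sum>\<beta> | (\<Sum>r\<in>UNIV. \<beta> r) = l. \<mu> y' (index_list \<beta>) * D L (index_list \<beta>) / index_fact \<beta>)
        = \<mu> y M * (\<Sum>\<beta> | (\<Sum>r\<in>UNIV. \<beta> r) = l. \<mu> y' (index_list \<beta>) * D M (index_list \<beta>) / index_fact \<beta>)"
      using \<mu>[OF LM(2)] by simp
  qed
  also have "\<dots> = (\<Sum>\<alpha> | (\<Sum>r\<in>UNIV. \<alpha> r) = i. \<Sum>\<beta> | (\<Sum>r\<in>UNIV. \<beta> r) = l.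
       \<mu> y (index_list \<alpha>) * kernel_coeff k \<alpha> \<beta> * \<mu> y' (index_list \<beta>))"
    unfolding coeff by (simp add: sum_distrib_left sum_divide_distrib mult_ac)
  finally have eq: "1 / (fact i * fact l) * (\<Sum>L' | length L' = i. \<Sum>L | length L = l. \<mu> y L' * \<mu> y' L * D L' L) = \<dots>" .
  show ?thesis
    using kernel_limit_lists[OF k il y y', folded \<mu>_def D_def] unfolding eq \<mu>' .
qed

section \<open>Smoothness of radial kernels\<close>

lemma iter_deriv_step:
  assumes U: "open U" and z: "z \<in> U"
    and eq: "\<And>z. z \<in> U \<Longrightarrow> iter_deriv bs f z = g z"
    and D: "((\<lambda>t. g (z + t *\<^sub>R b)) has_real_derivative D) (at 0)"
  shows "((\<lambda>t. iter_deriv bs f (z + t *\<^sub>R b)) has_real_derivative D) (at 0)"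
proof -
  obtain \<delta> where \<delta>: "\<delta> > 0" "\<And>s t. \<bar>s\<bar> < \<delta> \<Longrightarrow> \<bar>t\<bar> < \<delta> \<Longrightarrow> z + s *\<^sub>R b + t *\<^sub>R b \<in> U"
    using open_segment_bound[OF U z] by blast
  have "eventually (\<lambda>t. g (z + t *\<^sub>R b) = iter_deriv bs f (z + t *\<^sub>R b)) (nhds 0)"
    unfolding eventually_nhds_metric
  proof (intro exI[of _ \<delta>] conjI allI impI \<delta>(1))
    fix t :: real assume "dist t 0 < \<delta>"
    then have "z + t *\<^sub>R b \<in> U" using \<delta>(1) \<delta>(2)[of 0 t] by simp
    then show "g (z + t *\<^sub>R b) = iter_deriv bs f (z + t *\<^sub>R b)" using eq by simp
  qed
  then show ?thesis using D by (subst (asm) DERIV_cong_ev[OF refl _ refl])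
qed

text \<open>An induction principle: \<open>C i\<close> is a class meant to contain the derivatives
  of order i, and it is enough that one directional derivative leads from \<open>C i\<close> to
  \<open>C (Suc i)\<close>. It serves for polynomials and for radial terms, whose degree drops with
  i.\<close>

lemma iter_deriv_in_class:
  assumes U: "open U" and f: "C 0 f"
    and step: "\<And>i g b. i < N \<Longrightarrow> C i g \<Longrightarrow> \<exists>g'. C (Suc i) g' \<and> (\<forall>z\<in>U. ((\<lambda>t. g (z + t *\<^sub>R b)) has_real_derivative g' z) (at 0))"
  shows "length bs \<le> N \<Longrightarrow> iter_deriv_exists U bs f \<and> (\<exists>g. C (length bs) g \<and> (\<forall>z\<in>U. iter_deriv bs f z = g z))"
proof (induction bs)
  case Nil
  then show ?case using f by auto
next
  case (Cons b bs)
  then obtain g where ex: "iter_deriv_exists U bs f" and g: "C (length bs) g" "\<And>z. z \<in> U \<Longrightarrow> iter_deriv bs f z = g z"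
    by auto
  obtain g' where g': "C (Suc (length bs)) g'" "\<And>z. z \<in> U \<Longrightarrow> ((\<lambda>t. g (z + t *\<^sub>R b)) has_real_derivative g' z) (at 0)"
    using step[OF _ g(1), of b] Cons.prems by auto
  have d: "((\<lambda>t. iter_deriv bs f (z + t *\<^sub>R b)) has_real_derivative g' z) (at 0)" if "z \<in> U" for z
    by (rule iter_deriv_step[OF U that g(2) g'(2)[OF that]])
  have "iter_deriv_exists U (b # bs) f"
    using ex d by (auto simp: real_differentiable_def)
  moreover have "iter_deriv (b # bs) f z = g' z" if "z \<in> U" for z
    using DERIV_imp_deriv[OF d[OF that]] by simp
  ultimately show ?case using g'(1) by auto
qed

lemma iter_deriv_exists_cong:
  assumes U: "open U" and eq: "\<And>z. z \<in> U \<Longrightarrow> f z = g z"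
  shows "iter_deriv_exists U bs f \<Longrightarrow> iter_deriv_exists U bs g"
proof (induction bs)
  case (Cons b bs)
  have "(\<lambda>t. iter_deriv bs g (z + t *\<^sub>R b)) differentiable (at 0)" if z: "z \<in> U" for z
  proof -
    obtain D where "((\<lambda>t. iter_deriv bs f (z + t *\<^sub>R b)) has_real_derivative D) (at 0)"
      using Cons.prems z by (auto simp: real_differentiable_def)
    from iter_deriv_step[OF U z _ this, of bs g] iter_deriv_cong[OF U eq]
    show ?thesis by (auto simp: real_differentiable_def)
  qed
  then show ?case using Cons by simp
qed simp

lemma smooth_along_cong:
  fixes e :: "'i \<Rightarrow> 'a::real_normed_vector"
  assumes "open U" "\<And>z. z \<in> U \<Longrightarrow> f z = g z" "smooth_along U e N f"
  shows "smooth_along U e N g"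
  unfolding smooth_along_def
proof (intro allI impI conjI)
  fix L :: "'i list" assume L: "length L \<le> N"
  show "iter_deriv_exists U (map e L) g"
    using iter_deriv_exists_cong[of U f g "map e L", OF assms(1,2)] assms(3) L unfolding smooth_along_def by blast
  have "continuous_on U (iter_deriv (map e L) f)" using assms(3) L unfolding smooth_along_def by blast
  then show "continuous_on U (iter_deriv (map e L) g)"
    by (rule continuous_on_eq) (rule iter_deriv_cong[of U f g, OF assms(1,2)])
qed

lemma iter_deriv_add:
  assumes U: "open U" and ex: "iter_deriv_exists U bs f" "iter_deriv_exists U bs g"
  shows "iter_deriv_exists U bs (\<lambda>z. f z + g z) \<and> (\<forall>z\<in>U. iter_deriv bs (\<lambda>z. f z + g z) z = iter_deriv bs f z + iter_deriv bs g z)"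
  using ex
proof (induction bs)
  case (Cons b bs)
  have d: "((\<lambda>t. iter_deriv bs (\<lambda>z. f z + g z) (z + t *\<^sub>R b)) has_real_derivative
      iter_deriv (b # bs) f z + iter_deriv (b # bs) g z) (at 0)" if z: "z \<in> U" for z
    by (rule iter_deriv_step[OF U z, where g = "\<lambda>z. iter_deriv bs f z + iter_deriv bs g z"])
      (use Cons z in \<open>auto intro!: DERIV_add iter_deriv_has_derivative simp del: iter_deriv.simps(2)\<close>)
  show ?case
  proof (intro conjI ballI)
    show "iter_deriv_exists U (b # bs) (\<lambda>z. f z + g z)"
      using Cons d by (auto simp: real_differentiable_def simp del: iter_deriv.simps(2))
    show "iter_deriv (b # bs) (\<lambda>z. f z + g z) z = iter_deriv (b # bs) f z + iter_deriv (b # bs) g z" if "z \<in> U" for z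
      using DERIV_imp_deriv[OF d[OF that]] by simp
  qed
qed simp

lemma iter_deriv_cmult:
  assumes U: "open U" and ex: "iter_deriv_exists U bs f"
  shows "iter_deriv_exists U bs (\<lambda>z. c * f z) \<and> (\<forall>z\<in>U. iter_deriv bs (\<lambda>z. c * f z) z = c * iter_deriv bs f z)"
  using ex
proof (induction bs)
  case (Cons b bs)
  have d: "((\<lambda>t. iter_deriv bs (\<lambda>z. c * f z) (z + t *\<^sub>R b)) has_real_derivative c * iter_deriv (b # bs) f z) (at 0)"
    if z: "z \<in> U" for z
    by (rule iter_deriv_step[OF U z, where g = "\<lambda>z. c * iter_deriv bs f z"])
      (use Cons z in \<open>auto intro!: DERIV_cmult iter_deriv_has_derivative simp del: iter_deriv.simps(2)\<close>)
  show ?case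
  proof (intro conjI ballI)
    show "iter_deriv_exists U (b # bs) (\<lambda>z. c * f z)"
      using Cons d by (auto simp: real_differentiable_def simp del: iter_deriv.simps(2))
    show "iter_deriv (b # bs) (\<lambda>z. c * f z) z = c * iter_deriv (b # bs) f z" if "z \<in> U" for z
      using DERIV_imp_deriv[OF d[OF that]] by simp
  qed
qed simp

lemma smooth_along_add:
  fixes e :: "'i \<Rightarrow> 'a::real_normed_vector"
  assumes U: "open U" and f: "smooth_along U e N f" and g: "smooth_along U e N g"
  shows "smooth_along U e N (\<lambda>z. f z + g z)"
  unfolding smooth_along_def
proof (intro allI impI conjI)
  fix L :: "'i list" assume L: "length L \<le> N"
  note s = iter_deriv_add[OF U, of "map e L" f g]
  have ex: "iter_deriv_exists U (map e L) f" "iter_deriv_exists U (map e L) g"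
    using f g L unfolding smooth_along_def by blast+
  show "iter_deriv_exists U (map e L) (\<lambda>z. f z + g z)" using s[OF ex] by blast
  have "continuous_on U (\<lambda>z. iter_deriv (map e L) f z + iter_deriv (map e L) g z)"
    by (intro continuous_on_add smooth_along_continuous[OF f L] smooth_along_continuous[OF g L])
  then show "continuous_on U (iter_deriv (map e L) (\<lambda>z. f z + g z))"
    by (rule continuous_on_eq) (use s[OF ex] in auto)
qed

lemma real_polynomial_function_directional_derivative:
  assumes "real_polynomial_function (p :: 'a::real_normed_vector \<Rightarrow> real)"
  shows "\<exists>p'. real_polynomial_function p' \<and> (\<forall>z. ((\<lambda>t. p (z + t *\<^sub>R v)) has_real_derivative p' z) (at 0))"
  using assms
proof (induction rule: real_polynomial_function.induct)
  case (linear f)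
  then interpret bounded_linear f .
  have "((\<lambda>t. f (z + t *\<^sub>R v)) has_real_derivative f v) (at 0)" for z
    unfolding add scale by (auto intro!: derivative_eq_intros)
  then show ?case by (intro exI[of _ "\<lambda>_. f v"]) (auto intro: real_polynomial_function.intros)
next
  case (const c)
  then show ?case by (intro exI[of _ "\<lambda>_. 0"]) (auto intro: real_polynomial_function.intros)
next
  case (add f g)
  then obtain f' g' where "real_polynomial_function f'" "real_polynomial_function g'"
    "\<And>z. ((\<lambda>t. f (z + t *\<^sub>R v)) has_real_derivative f' z) (at 0)"
    "\<And>z. ((\<lambda>t. g (z + t *\<^sub>R v)) has_real_derivative g' z) (at 0)" by blast
  then show ?case
    by (intro exI[of _ "\<lambda>z. f' z + g' z"]) (auto intro: real_polynomial_function.intros DERIV_add)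
next
  case (mult f g)
  then obtain f' g' where f': "real_polynomial_function f'" "\<And>z. ((\<lambda>t. f (z + t *\<^sub>R v)) has_real_derivative f' z) (at 0)"
    and g': "real_polynomial_function g'" "\<And>z. ((\<lambda>t. g (z + t *\<^sub>R v)) has_real_derivative g' z) (at 0)" by blast
  have "((\<lambda>t. f (z + t *\<^sub>R v) * g (z + t *\<^sub>R v)) has_real_derivative f' z * g z + g' z * f z) (at 0)" for z
    using DERIV_mult[OF f'(2)[of z] g'(2)[of z]] by simp
  moreover have "real_polynomial_function (\<lambda>z. f' z * g z + g' z * f z)"
    by (intro real_polynomial_function.intros(3,4) f' g' mult.hyps)
  ultimately show ?case by (intro exI[of _ "\<lambda>z. f' z * g z + g' z * f z"]) blast
qed

lemma smooth_along_polynomial: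
  fixes e :: "'i \<Rightarrow> 'a::real_normed_vector"
  assumes U: "open U" and p: "real_polynomial_function p"
  shows "smooth_along U e N p"
proof -
  have *: "iter_deriv_exists U bs p \<and> (\<exists>g. real_polynomial_function g \<and> (\<forall>z\<in>U. iter_deriv bs p z = g z))" if "length bs \<le> N" for bs
    using iter_deriv_in_class[OF U, of "\<lambda>_. real_polynomial_function" p N bs] p that real_polynomial_function_directional_derivative by metis
  show ?thesis unfolding smooth_along_def
  proof (intro allI impI conjI)
    fix L :: "'i list" assume "length L \<le> N"
    with *[of "map e L"] obtain g where g: "iter_deriv_exists U (map e L) p" "real_polynomial_function g" "\<And>z. z \<in> U \<Longrightarrow> iter_deriv (map e L) p z = g z"
      by auto
    show "iter_deriv_exists U (map e L) p" by (rule g)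
    have "continuous_on U g" using g(2) continuous_on_polymonial_function[of g U]
      by (simp add: real_polynomial_function_eq)
    then show "continuous_on U (iter_deriv (map e L) p)" by (rule continuous_on_eq) (simp add: g(3))
  qed
qed

section \<open>Homogeneous polynomials, radial terms and their behaviour at the origin\<close>

text \<open>Homogeneous polynomials of degree e, generated by linear forms. Keeping the degree as an
  index gives the bound by |z|^e and the loss of one degree per derivative.\<close>

inductive hpoly :: "nat \<Rightarrow> ('a::real_inner \<Rightarrow> real) \<Rightarrow> bool" where
  const: "hpoly 0 (\<lambda>_. c)"
| lin: "hpoly e p \<Longrightarrow> hpoly (Suc e) (\<lambda>z. (z \<bullet> w) * p z)"
| add: "hpoly e p \<Longrightarrow> hpoly e q \<Longrightarrow> hpoly e (\<lambda>z. p z + q z)"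

lemma hpoly_cmult: "hpoly e p \<Longrightarrow> hpoly e (\<lambda>z. c * p z)"
proof (induction rule: hpoly.induct)
  case (lin e p w)
  from hpoly.lin[OF lin.IH, of w] show ?case by (simp add: mult.left_commute)
qed (auto intro: hpoly.intros simp: distrib_left)

text \<open>The derivative of a constant would have degree -1. For e = 0 the zero function is
  recorded explicitly, as truncated subtraction would give degree 0 and lose the factor |z|.\<close>

lemma hpoly_derivative:
  assumes "hpoly e p"
  shows "\<exists>p'. (if e = 0 then p' = (\<lambda>_. 0) else hpoly (e - 1) p') \<and> (\<forall>z. ((\<lambda>t. p (z + t *\<^sub>R v)) has_real_derivative p' z) (at 0))"
  using assms
proof (induction rule: hpoly.induct)
  case (const c)
  then show ?case by auto
next
  case (lin e p w)
  then obtain p' where p': "if e = 0 then p' = (\<lambda>_. 0) else hpoly (e - 1) p'"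
    "\<And>z. ((\<lambda>t. p (z + t *\<^sub>R v)) has_real_derivative p' z) (at 0)" by blast
  have l: "((\<lambda>t. (z + t *\<^sub>R v) \<bullet> w) has_real_derivative v \<bullet> w) (at 0)" for z
    unfolding inner_add_left inner_scaleR_left by (auto intro!: derivative_eq_intros)
  have d: "((\<lambda>t. ((z + t *\<^sub>R v) \<bullet> w) * p (z + t *\<^sub>R v)) has_real_derivative (v \<bullet> w) * p z + (z \<bullet> w) * p' z) (at 0)" for z
    using DERIV_mult[OF l[of z] p'(2)[of z]] by (simp add: mult.commute)
  have "hpoly e (\<lambda>z. (v \<bullet> w) * p z + (z \<bullet> w) * p' z)"
  proof (cases "e = 0")
    case True
    then show ?thesis using p'(1) hpoly_cmult[OF lin.hyps, of "v \<bullet> w"] by simp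
  next
    case False
    then have "hpoly (Suc (e - 1)) (\<lambda>z. (z \<bullet> w) * p' z)" using p'(1) by (intro hpoly.lin) simp
    then show ?thesis using False by (intro hpoly.add hpoly_cmult lin.hyps) simp
  qed
  then show ?case using d by (intro exI[of _ "\<lambda>z. (v \<bullet> w) * p z + (z \<bullet> w) * p' z"]) simp
next
  case (add e p q)
  then obtain p' q' where p': "if e = 0 then p' = (\<lambda>_. 0) else hpoly (e - 1) p'"
    "\<And>z. ((\<lambda>t. p (z + t *\<^sub>R v)) has_real_derivative p' z) (at 0)"
    and q': "if e = 0 then q' = (\<lambda>_. 0) else hpoly (e - 1) q'"
    "\<And>z. ((\<lambda>t. q (z + t *\<^sub>R v)) has_real_derivative q' z) (at 0)" by blast
  have "((\<lambda>t. p (z + t *\<^sub>R v) + q (z + t *\<^sub>R v)) has_real_derivative p' z + q' z) (at 0)" for z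
    by (intro DERIV_add p' q')
  moreover have "if e = 0 then (\<lambda>z. p' z + q' z) = (\<lambda>_. 0) else hpoly (e - 1) (\<lambda>z. p' z + q' z)"
    using p'(1) q'(1) by (auto intro: hpoly.add)
  ultimately show ?case by (intro exI[of _ "\<lambda>z. p' z + q' z"]) blast
qed

lemma hpoly_bound: "hpoly e p \<Longrightarrow> \<exists>C\<ge>0. \<forall>z. \<bar>p z\<bar> \<le> C * norm z ^ e"
proof (induction rule: hpoly.induct)
  case (const c)
  then show ?case by (intro exI[of _ "\<bar>c\<bar>"]) simp
next
  case (lin e p w)
  then obtain C where C: "C \<ge> 0" "\<And>z. \<bar>p z\<bar> \<le> C * norm z ^ e" by blast
  have "\<bar>(z \<bullet> w) * p z\<bar> \<le> (norm w * C) * norm z ^ Suc e" for z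
  proof -
    have "\<bar>(z \<bullet> w) * p z\<bar> \<le> (norm z * norm w) * (C * norm z ^ e)"
      unfolding abs_mult by (intro mult_mono Cauchy_Schwarz_ineq2 C) auto
    then show ?thesis by (simp add: mult_ac)
  qed
  then show ?case using C(1) by (intro exI[of _ "norm w * C"]) auto
next
  case (add e p q)
  then obtain C D where C: "C \<ge> 0" "\<And>z. \<bar>p z\<bar> \<le> C * norm z ^ e" and D: "D \<ge> 0" "\<And>z. \<bar>q z\<bar> \<le> D * norm z ^ e" by blast
  have "\<bar>p z + q z\<bar> \<le> (C + D) * norm z ^ e" for z
    using C(2)[of z] D(2)[of z] abs_triangle_ineq[of "p z" "q z"] by (simp add: distrib_right)
  then show ?case using C(1) D(1) by (intro exI[of _ "C + D"]) auto
qed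

lemma hpoly_continuous: "hpoly e p \<Longrightarrow> continuous_on U p"
  by (induction rule: hpoly.induct) (auto intro!: continuous_intros)

text \<open>
  Sums of terms \<open>p(z) |z|\<^sup>r \<Lambda>(|z|)\<close> with \<open>p\<close> a form of degree \<open>e\<close>, \<open>\<Lambda>\<close> analytic and \<open>e + r \<ge> q\<close>: a
  directional derivative lowers \<open>q\<close> by one, and such functions are \<open>O(|z|\<^sup>q)\<close>.
\<close>

inductive radial_term :: "real \<Rightarrow> int \<Rightarrow> ('a::real_inner \<Rightarrow> real) \<Rightarrow> bool" for \<delta> where
  gen: "hpoly e p \<Longrightarrow> (\<And>s. \<bar>s\<bar> < \<delta> \<Longrightarrow> (\<lambda>m. b m * s ^ m) sums \<Lambda> s) \<Longrightarrow> q \<le> int e + r \<Longrightarrow>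
    (\<And>z. z \<noteq> 0 \<Longrightarrow> norm z < \<delta> \<Longrightarrow> f z = p z * (norm z powi r * \<Lambda> (norm z))) \<Longrightarrow> radial_term \<delta> q f"
| add: "radial_term \<delta> q f \<Longrightarrow> radial_term \<delta> q g \<Longrightarrow> (\<And>z. z \<noteq> 0 \<Longrightarrow> norm z < \<delta> \<Longrightarrow> h z = f z + g z) \<Longrightarrow> radial_term \<delta> q h"

text \<open>The second series represents r \<Lambda> + s \<Lambda>', that is, s^(1 - r) times the
  derivative of s^r \<Lambda>(s): the analytic factor that arises when a radial term is
  differentiated.\<close>

lemma power_series_derivative:
  fixes b :: "nat \<Rightarrow> real"
  assumes ps: "\<And>s. \<bar>s\<bar> < \<delta> \<Longrightarrow> (\<lambda>m. b m * s ^ m) sums \<Lambda> s" and s: "\<bar>s\<bar> < \<delta>"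
  shows "(\<Lambda> has_real_derivative (\<Sum>m. diffs b m * s ^ m)) (at s)"
    "(\<lambda>m. (of_int r + of_nat m) * b m * s ^ m) sums (of_int r * \<Lambda> s + s * (\<Sum>m. diffs b m * s ^ m))"
proof -
  obtain K where K: "\<bar>s\<bar> < K" "K < \<delta>" using dense s by blast
  then have "\<bar>K\<bar> < \<delta>" by linarith
  have sK: "summable (\<lambda>m. b m * K ^ m)" using ps[OF \<open>\<bar>K\<bar> < \<delta>\<close>] by (rule sums_summable)
  have sK': "norm s < norm K" using K by simp
  have "((\<lambda>x. \<Sum>m. b m * x ^ m) has_real_derivative (\<Sum>m. diffs b m * s ^ m)) (at s)"
    by (rule termdiffs_strong[OF sK sK'])
  moreover have "eventually (\<lambda>x. (\<Sum>m. b m * x ^ m) = \<Lambda> x) (nhds s)"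
  proof -
    have "eventually (\<lambda>x. dist x s < \<delta> - \<bar>s\<bar>) (nhds s)"
      unfolding eventually_nhds_metric using s by (intro exI[of _ "\<delta> - \<bar>s\<bar>"]) auto
    then show ?thesis
    proof eventually_elim
      case (elim x)
      then have "\<bar>x\<bar> < \<delta>" by (simp add: dist_real_def)
      from sums_unique[OF ps[OF this]] show ?case by simp
    qed
  qed
  ultimately show "(\<Lambda> has_real_derivative (\<Sum>m. diffs b m * s ^ m)) (at s)"
    by (subst (asm) DERIV_cong_ev[OF refl _ refl])
  have "summable (\<lambda>m. diffs b m * s ^ m)" by (rule termdiff_converges[of s K b])
      (use sK' K in \<open>auto intro!: sums_summable[OF ps]\<close>)
  from sums_mult[OF diffs_equiv[OF this], of s]
  have "(\<lambda>m. s * (of_nat m * b m * s ^ (m - Suc 0))) sums (s * (\<Sum>m. diffs b m * s ^ m))" .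
  moreover have "s * (of_nat m * b m * s ^ (m - Suc 0)) = of_nat m * b m * s ^ m" for m
    by (cases m) simp_all
  ultimately have "(\<lambda>m. of_nat m * b m * s ^ m) sums (s * (\<Sum>m. diffs b m * s ^ m))" by simp
  from sums_add[OF sums_mult[OF ps[OF s], of "of_int r"] this]
  show "(\<lambda>m. (of_int r + of_nat m) * b m * s ^ m) sums (of_int r * \<Lambda> s + s * (\<Sum>m. diffs b m * s ^ m))"
    by (simp add: algebra_simps)
qed

lemma norm_directional_derivative:
  fixes z :: "'a::real_inner"
  assumes "z \<noteq> 0"
  shows "((\<lambda>t. norm (z + t *\<^sub>R v)) has_real_derivative (z \<bullet> v) / norm z) (at 0)"
proof -
  have "((\<lambda>t. (z + t *\<^sub>R v) \<bullet> (z + t *\<^sub>R v)) has_real_derivative 2 * (z \<bullet> v)) (at 0)"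
    unfolding inner_add_left inner_add_right inner_scaleR_left inner_scaleR_right
    by (auto intro!: derivative_eq_intros simp: inner_commute)
  from DERIV_real_sqrt[THEN DERIV_chain2, OF _ this] assms
  show ?thesis by (simp add: norm_eq_sqrt_inner field_simps)
qed

lemma powi_derivative:
  assumes "(s::real) > 0"
  shows "((\<lambda>s. s powi r) has_real_derivative of_int r * s powi (r - 1)) (at s)"
  using DERIV_power_int[of "\<lambda>s. s" 1 s UNIV r] assms by (simp add: mult.commute)

text \<open>The product rule yields p' |z|^r \<Lambda> and (z \<bullet> v) p |z|^(r - 2) (r
  \<Lambda> + |z| \<Lambda>'), both of degree at least q - 1; the exponent r may become negative.
  The value 0 at the origin is a normalisation: it is the derivative there once q is at least 2 and
  f vanishes at 0.\<close>

lemma radial_term_derivative: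
  assumes "radial_term \<delta> q f"
  shows "\<exists>g. radial_term \<delta> (q - 1) g \<and> g 0 = 0 \<and> (\<forall>z. z \<noteq> 0 \<and> norm z < \<delta> \<longrightarrow> ((\<lambda>t. f (z + t *\<^sub>R v)) has_real_derivative g z) (at 0))"
  using assms
proof (induction rule: radial_term.induct)
  case (gen e p b \<Lambda> q r f)
  obtain p' where p': "if e = 0 then p' = (\<lambda>_. 0) else hpoly (e - 1) p'"
    "\<And>z. ((\<lambda>t. p (z + t *\<^sub>R v)) has_real_derivative p' z) (at 0)"
    using hpoly_derivative[OF gen(1), of v] by blast
  define \<Lambda>' where "\<Lambda>' s = (\<Sum>m. diffs b m * s ^ m)" for s
  define \<Lambda>2 where "\<Lambda>2 s = of_int r * \<Lambda> s + s * \<Lambda>' s" for s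
  have ps: "\<bar>s\<bar> < \<delta> \<Longrightarrow> (\<Lambda> has_real_derivative \<Lambda>' s) (at s)"
    "\<bar>s\<bar> < \<delta> \<Longrightarrow> (\<lambda>m. (of_int r + of_nat m) * b m * s ^ m) sums (of_int r * \<Lambda> s + s * \<Lambda>' s)" for s
    unfolding \<Lambda>'_def by (rule power_series_derivative[OF gen(2)]; assumption)+
  define g1 where "g1 z = p' z * (norm z powi r * \<Lambda> (norm z))" for z
  define g2 where "g2 z = ((z \<bullet> v) * p z) * (norm z powi (r - 2) * \<Lambda>2 (norm z))" for z
  have "radial_term \<delta> (q - 1) g1"
  proof (cases "e = 0")
    case True
    then have "p' = (\<lambda>_. 0)" using p'(1) by simp
    then have "hpoly 0 p'" by (simp add: hpoly.const)
    then show ?thesis using True gen(2,3) by (intro radial_term.gen[of 0 p' \<delta> b \<Lambda> _ r]) (auto simp: g1_def)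
  next
    case False
    then have "hpoly (e - 1) p'" using p'(1) by simp
    then show ?thesis using False gen(2,3) by (intro radial_term.gen[of "e - 1" p' \<delta> b \<Lambda> _ r]) (auto simp: g1_def)
  qed
  moreover have "radial_term \<delta> (q - 1) g2"
    using ps(2) gen(3)
    by (intro radial_term.gen[of "Suc e" "\<lambda>z. (z \<bullet> v) * p z" \<delta> "\<lambda>m. (of_int r + of_nat m) * b m" \<Lambda>2 _ "r - 2"] hpoly.lin gen(1))
      (auto simp: g2_def \<Lambda>2_def)
  ultimately have rad: "radial_term \<delta> (q - 1) (\<lambda>z. if z = 0 then 0 else g1 z + g2 z)" by (rule radial_term.add) simp
  have "((\<lambda>t. f (z + t *\<^sub>R v)) has_real_derivative g1 z + g2 z) (at 0)" if z: "z \<noteq> 0" "norm z < \<delta>" for z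
  proof -
    let ?s = "norm z"
    have s: "?s > 0" "\<bar>?s\<bar> < \<delta>" using z by auto
    have N: "((\<lambda>t. norm (z + t *\<^sub>R v)) has_real_derivative (z \<bullet> v) / ?s) (at 0)"
      by (rule norm_directional_derivative[OF z(1)])
    have "((\<lambda>s. s powi r * \<Lambda> s) has_real_derivative of_int r * ?s powi (r - 1) * \<Lambda> ?s + \<Lambda>' ?s * ?s powi r) (at ?s)"
      by (rule DERIV_mult[OF powi_derivative[OF s(1)] ps(1)[OF s(2)]])
    also have "of_int r * ?s powi (r - 1) * \<Lambda> ?s + \<Lambda>' ?s * ?s powi r = ?s powi (r - 2) * ?s * \<Lambda>2 ?s"
    proof -
      have "?s powi r = ?s powi (r - 2) * ?s * ?s" "?s powi (r - 1) = ?s powi (r - 2) * ?s"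
        using s(1) power_int_add_1[of ?s "r - 2"] power_int_add_1[of ?s "r - 1"] by auto
      then show ?thesis unfolding \<Lambda>2_def by (simp add: algebra_simps)
    qed
    finally have "((\<lambda>s. s powi r * \<Lambda> s) has_real_derivative ?s powi (r - 2) * ?s * \<Lambda>2 ?s) (at (norm (z + 0 *\<^sub>R v)))" by simp
    from DERIV_chain2[OF this N]
    have "((\<lambda>t. norm (z + t *\<^sub>R v) powi r * \<Lambda> (norm (z + t *\<^sub>R v))) has_real_derivative
        ?s powi (r - 2) * ?s * \<Lambda>2 ?s * ((z \<bullet> v) / ?s)) (at 0)" .
    from DERIV_mult[OF p'(2)[of z] this]
    have "((\<lambda>t. p (z + t *\<^sub>R v) * (norm (z + t *\<^sub>R v) powi r * \<Lambda> (norm (z + t *\<^sub>R v)))) has_real_derivative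
        p' z * (?s powi r * \<Lambda> ?s) + ?s powi (r - 2) * ?s * \<Lambda>2 ?s * ((z \<bullet> v) / ?s) * p z) (at 0)" by simp
    also have "p' z * (?s powi r * \<Lambda> ?s) + ?s powi (r - 2) * ?s * \<Lambda>2 ?s * ((z \<bullet> v) / ?s) * p z = g1 z + g2 z"
      using s unfolding g1_def g2_def by simp
    finally have d: "((\<lambda>t. p (z + t *\<^sub>R v) * (norm (z + t *\<^sub>R v) powi r * \<Lambda> (norm (z + t *\<^sub>R v)))) has_real_derivative g1 z + g2 z) (at 0)" .
    have U: "open (ball 0 \<delta> - {0 :: 'a})" "z \<in> ball 0 \<delta> - {0}" using z by auto
    show ?thesis
      using iter_deriv_step[OF U, of "[]" f "\<lambda>z. p z * (norm z powi r * \<Lambda> (norm z))" v, OF _ d] gen(4) by simp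
  qed
  then show ?case using rad by (intro exI[of _ "\<lambda>z. if z = 0 then 0 else g1 z + g2 z"]) auto
next
  case (add q f g h)
  from add.IH(1) obtain f' where f': "radial_term \<delta> (q - 1) f'" "\<And>z. z \<noteq> 0 \<Longrightarrow> norm z < \<delta> \<Longrightarrow> ((\<lambda>t. f (z + t *\<^sub>R v)) has_real_derivative f' z) (at 0)"
    by blast
  from add.IH(2) obtain g' where g': "radial_term \<delta> (q - 1) g'" "\<And>z. z \<noteq> 0 \<Longrightarrow> norm z < \<delta> \<Longrightarrow> ((\<lambda>t. g (z + t *\<^sub>R v)) has_real_derivative g' z) (at 0)" by blast
  have "radial_term \<delta> (q - 1) (\<lambda>z. if z = 0 then 0 else f' z + g' z)" using f'(1) g'(1) by (rule radial_term.add) simp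
  moreover have "((\<lambda>t. h (z + t *\<^sub>R v)) has_real_derivative f' z + g' z) (at 0)" if z: "z \<noteq> 0" "norm z < \<delta>" for z
  proof -
    have U: "open (ball 0 \<delta> - {0 :: 'a})" "z \<in> ball 0 \<delta> - {0}" using z by auto
    show ?thesis
      using iter_deriv_step[OF U, of "[]" h "\<lambda>z. f z + g z" v, OF _ DERIV_add[OF f'(2)[OF z] g'(2)[OF z]]] add.hyps by simp
  qed
  ultimately show ?case by (intro exI[of _ "\<lambda>z. if z = 0 then 0 else f' z + g' z"]) auto
qed

text \<open>\<rho> \<le> 1 gives |z|^(e + r) \<le> |z|^q whenever e + r \<ge> q, and \<rho> <
  \<delta> keeps \<Lambda> bounded by compactness of [0, \<rho>].\<close>

lemma radial_term_bound:
  assumes "radial_term \<delta> q f" "0 < \<rho>" "\<rho> < \<delta>" "\<rho> \<le> 1"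
  shows "\<exists>C\<ge>0. \<forall>z. z \<noteq> 0 \<and> norm z \<le> \<rho> \<longrightarrow> \<bar>f z\<bar> \<le> C * norm z powi q"
  using assms(1)
proof (induction rule: radial_term.induct)
  case (gen e p b \<Lambda> q r f)
  obtain C where C: "C \<ge> 0" "\<And>z. \<bar>p z\<bar> \<le> C * norm z ^ e" using hpoly_bound[OF gen(1)] by blast
  have "continuous_on {0..\<rho>} \<Lambda>"
  proof (rule continuous_at_imp_continuous_on, rule ballI)
    fix s assume "s \<in> {0..\<rho>}"
    then have "\<bar>s\<bar> < \<delta>" using assms by auto
    then show "isCont \<Lambda> s" by (rule DERIV_isCont[OF power_series_derivative(1)[OF gen(2)], rotated])
  qed
  then have "bounded (\<Lambda> ` {0..\<rho>})" by (intro compact_imp_bounded compact_continuous_image) auto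
  then obtain D where "\<forall>y\<in>\<Lambda> ` {0..\<rho>}. norm y \<le> D" unfolding bounded_iff by blast
  then have D: "\<bar>\<Lambda> s\<bar> \<le> D" if "0 \<le> s" "s \<le> \<rho>" for s using that by auto
  have D0: "D \<ge> 0" using D[of 0] assms by auto
  have "\<bar>f z\<bar> \<le> (C * D) * norm z powi q" if z: "z \<noteq> 0" "norm z \<le> \<rho>" for z
  proof -
    have n: "norm z > 0" "norm z \<le> 1" "norm z < \<delta>" using z assms by auto
    have "norm z ^ e * norm z powi r = norm z powi (int e + r)" using n by (simp add: power_int_add)
    also have "\<dots> \<le> norm z powi q"
    proof -
      have "norm z powi (int e + r) = norm z powi q * norm z ^ nat (int e + r - q)"
        using gen(3) n by (simp add: power_int_add[symmetric] flip: power_int_of_nat)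
      also have "\<dots> \<le> norm z powi q * 1" using n by (intro mult_left_mono power_le_one) auto
      finally show ?thesis by simp
    qed
    finally have e: "norm z ^ e * norm z powi r \<le> norm z powi q" .
    have "\<bar>f z\<bar> = \<bar>p z\<bar> * (norm z powi r * \<bar>\<Lambda> (norm z)\<bar>)"
      using gen(4)[OF z(1) n(3)] n by (simp add: abs_mult)
    also have "\<dots> \<le> (C * norm z ^ e) * (norm z powi r * D)"
      using C D z by (intro mult_mono) auto
    also have "\<dots> = (C * D) * (norm z ^ e * norm z powi r)" by (simp add: mult_ac)
    also have "\<dots> \<le> (C * D) * norm z powi q" using e C(1) D0 by (intro mult_left_mono) auto
    finally show ?thesis .
  qed
  then show ?case using C(1) D0 by (intro exI[of _ "C * D"]) auto
next
  case (add q f g h)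
  from add.IH(1) obtain C where C: "C \<ge> 0" "\<And>z. z \<noteq> 0 \<Longrightarrow> norm z \<le> \<rho> \<Longrightarrow> \<bar>f z\<bar> \<le> C * norm z powi q"
    by blast
  from add.IH(2) obtain D where D: "D \<ge> 0" "\<And>z. z \<noteq> 0 \<Longrightarrow> norm z \<le> \<rho> \<Longrightarrow> \<bar>g z\<bar> \<le> D * norm z powi q" by blast
  have "\<bar>h z\<bar> \<le> (C + D) * norm z powi q" if z: "z \<noteq> 0" "norm z \<le> \<rho>" for z
  proof -
    have "h z = f z + g z" using add.hyps z assms by auto
    then show ?thesis using C(2)[OF z] D(2)[OF z] abs_triangle_ineq[of "f z" "g z"] by (simp add: distrib_right)
  qed
  then show ?case using C(1) D(1) by (intro exI[of _ "C + D"]) auto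
qed

lemma radial_term_continuous:
  assumes "radial_term \<delta> q f"
  shows "continuous_on (ball 0 \<delta> - {0}) f"
  using assms
proof (induction rule: radial_term.induct)
  case (gen e p b \<Lambda> q r f)
  have L: "continuous_on {0..<\<delta>} \<Lambda>"
  proof (rule continuous_at_imp_continuous_on, rule ballI)
    fix s assume "s \<in> {0..<\<delta>}"
    then have "\<bar>s\<bar> < \<delta>" by auto
    then show "isCont \<Lambda> s" by (rule DERIV_isCont[OF power_series_derivative(1)[OF gen(2)], rotated])
  qed
  have "continuous_on (ball 0 \<delta> - {0}) (\<lambda>z. p z * (norm z powi r * \<Lambda> (norm z)))"
    by (intro continuous_on_mult hpoly_continuous[OF gen(1)] continuous_on_power_int continuous_on_norm continuous_on_id
        continuous_on_compose2[OF L]) auto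
  then show ?case by (rule continuous_on_eq) (use gen(4) in auto)
next
  case (add q f g h)
  have "continuous_on (ball 0 \<delta> - {0}) (\<lambda>z. f z + g z)" by (intro continuous_on_add add.IH)
  then show ?case by (rule continuous_on_eq) (use add.hyps in auto)
qed

text \<open>At the origin the product rule says nothing, and the bound f = O(|z|^q) takes over: q
  \<ge> 1 gives the limit, and q \<ge> 2 makes the difference quotient O(|t|).\<close>

lemma radial_term_vanish_at_0:
  assumes f: "radial_term \<delta> q f" and \<delta>: "\<delta> > 0" and q: "q \<ge> 1"
  shows "(f \<longlongrightarrow> 0) (at 0)" "q \<ge> 2 \<Longrightarrow> f 0 = 0 \<Longrightarrow> ((\<lambda>t. f (0 + t *\<^sub>R v)) has_real_derivative 0) (at 0)"
proof -
  define \<rho> where "\<rho> = min (\<delta> / 2) 1"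
  have \<rho>: "0 < \<rho>" "\<rho> < \<delta>" "\<rho> \<le> 1" unfolding \<rho>_def using \<delta> by auto
  obtain C where C: "C \<ge> 0" "\<And>z. z \<noteq> 0 \<Longrightarrow> norm z \<le> \<rho> \<Longrightarrow> \<bar>f z\<bar> \<le> C * norm z powi q"
    using radial_term_bound[OF f \<rho>] by blast
  have bd: "\<bar>f z\<bar> \<le> C * norm z ^ i" if "z \<noteq> 0" "norm z \<le> \<rho>" "int i \<le> q" for z i
  proof -
    have n: "norm z > 0" "norm z \<le> 1" using that \<rho> by auto
    have "norm z powi q = norm z ^ i * norm z ^ nat (q - int i)"
      using that n by (simp add: power_int_add[symmetric] flip: power_int_of_nat)
    also have "\<dots> \<le> norm z ^ i * 1" using n by (intro mult_left_mono power_le_one) auto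
    finally have "C * norm z powi q \<le> C * norm z ^ i" using C(1) by (intro mult_left_mono) auto
    then show ?thesis using C(2)[OF that(1,2)] by linarith
  qed
  have ev: "eventually (\<lambda>z. z \<noteq> 0 \<and> norm z \<le> \<rho>) (at (0 :: 'a))"
    unfolding eventually_at using \<rho>(1) by (intro exI[of _ \<rho>]) auto
  show "(f \<longlongrightarrow> 0) (at 0)"
  proof (rule Lim_null_comparison[where g = "\<lambda>z. C * norm z ^ 1"])
    show "eventually (\<lambda>z. norm (f z) \<le> C * norm z ^ 1) (at 0)"
      using ev by eventually_elim (use bd[of _ 1] q in auto)
    show "((\<lambda>z :: 'a. C * norm z ^ 1) \<longlongrightarrow> 0) (at 0)" by (auto intro!: tendsto_eq_intros)
  qed
  show "((\<lambda>t. f (0 + t *\<^sub>R v)) has_real_derivative 0) (at 0)" if q2: "q \<ge> 2" and f0: "f 0 = 0"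
  proof (cases "v = 0")
    case False
    have "((\<lambda>t. f (t *\<^sub>R v) / t) \<longlongrightarrow> 0) (at 0)"
    proof (rule Lim_null_comparison[where g = "\<lambda>t. C * (norm v)\<^sup>2 * \<bar>t\<bar>"])
      have "eventually (\<lambda>t. t \<noteq> 0 \<and> \<bar>t\<bar> < \<rho> / norm v) (at (0::real))"
        unfolding eventually_at using \<rho>(1) False by (intro exI[of _ "\<rho> / norm v"]) auto
      then show "eventually (\<lambda>t. norm (f (t *\<^sub>R v) / t) \<le> C * (norm v)\<^sup>2 * \<bar>t\<bar>) (at 0)"
      proof eventually_elim
        case (elim t)
        then have "norm (t *\<^sub>R v) \<le> \<rho>" using False by (simp add: field_simps)
        from bd[OF _ this, of 2] have "\<bar>f (t *\<^sub>R v)\<bar> \<le> C * (\<bar>t\<bar> * norm v)\<^sup>2" using elim False q2 by simp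
        then have "\<bar>f (t *\<^sub>R v)\<bar> / \<bar>t\<bar> \<le> C * (\<bar>t\<bar> * norm v)\<^sup>2 / \<bar>t\<bar>" by (rule divide_right_mono) simp
        also have "\<dots> = C * (norm v)\<^sup>2 * \<bar>t\<bar>" using elim by (simp add: power2_eq_square field_simps)
        finally show ?case by (simp add: abs_divide)
      qed
      show "((\<lambda>t::real. C * (norm v)\<^sup>2 * \<bar>t\<bar>) \<longlongrightarrow> 0) (at 0)" by (auto intro!: tendsto_eq_intros)
    qed
    then show ?thesis unfolding has_field_derivative_iff using f0 by simp
  qed (simp add: f0)
qed

lemma radial_term_iter_deriv_punctured:
  fixes f :: "'a::real_inner \<Rightarrow> real"
  assumes "radial_term \<delta> q f"
  shows "iter_deriv_exists (ball 0 \<delta> - {0}) bs f \<and> (\<exists>g. radial_term \<delta> (q - int (length bs)) g \<and> (\<forall>z\<in>ball 0 \<delta> - {0}. iter_deriv bs f z = g z))"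
proof (rule iter_deriv_in_class[where C = "\<lambda>i. radial_term \<delta> (q - int i)" and N = "length bs"])
  show "open (ball 0 \<delta> - {0 :: 'a})" by auto
  show "radial_term \<delta> (q - int 0) f" using assms by simp
  fix i :: nat and g :: "'a \<Rightarrow> real" and b :: 'a assume "radial_term \<delta> (q - int i) g"
  from radial_term_derivative[OF this, of b] obtain g' where "radial_term \<delta> (q - int i - 1) g'"
    "\<And>z. z \<noteq> 0 \<Longrightarrow> norm z < \<delta> \<Longrightarrow> ((\<lambda>t. g (z + t *\<^sub>R b)) has_real_derivative g' z) (at 0)" by blast
  then show "\<exists>g'. radial_term \<delta> (q - int (Suc i)) g' \<and> (\<forall>z\<in>ball 0 \<delta> - {0}. ((\<lambda>t. g (z + t *\<^sub>R b)) has_real_derivative g' z) (at 0))"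
    by (intro exI[of _ g']) (auto simp: diff_diff_eq add.commute)
qed simp

lemma radial_term_smooth_punctured:
  fixes f :: "'a::real_inner \<Rightarrow> real" and e :: "'i \<Rightarrow> 'a"
  assumes "radial_term \<delta> q f"
  shows "smooth_along (ball 0 \<delta> - {0}) e N f"
  unfolding smooth_along_def
proof (intro allI impI conjI)
  fix L :: "'i list"
  obtain g where g: "iter_deriv_exists (ball 0 \<delta> - {0}) (map e L) f" "radial_term \<delta> (q - int (length (map e L))) g"
    "\<And>z. z \<in> ball 0 \<delta> - {0} \<Longrightarrow> iter_deriv (map e L) f z = g z"
    using radial_term_iter_deriv_punctured[OF assms, of "map e L"] by blast
  show "iter_deriv_exists (ball 0 \<delta> - {0}) (map e L) f" by (rule g(1))
  show "continuous_on (ball 0 \<delta> - {0}) (iter_deriv (map e L) f)"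
    by (rule continuous_on_eq[OF radial_term_continuous[OF g(2)]]) (simp add: g(3))
qed

text \<open>After i derivatives the degree is N + 1 - i. It is at least 2 for i < N, so one more
  derivative exists at the origin, and still at least 1 for i = N, so the last derivative is
  continuous there.\<close>

lemma radial_term_smooth:
  fixes f :: "'a::real_inner \<Rightarrow> real" and e :: "'i \<Rightarrow> 'a"
  assumes f: "radial_term \<delta> (int N + 1) f" "f 0 = 0" and \<delta>: "\<delta> > 0"
  shows "smooth_along (ball 0 \<delta>) e N f"
proof -
  have *: "iter_deriv_exists (ball 0 \<delta>) bs f \<and> (\<exists>g. (radial_term \<delta> (int N + 1 - int (length bs)) g \<and> g 0 = 0) \<and> (\<forall>z\<in>ball 0 \<delta>. iter_deriv bs f z = g z))"
    if "length bs \<le> N" for bs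
  proof (rule iter_deriv_in_class[where C = "\<lambda>i g. radial_term \<delta> (int N + 1 - int i) g \<and> g 0 = 0" and N = N])
    show "open (ball 0 \<delta> :: 'a set)" by auto
    show "radial_term \<delta> (int N + 1 - int 0) f \<and> f 0 = 0" using f by simp
    fix i :: nat and g :: "'a \<Rightarrow> real" and b :: 'a assume i: "i < N" and g: "radial_term \<delta> (int N + 1 - int i) g \<and> g 0 = 0"
    from radial_term_derivative[where v = b, OF g[THEN conjunct1]] obtain g' where g': "radial_term \<delta> (int N + 1 - int i - 1) g'" "g' 0 = 0"
      "\<And>z. z \<noteq> 0 \<Longrightarrow> norm z < \<delta> \<Longrightarrow> ((\<lambda>t. g (z + t *\<^sub>R b)) has_real_derivative g' z) (at 0)" by blast
    have "((\<lambda>t. g (0 + t *\<^sub>R b)) has_real_derivative 0) (at 0)"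
      by (rule radial_term_vanish_at_0(2)[OF g[THEN conjunct1] \<delta>]) (use i g in auto)
    then have "((\<lambda>t. g (z + t *\<^sub>R b)) has_real_derivative g' z) (at 0)" if "z \<in> ball 0 \<delta>" for z
      using g'(2) g'(3)[of z] that by (cases "z = 0") auto
    then show "\<exists>g'. (radial_term \<delta> (int N + 1 - int (Suc i)) g' \<and> g' 0 = 0) \<and> (\<forall>z\<in>ball 0 \<delta>. ((\<lambda>t. g (z + t *\<^sub>R b)) has_real_derivative g' z) (at 0))"
      using g'(1,2) by (intro exI[of _ g']) (auto simp: diff_diff_eq add.commute)
  qed (rule that)
  show ?thesis
    unfolding smooth_along_def
  proof (intro allI impI conjI)
    fix L :: "'i list" assume L: "length L \<le> N"
    then obtain g where g: "iter_deriv_exists (ball 0 \<delta>) (map e L) f" "radial_term \<delta> (int N + 1 - int (length L)) g" "g 0 = 0"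
      "\<And>z. z \<in> ball 0 \<delta> \<Longrightarrow> iter_deriv (map e L) f z = g z"
      using *[where bs = "map e L"] by auto
    show "iter_deriv_exists (ball 0 \<delta>) (map e L) f" by (rule g(1))
    have "isCont g z" if "z \<in> ball 0 \<delta>" for z
    proof (cases "z = 0")
      case True
      then show ?thesis using radial_term_vanish_at_0(1)[OF g(2) \<delta>] g(3) L by (simp add: isCont_def)
    next
      case False
      have "open (ball 0 \<delta> - {0 :: 'a})" by auto
      then show ?thesis using radial_term_continuous[OF g(2)] False that by (simp add: continuous_on_eq_continuous_at)
    qed
    then have "continuous_on (ball 0 \<delta>) g" by (intro continuous_at_imp_continuous_on) auto
    then show "continuous_on (ball 0 \<delta>) (iter_deriv (map e L) f)"
      by (rule continuous_on_eq) (simp add: g(4))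
  qed
qed

section \<open>Kernels that depend on the difference of their arguments\<close>

lemma iter_deriv_difference:
  fixes F :: "'a::real_normed_vector \<Rightarrow> real"
  shows "iter_deriv bs (\<lambda>p. F (fst p - snd p)) p = iter_deriv (map (\<lambda>b. fst b - snd b) bs) F (fst p - snd p)"
proof (induction bs arbitrary: p)
  case (Cons b bs)
  have e: "fst (p + t *\<^sub>R b) - snd (p + t *\<^sub>R b) = (fst p - snd p) + t *\<^sub>R (fst b - snd b)" for t
    by (simp add: algebra_simps)
  show ?case by (simp only: iter_deriv.simps list.map Cons.IH e)
qed simp

lemma iter_deriv_exists_difference:
  fixes F :: "'a::real_normed_vector \<Rightarrow> real"
  assumes "iter_deriv_exists V (map (\<lambda>b. fst b - snd b) bs) F"
  shows "iter_deriv_exists {p. fst p - snd p \<in> V} bs (\<lambda>p. F (fst p - snd p))"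
  using assms
proof (induction bs)
  case (Cons b bs)
  have e: "fst (p + t *\<^sub>R b) - snd (p + t *\<^sub>R b) = (fst p - snd p) + t *\<^sub>R (fst b - snd b)" for t p
    by (simp add: algebra_simps)
  show ?case using Cons unfolding iter_deriv_exists.simps iter_deriv_difference e by simp
qed simp

text \<open>Derivatives in x and in y both fall on F, along e and -e respectively, so q derivatives
  in each variable cost 2 q derivatives of F. The family \<open>id\<close> admits every
  direction.\<close>

lemma kernel_C_difference:
  fixes F :: "real ^ 'd::finite \<Rightarrow> real"
  assumes F: "smooth_along (ball 0 \<delta>) id (2 * q) F" and \<delta>: "\<delta> > 0" and k: "\<And>x y. k x y = F (x - y)"
  shows "kernel_C q k"
proof -
  let ?U = "{p. fst p - snd p \<in> ball 0 \<delta>} :: ((real ^ 'd) \<times> (real ^ 'd)) set"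
  have k': "case_prod k = (\<lambda>p. F (fst p - snd p))" using k by auto
  have U: "open ?U"
  proof -
    have "continuous_on UNIV (\<lambda>p :: (real ^ 'd) \<times> (real ^ 'd). fst p - snd p)" by (intro continuous_intros)
    from open_vimage[OF open_ball[of 0 \<delta>] this] show ?thesis by (simp add: vimage_def)
  qed
  have main: "iter_deriv_exists ?U (xy_directions is js) (case_prod k) \<and> continuous_on ?U (iter_deriv (xy_directions is js) (case_prod k))"
    if "length is \<le> q" "length js \<le> q" for "is" js
  proof
    let ?bs = "map (\<lambda>b. fst b - snd b) (xy_directions is js)"
    have "length ?bs \<le> 2 * q" using that by (simp add: xy_directions_def)
    then have *: "iter_deriv_exists (ball 0 \<delta>) ?bs F" "continuous_on (ball 0 \<delta>) (iter_deriv ?bs F)"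
      using F[unfolded smooth_along_def, rule_format, of ?bs] by auto
    show "iter_deriv_exists ?U (xy_directions is js) (case_prod k)"
      unfolding k' by (rule iter_deriv_exists_difference[OF *(1)])
    have "iter_deriv (xy_directions is js) (case_prod k) = (\<lambda>p. iter_deriv ?bs F (fst p - snd p))"
      unfolding k' iter_deriv_difference ..
    then show "continuous_on ?U (iter_deriv (xy_directions is js) (case_prod k))"
      by (simp only:) (rule continuous_on_compose2[OF *(2)], auto intro!: continuous_intros)
  qed
  show ?thesis
    unfolding kernel_C_def by (rule exI[of _ ?U]) (use U \<delta> main in simp)
qed

lemma radial_remainder:
  fixes c :: "nat \<Rightarrow> real"
  assumes ps: "\<And>s. \<bar>s\<bar> < \<delta> \<Longrightarrow> (\<lambda>m. c m * s ^ m) sums \<psi> s"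
  shows "radial_term \<delta> (int N) (\<lambda>z :: 'a::real_inner. \<psi> (norm z) - (\<Sum>i<N. c i * norm z ^ i))"
proof -
  \<comment> \<open>The quotient has a removable singularity at 0; its value there has to be the
    constant term of the shifted series.\<close>
  define \<Lambda> where "\<Lambda> s = (if s = 0 then c N else (\<psi> s - (\<Sum>i<N. c i * s ^ i)) / s ^ N)" for s
  have "(\<lambda>m. c (m + N) * s ^ m) sums \<Lambda> s" if "\<bar>s\<bar> < \<delta>" for s
  proof (cases "s = 0")
    case True
    then show ?thesis using powser_sums_zero[of "\<lambda>m. c (m + N)"] by (simp add: \<Lambda>_def)
  next
    case False
    have "(\<lambda>m. c (m + N) * s ^ (m + N)) sums (\<psi> s - (\<Sum>i<N. c i * s ^ i))"
      by (rule sums_split_initial_segment[OF ps[OF that]])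
    then have "(\<lambda>m. c (m + N) * s ^ (m + N) / s ^ N) sums ((\<psi> s - (\<Sum>i<N. c i * s ^ i)) / s ^ N)"
      by (rule sums_divide)
    then show ?thesis using False by (simp add: \<Lambda>_def power_add)
  qed
  then show ?thesis
    by (intro radial_term.gen[of 0 "\<lambda>_. 1" \<delta> "\<lambda>m. c (m + N)" \<Lambda> _ "int N"] hpoly.const) (auto simp: \<Lambda>_def)
qed

lemma sum_even_coefficients:
  fixes c :: "nat \<Rightarrow> real"
  assumes "\<And>i. i < m \<Longrightarrow> c (2 * i + 1) = 0"
  shows "(\<Sum>i<2 * m + 1. c i * s ^ i) = (\<Sum>i\<le>m. c (2 * i) * (s\<^sup>2) ^ i)"
  using assms
proof (induction m)
  case (Suc m)
  have "{..<2 * Suc m + 1} = insert (2 * m + 2) (insert (2 * m + 1) {..<2 * m + 1})" by auto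
  then have "(\<Sum>i<2 * Suc m + 1. c i * s ^ i) = c (2 * m + 2) * s ^ (2 * m + 2) + (c (2 * m + 1) * s ^ (2 * m + 1) + (\<Sum>i<2 * m + 1. c i * s ^ i))"
    by simp
  then show ?case using Suc by (simp add: power_mult[symmetric])
qed simp

text \<open>The Taylor polynomial of \<psi> up to order 2 m contains only even powers, so it is a
  polynomial in z \<bullet> z. The remainder has degree 2 m + 1, exactly what
  \<open>radial_term_smooth\<close> asks for 2 m derivatives.\<close>

lemma radial_smooth:
  fixes e :: "'i \<Rightarrow> 'a::euclidean_space"
  assumes ps: "\<And>s. \<bar>s\<bar> < \<delta> \<Longrightarrow> (\<lambda>m. c m * s ^ m) sums \<psi> s" and \<delta>: "\<delta> > 0"
    and odd: "\<And>i. i < m \<Longrightarrow> c (2 * i + 1) = 0"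
  shows "smooth_along (ball 0 \<delta>) e (2 * m) (\<lambda>z. \<psi> (norm z))"
proof -
  define P where "P z = (\<Sum>i\<le>m. c (2 * i) * (z \<bullet> z) ^ i)" for z :: 'a
  define rem where "rem z = \<psi> (norm z) - (\<Sum>i<2 * m + 1. c i * norm z ^ i)" for z :: 'a
  have P: "P z = (\<Sum>i<2 * m + 1. c i * norm z ^ i)" for z
  proof -
    have "(\<Sum>i<2 * m + 1. c i * norm z ^ i) = (\<Sum>i\<le>m. c (2 * i) * ((norm z)\<^sup>2) ^ i)"
      by (rule sum_even_coefficients) (rule odd)
    then show ?thesis unfolding P_def power2_norm_eq_inner by simp
  qed
  have "real_polynomial_function (\<lambda>z :: 'a. z \<bullet> z)"
  proof -
    have "real_polynomial_function (\<lambda>z :: 'a. \<Sum>b\<in>Basis. (z \<bullet> b) * (z \<bullet> b))"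
      by (intro real_polynomial_function_sum real_polynomial_function.intros(4) real_polynomial_function.intros(1) bounded_linear_inner_left finite_Basis)
    then show ?thesis by (simp add: euclidean_inner[symmetric])
  qed
  then have "real_polynomial_function P"
    unfolding P_def by (intro real_polynomial_function_sum real_polynomial_function.intros(4) real_polynomial_function.intros(2) real_polynomial_function_power) auto
  then have sP: "smooth_along (ball 0 \<delta>) e (2 * m) P" by (intro smooth_along_polynomial) auto
  have "\<psi> 0 = c 0" using sums_unique2[OF ps[of 0] powser_sums_zero] \<delta> by simp
  moreover have "(\<Sum>i<2 * m + 1. c i * 0 ^ i) = c 0" by (simp add: power_0_left if_distrib cong: if_cong)
  ultimately have "rem 0 = 0" by (simp add: rem_def)
  moreover have "radial_term \<delta> (int (2 * m) + 1) rem"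
  proof -
    have "radial_term \<delta> (int (2 * m + 1)) rem" unfolding rem_def by (rule radial_remainder) (rule ps)
    then show ?thesis by (simp add: add.commute)
  qed
  ultimately have sr: "smooth_along (ball 0 \<delta>) e (2 * m) rem" using \<delta> by (intro radial_term_smooth) auto
  show ?thesis
    by (rule smooth_along_cong[OF _ _ smooth_along_add[OF _ sP sr]]) (auto simp: P rem_def)
qed

section \<open>Kernels of finite smoothness\<close>

text \<open>The factor \<kappa> is left free in order to cover homogeneity (\<kappa> = t^r, t > 0)
  and parity (t = -1, \<kappa> = 1) at once.\<close>

lemma iter_deriv_scale:
 fixes f :: "'a::real_normed_vector \<Rightarrow> real" and t :: real
  assumes U: "open U" and t: "t \<noteq> 0" and f: "\<And>z. f (t *\<^sub>R z) = \<kappa> * f z"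
  shows "iter_deriv_exists U bs f \<Longrightarrow> z \<in> U \<Longrightarrow> iter_deriv bs f (t *\<^sub>R z) = \<kappa> / t ^ length bs * iter_deriv bs f z"
proof (induction bs arbitrary: z)
  case (Cons b bs)
  have ex: "iter_deriv_exists U bs f" using Cons.prems(1) by simp
  obtain \<delta> where \<delta>: "\<delta> > 0" "\<And>r s. \<bar>r\<bar> < \<delta> \<Longrightarrow> \<bar>s\<bar> < \<delta> \<Longrightarrow> z + r *\<^sub>R b + s *\<^sub>R b \<in> U"
    using open_segment_bound[OF U Cons.prems(2)] by blast
  have "((\<lambda>s::real. s / t) has_real_derivative 1 / t) (at 0)"
    using t by (auto intro!: derivative_eq_intros)
  moreover have "((\<lambda>s. iter_deriv bs f (z + s *\<^sub>R b)) has_real_derivative iter_deriv (b # bs) f z) (at (0 / t))"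
    using iter_deriv_has_derivative[OF Cons.prems] by simp
  ultimately have "((\<lambda>s. iter_deriv bs f (z + (s / t) *\<^sub>R b)) has_real_derivative iter_deriv (b # bs) f z * (1 / t)) (at 0)"
    by (rule DERIV_chain2[rotated])
  then have d: "((\<lambda>s. \<kappa> / t ^ length bs * iter_deriv bs f (z + (s / t) *\<^sub>R b)) has_real_derivative
      \<kappa> / t ^ length bs * (iter_deriv (b # bs) f z * (1 / t))) (at 0)"
    by (rule DERIV_cmult)
  have "eventually (\<lambda>s. \<kappa> / t ^ length bs * iter_deriv bs f (z + (s / t) *\<^sub>R b) = iter_deriv bs f (t *\<^sub>R z + s *\<^sub>R b)) (nhds 0)"
    unfolding eventually_nhds_metric
  proof (intro exI[of _ "\<delta> * \<bar>t\<bar>"] conjI allI impI)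
    show "0 < \<delta> * \<bar>t\<bar>" using \<delta>(1) t by simp
    fix s :: real assume "dist s 0 < \<delta> * \<bar>t\<bar>"
    then have "\<bar>s / t\<bar> < \<delta>" using t by (simp add: abs_divide divide_less_eq)
    then have zU: "z + (s / t) *\<^sub>R b \<in> U" using \<delta>(2)[of 0 "s / t"] \<delta>(1) by simp
    have "t *\<^sub>R z + s *\<^sub>R b = t *\<^sub>R (z + (s / t) *\<^sub>R b)" using t by (simp add: algebra_simps)
    then show "\<kappa> / t ^ length bs * iter_deriv bs f (z + (s / t) *\<^sub>R b) = iter_deriv bs f (t *\<^sub>R z + s *\<^sub>R b)"
      using Cons.IH[OF ex zU] by simp
  qed
  then have "((\<lambda>s. iter_deriv bs f (t *\<^sub>R z + s *\<^sub>R b)) has_real_derivative \<kappa> / t ^ length bs * (iter_deriv (b # bs) f z * (1 / t))) (at 0)"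
    using d by (subst (asm) DERIV_cong_ev[OF refl _ refl])
  then have "iter_deriv (b # bs) f (t *\<^sub>R z) = \<kappa> / t ^ length bs * (iter_deriv (b # bs) f z * (1 / t))"
    by (simp add: DERIV_imp_deriv)
  then show ?case using t by (simp add: field_simps)
qed (use f in simp)

text \<open>Leibniz' rule stops after two terms because the second derivative of a linear factor is
  0. For s = 0 the factor s removes the term with truncated index.\<close>

lemma iter_deriv_replicate_linear_mult:
  fixes g :: "'a::real_inner \<Rightarrow> real"
  assumes U: "open U" and g: "iter_deriv_exists U (replicate s x) g" and z: "z \<in> U"
  shows "iter_deriv (replicate s x) (\<lambda>z. (z \<bullet> b) * g z) z
    = (z \<bullet> b) * iter_deriv (replicate s x) g z + real s * (x \<bullet> b) * iter_deriv (replicate (s - 1) x) g z"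
  using g z
proof (induction s arbitrary: z)
  case (Suc s)
  have ex: "iter_deriv_exists U (replicate s x) g" using Suc.prems(1) by simp
  have l: "((\<lambda>t. (z + t *\<^sub>R x) \<bullet> b) has_real_derivative x \<bullet> b) (at 0)"
    unfolding inner_add_left inner_scaleR_left by (auto intro!: derivative_eq_intros)
  have d0: "((\<lambda>t. iter_deriv (replicate s x) g (z + t *\<^sub>R x)) has_real_derivative iter_deriv (replicate (Suc s) x) g z) (at 0)"
    using iter_deriv_has_derivative[of U x "replicate s x" g z] Suc.prems by simp
  have d1: "((\<lambda>t. real s * (x \<bullet> b) * iter_deriv (replicate (s - 1) x) g (z + t *\<^sub>R x)) has_real_derivative
      real s * (x \<bullet> b) * iter_deriv (replicate s x) g z) (at 0)"
  proof (cases s)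
    case (Suc s')
    then show ?thesis using iter_deriv_has_derivative[of U x "replicate s' x" g z] ex Suc.prems by (intro DERIV_cmult) simp
  qed simp
  have "((\<lambda>t. ((z + t *\<^sub>R x) \<bullet> b) * iter_deriv (replicate s x) g (z + t *\<^sub>R x) +
      real s * (x \<bullet> b) * iter_deriv (replicate (s - 1) x) g (z + t *\<^sub>R x)) has_real_derivative
      ((x \<bullet> b) * iter_deriv (replicate s x) g z + iter_deriv (replicate (Suc s) x) g z * (z \<bullet> b))
        + real s * (x \<bullet> b) * iter_deriv (replicate s x) g z) (at 0)"
    using DERIV_add[OF DERIV_mult[OF l d0] d1] by simp
  from iter_deriv_step[OF U Suc.prems(2) Suc.IH[OF ex] this]
  have "((\<lambda>t. iter_deriv (replicate s x) (\<lambda>z. (z \<bullet> b) * g z) (z + t *\<^sub>R x)) has_real_derivative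
      ((x \<bullet> b) * iter_deriv (replicate s x) g z + iter_deriv (replicate (Suc s) x) g z * (z \<bullet> b))
        + real s * (x \<bullet> b) * iter_deriv (replicate s x) g z) (at 0)" .
  then show ?case by (simp add: DERIV_imp_deriv algebra_simps)
qed simp

lemma radial_term_norm_power: "radial_term \<delta> (int r) (\<lambda>z :: 'a::real_inner. norm z ^ r)"
proof (rule radial_term.gen[OF hpoly.const[of 1], where r = "int r"])
  show "(\<lambda>m. (if m = 0 then 1 else 0) * s ^ m) sums s ^ 0" for s :: real by (rule powser_sums_if)
qed simp_all

lemma norm_power_derivative:
  fixes z :: "'a::real_inner"
  assumes z: "z \<noteq> 0"
  shows "((\<lambda>t. norm (z + t *\<^sub>R b) ^ (r + 2)) has_real_derivative real (r + 2) * ((z \<bullet> b) * norm z ^ r)) (at 0)"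
proof -
  have "((\<lambda>t. norm (z + t *\<^sub>R b) ^ (r + 2)) has_real_derivative
      real (r + 2) * ((z \<bullet> b) / norm z * norm (z + 0 *\<^sub>R b) ^ (r + 2 - Suc 0))) (at 0)"
    by (rule DERIV_power[OF norm_directional_derivative[OF z]])
  moreover have "real (r + 2) * ((z \<bullet> b) / norm z * norm (z + 0 *\<^sub>R b) ^ (r + 2 - Suc 0)) = real (r + 2) * ((z \<bullet> b) * norm z ^ r)"
    using z by simp
  ultimately show ?thesis by (simp only:)
qed

text \<open>
  If \<open>p(\<partial>)|z|\<^sup>r = 0\<close> for the form \<open>p = \<Sum> \<nu>\<^sub>a (x\<^sub>a \<bullet> \<partial>)\<^sup>D\<close>, then applying \<open>\<partial>\<^sub>b\<close> and writing \<open>\<partial>\<^sub>b|z|\<^sup>r = r z\<^sub>b |z|\<^sup>r\<^sup>-\<^sup>2\<close> gives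
  \<open>z\<^sub>b u + D v\<^sub>b = 0\<close> with \<open>u = p(\<partial>)|z|\<^sup>r\<^sup>-\<^sup>2\<close> and \<open>D v\<^sub>b = (\<partial>p/\<partial>\<xi>\<^sub>b)(\<partial>)|z|\<^sup>r\<^sup>-\<^sup>2\<close>. Taking the divergence and using Euler's
  relation yields \<open>u = 0\<close>, hence \<open>v\<^sub>b = 0\<close>, and one descends to the partial derivatives of \<open>p\<close>.
\<close>

lemma norm_power_annihilator:
  fixes x :: "'n \<Rightarrow> 'a::euclidean_space"
  assumes \<delta>: "\<delta> > 0" and A: "finite A"
  defines "U \<equiv> ball 0 \<delta> - {0 :: 'a}"
  shows "(\<And>z. z \<in> U \<Longrightarrow> (\<Sum>a\<in>A. \<nu> a * iter_deriv (replicate D (x a)) (\<lambda>z. norm z ^ r) z) = 0) \<Longrightarrow> 2 * D + 1 \<le> r \<Longrightarrow>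
    (\<Sum>a\<in>A. \<nu> a * (x a \<bullet> \<xi>) ^ D) = 0"
proof (induction D arbitrary: \<nu> r \<xi>)
  case 0
  obtain b :: 'a where b: "b \<in> Basis" using nonempty_Basis by blast
  then have "(\<delta> / 2) *\<^sub>R b \<in> U" unfolding U_def using \<delta> by (auto simp: nonzero_Basis)
  from 0(1)[OF this] b \<delta> have "(\<Sum>a\<in>A. \<nu> a) = 0"
    by (simp add: sum_distrib_right[symmetric])
  then show ?case by simp
next
  case (Suc D)
  define s where "s = r - 2"
  have r: "r = s + 2" "2 * D + 1 \<le> s" using Suc.prems(2) unfolding s_def by auto
  define f where "f k = (\<lambda>z :: 'a. norm z ^ k)" for k
  have U: "open U" unfolding U_def by auto
  have sm: "smooth_along U id N (f k)" for N k
    unfolding U_def f_def by (rule radial_term_smooth_punctured[OF radial_term_norm_power])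
  have ex: "iter_deriv_exists U bs (f k)" for bs k
    using sm[of "length bs" k] unfolding smooth_along_def by (metis list.map_id order_refl)
  have der: "((\<lambda>t. iter_deriv bs (f k) (z + t *\<^sub>R b)) has_real_derivative iter_deriv (b # bs) (f k) z) (at 0)" if "z \<in> U" for bs k b z
    by (rule iter_deriv_has_derivative[OF ex that])
  define u where "u z = (\<Sum>a\<in>A. \<nu> a * iter_deriv (replicate (Suc D) (x a)) (f s) z)" for z
  define v where "v b z = (\<Sum>a\<in>A. \<nu> a * (x a \<bullet> b) * iter_deriv (replicate D (x a)) (f s) z)" for b z
  define u' where "u' b z = (\<Sum>a\<in>A. \<nu> a * iter_deriv (b # replicate (Suc D) (x a)) (f s) z)" for b z
  have rel: "(z \<bullet> b) * u z + real (Suc D) * v b z = 0" if z: "z \<in> U" for z b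
  proof -
    have "((\<lambda>t. \<Sum>a\<in>A. \<nu> a * iter_deriv (replicate (Suc D) (x a)) (f r) (z + t *\<^sub>R b)) has_real_derivative
        (\<Sum>a\<in>A. \<nu> a * iter_deriv (b # replicate (Suc D) (x a)) (f r) z)) (at 0)"
      by (intro DERIV_sum DERIV_cmult der z)
    moreover have "((\<lambda>t. \<Sum>a\<in>A. \<nu> a * iter_deriv (replicate (Suc D) (x a)) (f r) (z + t *\<^sub>R b)) has_real_derivative 0) (at 0)"
      using iter_deriv_step[OF U z, of "[]" "\<lambda>z. \<Sum>a\<in>A. \<nu> a * iter_deriv (replicate (Suc D) (x a)) (f r) z" "\<lambda>_. 0" b 0] Suc.prems(1)
      by (simp add: f_def del: replicate.simps)
    ultimately have "0 = (\<Sum>a\<in>A. \<nu> a * iter_deriv (b # replicate (Suc D) (x a)) (f r) z)" by (rule DERIV_unique[rotated])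
    also have "\<dots> = (\<Sum>a\<in>A. \<nu> a * (real r * ((z \<bullet> b) * iter_deriv (replicate (Suc D) (x a)) (f s) z + real (Suc D) * (x a \<bullet> b) * iter_deriv (replicate D (x a)) (f s) z)))"
    proof (intro sum.cong refl arg_cong2[where f = "(*)"])
      fix a
      have "iter_deriv (b # replicate (Suc D) (x a)) (f r) z = iter_deriv (replicate (Suc D) (x a) @ [b]) (f r) z"
        using smooth_along_mset[OF U sm[of "Suc (Suc D)" r], of "b # replicate (Suc D) (x a)" "replicate (Suc D) (x a) @ [b]" z] z
        by simp
      also have "\<dots> = iter_deriv (replicate (Suc D) (x a)) (iter_deriv [b] (f r)) z" by (rule iter_deriv_append[THEN fun_cong])
      also have "\<dots> = iter_deriv (replicate (Suc D) (x a)) (\<lambda>z. real r * ((z \<bullet> b) * f s z)) z"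
      proof (rule iter_deriv_cong[OF U _ z])
        fix y assume "y \<in> U"
        then have "y \<noteq> 0" by (simp add: U_def)
        from DERIV_imp_deriv[OF norm_power_derivative[OF this, of b s]]
        show "iter_deriv [b] (f r) y = real r * ((y \<bullet> b) * f s y)" unfolding f_def r by simp
      qed
      also have "\<dots> = real r * iter_deriv (replicate (Suc D) (x a)) (\<lambda>z. (z \<bullet> b) * f s z) z"
      proof -
        have "radial_term \<delta> (int s + 1) (\<lambda>z :: 'a. (z \<bullet> b) * f s z)"
        proof (rule radial_term.gen[OF hpoly.lin[OF hpoly.const[of 1], of b], where r = "int s"])
          show "(\<lambda>m. (if m = 0 then 1 else 0) * s ^ m) sums s ^ 0" for s :: real by (rule powser_sums_if)
        qed (simp_all add: f_def)
        from radial_term_iter_deriv_punctured[OF this, of "replicate (Suc D) (x a)"]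
        have "iter_deriv_exists U (replicate (Suc D) (x a)) (\<lambda>z. (z \<bullet> b) * f s z)" unfolding U_def by blast
        from iter_deriv_cmult[OF U this, of "real r"] z show ?thesis by blast
      qed
      also have "iter_deriv (replicate (Suc D) (x a)) (\<lambda>z. (z \<bullet> b) * f s z) z =
          (z \<bullet> b) * iter_deriv (replicate (Suc D) (x a)) (f s) z + real (Suc D) * (x a \<bullet> b) * iter_deriv (replicate D (x a)) (f s) z"
        using iter_deriv_replicate_linear_mult[where s = "Suc D" and x = "x a" and b = b and g = "f s", OF U ex z]
        by (simp only: diff_Suc_1)
      finally show "iter_deriv (b # replicate (Suc D) (x a)) (f r) z = real r * ((z \<bullet> b) * iter_deriv (replicate (Suc D) (x a)) (f s) z + real (Suc D) * (x a \<bullet> b) * iter_deriv (replicate D (x a)) (f s) z)" .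
    qed
    also have "\<dots> = real r * ((z \<bullet> b) * u z + real (Suc D) * v b z)"
      unfolding u_def v_def by (simp only: distrib_left sum.distrib sum_distrib_left mult_ac)
    finally show ?thesis using r(1) by simp
  qed
  have dir: "iter_deriv (y # bs) (f s) z = (\<Sum>b\<in>Basis. (y \<bullet> b) * iter_deriv (b # bs) (f s) z)" if z: "z \<in> U" for y bs z
  proof -
    have "((\<lambda>t. iter_deriv bs (f s) (z + t *\<^sub>R (\<Sum>b\<in>Basis. (y \<bullet> b) *\<^sub>R b))) has_real_derivative (\<Sum>b\<in>Basis. (y \<bullet> b) * iter_deriv (b # bs) (f s) z)) (at 0)"
    proof (rule directional_derivative_sum[OF U z finite_Basis, where e = "\<lambda>b. b" and D = "\<lambda>b. iter_deriv (b # bs) (f s)"])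
      show "continuous_on U (iter_deriv (b # bs) (f s))" for b
        using smooth_along_continuous[OF sm[of "Suc (length bs)" s], of "b # bs"] by (simp only: list.map_id length_Cons order_refl)
    qed (rule der)
    then show ?thesis unfolding euclidean_representation by (rule DERIV_unique[OF der[OF z]])
  qed
  have uz: "u z = 0" if z: "z \<in> U" for z
  proof -
    have du: "((\<lambda>t. u (z + t *\<^sub>R b)) has_real_derivative u' b z) (at 0)" for b
      unfolding u_def u'_def by (intro DERIV_sum DERIV_cmult der z)
    have dv: "real (Suc D) * (\<Sum>a\<in>A. \<nu> a * (x a \<bullet> b) * iter_deriv (b # replicate D (x a)) (f s) z) = - ((b \<bullet> b) * u z + (z \<bullet> b) * u' b z)" for b
    proof -
      have "((\<lambda>t. real (Suc D) * v b (z + t *\<^sub>R b)) has_real_derivative real (Suc D) * (\<Sum>a\<in>A. \<nu> a * (x a \<bullet> b) * iter_deriv (b # replicate D (x a)) (f s) z)) (at 0)"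
        unfolding v_def by (intro DERIV_sum DERIV_cmult der z)
      moreover have "((\<lambda>t. real (Suc D) * v b (z + t *\<^sub>R b)) has_real_derivative - ((b \<bullet> b) * u z + u' b z * (z \<bullet> b))) (at 0)"
      proof -
        have l: "((\<lambda>t. (z + t *\<^sub>R b) \<bullet> b) has_real_derivative b \<bullet> b) (at 0)"
          unfolding inner_add_left inner_scaleR_left by (auto intro!: derivative_eq_intros)
        have "((\<lambda>t. - (((z + t *\<^sub>R b) \<bullet> b) * u (z + t *\<^sub>R b))) has_real_derivative - ((b \<bullet> b) * u z + u' b z * (z \<bullet> b))) (at 0)"
          using DERIV_minus[OF DERIV_mult[OF l du[of b]]] by simp
        moreover have "real (Suc D) * v b y = - ((y \<bullet> b) * u y)" if "y \<in> U" for y using rel[OF that, of b] by linarith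
        ultimately show ?thesis
          using iter_deriv_step[OF U z, of "[]" "\<lambda>y. real (Suc D) * v b y" "\<lambda>y. - ((y \<bullet> b) * u y)" b] by simp
      qed
      ultimately have "real (Suc D) * (\<Sum>a\<in>A. \<nu> a * (x a \<bullet> b) * iter_deriv (b # replicate D (x a)) (f s) z) = - ((b \<bullet> b) * u z + u' b z * (z \<bullet> b))"
        by (rule DERIV_unique)
      then show ?thesis by (simp only: mult.commute)
    qed
    have "real (Suc D) * u z = real (Suc D) * (\<Sum>a\<in>A. \<nu> a * (\<Sum>b\<in>Basis. (x a \<bullet> b) * iter_deriv (b # replicate D (x a)) (f s) z))"
      unfolding u_def replicate_Suc by (intro arg_cong2[where f = "(*)"] sum.cong refl dir[OF z])
    also have "\<dots> = (\<Sum>b\<in>Basis. real (Suc D) * (\<Sum>a\<in>A. \<nu> a * (x a \<bullet> b) * iter_deriv (b # replicate D (x a)) (f s) z))"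
      unfolding sum_distrib_left by (subst sum.swap) (simp only: mult.assoc)
    also have "\<dots> = - (\<Sum>b\<in>Basis. (b \<bullet> b) * u z + (z \<bullet> b) * u' b z)"
      unfolding dv sum_negf ..
    also have "(\<Sum>b\<in>Basis. (b \<bullet> b) * u z + (z \<bullet> b) * u' b z) = real DIM('a) * u z + (\<Sum>b\<in>Basis. (z \<bullet> b) * u' b z)"
      by (simp add: sum.distrib inner_same_Basis)
    also have "(\<Sum>b\<in>Basis. (z \<bullet> b) * u' b z) = u' z z"
    proof -
      have "(\<Sum>b\<in>Basis. (z \<bullet> b) * u' b z) = (\<Sum>a\<in>A. \<nu> a * (\<Sum>b\<in>Basis. (z \<bullet> b) * iter_deriv (b # replicate (Suc D) (x a)) (f s) z))"
        unfolding u'_def sum_distrib_left by (subst sum.swap) (simp only: mult.left_commute)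
      also have "\<dots> = u' z z"
        unfolding u'_def by (intro arg_cong2[where f = "(*)"] sum.cong refl dir[OF z, symmetric])
      finally show ?thesis .
    qed
    also have "u' z z = real (s - Suc D) * u z"
    proof -
      have sc: "u ((1 + t) *\<^sub>R z) = (1 + t) ^ (s - Suc D) * u z" if t: "\<bar>t\<bar> < 1" for t
      proof -
        have t0: "1 + t > 0" using t by auto
        have "iter_deriv (replicate (Suc D) (x a)) (f s) ((1 + t) *\<^sub>R z) = (1 + t) ^ s / (1 + t) ^ length (replicate (Suc D) (x a)) * iter_deriv (replicate (Suc D) (x a)) (f s) z" for a
          by (rule iter_deriv_scale[OF U _ _ ex z]) (use t0 in \<open>auto simp: f_def power_mult_distrib\<close>)
        moreover have "(1 + t) ^ s / (1 + t) ^ Suc D = (1 + t) ^ (s - Suc D)" using t0 r by (subst power_diff) auto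
        ultimately show ?thesis unfolding u_def length_replicate by (simp only: sum_distrib_left mult.left_commute)
      qed
      have "((\<lambda>t. (1 + t) ^ (s - Suc D) * u z) has_real_derivative real (s - Suc D) * u z) (at 0)"
        by (auto intro!: derivative_eq_intros)
      moreover have "eventually (\<lambda>t. (1 + t) ^ (s - Suc D) * u z = u (z + t *\<^sub>R z)) (nhds 0)"
        unfolding eventually_nhds_metric
      proof (intro exI[of _ 1] conjI allI impI)
        fix t :: real assume "dist t 0 < 1"
        then have "\<bar>t\<bar> < 1" by simp
        from sc[OF this] show "(1 + t) ^ (s - Suc D) * u z = u (z + t *\<^sub>R z)" by (simp add: scaleR_add_left)
      qed simp
      ultimately have "((\<lambda>t. u (z + t *\<^sub>R z)) has_real_derivative real (s - Suc D) * u z) (at 0)"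
        by (subst (asm) DERIV_cong_ev[OF refl _ refl])
      from DERIV_unique[OF du this] show ?thesis .
    qed
    \<comment> \<open>The three summands come from the relation \<open>rel\<close>, from the trace
      of the identity, and from Euler's relation for u, homogeneous of degree s - Suc D. As 2 D + 1
      \<le> s this subtraction is not truncated, and the coefficient of u is positive.\<close>
    finally have "(real (Suc D) + real DIM('a) + real (s - Suc D)) * u z = 0" by (simp add: algebra_simps)
    moreover have "real (Suc D) + real DIM('a) + real (s - Suc D) > 0" by simp
    ultimately show ?thesis by simp
  qed
  have "(\<Sum>a\<in>A. (\<nu> a * (x a \<bullet> b)) * (x a \<bullet> \<xi>) ^ D) = 0" for b
  proof (rule Suc.IH[OF _ r(2)])
    fix z assume z: "z \<in> U"
    have "v b z = 0" using rel[OF z, of b] uz[OF z] by simp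
    then show "(\<Sum>a\<in>A. \<nu> a * (x a \<bullet> b) * iter_deriv (replicate D (x a)) (\<lambda>z. norm z ^ s) z) = 0"
      unfolding v_def f_def .
  qed
  \<comment> \<open>The relation holds for every vector b; b = \<xi> supplies the missing factor x_a
    \<bullet> \<xi>.\<close>
  from this[of \<xi>] show ?case by (simp add: mult.assoc)
qed

section \<open>Cauchy-Schwarz in the native space and limits of functionals\<close>

lemma kernel_form_pos:
  fixes x :: "nat \<Rightarrow> 'p" and v :: "nat \<Rightarrow> real"
  assumes k: "positive_definite_kernel k" and x: "inj_on x {..<n}"
  shows "0 \<le> (\<Sum>a<n. \<Sum>b<n. v a * v b * k (x a) (x b))"
    "a < n \<Longrightarrow> v a \<noteq> 0 \<Longrightarrow> 0 < (\<Sum>a<n. \<Sum>b<n. v a * v b * k (x a) (x b))"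
proof -
  let ?A = "kernel_mat n x k" and ?v = "Matrix.vec n v"
  have A: "?A \<in> carrier_mat n n" unfolding kernel_mat_def by simp
  have pd: "positive_definite_mat ?A" using k x unfolding positive_definite_kernel_def by blast
  have "?v \<bullet> (?A *\<^sub>v ?v) = (\<Sum>a<n. v a * (\<Sum>b<n. k (x a) (x b) * v b))"
    unfolding scalar_prod_def kernel_mat_def by (simp add: scalar_prod_def atLeast0LessThan)
  also have "\<dots> = (\<Sum>a<n. \<Sum>b<n. v a * v b * k (x a) (x b))"
    by (simp add: sum_distrib_left mult_ac)
  finally have eq: "?v \<bullet> (?A *\<^sub>v ?v) = (\<Sum>a<n. \<Sum>b<n. v a * v b * k (x a) (x b))" .
  have pos: "0 < (\<Sum>a<n. \<Sum>b<n. v a * v b * k (x a) (x b))" if "?v \<noteq> 0\<^sub>v n"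
    using pd A that unfolding positive_definite_mat_def eq[symmetric] by auto
  show "0 < (\<Sum>a<n. \<Sum>b<n. v a * v b * k (x a) (x b))" if "a < n" "v a \<noteq> 0"
  proof (rule pos)
    show "?v \<noteq> 0\<^sub>v n"
    proof
      assume "?v = 0\<^sub>v n"
      then have "vec_index ?v a = vec_index (0\<^sub>v n) a" by simp
      then show False using that by simp
    qed
  qed
  show "0 \<le> (\<Sum>a<n. \<Sum>b<n. v a * v b * k (x a) (x b))"
  proof (cases "?v = 0\<^sub>v n")
    case True
    have "v a = 0" if "a < n" for a
    proof -
      have "vec_index ?v a = vec_index (0\<^sub>v n) a" using True by simp
      then show ?thesis using that by simp
    qed
    then show ?thesis by simp
  next
    case False
    then show ?thesis using pos by simp
  qed
qed

text \<open>The form of k at the n + 1 points, with weight t at w, is a nonnegative quadratic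
  polynomial in t. Its minimiser -g/k(w, w) gives the inequality; \<open>w\<close> must be a new
  point because positive definiteness is stated for distinct points.\<close>

lemma kernel_cauchy_schwarz:
  fixes x :: "nat \<Rightarrow> 'p" and v :: "nat \<Rightarrow> real"
  assumes k: "positive_definite_kernel k" and x: "inj_on x {..<n}" and w: "w \<notin> x ` {..<n}"
  shows "(\<Sum>a<n. v a * k (x a) w)\<^sup>2 \<le> (\<Sum>a<n. \<Sum>b<n. v a * v b * k (x a) (x b)) * k w w"
proof -
  define g where "g = (\<Sum>a<n. v a * k (x a) w)"
  define q where "q = (\<Sum>a<n. \<Sum>b<n. v a * v b * k (x a) (x b))"
  define x' where "x' a = (if a < n then x a else w)" for a
  have inj: "inj_on x' {..<Suc n}"
    unfolding inj_on_def x'_def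
  proof (intro ballI impI)
    fix a b assume ab: "a \<in> {..<Suc n}" "b \<in> {..<Suc n}" "(if a < n then x a else w) = (if b < n then x b else w)"
    show "a = b"
      using ab w x by (cases "a < n"; cases "b < n") (auto dest: inj_onD)
  qed
  have sym: "k a b = k b a" for a b using k unfolding positive_definite_kernel_def by blast
  have *: "q + 2 * t * g + t\<^sup>2 * k w w \<ge> 0" for t
  proof -
    define v' where "v' a = (if a < n then v a else t)" for a
    have "0 \<le> (\<Sum>a<Suc n. \<Sum>b<Suc n. v' a * v' b * k (x' a) (x' b))" by (rule kernel_form_pos(1)[OF k inj])
    also have "\<dots> = q + (\<Sum>a<n. v a * t * k (x a) w) + ((\<Sum>b<n. t * v b * k w (x b)) + t * t * k w w)"
      by (simp add: v'_def x'_def q_def sum.distrib)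
    also have "(\<Sum>b<n. t * v b * k w (x b)) = t * g" unfolding g_def by (simp add: sum_distrib_left sym[of w] mult_ac)
    also have "(\<Sum>a<n. v a * t * k (x a) w) = t * g" unfolding g_def by (simp add: sum_distrib_left mult_ac)
    finally show ?thesis by (simp add: power2_eq_square algebra_simps)
  qed
  have kw: "k w w > 0"
    using kernel_form_pos(2)[OF k, of "\<lambda>_. w" 1 0 "\<lambda>_. 1"] by (simp add: inj_on_def)
  have "q + 2 * (- g / k w w) * g + (- g / k w w)\<^sup>2 * k w w = q - g\<^sup>2 / k w w"
    using kw by (simp add: power2_eq_square field_simps)
  with *[of "- g / k w w"] have "g\<^sup>2 / k w w \<le> q" by simp
  then show ?thesis using kw unfolding g_def q_def by (simp add: field_simps)
qed

lemma annihilates_multi_deriv: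
  fixes x :: "nat \<Rightarrow> real ^ 'd::finite"
  assumes "annihilates n x \<nu> l" "s < l"
  shows "(\<Sum>a<n. \<nu> a * multi_deriv (vec_nth (x a)) e s F z) = 0"
proof -
  have "(\<Sum>a<n. \<nu> a * multi_deriv (vec_nth (x a)) e s F z)
      = (\<Sum>a<n. \<Sum>L | length L = s. (\<nu> a * prod_list (map (vec_nth (x a)) L)) * iter_deriv (map e L) F z)"
    unfolding multi_deriv_def by (simp add: sum_distrib_left mult.assoc)
  also have "\<dots> = (\<Sum>L | length L = s. \<Sum>a<n. (\<nu> a * prod_list (map (vec_nth (x a)) L)) * iter_deriv (map e L) F z)"
    by (rule sum.swap)
  also have "\<dots> = (\<Sum>L | length L = s. (\<Sum>a<n. \<nu> a * prod_list (map (vec_nth (x a)) L)) * iter_deriv (map e L) F z)"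
    unfolding sum_distrib_right ..
  also have "\<dots> = 0"
    using annihilates_list[OF assms(1)] assms(2) by (intro sum.neutral ballI) auto
  finally show ?thesis .
qed

lemma iter_deriv_replicate_axis:
  fixes x :: "real ^ 'd::finite"
  assumes "open U" "\<And>N. smooth_along U (\<lambda>i. axis i 1) N F" "z \<in> U"
  shows "iter_deriv (replicate l x) F z = multi_deriv (vec_nth x) (\<lambda>i. axis i 1) l F z"
  using iter_deriv_replicate[OF assms(1,2) order_refl assms(3), of l "vec_nth x"] unfolding axis_sum .

text \<open>The counterpart of \<open>kernel_limit_lists\<close> for one function: an annihilating
  functional at the points z + \<epsilon> x_a, divided by \<epsilon>^l, tends to a homogeneous
  differential operator of order l at z.\<close>

lemma annihilator_limit:
  fixes x :: "nat \<Rightarrow> real ^ 'd::finite"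
  assumes U: "open U" and F: "\<And>N. smooth_along U (\<lambda>i. axis i 1) N F" and z: "z \<in> U" and \<nu>: "annihilates n x \<nu> l"
  shows "((\<lambda>\<epsilon>. (\<Sum>a<n. \<nu> a * F (z + \<epsilon> *\<^sub>R x a)) / \<epsilon> ^ l) \<longlongrightarrow> (\<Sum>a<n. \<nu> a * iter_deriv (replicate l (x a)) F z) / fact l) (at_right 0)"
proof -
  let ?e = "\<lambda>i :: 'd. axis i (1::real)"
  let ?M = "\<lambda>a. multi_deriv (vec_nth (x a)) ?e l F"
  have ev0: "eventually (\<lambda>\<epsilon>. \<forall>a\<in>{..<n}. \<forall>t. 0 \<le> t \<longrightarrow> t \<le> \<epsilon> \<longrightarrow> z + t *\<^sub>R x a \<in> U) (at_right 0)"
  proof (intro eventually_ball_finite ballI)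
    fix a
    obtain \<delta> where \<delta>: "\<delta> > 0" "\<And>r s. \<bar>r\<bar> < \<delta> \<Longrightarrow> \<bar>s\<bar> < \<delta> \<Longrightarrow> z + r *\<^sub>R x a + s *\<^sub>R x a \<in> U"
      using open_segment_bound[OF U z] by blast
    have "z + t *\<^sub>R x a \<in> U" if "0 \<le> t" "t \<le> \<epsilon>" "\<epsilon> < \<delta>" for t \<epsilon>
      using \<delta>(2)[of 0 t] \<delta>(1) that by simp
    then show "eventually (\<lambda>\<epsilon>. \<forall>t. 0 \<le> t \<longrightarrow> t \<le> \<epsilon> \<longrightarrow> z + t *\<^sub>R x a \<in> U) (at_right 0)"
      unfolding eventually_at_right_field using \<delta>(1) by blast
  qed simp
  then obtain \<delta> where \<delta>: "\<delta> > 0" "\<And>\<epsilon> a t. 0 < \<epsilon> \<Longrightarrow> \<epsilon> < \<delta> \<Longrightarrow> a < n \<Longrightarrow> 0 \<le> t \<Longrightarrow> t \<le> \<epsilon> \<Longrightarrow> z + t *\<^sub>R x a \<in> U"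
    unfolding eventually_at_right_field by auto
  have "\<exists>t. 0 < \<epsilon> \<and> \<epsilon> < \<delta> \<longrightarrow> 0 \<le> t \<and> t \<le> \<epsilon> \<and> (\<Sum>a<n. \<nu> a * F (z + \<epsilon> *\<^sub>R x a)) = \<epsilon> ^ l / fact l * (\<Sum>a<n. \<nu> a * ?M a (z + t *\<^sub>R x a))" for \<epsilon>
  proof (cases "0 < \<epsilon> \<and> \<epsilon> < \<delta>")
    case True
    have "\<exists>t. 0 \<le> t \<and> t \<le> \<epsilon> \<and> (\<Sum>a<n. \<nu> a * F (z + \<epsilon> *\<^sub>R (\<Sum>i\<in>UNIV. vec_nth (x a) i *\<^sub>R ?e i))) =
        \<epsilon> ^ l / fact l * (\<Sum>a<n. \<nu> a * ?M a (z + t *\<^sub>R (\<Sum>i\<in>UNIV. vec_nth (x a) i *\<^sub>R ?e i)))"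
    proof (rule taylor_sum[OF U F order_refl])
      show "0 < \<epsilon>" using True by simp
      show "z + t *\<^sub>R (\<Sum>i\<in>UNIV. vec_nth (x a) i *\<^sub>R ?e i) \<in> U" if "a \<in> {..<n}" "0 \<le> t" "t \<le> \<epsilon>" for a t
        unfolding axis_sum using \<delta>(2)[of \<epsilon> a t] True that by simp
      show "(\<Sum>a<n. \<nu> a * multi_deriv (vec_nth (x a)) ?e s F z) = 0" if "s < l" for s
        by (rule annihilates_multi_deriv[OF \<nu> that])
    qed
    then show ?thesis unfolding axis_sum by blast
  qed blast
  then have "\<forall>\<epsilon>. \<exists>t. 0 < \<epsilon> \<and> \<epsilon> < \<delta> \<longrightarrow> 0 \<le> t \<and> t \<le> \<epsilon> \<and> (\<Sum>a<n. \<nu> a * F (z + \<epsilon> *\<^sub>R x a)) = \<epsilon> ^ l / fact l * (\<Sum>a<n. \<nu> a * ?M a (z + t *\<^sub>R x a))"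
    by (rule allI)
  from choice[OF this] obtain \<theta> where "\<forall>\<epsilon>. 0 < \<epsilon> \<and> \<epsilon> < \<delta> \<longrightarrow> 0 \<le> \<theta> \<epsilon> \<and> \<theta> \<epsilon> \<le> \<epsilon> \<and> (\<Sum>a<n. \<nu> a * F (z + \<epsilon> *\<^sub>R x a)) = \<epsilon> ^ l / fact l * (\<Sum>a<n. \<nu> a * ?M a (z + \<theta> \<epsilon> *\<^sub>R x a))"
    by (rule exE)
  note \<theta> = mp[OF spec[OF this]]
  have ev: "eventually (\<lambda>\<epsilon>. 0 < \<epsilon> \<and> \<epsilon> < \<delta>) (at_right (0::real))"
    using \<delta>(1) by (auto simp: eventually_at_right_field intro: exI[of _ \<delta>])
  have \<theta>lim: "(\<theta> \<longlongrightarrow> 0) (at_right 0)"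
  proof (rule Lim_null_comparison[where g = "\<lambda>t. t"])
    show "eventually (\<lambda>t. norm (\<theta> t) \<le> t) (at_right 0)"
      using ev by eventually_elim (use \<theta> in \<open>auto simp: abs_of_nonneg\<close>)
  qed (auto intro!: tendsto_eq_intros)
  have "((\<lambda>\<epsilon>. ?M a (z + \<theta> \<epsilon> *\<^sub>R x a)) \<longlongrightarrow> ?M a z) (at_right 0)" for a
  proof -
    have "continuous_on U (?M a)"
      unfolding multi_deriv_def by (intro continuous_intros smooth_along_continuous[OF F order_refl])
    then have "isCont (?M a) z" using U z by (simp add: continuous_on_eq_continuous_at)
    moreover have "((\<lambda>\<epsilon>. z + \<theta> \<epsilon> *\<^sub>R x a) \<longlongrightarrow> z + 0 *\<^sub>R x a) (at_right 0)"
      by (intro tendsto_intros \<theta>lim)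
    ultimately show ?thesis using isCont_tendsto_compose[of z "?M a"] by simp
  qed
  then have "((\<lambda>\<epsilon>. (\<Sum>a<n. \<nu> a * ?M a (z + \<theta> \<epsilon> *\<^sub>R x a)) / fact l) \<longlongrightarrow> (\<Sum>a<n. \<nu> a * ?M a z) / fact l) (at_right 0)"
    by (intro tendsto_divide tendsto_sum tendsto_mult tendsto_const) auto
  moreover have "eventually (\<lambda>\<epsilon>. (\<Sum>a<n. \<nu> a * ?M a (z + \<theta> \<epsilon> *\<^sub>R x a)) / fact l = (\<Sum>a<n. \<nu> a * F (z + \<epsilon> *\<^sub>R x a)) / \<epsilon> ^ l) (at_right 0)"
    using ev
  proof eventually_elim
    case (elim \<epsilon>)
    then have "(\<Sum>a<n. \<nu> a * F (z + \<epsilon> *\<^sub>R x a)) = \<epsilon> ^ l / fact l * (\<Sum>a<n. \<nu> a * ?M a (z + \<theta> \<epsilon> *\<^sub>R x a))" using \<theta> by blast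
    then show ?case using elim by simp
  qed
  ultimately have "((\<lambda>\<epsilon>. (\<Sum>a<n. \<nu> a * F (z + \<epsilon> *\<^sub>R x a)) / \<epsilon> ^ l) \<longlongrightarrow> (\<Sum>a<n. \<nu> a * ?M a z) / fact l) (at_right 0)"
    by (rule Lim_transform_eventually)
  then show ?thesis unfolding iter_deriv_replicate_axis[OF U F z] .
qed

section \<open>Vanishing of the leading form of an annihilating operator\<close>

lemma small_polynomial_coeff:
  fixes p :: "real poly"
  assumes "0 < t0"
  shows "(\<And>t. 0 < t \<Longrightarrow> t < t0 \<Longrightarrow> \<bar>poly p t\<bar> \<le> C * t ^ N) \<Longrightarrow> i < N \<Longrightarrow> coeff p i = 0"
proof (induction N arbitrary: p i)
  case (Suc N)
  obtain a q where p: "p = pCons a q" by (cases p)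
  have ev: "eventually (\<lambda>t. 0 < t \<and> t < t0) (at_right (0::real))"
    using assms by (auto simp: eventually_at_right_field intro: exI[of _ t0])
  have l: "((\<lambda>t. poly p t) \<longlongrightarrow> 0) (at_right 0)"
  proof (rule Lim_null_comparison[where g = "\<lambda>t. C * t ^ Suc N"])
    show "eventually (\<lambda>t. norm (poly p t) \<le> C * t ^ Suc N) (at_right 0)"
      using ev by eventually_elim (use Suc.prems(1) in \<open>auto simp del: power_Suc\<close>)
    have "((\<lambda>t. C * t ^ Suc N) \<longlongrightarrow> C * 0 ^ Suc N) (at_right 0)" by (intro tendsto_intros)
    then show "((\<lambda>t. C * t ^ Suc N) \<longlongrightarrow> 0) (at_right 0)" by simp
  qed
  have "((\<lambda>t. poly p t) \<longlongrightarrow> poly p 0) (at_right 0)" by (intro tendsto_intros)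
  from tendsto_unique[OF trivial_limit_at_right_real this l] have a: "a = 0" unfolding p by simp
  have q: "\<bar>poly q t\<bar> \<le> C * t ^ N" if t: "0 < t" "t < t0" for t
  proof -
    have "t * \<bar>poly q t\<bar> \<le> t * (C * t ^ N)"
      using Suc.prems(1)[OF t] t unfolding p a by (simp add: abs_mult mult.left_commute)
    then show ?thesis using t by simp
  qed
  show ?case
  proof (cases i)
    case 0
    then show ?thesis unfolding p a by simp
  next
    case (Suc i')
    then show ?thesis using Suc.IH[OF q, of i'] Suc.prems(2) unfolding p by simp
  qed
qed simp

text \<open>Polarisation: differentiating the identity in \<xi> along b lowers the power by one and
  inserts the factor x_a \<bullet> b.\<close>

lemma power_sum_moments:
  fixes x :: "'n \<Rightarrow> 'a::real_inner"
  assumes A: "finite A"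
  shows "(\<And>\<xi>. (\<Sum>a\<in>A. \<nu> a * (x a \<bullet> \<xi>) ^ length bs) = 0) \<Longrightarrow> (\<Sum>a\<in>A. \<nu> a * prod_list (map (\<lambda>b. x a \<bullet> b) bs)) = 0"
proof (induction bs arbitrary: \<nu>)
  case (Cons b bs)
  have "(\<Sum>a\<in>A. (\<nu> a * (x a \<bullet> b)) * (x a \<bullet> \<xi>) ^ length bs) = 0" for \<xi>
  proof -
    have "((\<lambda>t. x a \<bullet> (\<xi> + t *\<^sub>R b)) has_real_derivative x a \<bullet> b) (at 0)" for a
      unfolding inner_add_right inner_scaleR_right by (auto intro!: derivative_eq_intros)
    from DERIV_power[OF this, of _ "length (b # bs)"]
    have "((\<lambda>t. \<Sum>a\<in>A. \<nu> a * (x a \<bullet> (\<xi> + t *\<^sub>R b)) ^ length (b # bs)) has_real_derivative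
       (\<Sum>a\<in>A. \<nu> a * (real (length (b # bs)) * ((x a \<bullet> b) * (x a \<bullet> (\<xi> + 0 *\<^sub>R b)) ^ (length (b # bs) - Suc 0))))) (at 0)"
      by (intro DERIV_sum DERIV_cmult)
    then have "((\<lambda>t. 0) has_real_derivative
       (\<Sum>a\<in>A. \<nu> a * (real (length (b # bs)) * ((x a \<bullet> b) * (x a \<bullet> (\<xi> + 0 *\<^sub>R b)) ^ (length (b # bs) - Suc 0))))) (at (0::real))"
      unfolding Cons.prems .
    from DERIV_unique[OF this DERIV_const]
    have "real (length (b # bs)) * (\<Sum>a\<in>A. (\<nu> a * (x a \<bullet> b)) * (x a \<bullet> \<xi>) ^ length bs) = 0"
      by (simp add: sum_distrib_left mult_ac)
    then show ?thesis by simp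
  qed
  from Cons.IH[OF this] show ?case by (simp add: mult.assoc)
qed simp

lemma iter_deriv_sum:
  assumes U: "open U" and "finite I" and ex: "\<And>i. i \<in> I \<Longrightarrow> iter_deriv_exists U bs (f i)"
  shows "iter_deriv_exists U bs (\<lambda>z. \<Sum>i\<in>I. c i * f i z) \<and> (\<forall>z\<in>U. iter_deriv bs (\<lambda>z. \<Sum>i\<in>I. c i * f i z) z = (\<Sum>i\<in>I. c i * iter_deriv bs (f i) z))"
  using \<open>finite I\<close> ex
proof (induction I rule: finite_induct)
  case empty
  have "iter_deriv bs (\<lambda>_. 0) = (\<lambda>_ :: 'a. 0)" for bs by (induction bs) simp_all
  moreover have "iter_deriv_exists U bs (\<lambda>_ :: 'a. 0)" for bs
  proof (induction bs)
    case (Cons b bs)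
    then show ?case using \<open>\<And>bs. iter_deriv bs (\<lambda>_. 0) = (\<lambda>_ :: 'a. 0)\<close> by simp
  qed simp
  ultimately show ?case by simp
next
  case (insert i I)
  have 1: "iter_deriv_exists U bs (\<lambda>z. c i * f i z)" "\<And>z. z \<in> U \<Longrightarrow> iter_deriv bs (\<lambda>z. c i * f i z) z = c i * iter_deriv bs (f i) z"
    using iter_deriv_cmult[OF U, of bs "f i" "c i"] insert.prems by auto
  have 2: "iter_deriv_exists U bs (\<lambda>z. \<Sum>i\<in>I. c i * f i z)"
    "\<And>z. z \<in> U \<Longrightarrow> iter_deriv bs (\<lambda>z. \<Sum>i\<in>I. c i * f i z) z = (\<Sum>i\<in>I. c i * iter_deriv bs (f i) z)"
    using insert.IH insert.prems by auto
  have e: "(\<lambda>z. \<Sum>i\<in>insert i I. c i * f i z) = (\<lambda>z. c i * f i z + (\<Sum>i\<in>I. c i * f i z))"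
    using insert.hyps by simp
  show ?case unfolding e using iter_deriv_add[OF U 1(1) 2(1)] 1(2) 2(2) insert.hyps by simp
qed

text \<open>The test point is -z, because k(\<epsilon> x_a, -z) = F(z + \<epsilon> x_a); for small
  \<epsilon> it avoids the points \<epsilon> x_a, since z \<noteq> 0. Cauchy-Schwarz drives the sum
  g to 0, while term by term it tends to the differential operators applied to F at z, away from the
  origin, where F has derivatives of every order.\<close>

lemma radial_limit_annihilates:
  fixes x :: "nat \<Rightarrow> real ^ 'd::finite"
  assumes k: "positive_definite_kernel k" and x: "inj_on x {..<n}"
    and kF: "\<And>y z. k y z = F (y - z)"
    and U: "open U" "0 \<notin> U" and F: "\<And>N. smooth_along U (\<lambda>i. axis i 1) N F" and z: "z \<in> U"
    and \<nu>: "\<And>l. l \<le> m \<Longrightarrow> annihilates n x (\<nu> l) l"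
    and lim: "((\<lambda>\<epsilon>. \<Sum>a<n. \<Sum>b<n. (\<Sum>l\<le>m. \<nu> l a / \<epsilon> ^ l) * (\<Sum>l\<le>m. \<nu> l b / \<epsilon> ^ l) * k (\<epsilon> *\<^sub>R x a) (\<epsilon> *\<^sub>R x b)) \<longlongrightarrow> 0) (at_right 0)"
  shows "(\<Sum>l\<le>m. (\<Sum>a<n. \<nu> l a * iter_deriv (replicate l (x a)) F z) / fact l) = 0"
proof -
  define g where "g \<epsilon> = (\<Sum>a<n. (\<Sum>l\<le>m. \<nu> l a / \<epsilon> ^ l) * k (\<epsilon> *\<^sub>R x a) (- z))" for \<epsilon>
  define q where "q \<epsilon> = (\<Sum>a<n. \<Sum>b<n. (\<Sum>l\<le>m. \<nu> l a / \<epsilon> ^ l) * (\<Sum>l\<le>m. \<nu> l b / \<epsilon> ^ l) * k (\<epsilon> *\<^sub>R x a) (\<epsilon> *\<^sub>R x b))" for \<epsilon>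
  have z0: "z \<noteq> 0" using U(2) z by auto
  have ev: "eventually (\<lambda>\<epsilon>. \<forall>a\<in>{..<n}. \<epsilon> *\<^sub>R x a \<noteq> - z) (at_right 0)"
  proof (intro eventually_ball_finite ballI)
    fix a
    have "((\<lambda>\<epsilon>. \<epsilon> *\<^sub>R x a) \<longlongrightarrow> 0 *\<^sub>R x a) (at_right 0)" by (intro tendsto_intros)
    then show "eventually (\<lambda>\<epsilon>. \<epsilon> *\<^sub>R x a \<noteq> - z) (at_right 0)"
      by (rule tendsto_imp_eventually_ne) (use z0 in simp)
  qed simp
  have ev_pos: "eventually (\<lambda>\<epsilon>::real. 0 < \<epsilon>) (at_right 0)" by (rule eventually_at_right_less)
  have le: "eventually (\<lambda>\<epsilon>. (g \<epsilon>)\<^sup>2 \<le> q \<epsilon> * k (- z) (- z)) (at_right 0)"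
    using ev ev_pos
  proof eventually_elim
    case (elim \<epsilon>)
    have "inj_on (\<lambda>a. \<epsilon> *\<^sub>R x a) {..<n}" using x elim(2) by (auto simp: inj_on_def)
    then show ?case unfolding g_def q_def using elim(1) by (intro kernel_cauchy_schwarz[OF k]) auto
  qed
  have q0: "((\<lambda>\<epsilon>. q \<epsilon> * k (- z) (- z)) \<longlongrightarrow> 0) (at_right 0)"
    using tendsto_mult_right[OF lim, of "k (- z) (- z)"] unfolding q_def by simp
  have "((\<lambda>\<epsilon>. (g \<epsilon>)\<^sup>2) \<longlongrightarrow> 0) (at_right 0)"
    by (rule tendsto_sandwich[OF _ le tendsto_const q0]) simp
  then have g0: "(g \<longlongrightarrow> 0) (at_right 0)" by simp
  have "((\<lambda>\<epsilon>. \<Sum>l\<le>m. (\<Sum>a<n. \<nu> l a * F (z + \<epsilon> *\<^sub>R x a)) / \<epsilon> ^ l) \<longlongrightarrow> (\<Sum>l\<le>m. (\<Sum>a<n. \<nu> l a * iter_deriv (replicate l (x a)) F z) / fact l)) (at_right 0)"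
    by (intro tendsto_sum annihilator_limit[OF U(1) F z] \<nu>) auto
  moreover have "(\<Sum>l\<le>m. (\<Sum>a<n. \<nu> l a * F (z + \<epsilon> *\<^sub>R x a)) / \<epsilon> ^ l) = g \<epsilon>" for \<epsilon>
  proof -
    have "(\<Sum>l\<le>m. (\<Sum>a<n. \<nu> l a * F (z + \<epsilon> *\<^sub>R x a)) / \<epsilon> ^ l) = (\<Sum>l\<le>m. \<Sum>a<n. \<nu> l a / \<epsilon> ^ l * F (z + \<epsilon> *\<^sub>R x a))"
      by (simp add: sum_divide_distrib)
    also have "\<dots> = (\<Sum>a<n. \<Sum>l\<le>m. \<nu> l a / \<epsilon> ^ l * F (z + \<epsilon> *\<^sub>R x a))" by (rule sum.swap)
    also have "\<dots> = g \<epsilon>" unfolding g_def kF by (simp add: sum_distrib_right add.commute)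
    finally show ?thesis .
  qed
  ultimately show ?thesis using tendsto_unique[OF trivial_limit_at_right_real _ g0] by simp
qed

text \<open>
  The polynomial differential operator \<open>p(\<partial>) = \<Sum>\<^sub>l (1/l!) \<Sum>\<^sub>a \<nu>\<^sub>l\<^sub>a (x\<^sub>a \<bullet> \<partial>)\<^sup>l\<close> kills \<open>\<psi>(|z|)\<close> near \<open>0\<close>. By parity the same holds
  for the part of \<open>p\<close> whose degrees have the parity of the top degree \<open>D\<close>; comparing the terms of degree
  \<open>2m + 1 - D\<close> in \<open>z\<close>, only \<open>p\<^sub>D(\<partial>)|z|\<^sup>2\<^sup>m\<^sup>+\<^sup>1\<close> survives.
\<close>

lemma radial_top_degree:
  fixes x :: "nat \<Rightarrow> real ^ 'd::finite"
  assumes ps: "\<And>s. \<bar>s\<bar> < \<delta> \<Longrightarrow> (\<lambda>i. c i * s ^ i) sums \<psi> s" and \<delta>: "\<delta> > 0"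
    and odd: "\<And>i. i < m \<Longrightarrow> c (2 * i + 1) = 0" and c: "c (2 * m + 1) \<noteq> 0" and D: "D \<le> m"
    and kill: "\<And>z. z \<noteq> 0 \<Longrightarrow> norm z < \<delta> \<Longrightarrow>
      (\<Sum>l\<le>D. (\<Sum>a<n. \<nu> l a * iter_deriv (replicate l (x a)) (\<lambda>z. \<psi> (norm z)) z) / fact l) = 0"
  shows "(\<Sum>a<n. \<nu> D a * (x a \<bullet> \<xi>) ^ D) = 0"
proof -
  note sum.lessThan_Suc [simp del]
  define U where "U = ball 0 \<delta> - {0 :: real ^ 'd}"
  have U: "open U" unfolding U_def by auto
  define F where "F = (\<lambda>z :: real ^ 'd. \<psi> (norm z))"
  define rest where "rest z = F z - (\<Sum>i<2 * m + 2. c i * norm z ^ i)" for z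
  define f where "f i = (\<lambda>z :: real ^ 'd. norm z ^ i)" for i
  have rad: "radial_term \<delta> (int (2 * m + 2)) rest"
    unfolding rest_def F_def by (rule radial_remainder) (rule ps)
  have radF: "radial_term \<delta> 0 F"
    using radial_remainder[OF ps, where N = 0, where ?'a = "real ^ 'd", of \<delta>] unfolding F_def by simp
  define op where "op l g z = (\<Sum>a<n. \<nu> l a * iter_deriv (replicate l (x a)) g z) / fact l" for l and g :: "real ^ 'd \<Rightarrow> real" and z
  have exf: "iter_deriv_exists U bs (f i)" for bs i
    unfolding U_def f_def using radial_term_iter_deriv_punctured[OF radial_term_norm_power] by blast
  have exr: "iter_deriv_exists U bs rest" for bs
    unfolding U_def using radial_term_iter_deriv_punctured[OF rad] by blast
  have exF: "iter_deriv_exists U bs F" for bs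
    unfolding U_def using radial_term_iter_deriv_punctured[OF radF] by blast
  have dec: "op l F z = (\<Sum>i<2 * m + 2. c i * op l (f i) z) + op l rest z" if z: "z \<in> U" for l z
  proof -
    have "iter_deriv bs F z = (\<Sum>i<2 * m + 2. c i * iter_deriv bs (f i) z) + iter_deriv bs rest z" for bs
    proof -
      have s: "iter_deriv_exists U bs (\<lambda>z. \<Sum>i<2 * m + 2. c i * f i z)"
        "iter_deriv bs (\<lambda>z. \<Sum>i<2 * m + 2. c i * f i z) z = (\<Sum>i<2 * m + 2. c i * iter_deriv bs (f i) z)"
        using iter_deriv_sum[OF U, of "{..<2 * m + 2}" bs f c] exf z by auto
      have "F = (\<lambda>z. (\<Sum>i<2 * m + 2. c i * f i z) + rest z)" by (simp add: rest_def f_def)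
      then show ?thesis using iter_deriv_add[OF U s(1) exr] z s(2) by simp
    qed
    then have "op l F z = (\<Sum>a<n. \<nu> l a * ((\<Sum>i<2 * m + 2. c i * iter_deriv (replicate l (x a)) (f i) z) + iter_deriv (replicate l (x a)) rest z)) / fact l"
      unfolding op_def by simp
    also have "\<dots> = (\<Sum>a<n. \<Sum>i<2 * m + 2. c i * (\<nu> l a * iter_deriv (replicate l (x a)) (f i) z)) / fact l + op l rest z"
      unfolding op_def by (simp add: distrib_left sum.distrib add_divide_distrib sum_distrib_left mult.left_commute)
    also have "(\<Sum>a<n. \<Sum>i<2 * m + 2. c i * (\<nu> l a * iter_deriv (replicate l (x a)) (f i) z)) = (\<Sum>i<2 * m + 2. \<Sum>a<n. c i * (\<nu> l a * iter_deriv (replicate l (x a)) (f i) z))"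
      by (rule sum.swap)
    also have "\<dots> / fact l = (\<Sum>i<2 * m + 2. c i * op l (f i) z)"
      unfolding op_def by (simp add: sum_distrib_left sum_divide_distrib)
    finally show ?thesis .
  qed
  have par: "op l F (- z) = (- 1) ^ l * op l F z" if z: "z \<in> U" for l z
  proof -
    have "iter_deriv (replicate l (x a)) F ((- 1) *\<^sub>R z) = 1 / (- 1) ^ length (replicate l (x a)) * iter_deriv (replicate l (x a)) F z" for a
      by (rule iter_deriv_scale[OF U _ _ exF z]) (auto simp: F_def)
    moreover have "1 / (- 1 :: real) ^ l = (- 1) ^ l" by (simp add: power_one_over[symmetric])
    ultimately have "iter_deriv (replicate l (x a)) F (- z) = (- 1) ^ l * iter_deriv (replicate l (x a)) F z" for a by simp
    then show ?thesis unfolding op_def by (simp add: sum_distrib_left mult.left_commute)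
  qed
  have evenpart: "(\<Sum>l | l \<le> D \<and> even (D - l). op l F z) = 0" if z: "z \<in> U" for z
  proof -
    have k1: "(\<Sum>l\<le>D. op l F z) = 0" using kill[of z] z unfolding op_def U_def F_def by simp
    have k2: "(\<Sum>l\<le>D. (- 1) ^ l * op l F z) = 0"
      using kill[of "- z"] z par[OF z] unfolding op_def[symmetric] F_def[symmetric] U_def by simp
    have "(\<Sum>l\<le>D. (1 + (- 1) ^ (D + l)) * op l F z) = (\<Sum>l\<le>D. op l F z) + (- 1) ^ D * (\<Sum>l\<le>D. (- 1) ^ l * op l F z)"
      by (simp add: distrib_right sum.distrib sum_distrib_left power_add mult.assoc)
    then have "(\<Sum>l\<le>D. (1 + (- 1) ^ (D + l)) * op l F z) = 0" unfolding k1 k2 by simp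
    also have "(\<Sum>l\<le>D. (1 + (- 1) ^ (D + l)) * op l F z) = (\<Sum>l\<in>{l. l \<le> D \<and> even (D - l)}. 2 * op l F z)"
      by (rule sum.mono_neutral_cong_right) auto
    finally show ?thesis by (simp add: sum_distrib_left[symmetric])
  qed
  have top: "op D (f (2 * m + 1)) z = 0" if z: "z \<in> U" for z
  proof -
    let ?L = "{l. l \<le> D \<and> even (D - l)}"
    have finL: "finite ?L" by simp
    \<comment> \<open>The function \<open>op l (f i)\<close> is homogeneous of degree i - l.
      Multiplication by t^D makes all exponents nonnegative, so that its values along the ray t z
      form a polynomial in t.\<close>
    define p where "p = (\<Sum>l\<in>?L. \<Sum>i<2 * m + 2. Polynomial.monom (c i * op l (f i) z) (i + (D - l)))"
    define \<rho> where "\<rho> = min (\<delta> / 2) 1"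
    have \<rho>: "0 < \<rho>" "\<rho> < \<delta>" "\<rho> \<le> 1" unfolding \<rho>_def using \<delta> by auto
    have nz: "norm z > 0" using z by (simp add: U_def)
    have bd: "\<exists>C\<ge>0. \<forall>y. y \<noteq> 0 \<and> norm y \<le> \<rho> \<longrightarrow> \<bar>op l rest y\<bar> \<le> C * norm y ^ (2 * m + 2 - l)" if l: "l \<le> D" for l
    proof -
      have "\<exists>C\<ge>0. \<forall>y. y \<noteq> 0 \<and> norm y \<le> \<rho> \<longrightarrow> \<bar>iter_deriv (replicate l (x a)) rest y\<bar> \<le> C * norm y ^ (2 * m + 2 - l)" for a
      proof -
        obtain g where g: "radial_term \<delta> (int (2 * m + 2) - int (length (replicate l (x a)))) g"
          "\<And>y. y \<in> U \<Longrightarrow> iter_deriv (replicate l (x a)) rest y = g y"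
          using radial_term_iter_deriv_punctured[OF rad, of "replicate l (x a)"] unfolding U_def by blast
        obtain C where C: "C \<ge> 0" "\<And>y. y \<noteq> 0 \<Longrightarrow> norm y \<le> \<rho> \<Longrightarrow> \<bar>g y\<bar> \<le> C * norm y powi (int (2 * m + 2) - int (length (replicate l (x a))))"
          using radial_term_bound[OF g(1) \<rho>] by blast
        have e: "int (2 * m + 2) - int (length (replicate l (x a))) = int (2 * m + 2 - l)" using l D by simp
        have "\<bar>iter_deriv (replicate l (x a)) rest y\<bar> \<le> C * norm y ^ (2 * m + 2 - l)" if y: "y \<noteq> 0" "norm y \<le> \<rho>" for y
        proof -
          have "y \<in> U" using y \<rho> by (simp add: U_def)
          then show ?thesis using C(2)[OF y] g(2)[of y] unfolding e power_int_of_nat by simp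
        qed
        then show ?thesis using C(1) by blast
      qed
      then have "\<forall>a. \<exists>C. 0 \<le> C \<and> (\<forall>y. y \<noteq> 0 \<and> norm y \<le> \<rho> \<longrightarrow> \<bar>iter_deriv (replicate l (x a)) rest y\<bar> \<le> C * norm y ^ (2 * m + 2 - l))"
        by blast
      from choice[OF this] obtain C where C: "\<forall>a. 0 \<le> C a \<and> (\<forall>y. y \<noteq> 0 \<and> norm y \<le> \<rho> \<longrightarrow> \<bar>iter_deriv (replicate l (x a)) rest y\<bar> \<le> C a * norm y ^ (2 * m + 2 - l))"
        by (rule exE)
      have "\<bar>op l rest y\<bar> \<le> (\<Sum>a<n. \<bar>\<nu> l a\<bar> * C a) * norm y ^ (2 * m + 2 - l)" if y: "y \<noteq> 0" "norm y \<le> \<rho>" for y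
      proof -
        have "\<bar>op l rest y\<bar> = \<bar>\<Sum>a<n. \<nu> l a * iter_deriv (replicate l (x a)) rest y\<bar> / fact l" unfolding op_def by (simp add: abs_divide)
        also have "\<dots> \<le> \<bar>\<Sum>a<n. \<nu> l a * iter_deriv (replicate l (x a)) rest y\<bar>"
          using divide_left_mono[of 1 "fact l" "\<bar>\<Sum>a<n. \<nu> l a * iter_deriv (replicate l (x a)) rest y\<bar>"] fact_ge_1[of l, where ?'a = real]
          by (simp del: fact_ge_1)
        also have "\<dots> \<le> (\<Sum>a<n. \<bar>\<nu> l a\<bar> * (C a * norm y ^ (2 * m + 2 - l)))"
          by (rule order_trans[OF sum_abs]) (use C y in \<open>auto simp: abs_mult intro!: sum_mono mult_left_mono\<close>)
        finally show ?thesis by (simp add: sum_distrib_right mult.assoc)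
      qed
      moreover have "(\<Sum>a<n. \<bar>\<nu> l a\<bar> * C a) \<ge> 0" using C by (intro sum_nonneg mult_nonneg_nonneg) auto
      ultimately show ?thesis by blast
    qed
    then have "\<forall>l. \<exists>C. l \<le> D \<longrightarrow> 0 \<le> C \<and> (\<forall>y. y \<noteq> 0 \<and> norm y \<le> \<rho> \<longrightarrow> \<bar>op l rest y\<bar> \<le> C * norm y ^ (2 * m + 2 - l))"
      by blast
    from choice[OF this] obtain C where C: "\<forall>l. l \<le> D \<longrightarrow> 0 \<le> C l \<and> (\<forall>y. y \<noteq> 0 \<and> norm y \<le> \<rho> \<longrightarrow> \<bar>op l rest y\<bar> \<le> C l * norm y ^ (2 * m + 2 - l))"
      by (rule exE)
    define t0 where "t0 = \<rho> / norm z"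
    have t0: "t0 > 0" unfolding t0_def using \<rho> nz by simp
    define K where "K = (\<Sum>l\<in>?L. C l * norm z ^ (2 * m + 2 - l))"
    \<comment> \<open>By \<open>evenpart\<close> and \<open>dec\<close>, p(t) is -t^D times the
      operators applied to \<open>rest\<close>, which are O(t^(2 m + 2 - l)). The surplus factor
      t^(D - l) is at most (max 1 t0)^D.\<close>
    have small: "\<bar>poly p t\<bar> \<le> K * max 1 t0 ^ D * t ^ (2 * m + 2)" if t: "0 < t" "t < t0" for t
    proof -
      have nt: "norm (t *\<^sub>R z) \<le> \<rho>" using t nz unfolding t0_def by (simp add: field_simps)
      have tz: "t *\<^sub>R z \<in> U" "t *\<^sub>R z \<noteq> 0" using nt t nz \<rho> by (auto simp: U_def)
      have sc: "t ^ D * op l (f i) (t *\<^sub>R z) = t ^ (i + (D - l)) * op l (f i) z" if l: "l \<le> D" for l i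
      proof -
        have "iter_deriv (replicate l (x a)) (f i) (t *\<^sub>R z) = t ^ i / t ^ length (replicate l (x a)) * iter_deriv (replicate l (x a)) (f i) z" for a
          by (rule iter_deriv_scale[OF U _ _ exf z]) (use t in \<open>auto simp: f_def power_mult_distrib\<close>)
        then have "op l (f i) (t *\<^sub>R z) = t ^ i / t ^ l * op l (f i) z"
          unfolding op_def by (simp add: sum_distrib_left mult.left_commute)
        moreover have "t ^ D = t ^ (D - l) * t ^ l" using l by (simp flip: power_add)
        ultimately show ?thesis using t by (simp add: power_add)
      qed
      have "poly p t = (\<Sum>l\<in>?L. \<Sum>i<2 * m + 2. c i * op l (f i) z * t ^ (i + (D - l)))"
        unfolding p_def by (simp add: poly_sum poly_monom)
      also have "\<dots> = t ^ D * (\<Sum>l\<in>?L. \<Sum>i<2 * m + 2. c i * op l (f i) (t *\<^sub>R z))"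
      proof -
        have "c i * op l (f i) z * t ^ (i + (D - l)) = t ^ D * (c i * op l (f i) (t *\<^sub>R z))" if "l \<in> ?L" for l i
        proof -
          have "l \<le> D" using that by simp
          from sc[OF this, of i] show ?thesis by (simp only: mult.left_commute mult.commute mult.assoc)
        qed
        then show ?thesis unfolding sum_distrib_left by (intro sum.cong refl)
      qed
      also have "(\<Sum>l\<in>?L. \<Sum>i<2 * m + 2. c i * op l (f i) (t *\<^sub>R z)) = (\<Sum>l\<in>?L. op l F (t *\<^sub>R z) - op l rest (t *\<^sub>R z))"
        using dec[OF tz(1)] by simp
      also have "\<dots> = - (\<Sum>l\<in>?L. op l rest (t *\<^sub>R z))"
        using evenpart[OF tz(1)] by (simp add: sum_subtractf)
      finally have "\<bar>poly p t\<bar> = t ^ D * \<bar>\<Sum>l\<in>?L. op l rest (t *\<^sub>R z)\<bar>" using t by (simp add: abs_mult)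
      also have "\<dots> \<le> t ^ D * (\<Sum>l\<in>?L. C l * norm (t *\<^sub>R z) ^ (2 * m + 2 - l))"
      proof (rule mult_left_mono[OF order_trans[OF sum_abs sum_mono]])
        fix l assume "l \<in> ?L"
        then have "l \<le> D" by simp
        then show "\<bar>op l rest (t *\<^sub>R z)\<bar> \<le> C l * norm (t *\<^sub>R z) ^ (2 * m + 2 - l)" using C tz(2) nt by blast
      qed (use t in simp)
      also have "\<dots> = (\<Sum>l\<in>?L. C l * norm z ^ (2 * m + 2 - l) * t ^ (D + (2 * m + 2 - l)))"
        using t by (simp add: sum_distrib_left power_mult_distrib power_add mult_ac)
      also have "\<dots> \<le> (\<Sum>l\<in>?L. C l * norm z ^ (2 * m + 2 - l) * t ^ (2 * m + 2) * max 1 t0 ^ D)"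
      proof (intro sum_mono)
        fix l assume l: "l \<in> ?L"
        have "D + (2 * m + 2 - l) = (2 * m + 2) + (D - l)" using l D by auto
        then have "t ^ (D + (2 * m + 2 - l)) = t ^ (2 * m + 2) * t ^ (D - l)" by (simp flip: power_add)
        also have "\<dots> \<le> t ^ (2 * m + 2) * max 1 t0 ^ D"
        proof (rule mult_left_mono)
          have "t ^ (D - l) \<le> max 1 t0 ^ (D - l)" using t by (intro power_mono) auto
          also have "\<dots> \<le> max 1 t0 ^ D" by (intro power_increasing) auto
          finally show "t ^ (D - l) \<le> max 1 t0 ^ D" .
        qed (use t in auto)
        finally show "C l * norm z ^ (2 * m + 2 - l) * t ^ (D + (2 * m + 2 - l)) \<le> C l * norm z ^ (2 * m + 2 - l) * t ^ (2 * m + 2) * max 1 t0 ^ D"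
          using C l by (simp add: mult_left_mono mult.assoc)
      qed
      also have "\<dots> = K * max 1 t0 ^ D * t ^ (2 * m + 2)" unfolding K_def by (simp add: sum_distrib_left sum_distrib_right mult_ac)
      finally show ?thesis .
    qed
    have "coeff p (2 * m + 1) = 0" by (rule small_polynomial_coeff[OF t0 small]) auto
    moreover have "coeff p (2 * m + 1) = c (2 * m + 1) * op D (f (2 * m + 1)) z"
    proof -
      have "coeff p (2 * m + 1) = (\<Sum>l\<in>?L. \<Sum>i<2 * m + 2. if i + (D - l) = 2 * m + 1 then c i * op l (f i) z else 0)"
        unfolding p_def by (simp add: coeff_sum)
      also have "\<dots> = (\<Sum>l\<in>?L. if l = D then c (2 * m + 1) * op D (f (2 * m + 1)) z else 0)"
      proof (rule sum.cong[OF refl])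
        fix l assume l: "l \<in> ?L"
        \<comment> \<open>As D - l is even, the exponent 2 m + 1 is reached only by odd i. The odd
          coefficients below 2 m + 1 vanish and the sum stops there, so i = 2 m + 1 and l =
          D.\<close>
        have "(if i + (D - l) = 2 * m + 1 then c i * op l (f i) z else 0) = (if i = 2 * m + 1 then (if l = D then c (2 * m + 1) * op D (f (2 * m + 1)) z else 0) else 0)"
          if i: "i < 2 * m + 2" for i
        proof (cases "i + (D - l) = 2 * m + 1")
          case True
          then have "odd i" using l by (metis (mono_tags) even_add even_mult_iff even_numeral mem_Collect_eq odd_one)
          then obtain i' where i': "i = 2 * i' + 1" by (auto elim: oddE)
          show ?thesis
          proof (cases "i' < m")
            case True
            then show ?thesis using odd[OF True] i' by auto
          next
            case False
            then show ?thesis using i i' True l by auto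
          qed
        next
          case False
          then show ?thesis using l by auto
        qed
        then show "(\<Sum>i<2 * m + 2. if i + (D - l) = 2 * m + 1 then c i * op l (f i) z else 0) = (if l = D then c (2 * m + 1) * op D (f (2 * m + 1)) z else 0)"
          by simp
      qed
      also have "\<dots> = c (2 * m + 1) * op D (f (2 * m + 1)) z" by (simp add: finL)
      finally show ?thesis .
    qed
    ultimately show ?thesis using c by simp
  qed
  show ?thesis
    by (rule norm_power_annihilator[OF \<delta>, where A = "{..<n}" and \<nu> = "\<nu> D" and D = D and x = x and r = "2 * m + 1"]) (use top D in \<open>auto simp: op_def f_def U_def\<close>)
qed

text \<open>Let D be the largest degree in which the claim fails. The parts of degree above D have
  vanishing moments and give the zero operator, so D is the top degree of the operator that kills
  the kernel. \<open>radial_top_degree\<close> kills its leading form, and by polarisation all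
  moments of degree D vanish, against the choice of D.\<close>

lemma finitely_smooth_annihilates:
  fixes x :: "nat \<Rightarrow> real ^ 'd::finite"
  assumes k: "positive_definite_kernel k" and x: "inj_on x {..<n}"
    and radial: "radial_kernel k \<psi> c" and odd: "\<And>i. i < m \<Longrightarrow> c (2 * i + 1) = 0" and c: "c (2 * m + 1) \<noteq> 0"
    and \<nu>: "\<And>l. l \<le> m \<Longrightarrow> annihilates n x (\<nu> l) l"
    and lim: "((\<lambda>\<epsilon>. \<Sum>a<n. \<Sum>b<n. (\<Sum>l\<le>m. \<nu> l a / \<epsilon> ^ l) * (\<Sum>l\<le>m. \<nu> l b / \<epsilon> ^ l) * k (\<epsilon> *\<^sub>R x a) (\<epsilon> *\<^sub>R x b)) \<longlongrightarrow> 0) (at_right 0)"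
    and l: "l \<le> m"
  shows "annihilates n x (\<nu> l) (Suc l)"
proof (rule ccontr)
  assume bad: "\<not> annihilates n x (\<nu> l) (Suc l)"
  define Bad where "Bad = {l. l \<le> m \<and> \<not> annihilates n x (\<nu> l) (Suc l)}"
  have fin: "finite Bad" unfolding Bad_def by simp
  have ne: "Bad \<noteq> {}" using bad l unfolding Bad_def by blast
  define D where "D = Max Bad"
  have D: "D \<le> m" "\<not> annihilates n x (\<nu> D) (Suc D)" using Max_in[OF fin ne] unfolding D_def Bad_def by auto
  have above: "annihilates n x (\<nu> l) (Suc l)" if "D < l" "l \<le> m" for l
  proof (rule ccontr)
    assume "\<not> annihilates n x (\<nu> l) (Suc l)"
    then have "l \<in> Bad" unfolding Bad_def using that by simp
    from Max_ge[OF fin this] that(1) show False unfolding D_def by simp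
  qed
  obtain \<delta> where \<delta>: "\<delta> > 0" and ps: "\<And>s. \<bar>s\<bar> < \<delta> \<Longrightarrow> (\<lambda>i. c i * s ^ i) sums \<psi> s"
    using radial unfolding radial_kernel_def power_series_at_0_def by blast
  define F where "F = (\<lambda>z :: real ^ 'd. \<psi> (norm z))"
  have kF: "k y z = F (y - z)" for y z using radial unfolding radial_kernel_def F_def by blast
  define U where "U = ball 0 \<delta> - {0 :: real ^ 'd}"
  have U: "open U" "0 \<notin> U" unfolding U_def by auto
  have radF: "radial_term \<delta> (int 0) F"
  proof -
    have "radial_term \<delta> (int 0) (\<lambda>z :: real ^ 'd. \<psi> (norm z) - (\<Sum>i<0. c i * norm z ^ i))"
      by (rule radial_remainder) (rule ps)
    then show ?thesis unfolding F_def by simp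
  qed
  have smF: "smooth_along U (\<lambda>i. axis i 1) N F" for N
    unfolding U_def by (rule radial_term_smooth_punctured[OF radF])
  have "(\<Sum>a<n. \<nu> D a * (x a \<bullet> \<xi>) ^ D) = 0" for \<xi>
  proof (rule radial_top_degree[OF ps \<delta> odd c D(1)])
    fix z :: "real ^ 'd" assume "z \<noteq> 0" "norm z < \<delta>"
    then have z: "z \<in> U" unfolding U_def by simp
    have "(\<Sum>l\<le>m. (\<Sum>a<n. \<nu> l a * iter_deriv (replicate l (x a)) F z) / fact l) = 0"
      by (rule radial_limit_annihilates[OF k x kF U smF z \<nu> lim])
    moreover have "(\<Sum>l\<le>m. (\<Sum>a<n. \<nu> l a * iter_deriv (replicate l (x a)) F z) / fact l) =
      (\<Sum>l\<le>D. (\<Sum>a<n. \<nu> l a * iter_deriv (replicate l (x a)) F z) / fact l)"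
    proof (rule sum.mono_neutral_right)
      show "\<forall>l\<in>{..m} - {..D}. (\<Sum>a<n. \<nu> l a * iter_deriv (replicate l (x a)) F z) / fact l = 0"
      proof
        fix l assume "l \<in> {..m} - {..D}"
        then have "annihilates n x (\<nu> l) (Suc l)" by (intro above) auto
        from annihilates_multi_deriv[OF this lessI]
        have "(\<Sum>a<n. \<nu> l a * iter_deriv (replicate l (x a)) F z) = 0"
          unfolding iter_deriv_replicate_axis[OF U(1) smF z] .
        then show "(\<Sum>a<n. \<nu> l a * iter_deriv (replicate l (x a)) F z) / fact l = 0" by simp
      qed
    qed (use D in auto)
    ultimately show "(\<Sum>l\<le>D. (\<Sum>a<n. \<nu> l a * iter_deriv (replicate l (x a)) (\<lambda>z. \<psi> (norm z)) z) / fact l) = 0"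
      unfolding F_def by simp
  qed
  note pw = this
  have "annihilates n x (\<nu> D) (Suc D)"
    unfolding annihilates_def
  proof (intro allI impI)
    fix \<alpha> :: "'d \<Rightarrow> nat" assume "(\<Sum>i\<in>UNIV. \<alpha> i) < Suc D"
    then consider "(\<Sum>i\<in>UNIV. \<alpha> i) < D" | "(\<Sum>i\<in>UNIV. \<alpha> i) = D" by linarith
    then show "(\<Sum>a<n. \<nu> D a * monomial \<alpha> (x a)) = 0"
    proof cases
      case 1
      then show ?thesis using \<nu>[OF D(1)] unfolding annihilates_def by blast
    next
      case 2
      let ?bs = "map (\<lambda>i. axis i (1::real)) (index_list \<alpha>)"
      have len: "length ?bs = D" using 2 by (simp add: length_index_list)
      have "(\<Sum>a<n. \<nu> D a * prod_list (map (\<lambda>b. x a \<bullet> b) ?bs)) = 0"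
        by (rule power_sum_moments[OF finite_lessThan]) (simp only: len pw)
      moreover have "prod_list (map (\<lambda>b. x a \<bullet> b) ?bs) = monomial \<alpha> (x a)" for a
      proof -
        have "map (\<lambda>b. x a \<bullet> b) ?bs = map (vec_nth (x a)) (index_list \<alpha>)"
          by (simp add: inner_axis)
        moreover have "count (mset (index_list \<alpha>)) = \<alpha>" by (rule ext) (rule count_index_list)
        ultimately show ?thesis by (simp only: prod_list_monomial)
      qed
      ultimately show ?thesis by simp
    qed
  qed
  then show False using D(2) by blast
qed

section \<open>What the two cases provide for the kernel and its matrices\<close>

lemma radial_kernel_C:
  fixes k :: "real ^ 'd::finite \<Rightarrow> real ^ 'd \<Rightarrow> real"
  assumes radial: "radial_kernel k \<psi> c" and odd: "\<And>i. i < m \<Longrightarrow> c (2 * i + 1) = 0"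
  shows "kernel_C m k"
proof -
  obtain \<delta> where \<delta>: "\<delta> > 0" and ps: "\<And>s. \<bar>s\<bar> < \<delta> \<Longrightarrow> (\<lambda>i. c i * s ^ i) sums \<psi> s"
    using radial unfolding radial_kernel_def power_series_at_0_def by blast
  have "smooth_along (ball 0 \<delta>) id (2 * m) (\<lambda>z :: real ^ 'd. \<psi> (norm z))"
    by (rule radial_smooth[OF ps \<delta> odd])
  then show ?thesis by (rule kernel_C_difference[OF _ \<delta>]) (use radial in \<open>simp add: radial_kernel_def\<close>)
qed

lemma kernel_C_mono: "kernel_C q k \<Longrightarrow> q' \<le> q \<Longrightarrow> kernel_C q' k"
  unfolding kernel_C_def by (meson order_trans)

lemma regularity_index_ge:
  assumes "enat (m + 1) \<le> regularity_index c" "i < m"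
  shows "c (2 * i + 1) = 0"
proof (rule ccontr)
  assume ne: "c (2 * i + 1) \<noteq> 0"
  then have P: "1 \<le> i + 1 \<and> c (2 * (i + 1) - 1) \<noteq> 0" by simp
  then have "regularity_index c = enat (LEAST r. 1 \<le> r \<and> c (2 * r - 1) \<noteq> 0)"
    unfolding regularity_index_def by auto
  moreover have "(LEAST r. 1 \<le> r \<and> c (2 * r - 1) \<noteq> 0) \<le> i + 1" by (rule Least_le) (rule P)
  ultimately show False using assms by simp
qed

lemma regularity_index_eq:
  assumes "regularity_index c = enat (m + 1)"
  shows "c (2 * m + 1) \<noteq> 0"
proof -
  have ex: "\<exists>r\<ge>1. c (2 * r - 1) \<noteq> 0" using assms unfolding regularity_index_def by (metis enat.distinct(2))
  then have "(LEAST r. 1 \<le> r \<and> c (2 * r - 1) \<noteq> 0) = m + 1" using assms unfolding regularity_index_def by simp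
  moreover have "c (2 * (LEAST r. 1 \<le> r \<and> c (2 * r - 1) \<noteq> 0) - 1) \<noteq> 0"
    using LeastI_ex[of "\<lambda>r. 1 \<le> r \<and> c (2 * r - 1) \<noteq> 0"] ex by blast
  ultimately show ?thesis by simp
qed

lemma case_kernel_C:
  assumes "smooth_case mons n x k K m \<or> finitely_smooth_case mons n x k K m"
  shows "kernel_C m k"
  using assms
proof
  assume "smooth_case mons n x k K m"
  then consider \<psi> c where "radial_kernel k \<psi> c" "enat (m + 1) \<le> regularity_index c" | "kernel_C (m + 1) k"
    unfolding smooth_case_def by blast
  then show ?thesis
  proof cases
    case 1
    then show ?thesis using radial_kernel_C regularity_index_ge by blast
  next
    case 2
    then show ?thesis by (rule kernel_C_mono) simp
  qed
next
  assume "finitely_smooth_case mons n x k K m"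
  then obtain \<psi> c where "radial_kernel k \<psi> c" "regularity_index c = enat (m + 1)"
    unfolding finitely_smooth_case_def by blast
  then show ?thesis using radial_kernel_C regularity_index_ge by (metis order_refl)
qed

lemma radial_kernel_mat_pos:
  assumes "radial_kernel k \<psi> c" "0 < \<epsilon>" "i < n" "l < n"
  shows "radial_kernel_mat n x \<psi> \<epsilon> $$ (i, l) = k (\<epsilon> *\<^sub>R x i) (\<epsilon> *\<^sub>R x l)"
proof -
  have "norm (\<epsilon> *\<^sub>R x i - \<epsilon> *\<^sub>R x l) = \<epsilon> * norm (x i - x l)"
    using assms(2) by (simp add: scaleR_diff_right[symmetric])
  then show ?thesis using assms unfolding radial_kernel_def radial_kernel_mat_def by simp
qed

text \<open>For \<epsilon> < 0 the radial matrix evaluates \<psi> at negative arguments and need not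
  be a kernel matrix, which is why later limits are taken in \<open>at_right 0\<close>.\<close>

lemma case_kernel_mat:
  assumes "smooth_case mons n x k K m \<or> finitely_smooth_case mons n x k K m"
  shows "K \<epsilon> \<in> carrier_mat n n" "0 < \<epsilon> \<Longrightarrow> i < n \<Longrightarrow> l < n \<Longrightarrow> K \<epsilon> $$ (i, l) = k (\<epsilon> *\<^sub>R x i) (\<epsilon> *\<^sub>R x l)"
proof -
  consider \<psi> c where "radial_kernel k \<psi> c" "K = radial_kernel_mat n x \<psi>" | "K = (\<lambda>\<epsilon>. kernel_mat n (\<lambda>i. \<epsilon> *\<^sub>R x i) k)"
    using assms unfolding smooth_case_def finitely_smooth_case_def by blast
  then show "K \<epsilon> \<in> carrier_mat n n" by cases (simp_all add: radial_kernel_mat_def kernel_mat_def)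
  show "K \<epsilon> $$ (i, l) = k (\<epsilon> *\<^sub>R x i) (\<epsilon> *\<^sub>R x l)" if "0 < \<epsilon>" "i < n" "l < n"
    using assms
  proof -
    consider \<psi> c where "radial_kernel k \<psi> c" "K = radial_kernel_mat n x \<psi>" | "K = (\<lambda>\<epsilon>. kernel_mat n (\<lambda>i. \<epsilon> *\<^sub>R x i) k)"
      using assms unfolding smooth_case_def finitely_smooth_case_def by blast
    then show ?thesis by cases (use that in \<open>simp_all add: radial_kernel_mat_pos kernel_mat_def\<close>)
  qed
qed

section \<open>Spectral asymptotics\<close>

lemma psd_cauchy_schwarz:
  fixes A :: "'a \<Rightarrow> 'a \<Rightarrow> real"
  assumes "finite I" and sym: "\<And>a b. a \<in> I \<Longrightarrow> b \<in> I \<Longrightarrow> A a b = A b a"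
    and psd: "\<And>c. (\<Sum>a\<in>I. \<Sum>b\<in>I. c a * A a b * c b) \<ge> 0" and a: "a \<in> I"
  shows "(\<Sum>b\<in>I. A a b * c b)\<^sup>2 \<le> A a a * (\<Sum>a\<in>I. \<Sum>b\<in>I. c a * A a b * c b)"
proof -
  define g where "g = (\<Sum>b\<in>I. A a b * c b)"
  define Q where "Q = (\<Sum>a\<in>I. \<Sum>b\<in>I. c a * A a b * c b)"
  define \<delta> where "\<delta> b = (if b = a then 1 else 0 :: real)" for b
  have d: "(\<Sum>b\<in>I. \<delta> b * h b) = h a" for h
    using \<open>finite I\<close> a unfolding \<delta>_def by (simp add: if_distrib[of "\<lambda>r. r * _"] cong: if_cong)
  have q: "s\<^sup>2 * Q + 2 * s * t * g + t\<^sup>2 * A a a \<ge> 0" for s t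
  proof -
    have "(\<Sum>a\<in>I. \<Sum>b\<in>I. (s * c a + t * \<delta> a) * A a b * (s * c b + t * \<delta> b))
       = s\<^sup>2 * Q + s * t * (\<Sum>p\<in>I. \<Sum>b\<in>I. \<delta> b * (c p * A p b)) + s * t * (\<Sum>p\<in>I. \<delta> p * (\<Sum>b\<in>I. A p b * c b))
         + t\<^sup>2 * (\<Sum>p\<in>I. \<delta> p * (\<Sum>b\<in>I. \<delta> b * A p b))"
    proof -
      have "(s * c a + t * \<delta> a) * A a b * (s * c b + t * \<delta> b) = s\<^sup>2 * (c a * A a b * c b) + s * t * (\<delta> b * (c a * A a b))
          + s * t * (\<delta> a * (A a b * c b)) + t\<^sup>2 * (\<delta> a * (\<delta> b * A a b))" for a b
        by (simp add: power2_eq_square algebra_simps)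
      then show ?thesis unfolding Q_def by (simp only: sum.distrib sum_distrib_left)
    qed
    also have "\<dots> = s\<^sup>2 * Q + 2 * s * t * g + t\<^sup>2 * A a a"
    proof -
      have "(\<Sum>p\<in>I. \<Sum>b\<in>I. \<delta> b * (c p * A p b)) = g"
        unfolding d g_def using sym a by (intro sum.cong) (auto simp: mult.commute)
      then show ?thesis unfolding d g_def by simp
    qed
    finally show ?thesis using psd[of "\<lambda>a. s * c a + t * \<delta> a"] by (simp only:)
  qed
  have Q0: "Q \<ge> 0" using q[of 1 0] by simp
  have A0: "A a a \<ge> 0" using q[of 0 1] by simp
  have "g\<^sup>2 \<le> A a a * Q"
  proof (cases "A a a = 0")
    case True
    have "g = 0"
    proof (rule ccontr)
      assume "g \<noteq> 0"
      \<comment> \<open>With a zero diagonal entry the form is affine in t, and this t gives it the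
        value -1.\<close>
      then have "1\<^sup>2 * Q + 2 * 1 * (- (Q + 1) / (2 * g)) * g + (- (Q + 1) / (2 * g))\<^sup>2 * A a a = - 1"
        using True by (simp add: field_simps)
      then show False using q[of 1 "- (Q + 1) / (2 * g)"] by linarith
    qed
    then show ?thesis using True by simp
  next
    case False
    then have A: "A a a > 0" using A0 by simp
    \<comment> \<open>The minimiser t/s = -g / A a a, cleared of its denominator.\<close>
    have "(A a a)\<^sup>2 * Q + 2 * A a a * (- g) * g + (- g)\<^sup>2 * A a a \<ge> 0" using q[of "A a a" "- g"] by simp
    then have "A a a * (A a a * Q - g\<^sup>2) \<ge> 0" by (simp add: power2_eq_square algebra_simps)
    then show ?thesis using A by (simp add: zero_le_mult_iff)
  qed
  then show ?thesis unfolding g_def Q_def .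
qed

text \<open>Each coordinate of c = G (A c) is a fixed combination of the entries of A c, whose
  squares are at most A s s times the form by \<open>psd_cauchy_schwarz\<close>. This gives a lower
  bound without eigenvalues of A.\<close>

lemma psd_invertible_coercive:
  fixes A G :: "'a \<Rightarrow> 'a \<Rightarrow> real"
  assumes I: "finite I" and sym: "\<And>a b. a \<in> I \<Longrightarrow> b \<in> I \<Longrightarrow> A a b = A b a"
    and psd: "\<And>c. (\<Sum>a\<in>I. \<Sum>b\<in>I. c a * A a b * c b) \<ge> 0"
    and inv: "\<And>a b. a \<in> I \<Longrightarrow> b \<in> I \<Longrightarrow> (\<Sum>s\<in>I. G a s * A s b) = (if a = b then 1 else 0)"
  shows "\<exists>\<gamma>>0. \<forall>c. \<gamma> * (\<Sum>a\<in>I. (c a)\<^sup>2) \<le> (\<Sum>a\<in>I. \<Sum>b\<in>I. c a * A a b * c b)"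
proof -
  \<comment> \<open>The summand 1 keeps K positive also for empty I.\<close>
  define K where "K = (\<Sum>a\<in>I. (\<Sum>s\<in>I. (G a s)\<^sup>2) * (\<Sum>s\<in>I. A s s)) + 1"
  have Ass: "A s s \<ge> 0" if "s \<in> I" for s
    using psd_cauchy_schwarz[OF I sym psd that, of "\<lambda>b. if b = s then 1 else 0"] I that psd[of "\<lambda>b. if b = s then 1 else 0"]
    by (simp add: if_distrib[of "\<lambda>r. r * _"] if_distrib[of "\<lambda>r. _ * r"] cong: if_cong)
  have K: "K > 0" unfolding K_def using Ass by (intro add_nonneg_pos sum_nonneg mult_nonneg_nonneg) auto
  have "(\<Sum>a\<in>I. (c a)\<^sup>2) \<le> K * (\<Sum>a\<in>I. \<Sum>b\<in>I. c a * A a b * c b)" for c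
  proof -
    let ?Q = "\<Sum>a\<in>I. \<Sum>b\<in>I. c a * A a b * c b"
    have "(c a)\<^sup>2 \<le> (\<Sum>s\<in>I. (G a s)\<^sup>2) * (\<Sum>s\<in>I. A s s) * ?Q" if a: "a \<in> I" for a
    proof -
      have "(\<Sum>s\<in>I. G a s * (\<Sum>b\<in>I. A s b * c b)) = (\<Sum>b\<in>I. (\<Sum>s\<in>I. G a s * A s b) * c b)"
        unfolding sum_distrib_left sum_distrib_right by (subst sum.swap) (simp add: mult.assoc)
      also have "\<dots> = (\<Sum>b\<in>I. (if a = b then 1 else 0) * c b)" using inv a by (intro sum.cong) auto
      also have "\<dots> = c a" using I a by (simp add: if_distrib[of "\<lambda>r. r * _"] cong: if_cong)
      finally have "(c a)\<^sup>2 = (\<Sum>s\<in>I. G a s * (\<Sum>b\<in>I. A s b * c b))\<^sup>2" by simp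
      also have "\<dots> \<le> (\<Sum>s\<in>I. (G a s)\<^sup>2) * (\<Sum>s\<in>I. (\<Sum>b\<in>I. A s b * c b)\<^sup>2)"
        by (rule Cauchy_Schwarz_ineq_sum)
      also have "\<dots> \<le> (\<Sum>s\<in>I. (G a s)\<^sup>2) * (\<Sum>s\<in>I. A s s * ?Q)"
        by (intro mult_left_mono sum_mono psd_cauchy_schwarz[OF I sym psd] sum_nonneg) auto
      finally show ?thesis by (simp add: sum_distrib_right mult.assoc)
    qed
    then have "(\<Sum>a\<in>I. (c a)\<^sup>2) \<le> (\<Sum>a\<in>I. (\<Sum>s\<in>I. (G a s)\<^sup>2) * (\<Sum>s\<in>I. A s s) * ?Q)" by (rule sum_mono)
    also have "\<dots> = (\<Sum>a\<in>I. (\<Sum>s\<in>I. (G a s)\<^sup>2) * (\<Sum>s\<in>I. A s s)) * ?Q" by (rule sum_distrib_right[symmetric])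
    also have "\<dots> \<le> K * ?Q" unfolding K_def using psd[of c] by (intro mult_right_mono) simp_all
    finally show ?thesis .
  qed
  then show ?thesis using K by (intro exI[of _ "1 / K"]) (simp add: field_simps)
qed

section \<open>The flat limit of a spectrum in abstract form\<close>

definition ip :: "nat \<Rightarrow> (nat \<Rightarrow> real) \<Rightarrow> (nat \<Rightarrow> real) \<Rightarrow> real" where
  "ip n v w = (\<Sum>i<n. v i * w i)"

definition bform :: "nat \<Rightarrow> (nat \<Rightarrow> nat \<Rightarrow> real) \<Rightarrow> (nat \<Rightarrow> real) \<Rightarrow> (nat \<Rightarrow> real) \<Rightarrow> real" where
  "bform n A v w = (\<Sum>i<n. \<Sum>l<n. v i * A i l * w l)"

lemma ip_commute: "ip n v w = ip n w v"
  unfolding ip_def by (simp add: mult.commute)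

lemma ip_sum_right: "ip n v (\<lambda>l. \<Sum>t\<in>T. f t * g t l) = (\<Sum>t\<in>T. f t * ip n v (g t))"
  unfolding ip_def sum_distrib_left by (subst sum.swap) (simp add: mult_ac)

lemma ip_diff_right: "ip n v (\<lambda>l. f l - g l) = ip n v f - ip n v g"
  unfolding ip_def by (simp add: sum_subtractf algebra_simps)

lemma bform_cong: "(\<And>l. l < n \<Longrightarrow> v l = v' l) \<Longrightarrow> (\<And>l. l < n \<Longrightarrow> w l = w' l) \<Longrightarrow> bform n A v w = bform n A v' w'"
  unfolding bform_def by (intro sum.cong) auto

lemma bform_sum_left: "bform n A (\<lambda>l. \<Sum>t\<in>T. f t * g t l) w = (\<Sum>t\<in>T. f t * bform n A (g t) w)"
proof -
  have "bform n A (\<lambda>l. \<Sum>t\<in>T. f t * g t l) w = (\<Sum>i<n. \<Sum>l<n. \<Sum>t\<in>T. f t * (g t i * A i l * w l))"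
    unfolding bform_def by (simp add: sum_distrib_right mult.assoc)
  also have "\<dots> = (\<Sum>i<n. \<Sum>t\<in>T. \<Sum>l<n. f t * (g t i * A i l * w l))"
    by (intro sum.cong refl sum.swap)
  also have "\<dots> = (\<Sum>t\<in>T. \<Sum>i<n. \<Sum>l<n. f t * (g t i * A i l * w l))"
    by (rule sum.swap)
  finally show ?thesis unfolding bform_def sum_distrib_left .
qed

lemma bform_sum_right: "bform n A v (\<lambda>l. \<Sum>t\<in>T. f t * g t l) = (\<Sum>t\<in>T. f t * bform n A v (g t))"
proof -
  have "bform n A v (\<lambda>l. \<Sum>t\<in>T. f t * g t l) = (\<Sum>i<n. \<Sum>l<n. \<Sum>t\<in>T. f t * (v i * A i l * g t l))"
    unfolding bform_def by (simp add: sum_distrib_left mult_ac)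
  also have "\<dots> = (\<Sum>i<n. \<Sum>t\<in>T. \<Sum>l<n. f t * (v i * A i l * g t l))"
    by (intro sum.cong refl sum.swap)
  also have "\<dots> = (\<Sum>t\<in>T. \<Sum>i<n. \<Sum>l<n. f t * (v i * A i l * g t l))"
    by (rule sum.swap)
  finally show ?thesis unfolding bform_def sum_distrib_left .
qed

lemma bform_expand:
  "bform n A (\<lambda>l. \<Sum>t\<in>T. f t * g t l) (\<lambda>l. \<Sum>t\<in>T'. h t * g t l)
    = (\<Sum>t\<in>T. \<Sum>t'\<in>T'. f t * h t' * bform n A (g t) (g t'))"
  unfolding bform_sum_left bform_sum_right by (simp add: sum_distrib_left mult.assoc)

text \<open>
  \<open>K(\<epsilon>)\<close> is given by its eigenvalues \<open>lam k\<close>, of order \<open>a k\<close>, and eigenvectors \<open>u k\<close>. The vectors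
  \<open>g t\<close>, \<open>t \<in> T\<close>, span the space, \<open>p t\<close> being the coordinate functionals; the Gram matrix of the
  vectors \<open>\<epsilon>\<^sup>-\<^sup>d\<^sup>t g t\<close> with respect to \<open>K(\<epsilon>)\<close> tends to \<open>M0\<close>. The indices in \<open>S\<close> are those with
  \<open>d t < j\<close>.
\<close>

locale flat_spectrum =
  fixes n j :: nat and \<kappa> :: "real \<Rightarrow> nat \<Rightarrow> nat \<Rightarrow> real"
    and lam :: "nat \<Rightarrow> real \<Rightarrow> real" and u :: "nat \<Rightarrow> real \<Rightarrow> nat \<Rightarrow> real" and u0 :: "nat \<Rightarrow> nat \<Rightarrow> real"
    and a :: "nat \<Rightarrow> nat" and c :: "nat \<Rightarrow> real"
    and S T :: "'t set" and g p :: "'t \<Rightarrow> nat \<Rightarrow> real" and d :: "'t \<Rightarrow> nat"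
    and M0 G :: "'t \<Rightarrow> 't \<Rightarrow> real"
  assumes T: "finite T" "S \<subseteq> T"
    and dS: "\<And>s. s \<in> S \<Longrightarrow> d s < j" and dU: "\<And>t. t \<in> T - S \<Longrightarrow> d t = j"
    and pS: "\<And>s. s \<in> S \<Longrightarrow> p s = g s"
    and coord: "\<And>w l. l < n \<Longrightarrow> w l = (\<Sum>t\<in>T. ip n (p t) w * g t l)"
    and orthU: "\<And>s t. s \<in> S \<Longrightarrow> t \<in> T - S \<Longrightarrow> ip n (g s) (g t) = 0"
    and spectral: "eventually (\<lambda>\<epsilon>. \<forall>v w. bform n (\<kappa> \<epsilon>) v w = (\<Sum>k<n. lam k \<epsilon> * ip n (u k \<epsilon>) v * ip n (u k \<epsilon>) w)) (at_right 0)"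
    and uorth: "eventually (\<lambda>\<epsilon>. \<forall>k<n. \<forall>l<n. ip n (u k \<epsilon>) (u l \<epsilon>) = (if k = l then 1 else 0)) (at_right 0)"
    and u0orth: "\<And>k l. k < n \<Longrightarrow> l < n \<Longrightarrow> ip n (u0 k) (u0 l) = (if k = l then 1 else 0)"
    and pos: "eventually (\<lambda>\<epsilon>. \<forall>k<n. lam k \<epsilon> > 0) (at_right 0)"
    and lead: "\<And>k. k < n \<Longrightarrow> ((\<lambda>\<epsilon>. lam k \<epsilon> / \<epsilon> ^ a k) \<longlongrightarrow> c k) (at_right 0)" "\<And>k. k < n \<Longrightarrow> c k \<noteq> 0"
    and ulim: "\<And>k i. k < n \<Longrightarrow> i < n \<Longrightarrow> ((\<lambda>\<epsilon>. u k \<epsilon> i) \<longlongrightarrow> u0 k i) (at_right 0)"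
    and M0: "\<And>t t'. t \<in> T \<Longrightarrow> t' \<in> T \<Longrightarrow> ((\<lambda>\<epsilon>. bform n (\<kappa> \<epsilon>) (g t) (g t') / \<epsilon> ^ (d t + d t')) \<longlongrightarrow> M0 t t') (at_right 0)"
    and inv: "\<And>s t. s \<in> S \<Longrightarrow> t \<in> S \<Longrightarrow> (\<Sum>r\<in>S. G s r * M0 r t) = (if s = t then 1 else 0)"
      "\<And>s t. s \<in> S \<Longrightarrow> t \<in> S \<Longrightarrow> (\<Sum>r\<in>S. M0 s r * G r t) = (if s = t then 1 else 0)"
begin

definition scaled_gram :: "real \<Rightarrow> 't \<Rightarrow> 't \<Rightarrow> real" where
  "scaled_gram \<epsilon> t t' = bform n (\<kappa> \<epsilon>) (g t) (g t') / \<epsilon> ^ (d t + d t')"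

definition quad_form :: "('t \<Rightarrow> 't \<Rightarrow> real) \<Rightarrow> ('t \<Rightarrow> real) \<Rightarrow> real" where
  "quad_form M \<zeta> = (\<Sum>t\<in>T. \<Sum>t'\<in>T. \<zeta> t * M t t' * \<zeta> t')"

text \<open>The quadratic form of the coefficient of \<epsilon>^(2 j) in the asymptotic spectral
  equivalent.\<close>

definition leading_quad :: "(nat \<Rightarrow> real) \<Rightarrow> real" where
  "leading_quad w = (\<Sum>k<n. (if a k = 2 * j then c k else 0) * (ip n (u0 k) w)\<^sup>2)"

text \<open>The coordinates in S that minimise the limit form \<open>M0\<close> when those outside S
  are prescribed by \<zeta>.\<close>

definition schur_extension :: "('t \<Rightarrow> real) \<Rightarrow> 't \<Rightarrow> real" where
  "schur_extension \<zeta> t = (if t \<in> S then - (\<Sum>s\<in>S. G t s * (\<Sum>t'\<in>T - S. M0 s t' * \<zeta> t')) else \<zeta> t)"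

definition schur_quad :: "('t \<Rightarrow> real) \<Rightarrow> real" where
  "schur_quad \<zeta> = (\<Sum>t\<in>T - S. \<Sum>t'\<in>T - S. \<zeta> t * M0 t t' * \<zeta> t')
      - (\<Sum>t\<in>T - S. \<Sum>s\<in>S. \<Sum>s'\<in>S. \<Sum>t'\<in>T - S. \<zeta> t * M0 t s * G s s' * M0 s' t' * \<zeta> t')"

lemma finS: "finite S" using T finite_subset by blast

lemma scaled_gram_lim: "t \<in> T \<Longrightarrow> t' \<in> T \<Longrightarrow> ((\<lambda>\<epsilon>. scaled_gram \<epsilon> t t') \<longlongrightarrow> M0 t t') (at_right 0)"
  unfolding scaled_gram_def by (rule M0)

lemma ev_pos: "eventually (\<lambda>\<epsilon>::real. 0 < \<epsilon>) (at_right 0)"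
  by (rule eventually_at_right_less)

lemma quad_form_lim:
  assumes "\<And>t. t \<in> T \<Longrightarrow> ((\<lambda>\<epsilon>. \<zeta> \<epsilon> t) \<longlongrightarrow> \<zeta>0 t) (at_right 0)"
  shows "((\<lambda>\<epsilon>. quad_form (scaled_gram \<epsilon>) (\<zeta> \<epsilon>)) \<longlongrightarrow> quad_form M0 \<zeta>0) (at_right 0)"
  unfolding quad_form_def by (intro tendsto_sum tendsto_mult scaled_gram_lim assms)

lemma bform_sym: "eventually (\<lambda>\<epsilon>. \<forall>v w. bform n (\<kappa> \<epsilon>) v w = bform n (\<kappa> \<epsilon>) w v) (at_right 0)"
  using spectral
proof eventually_elim
  case (elim \<epsilon>)
  show ?case
  proof (intro allI)
    fix v w
    have "bform n (\<kappa> \<epsilon>) v w = (\<Sum>k<n. lam k \<epsilon> * ip n (u k \<epsilon>) v * ip n (u k \<epsilon>) w)" using elim by blast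
    also have "\<dots> = (\<Sum>k<n. lam k \<epsilon> * ip n (u k \<epsilon>) w * ip n (u k \<epsilon>) v)"
      by (intro sum.cong refl) (simp only: mult_ac)
    also have "\<dots> = bform n (\<kappa> \<epsilon>) w v" by (rule sym) (use elim in blast)
    finally show "bform n (\<kappa> \<epsilon>) v w = bform n (\<kappa> \<epsilon>) w v" .
  qed
qed

lemma scaled_gram_sym: "eventually (\<lambda>\<epsilon>. \<forall>t t'. scaled_gram \<epsilon> t t' = scaled_gram \<epsilon> t' t) (at_right 0)"
  using bform_sym
proof eventually_elim
  case (elim \<epsilon>)
  show ?case
  proof (intro allI)
    fix t t'
    have "bform n (\<kappa> \<epsilon>) (g t) (g t') = bform n (\<kappa> \<epsilon>) (g t') (g t)" using elim by blast
    then show "scaled_gram \<epsilon> t t' = scaled_gram \<epsilon> t' t" unfolding scaled_gram_def by (simp only: add.commute)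
  qed
qed

lemma M0_sym: assumes t: "t \<in> T" "t' \<in> T" shows "M0 t t' = M0 t' t"
proof (rule tendsto_unique[OF trivial_limit_at_right_real scaled_gram_lim[OF t]])
  have "eventually (\<lambda>\<epsilon>. scaled_gram \<epsilon> t' t = scaled_gram \<epsilon> t t') (at_right 0)"
    using scaled_gram_sym by eventually_elim blast
  then show "((\<lambda>\<epsilon>. scaled_gram \<epsilon> t t') \<longlongrightarrow> M0 t' t) (at_right 0)"
    by (rule Lim_transform_eventually[OF scaled_gram_lim[OF t(2,1)]])
qed

text \<open>The common factor \<epsilon>^j is absorbed by the vectors, whose coefficients
  \<epsilon>^(j - d t) then stay bounded as \<epsilon> tends to 0.\<close>

lemma quad_form_bform:
  assumes "\<epsilon> > 0"
  shows "quad_form (scaled_gram \<epsilon>) \<zeta> = bform n (\<kappa> \<epsilon>) (\<lambda>l. \<Sum>t\<in>T. (\<epsilon> ^ j / \<epsilon> ^ d t * \<zeta> t) * g t l) (\<lambda>l. \<Sum>t\<in>T. (\<epsilon> ^ j / \<epsilon> ^ d t * \<zeta> t) * g t l) / \<epsilon> ^ (2 * j)"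
proof -
  have "\<zeta> t * scaled_gram \<epsilon> t t' * \<zeta> t' = (\<epsilon> ^ j / \<epsilon> ^ d t * \<zeta> t) * (\<epsilon> ^ j / \<epsilon> ^ d t' * \<zeta> t') * bform n (\<kappa> \<epsilon>) (g t) (g t') / \<epsilon> ^ (2 * j)" for t t'
  proof -
    have e: "\<epsilon> ^ (2 * j) = \<epsilon> ^ j * \<epsilon> ^ j" by (simp flip: power_add add: mult_2)
    show ?thesis unfolding scaled_gram_def e power_add using assms by (simp add: field_simps)
  qed
  then show ?thesis unfolding quad_form_def bform_expand by (simp add: sum_divide_distrib)
qed

lemma bform_spectral_scaled:
  "eventually (\<lambda>\<epsilon>. \<forall>v. bform n (\<kappa> \<epsilon>) v v / \<epsilon> ^ (2 * j) = (\<Sum>k<n. lam k \<epsilon> / \<epsilon> ^ (2 * j) * (ip n (u k \<epsilon>) v)\<^sup>2)) (at_right 0)"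
  using spectral
proof eventually_elim
  case (elim \<epsilon>)
  show ?case
  proof
    fix v
    have "bform n (\<kappa> \<epsilon>) v v = (\<Sum>k<n. lam k \<epsilon> * ip n (u k \<epsilon>) v * ip n (u k \<epsilon>) v)" using elim by blast
    then show "bform n (\<kappa> \<epsilon>) v v / \<epsilon> ^ (2 * j) = (\<Sum>k<n. lam k \<epsilon> / \<epsilon> ^ (2 * j) * (ip n (u k \<epsilon>) v)\<^sup>2)"
      by (simp add: sum_divide_distrib power2_eq_square mult.assoc)
  qed
qed

lemma lam_scaled:
  assumes k: "k < n" "2 * j \<le> a k"
  shows "((\<lambda>\<epsilon>. lam k \<epsilon> / \<epsilon> ^ (2 * j)) \<longlongrightarrow> (if a k = 2 * j then c k else 0)) (at_right 0)"
proof -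
  have "((\<lambda>\<epsilon>::real. \<epsilon> ^ (a k - 2 * j)) \<longlongrightarrow> 0 ^ (a k - 2 * j)) (at_right 0)"
    by (intro tendsto_intros)
  then have "((\<lambda>\<epsilon>. lam k \<epsilon> / \<epsilon> ^ a k * \<epsilon> ^ (a k - 2 * j)) \<longlongrightarrow> c k * 0 ^ (a k - 2 * j)) (at_right 0)"
    by (intro tendsto_mult lead(1) k)
  moreover have "eventually (\<lambda>\<epsilon>. lam k \<epsilon> / \<epsilon> ^ a k * \<epsilon> ^ (a k - 2 * j) = lam k \<epsilon> / \<epsilon> ^ (2 * j)) (at_right 0)"
    using ev_pos
  proof eventually_elim
    case (elim \<epsilon>)
    have "\<epsilon> ^ a k = \<epsilon> ^ (2 * j) * \<epsilon> ^ (a k - 2 * j)" using k by (simp flip: power_add)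
    then show ?case using elim by (simp add: field_simps)
  qed
  ultimately have "((\<lambda>\<epsilon>. lam k \<epsilon> / \<epsilon> ^ (2 * j)) \<longlongrightarrow> c k * 0 ^ (a k - 2 * j)) (at_right 0)"
    by (rule Lim_transform_eventually)
  moreover have "c k * 0 ^ (a k - 2 * j) = (if a k = 2 * j then c k else 0)"
    using k by (cases "a k = 2 * j") (auto simp: power_0_left)
  ultimately show ?thesis by simp
qed

lemma ip_lim:
  assumes "k < n" "\<And>l. l < n \<Longrightarrow> ((\<lambda>\<epsilon>. w \<epsilon> l) \<longlongrightarrow> w0 l) (at_right 0)"
  shows "((\<lambda>\<epsilon>. ip n (u k \<epsilon>) (w \<epsilon>)) \<longlongrightarrow> ip n (u0 k) w0) (at_right 0)"
  unfolding ip_def by (intro tendsto_sum tendsto_mult ulim assms) auto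

text \<open>The upper half of the sandwich. The test vector Y carries arbitrary coordinates on S
  with weights \<epsilon>^(j - d t), which vanish in the limit because d t < j, so Y tends to w
  while the form tends to that of \<open>M0\<close>. Dropping the eigenvalues of order below 2 j
  gives the first claim. Each of those alone contributes at most the bounded total, although it
  dominates \<epsilon>^(2 j); so its limiting eigenvector is orthogonal to w.\<close>

lemma leading_quad_le:
  assumes w: "\<And>l. l < n \<Longrightarrow> w l = (\<Sum>t\<in>T - S. \<zeta> t * g t l)"
    and \<zeta>': "\<And>t. t \<in> T - S \<Longrightarrow> \<zeta>' t = \<zeta> t"
  shows "leading_quad w \<le> quad_form M0 \<zeta>'" "\<And>k. k < n \<Longrightarrow> a k < 2 * j \<Longrightarrow> ip n (u0 k) w = 0"
proof -
  define Y where "Y \<epsilon> l = (\<Sum>t\<in>T. (\<epsilon> ^ j / \<epsilon> ^ d t * \<zeta>' t) * g t l)" for \<epsilon> :: real and l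
  define LT where "LT k = (if a k = 2 * j then c k else 0)" for k
  have sc: "((\<lambda>\<epsilon>::real. \<epsilon> ^ j / \<epsilon> ^ d t * \<zeta>' t) \<longlongrightarrow> (if t \<in> S then 0 else \<zeta>' t)) (at_right 0)" if t: "t \<in> T" for t
  proof (cases "t \<in> S")
    case True
    have "((\<lambda>\<epsilon>::real. \<epsilon> ^ (j - d t) * \<zeta>' t) \<longlongrightarrow> 0 ^ (j - d t) * \<zeta>' t) (at_right 0)" by (intro tendsto_intros)
    moreover have "0 ^ (j - d t) = (0::real)" using dS[OF True] by simp
    moreover have "eventually (\<lambda>\<epsilon>::real. \<epsilon> ^ (j - d t) * \<zeta>' t = \<epsilon> ^ j / \<epsilon> ^ d t * \<zeta>' t) (at_right 0)"
      using ev_pos by eventually_elim (use dS[OF True] in \<open>simp add: power_diff\<close>)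
    ultimately have "((\<lambda>\<epsilon>::real. \<epsilon> ^ j / \<epsilon> ^ d t * \<zeta>' t) \<longlongrightarrow> 0 * \<zeta>' t) (at_right 0)"
      by (simp only: Lim_transform_eventually)
    then show ?thesis using True by simp
  next
    case False
    have "eventually (\<lambda>\<epsilon>::real. \<zeta>' t = \<epsilon> ^ j / \<epsilon> ^ d t * \<zeta>' t) (at_right 0)"
      using ev_pos by eventually_elim (use dU[of t] t False in simp)
    then show ?thesis using False by (simp add: Lim_transform_eventually[OF tendsto_const])
  qed
  have Ylim: "((\<lambda>\<epsilon>. Y \<epsilon> l) \<longlongrightarrow> w l) (at_right 0)" if "l < n" for l
  proof -
    have "((\<lambda>\<epsilon>. Y \<epsilon> l) \<longlongrightarrow> (\<Sum>t\<in>T. (if t \<in> S then 0 else \<zeta>' t) * g t l)) (at_right 0)"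
      unfolding Y_def by (intro tendsto_sum tendsto_mult tendsto_const sc)
    also have "(\<Sum>t\<in>T. (if t \<in> S then 0 else \<zeta>' t) * g t l) = (\<Sum>t\<in>T - S. (if t \<in> S then 0 else \<zeta>' t) * g t l)"
      by (rule sum.mono_neutral_right) (use T in auto)
    also have "\<dots> = w l" unfolding w[OF that] by (intro sum.cong) (auto simp: \<zeta>')
    finally show ?thesis .
  qed
  have uY: "((\<lambda>\<epsilon>. ip n (u k \<epsilon>) (Y \<epsilon>)) \<longlongrightarrow> ip n (u0 k) w) (at_right 0)" if "k < n" for k
    by (rule ip_lim[OF that Ylim])
  have Q: "((\<lambda>\<epsilon>. quad_form (scaled_gram \<epsilon>) \<zeta>') \<longlongrightarrow> quad_form M0 \<zeta>') (at_right 0)" by (intro quad_form_lim tendsto_const)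
  have Qs: "eventually (\<lambda>\<epsilon>. quad_form (scaled_gram \<epsilon>) \<zeta>' = (\<Sum>k<n. lam k \<epsilon> / \<epsilon> ^ (2 * j) * (ip n (u k \<epsilon>) (Y \<epsilon>))\<^sup>2)) (at_right 0)"
    using ev_pos bform_spectral_scaled
  proof eventually_elim
    case (elim \<epsilon>)
    then show ?case using quad_form_bform[OF elim(1), of \<zeta>'] unfolding Y_def[symmetric, abs_def] by simp
  qed
  have ge: "eventually (\<lambda>\<epsilon>. (\<Sum>k\<in>J. lam k \<epsilon> / \<epsilon> ^ (2 * j) * (ip n (u k \<epsilon>) (Y \<epsilon>))\<^sup>2) \<le> quad_form (scaled_gram \<epsilon>) \<zeta>') (at_right 0)"
    if "J \<subseteq> {..<n}" for J
    using Qs ev_pos pos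
  proof eventually_elim
    case (elim \<epsilon>)
    show ?case unfolding elim(1)
    proof (rule sum_mono2)
      show "0 \<le> lam k \<epsilon> / \<epsilon> ^ (2 * j) * (ip n (u k \<epsilon>) (Y \<epsilon>))\<^sup>2" if "k \<in> {..<n} - J" for k
        using elim(2,3) that by (intro mult_nonneg_nonneg divide_nonneg_nonneg) (auto simp: less_imp_le)
    qed (use that in auto)
  qed
  show "leading_quad w \<le> quad_form M0 \<zeta>'"
  proof (rule tendsto_le[OF trivial_limit_at_right_real Q _ ge[of "{k. k < n \<and> 2 * j \<le> a k}"]])
    have "((\<lambda>\<epsilon>. \<Sum>k\<in>{k. k < n \<and> 2 * j \<le> a k}. lam k \<epsilon> / \<epsilon> ^ (2 * j) * (ip n (u k \<epsilon>) (Y \<epsilon>))\<^sup>2) \<longlongrightarrow>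
        (\<Sum>k\<in>{k. k < n \<and> 2 * j \<le> a k}. LT k * (ip n (u0 k) w)\<^sup>2)) (at_right 0)"
      unfolding LT_def by (intro tendsto_sum tendsto_mult tendsto_power uY lam_scaled) auto
    also have "(\<Sum>k\<in>{k. k < n \<and> 2 * j \<le> a k}. LT k * (ip n (u0 k) w)\<^sup>2) = leading_quad w"
      unfolding leading_quad_def LT_def by (rule sum.mono_neutral_left) auto
    finally show "((\<lambda>\<epsilon>. \<Sum>k\<in>{k. k < n \<and> 2 * j \<le> a k}. lam k \<epsilon> / \<epsilon> ^ (2 * j) * (ip n (u k \<epsilon>) (Y \<epsilon>))\<^sup>2) \<longlongrightarrow> leading_quad w) (at_right 0)" .
  qed auto
  show "ip n (u0 k) w = 0" if k: "k < n" "a k < 2 * j" for k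
  proof -
    have l1: "((\<lambda>\<epsilon>. lam k \<epsilon> / \<epsilon> ^ a k * (ip n (u k \<epsilon>) (Y \<epsilon>))\<^sup>2) \<longlongrightarrow> c k * (ip n (u0 k) w)\<^sup>2) (at_right 0)"
      by (intro tendsto_mult tendsto_power uY lead k)
    have "((\<lambda>\<epsilon>. \<epsilon> ^ (2 * j - a k) * quad_form (scaled_gram \<epsilon>) \<zeta>') \<longlongrightarrow> 0 ^ (2 * j - a k) * quad_form M0 \<zeta>') (at_right 0)"
      by (intro tendsto_mult Q tendsto_power tendsto_ident_at)
    then have l2: "((\<lambda>\<epsilon>. \<epsilon> ^ (2 * j - a k) * quad_form (scaled_gram \<epsilon>) \<zeta>') \<longlongrightarrow> 0) (at_right 0)"
      using k by (simp add: power_0_left)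
    have "eventually (\<lambda>\<epsilon>. lam k \<epsilon> / \<epsilon> ^ a k * (ip n (u k \<epsilon>) (Y \<epsilon>))\<^sup>2 \<le> \<epsilon> ^ (2 * j - a k) * quad_form (scaled_gram \<epsilon>) \<zeta>') (at_right 0)"
      using ge[of "{k}", simplified, OF k(1)] ev_pos
    proof eventually_elim
      case (elim \<epsilon>)
      have e: "\<epsilon> ^ (2 * j) = \<epsilon> ^ a k * \<epsilon> ^ (2 * j - a k)" using k by (simp flip: power_add)
      have "\<epsilon> ^ (2 * j - a k) * (lam k \<epsilon> / \<epsilon> ^ (2 * j) * (ip n (u k \<epsilon>) (Y \<epsilon>))\<^sup>2) \<le> \<epsilon> ^ (2 * j - a k) * quad_form (scaled_gram \<epsilon>) \<zeta>'"
        using elim by (intro mult_left_mono) auto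
      also have "\<epsilon> ^ (2 * j - a k) * (lam k \<epsilon> / \<epsilon> ^ (2 * j) * (ip n (u k \<epsilon>) (Y \<epsilon>))\<^sup>2) = lam k \<epsilon> / \<epsilon> ^ a k * (ip n (u k \<epsilon>) (Y \<epsilon>))\<^sup>2"
        unfolding e using elim(2) by (simp add: field_simps)
      finally show ?case .
    qed
    then have le: "c k * (ip n (u0 k) w)\<^sup>2 \<le> 0" by (rule tendsto_le[OF trivial_limit_at_right_real l2 l1])
    have "c k \<ge> 0"
    proof (rule tendsto_lowerbound[OF lead(1)[OF k(1)] _ trivial_limit_at_right_real])
      show "eventually (\<lambda>\<epsilon>. 0 \<le> lam k \<epsilon> / \<epsilon> ^ a k) (at_right 0)"
        using pos ev_pos by eventually_elim (use k in \<open>auto intro!: divide_nonneg_nonneg less_imp_le\<close>)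
    qed
    then have "c k > 0" using lead(2)[OF k(1)] by simp
    with le show ?thesis by (simp add: mult_le_0_iff)
  qed
qed

lemma M0_psd: "quad_form M0 \<zeta> \<ge> 0"
proof (rule tendsto_lowerbound[OF quad_form_lim[of "\<lambda>_. \<zeta>"] _ trivial_limit_at_right_real])
  show "eventually (\<lambda>\<epsilon>. 0 \<le> quad_form (scaled_gram \<epsilon>) \<zeta>) (at_right 0)"
    using ev_pos bform_spectral_scaled pos
  proof eventually_elim
    case (elim \<epsilon>)
    have "0 \<le> (\<Sum>k<n. lam k \<epsilon> / \<epsilon> ^ (2 * j) * (ip n (u k \<epsilon>) v)\<^sup>2)" for v
      using elim by (intro sum_nonneg mult_nonneg_nonneg divide_nonneg_nonneg) (auto simp: less_imp_le)
    then show ?case unfolding quad_form_bform[OF elim(1)] using elim(2) by simp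
  qed
qed (rule tendsto_const)

lemma quad_form_S:
  assumes "\<And>t. t \<in> T - S \<Longrightarrow> \<zeta> t = 0"
  shows "quad_form M \<zeta> = (\<Sum>s\<in>S. \<Sum>s'\<in>S. \<zeta> s * M s s' * \<zeta> s')"
proof -
  have "quad_form M \<zeta> = (\<Sum>s\<in>S. \<Sum>t'\<in>T. \<zeta> s * M s t' * \<zeta> t')"
    unfolding quad_form_def by (rule sum.mono_neutral_right) (use T assms in auto)
  also have "\<dots> = (\<Sum>s\<in>S. \<Sum>s'\<in>S. \<zeta> s * M s s' * \<zeta> s')"
    by (intro sum.cong refl sum.mono_neutral_right) (use T assms in auto)
  finally show ?thesis .
qed

text \<open>Coercivity of the limit block survives small perturbations of its entries, at the price
  of half the constant.\<close>

lemma coercive: "\<exists>\<gamma>>0. eventually (\<lambda>\<epsilon>. \<forall>r. \<gamma> * (\<Sum>s\<in>S. (r s)\<^sup>2) \<le> (\<Sum>s\<in>S. \<Sum>s'\<in>S. r s * scaled_gram \<epsilon> s s' * r s')) (at_right 0)"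
proof -
  have psd: "(\<Sum>s\<in>S. \<Sum>s'\<in>S. r s * M0 s s' * r s') \<ge> 0" for r
  proof -
    have "(\<Sum>s\<in>S. \<Sum>s'\<in>S. r s * M0 s s' * r s') = quad_form M0 (\<lambda>t. if t \<in> S then r t else 0)"
      by (subst quad_form_S) auto
    then show ?thesis using M0_psd by simp
  qed
  have "\<exists>\<gamma>>0. \<forall>r. \<gamma> * (\<Sum>s\<in>S. (r s)\<^sup>2) \<le> (\<Sum>s\<in>S. \<Sum>s'\<in>S. r s * M0 s s' * r s')"
    by (rule psd_invertible_coercive[OF finS _ psd inv(1)]) (use M0_sym T in auto)
  then obtain \<gamma> where \<gamma>: "\<gamma> > 0" "\<And>r. \<gamma> * (\<Sum>s\<in>S. (r s)\<^sup>2) \<le> (\<Sum>s\<in>S. \<Sum>s'\<in>S. r s * M0 s s' * r s')" by blast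
  have "((\<lambda>\<epsilon>. \<Sum>s\<in>S. \<Sum>s'\<in>S. \<bar>scaled_gram \<epsilon> s s' - M0 s s'\<bar>) \<longlongrightarrow> (\<Sum>s\<in>S. \<Sum>s'\<in>S. \<bar>M0 s s' - M0 s s'\<bar>)) (at_right 0)"
    by (intro tendsto_sum tendsto_rabs tendsto_diff scaled_gram_lim tendsto_const) (use T in auto)
  then have "((\<lambda>\<epsilon>. \<Sum>s\<in>S. \<Sum>s'\<in>S. \<bar>scaled_gram \<epsilon> s s' - M0 s s'\<bar>) \<longlongrightarrow> 0) (at_right 0)" by simp
  then have "eventually (\<lambda>\<epsilon>. (\<Sum>s\<in>S. \<Sum>s'\<in>S. \<bar>scaled_gram \<epsilon> s s' - M0 s s'\<bar>) < \<gamma> / 2) (at_right 0)"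
    by (rule order_tendstoD(2)) (use \<gamma> in simp)
  then have "eventually (\<lambda>\<epsilon>. \<forall>r. \<gamma> / 2 * (\<Sum>s\<in>S. (r s)\<^sup>2) \<le> (\<Sum>s\<in>S. \<Sum>s'\<in>S. r s * scaled_gram \<epsilon> s s' * r s')) (at_right 0)"
  proof eventually_elim
    case (elim \<epsilon>)
    show ?case
    proof
      fix r :: "'t \<Rightarrow> real"
      define R where "R = (\<Sum>s\<in>S. (r s)\<^sup>2)"
      have R: "(r s)\<^sup>2 \<le> R" if "s \<in> S" for s
        unfolding R_def using member_le_sum[of s S "\<lambda>s. (r s)\<^sup>2"] that finS by auto
      have rr: "\<bar>r s\<bar> * \<bar>r s'\<bar> \<le> R" if "s \<in> S" "s' \<in> S" for s s'
      proof -
        have "2 * (\<bar>r s\<bar> * \<bar>r s'\<bar>) \<le> (r s)\<^sup>2 + (r s')\<^sup>2"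
          using sum_squares_bound[of "\<bar>r s\<bar>" "\<bar>r s'\<bar>"] by (simp add: mult.assoc)
        then show ?thesis using R[OF that(1)] R[OF that(2)] by linarith
      qed
      have R0: "R \<ge> 0" unfolding R_def by (simp add: sum_nonneg)
      have "\<gamma> * R \<le> (\<Sum>s\<in>S. \<Sum>s'\<in>S. r s * M0 s s' * r s')" using \<gamma>(2) unfolding R_def .
      also have "\<dots> = (\<Sum>s\<in>S. \<Sum>s'\<in>S. r s * scaled_gram \<epsilon> s s' * r s') + (\<Sum>s\<in>S. \<Sum>s'\<in>S. r s * r s' * (M0 s s' - scaled_gram \<epsilon> s s'))"
        by (simp add: sum.distrib[symmetric] algebra_simps)
      also have "(\<Sum>s\<in>S. \<Sum>s'\<in>S. r s * r s' * (M0 s s' - scaled_gram \<epsilon> s s')) \<le> (\<Sum>s\<in>S. \<Sum>s'\<in>S. R * \<bar>scaled_gram \<epsilon> s s' - M0 s s'\<bar>)"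
      proof (intro sum_mono)
        fix s s' assume s: "s \<in> S" "s' \<in> S"
        have "r s * r s' * (M0 s s' - scaled_gram \<epsilon> s s') \<le> \<bar>r s * r s' * (M0 s s' - scaled_gram \<epsilon> s s')\<bar>" by (rule abs_ge_self)
        also have "\<dots> = (\<bar>r s\<bar> * \<bar>r s'\<bar>) * \<bar>scaled_gram \<epsilon> s s' - M0 s s'\<bar>" by (simp add: abs_mult abs_minus_commute)
        also have "\<dots> \<le> R * \<bar>scaled_gram \<epsilon> s s' - M0 s s'\<bar>" by (intro mult_right_mono rr s) simp
        finally show "r s * r s' * (M0 s s' - scaled_gram \<epsilon> s s') \<le> R * \<bar>scaled_gram \<epsilon> s s' - M0 s s'\<bar>" .
      qed
      also have "(\<Sum>s\<in>S. \<Sum>s'\<in>S. R * \<bar>scaled_gram \<epsilon> s s' - M0 s s'\<bar>) = R * (\<Sum>s\<in>S. \<Sum>s'\<in>S. \<bar>scaled_gram \<epsilon> s s' - M0 s s'\<bar>)"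
        by (simp add: sum_distrib_left)
      also have "\<dots> \<le> R * (\<gamma> / 2)" using elim R0 by (intro mult_left_mono) auto
      finally show "\<gamma> / 2 * (\<Sum>s\<in>S. (r s)\<^sup>2) \<le> (\<Sum>s\<in>S. \<Sum>s'\<in>S. r s * scaled_gram \<epsilon> s s' * r s')"
        unfolding R_def[symmetric] by (simp add: mult.commute)
    qed
  qed
  then show ?thesis using \<gamma>(1) by (intro exI[of _ "\<gamma> / 2"]) simp
qed

lemma sum_split_S: "(\<Sum>t\<in>T. f t) = (\<Sum>t\<in>S. f t) + (\<Sum>t\<in>T - S. f t)" for f :: "'t \<Rightarrow> real"
  using sum.subset_diff[OF T(2,1), of f] by simp

text \<open>Stationarity of the minimiser: the gradient of the form in the S-coordinates is zero
  because G inverts the S-block of \<open>M0\<close>.\<close>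

lemma M0_schur_extension: assumes s: "s \<in> S" shows "(\<Sum>t\<in>T. M0 s t * schur_extension \<zeta> t) = 0"
proof -
  define b where "b s = (\<Sum>t\<in>T - S. M0 s t * \<zeta> t)" for s
  have "(\<Sum>t\<in>S. M0 s t * schur_extension \<zeta> t) = - (\<Sum>r\<in>S. M0 s r * (\<Sum>s'\<in>S. G r s' * b s'))"
    unfolding b_def by (simp add: schur_extension_def sum_negf)
  also have "(\<Sum>r\<in>S. M0 s r * (\<Sum>s'\<in>S. G r s' * b s')) = (\<Sum>s'\<in>S. (\<Sum>r\<in>S. M0 s r * G r s') * b s')"
    unfolding sum_distrib_left sum_distrib_right by (subst sum.swap) (simp add: mult.assoc)
  also have "\<dots> = (\<Sum>s'\<in>S. (if s = s' then 1 else 0) * b s')"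
    using inv(2)[OF s] by (intro sum.cong) auto
  also have "\<dots> = b s" using finS s by (simp add: if_distrib[of "\<lambda>r. r * _"] cong: if_cong)
  finally have "(\<Sum>t\<in>S. M0 s t * schur_extension \<zeta> t) = - b s" .
  moreover have "(\<Sum>t\<in>T - S. M0 s t * schur_extension \<zeta> t) = b s"
    unfolding b_def by (intro sum.cong) (auto simp: schur_extension_def)
  ultimately show ?thesis by (simp add: sum_split_S)
qed

lemma quad_form_add:
  assumes sym: "\<And>t t'. M t t' = M t' t" and r: "\<And>t. t \<in> T - S \<Longrightarrow> r t = 0"
  shows "quad_form M (\<lambda>t. x t + r t) = quad_form M x + 2 * (\<Sum>s\<in>S. r s * (\<Sum>t\<in>T. M s t * x t)) + (\<Sum>s\<in>S. \<Sum>s'\<in>S. r s * M s s' * r s')"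
proof -
  have rx: "(\<Sum>t\<in>T. \<Sum>t'\<in>T. r t * M t t' * x t') = (\<Sum>s\<in>S. r s * (\<Sum>t\<in>T. M s t * x t))"
    unfolding sum_distrib_left mult.assoc by (rule sum.mono_neutral_right) (use T r in auto)
  have "(\<Sum>t\<in>T. \<Sum>t'\<in>T. x t * M t t' * r t') = (\<Sum>t\<in>T. \<Sum>t'\<in>T. r t * M t t' * x t')"
    by (subst sum.swap) (intro sum.cong refl, simp add: sym mult_ac)
  then have xr: "(\<Sum>t\<in>T. \<Sum>t'\<in>T. x t * M t t' * r t') = (\<Sum>s\<in>S. r s * (\<Sum>t\<in>T. M s t * x t))"
    using rx by simp
  have "quad_form M (\<lambda>t. x t + r t) = quad_form M x + (\<Sum>t\<in>T. \<Sum>t'\<in>T. r t * M t t' * x t') + (\<Sum>t\<in>T. \<Sum>t'\<in>T. x t * M t t' * r t') + quad_form M r"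
    unfolding quad_form_def sum.distrib[symmetric] by (intro sum.cong refl) (simp add: algebra_simps)
  moreover have "quad_form M r = (\<Sum>s\<in>S. \<Sum>s'\<in>S. r s * M s s' * r s')" by (rule quad_form_S[OF r])
  ultimately show ?thesis unfolding rx xr by simp
qed

lemma schur_quad_eq: "schur_quad \<zeta> = quad_form M0 (schur_extension \<zeta>)"
proof -
  have "quad_form M0 (schur_extension \<zeta>) = (\<Sum>t\<in>T. schur_extension \<zeta> t * (\<Sum>t'\<in>T. M0 t t' * schur_extension \<zeta> t'))"
    unfolding quad_form_def by (simp add: sum_distrib_left mult.assoc)
  also have "\<dots> = (\<Sum>t\<in>T - S. schur_extension \<zeta> t * (\<Sum>t'\<in>T. M0 t t' * schur_extension \<zeta> t'))"
    unfolding sum_split_S by (simp add: M0_schur_extension[unfolded sum_split_S])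
  also have "\<dots> = (\<Sum>t\<in>T - S. \<zeta> t * ((\<Sum>s\<in>S. M0 t s * schur_extension \<zeta> s) + (\<Sum>t'\<in>T - S. M0 t t' * \<zeta> t')))"
    unfolding sum_split_S by (intro sum.cong refl arg_cong2[where f = "(*)"] arg_cong2[where f = "(+)"]) (auto simp: schur_extension_def)
  also have "\<dots> = (\<Sum>t\<in>T - S. \<Sum>t'\<in>T - S. \<zeta> t * M0 t t' * \<zeta> t') + (\<Sum>t\<in>T - S. \<Sum>s\<in>S. \<zeta> t * M0 t s * schur_extension \<zeta> s)"
    by (simp add: sum_distrib_left sum.distrib algebra_simps)
  also have "(\<Sum>t\<in>T - S. \<Sum>s\<in>S. \<zeta> t * M0 t s * schur_extension \<zeta> s)
      = - (\<Sum>t\<in>T - S. \<Sum>s\<in>S. \<Sum>s'\<in>S. \<Sum>t'\<in>T - S. \<zeta> t * M0 t s * G s s' * M0 s' t' * \<zeta> t')"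
    unfolding sum_negf[symmetric] by (intro sum.cong refl) (simp add: schur_extension_def sum_distrib_left sum_negf mult.assoc)
  finally show ?thesis unfolding schur_quad_def by simp
qed

text \<open>The lower half of the sandwich. Without its low components, w becomes a vector Y whose
  form involves only eigenvalues of order at least 2 j and tends to \<open>leading_quad w\<close>.
  The S-coordinates of Y are compared with the minimiser \<zeta>0: by coercivity the squared
  distance r is controlled by the excess of the form. Hence the excess is nonnegative in the limit,
  and r stays bounded.\<close>

lemma schur_quad_le:
  assumes w: "\<And>k. k < n \<Longrightarrow> a k < 2 * j \<Longrightarrow> ip n (u0 k) w = 0"
  shows "schur_quad (\<lambda>t. ip n (p t) w) \<le> leading_quad w" "\<And>s. s \<in> S \<Longrightarrow> ip n (p s) w = 0"
proof -
  define J where "J = {k. k < n \<and> 2 * j \<le> a k}"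
  define I where "I = {k. k < n \<and> a k < 2 * j}"
  \<comment> \<open>The projection uses the eigenvectors at \<epsilon>: with those at 0, an error in
    a low component might still be visible after division by \<epsilon>^(2 j).\<close>
  define Y where "Y \<epsilon> l = w l - (\<Sum>k\<in>I. ip n (u k \<epsilon>) w * u k \<epsilon> l)" for \<epsilon> l
  define \<zeta> where "\<zeta> \<epsilon> t = \<epsilon> ^ d t / \<epsilon> ^ j * ip n (p t) (Y \<epsilon>)" for \<epsilon> :: real and t
  \<comment> \<open>The true coordinates \<zeta> are divided by \<epsilon>^(j - d t) and are not
    known to converge on S. There \<zeta>1 takes the values of the minimiser instead; outside S the
    two agree.\<close>
  define \<zeta>0 where "\<zeta>0 = schur_extension (\<lambda>t. ip n (p t) w)"
  define \<zeta>1 where "\<zeta>1 \<epsilon> t = (if t \<in> S then \<zeta>0 t else \<zeta> \<epsilon> t)" for \<epsilon> t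
  define r where "r \<epsilon> t = \<zeta> \<epsilon> t - \<zeta>1 \<epsilon> t" for \<epsilon> t
  define \<delta> where "\<delta> \<epsilon> s = (\<Sum>t\<in>T. scaled_gram \<epsilon> s t * \<zeta>1 \<epsilon> t)" for \<epsilon> s
  have uw: "((\<lambda>\<epsilon>. ip n (u k \<epsilon>) w) \<longlongrightarrow> ip n (u0 k) w) (at_right 0)" if "k < n" for k
    by (rule ip_lim[OF that]) (rule tendsto_const)
  have Ylim: "((\<lambda>\<epsilon>. Y \<epsilon> l) \<longlongrightarrow> w l) (at_right 0)" if l: "l < n" for l
  proof -
    have "((\<lambda>\<epsilon>. Y \<epsilon> l) \<longlongrightarrow> w l - (\<Sum>k\<in>I. ip n (u0 k) w * u0 k l)) (at_right 0)"
      unfolding Y_def by (intro tendsto_diff tendsto_const tendsto_sum tendsto_mult uw ulim l) (auto simp: I_def)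
    also have "(\<Sum>k\<in>I. ip n (u0 k) w * u0 k l) = 0" using w by (intro sum.neutral) (auto simp: I_def)
    finally show ?thesis by simp
  qed
  have pY: "((\<lambda>\<epsilon>. ip n (p t) (Y \<epsilon>)) \<longlongrightarrow> ip n (p t) w) (at_right 0)" for t
    unfolding ip_def by (intro tendsto_sum tendsto_mult tendsto_const Ylim) auto
  have \<zeta>1lim: "((\<lambda>\<epsilon>. \<zeta>1 \<epsilon> t) \<longlongrightarrow> \<zeta>0 t) (at_right 0)" if t: "t \<in> T" for t
  proof (cases "t \<in> S")
    case False
    have "eventually (\<lambda>\<epsilon>. ip n (p t) (Y \<epsilon>) = \<zeta>1 \<epsilon> t) (at_right 0)"
      using ev_pos by eventually_elim (use False t dU[of t] in \<open>simp add: \<zeta>1_def \<zeta>_def\<close>)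
    then have "((\<lambda>\<epsilon>. \<zeta>1 \<epsilon> t) \<longlongrightarrow> ip n (p t) w) (at_right 0)" by (rule Lim_transform_eventually[OF pY])
    then show ?thesis using False by (simp add: \<zeta>0_def schur_extension_def)
  qed (simp add: \<zeta>1_def)
  have \<delta>lim: "((\<lambda>\<epsilon>. \<delta> \<epsilon> s) \<longlongrightarrow> 0) (at_right 0)" if s: "s \<in> S" for s
  proof -
    have "((\<lambda>\<epsilon>. \<delta> \<epsilon> s) \<longlongrightarrow> (\<Sum>t\<in>T. M0 s t * \<zeta>0 t)) (at_right 0)"
      unfolding \<delta>_def by (intro tendsto_sum tendsto_mult scaled_gram_lim \<zeta>1lim) (use s T in auto)
    then show ?thesis unfolding \<zeta>0_def M0_schur_extension[OF s] .
  qed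
  have YQ: "eventually (\<lambda>\<epsilon>. quad_form (scaled_gram \<epsilon>) (\<zeta> \<epsilon>) = (\<Sum>k\<in>J. lam k \<epsilon> / \<epsilon> ^ (2 * j) * (ip n (u k \<epsilon>) w)\<^sup>2)) (at_right 0)"
    using ev_pos bform_spectral_scaled uorth
  proof eventually_elim
    case (elim \<epsilon>)
    have "(\<Sum>t\<in>T. (\<epsilon> ^ j / \<epsilon> ^ d t * \<zeta> \<epsilon> t) * g t l) = Y \<epsilon> l" if "l < n" for l
      unfolding coord[OF that, of "Y \<epsilon>"] \<zeta>_def using elim(1) by (intro sum.cong) auto
    then have "quad_form (scaled_gram \<epsilon>) (\<zeta> \<epsilon>) = bform n (\<kappa> \<epsilon>) (Y \<epsilon>) (Y \<epsilon>) / \<epsilon> ^ (2 * j)"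
      unfolding quad_form_bform[OF elim(1)] by (intro arg_cong2[where f = "(/)"] refl bform_cong) auto
    also have "\<dots> = (\<Sum>k<n. lam k \<epsilon> / \<epsilon> ^ (2 * j) * (ip n (u k \<epsilon>) (Y \<epsilon>))\<^sup>2)" using elim(2) by blast
    also have "\<dots> = (\<Sum>k<n. lam k \<epsilon> / \<epsilon> ^ (2 * j) * (if k \<in> J then ip n (u k \<epsilon>) w else 0)\<^sup>2)"
    proof (rule sum.cong[OF refl])
      fix k assume "k \<in> {..<n}"
      then have k: "k < n" by simp
      have "ip n (u k \<epsilon>) (Y \<epsilon>) = ip n (u k \<epsilon>) w - (\<Sum>l\<in>I. ip n (u l \<epsilon>) w * ip n (u k \<epsilon>) (u l \<epsilon>))"
        unfolding Y_def ip_diff_right ip_sum_right ..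
      also have "(\<Sum>l\<in>I. ip n (u l \<epsilon>) w * ip n (u k \<epsilon>) (u l \<epsilon>)) = (\<Sum>l\<in>I. if k = l then ip n (u l \<epsilon>) w else 0)"
        using elim(3) k by (intro sum.cong) (auto simp: I_def)
      also have "\<dots> = (if k \<in> I then ip n (u k \<epsilon>) w else 0)" by (simp add: I_def)
      finally have "ip n (u k \<epsilon>) (Y \<epsilon>) = (if k \<in> J then ip n (u k \<epsilon>) w else 0)"
        using k by (auto simp: I_def J_def)
      then show "lam k \<epsilon> / \<epsilon> ^ (2 * j) * (ip n (u k \<epsilon>) (Y \<epsilon>))\<^sup>2 = lam k \<epsilon> / \<epsilon> ^ (2 * j) * (if k \<in> J then ip n (u k \<epsilon>) w else 0)\<^sup>2"
        by simp
    qed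
    also have "\<dots> = (\<Sum>k\<in>J. lam k \<epsilon> / \<epsilon> ^ (2 * j) * (ip n (u k \<epsilon>) w)\<^sup>2)"
      by (rule sum.mono_neutral_cong_right) (auto simp: J_def)
    finally show ?case .
  qed
  have "((\<lambda>\<epsilon>. \<Sum>k\<in>J. lam k \<epsilon> / \<epsilon> ^ (2 * j) * (ip n (u k \<epsilon>) w)\<^sup>2) \<longlongrightarrow>
      (\<Sum>k\<in>J. (if a k = 2 * j then c k else 0) * (ip n (u0 k) w)\<^sup>2)) (at_right 0)"
    by (intro tendsto_sum tendsto_mult tendsto_power uw lam_scaled) (auto simp: J_def)
  also have "(\<Sum>k\<in>J. (if a k = 2 * j then c k else 0) * (ip n (u0 k) w)\<^sup>2) = leading_quad w"
    unfolding leading_quad_def J_def by (rule sum.mono_neutral_left) auto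
  finally have Jlim: "((\<lambda>\<epsilon>. \<Sum>k\<in>J. lam k \<epsilon> / \<epsilon> ^ (2 * j) * (ip n (u k \<epsilon>) w)\<^sup>2) \<longlongrightarrow> leading_quad w) (at_right 0)" .
  have "eventually (\<lambda>\<epsilon>. (\<Sum>k\<in>J. lam k \<epsilon> / \<epsilon> ^ (2 * j) * (ip n (u k \<epsilon>) w)\<^sup>2) = quad_form (scaled_gram \<epsilon>) (\<zeta> \<epsilon>)) (at_right 0)"
    using YQ by eventually_elim (rule sym)
  then have Ylim2: "((\<lambda>\<epsilon>. quad_form (scaled_gram \<epsilon>) (\<zeta> \<epsilon>)) \<longlongrightarrow> leading_quad w) (at_right 0)"
    by (rule Lim_transform_eventually[OF Jlim])
  have Q1: "((\<lambda>\<epsilon>. quad_form (scaled_gram \<epsilon>) (\<zeta>1 \<epsilon>)) \<longlongrightarrow> quad_form M0 \<zeta>0) (at_right 0)"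
    by (rule quad_form_lim[OF \<zeta>1lim])
  obtain \<gamma> where \<gamma>: "\<gamma> > 0" and
    co: "eventually (\<lambda>\<epsilon>. \<forall>r. \<gamma> * (\<Sum>s\<in>S. (r s)\<^sup>2) \<le> (\<Sum>s\<in>S. \<Sum>s'\<in>S. r s * scaled_gram \<epsilon> s s' * r s')) (at_right 0)"
    using coercive by blast
  \<comment> \<open>In the expansion around \<zeta>1 the cross term is estimated by 2 |r \<delta>|
    \<le> \<gamma>/2 r^2 + 2/\<gamma> \<delta>^2. This uses up half of the coercive term and leaves
    the error 2/\<gamma> \<delta>^2, which tends to 0.\<close>
  define X where "X \<epsilon> = quad_form (scaled_gram \<epsilon>) (\<zeta> \<epsilon>) - quad_form (scaled_gram \<epsilon>) (\<zeta>1 \<epsilon>) + 2 / \<gamma> * (\<Sum>s\<in>S. (\<delta> \<epsilon> s)\<^sup>2)" for \<epsilon>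
  have key: "eventually (\<lambda>\<epsilon>. \<gamma> / 2 * (\<Sum>s\<in>S. (r \<epsilon> s)\<^sup>2) \<le> X \<epsilon>) (at_right 0)"
    using co scaled_gram_sym
  proof eventually_elim
    case (elim \<epsilon>)
    have "quad_form (scaled_gram \<epsilon>) (\<lambda>t. \<zeta>1 \<epsilon> t + r \<epsilon> t) = quad_form (scaled_gram \<epsilon>) (\<zeta>1 \<epsilon>) + 2 * (\<Sum>s\<in>S. r \<epsilon> s * \<delta> \<epsilon> s) + (\<Sum>s\<in>S. \<Sum>s'\<in>S. r \<epsilon> s * scaled_gram \<epsilon> s s' * r \<epsilon> s')"
      unfolding \<delta>_def
    proof (rule quad_form_add)
      show "scaled_gram \<epsilon> t t' = scaled_gram \<epsilon> t' t" for t t' using elim(2) by blast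
      show "r \<epsilon> t = 0" if "t \<in> T - S" for t using that by (simp add: r_def \<zeta>1_def)
    qed
    moreover have "(\<lambda>t. \<zeta>1 \<epsilon> t + r \<epsilon> t) = \<zeta> \<epsilon>" by (simp add: r_def)
    moreover have "\<gamma> * (\<Sum>s\<in>S. (r \<epsilon> s)\<^sup>2) \<le> (\<Sum>s\<in>S. \<Sum>s'\<in>S. r \<epsilon> s * scaled_gram \<epsilon> s s' * r \<epsilon> s')" using elim(1) by blast
    moreover have "- (\<gamma> / 2 * (\<Sum>s\<in>S. (r \<epsilon> s)\<^sup>2) + 2 / \<gamma> * (\<Sum>s\<in>S. (\<delta> \<epsilon> s)\<^sup>2)) \<le> 2 * (\<Sum>s\<in>S. r \<epsilon> s * \<delta> \<epsilon> s)"
      unfolding sum_distrib_left sum.distrib[symmetric] sum_negf[symmetric]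
    proof (rule sum_mono)
      fix s
      have "0 \<le> \<gamma> / 2 * (r \<epsilon> s + 2 / \<gamma> * \<delta> \<epsilon> s)\<^sup>2" using \<gamma> by simp
      also have "\<dots> = \<gamma> / 2 * (r \<epsilon> s)\<^sup>2 + 2 / \<gamma> * (\<delta> \<epsilon> s)\<^sup>2 + 2 * (r \<epsilon> s * \<delta> \<epsilon> s)"
        using \<gamma> by (simp add: field_simps power2_eq_square)
      finally show "- (\<gamma> / 2 * (r \<epsilon> s)\<^sup>2 + 2 / \<gamma> * (\<delta> \<epsilon> s)\<^sup>2) \<le> 2 * (r \<epsilon> s * \<delta> \<epsilon> s)" by linarith
    qed
    ultimately show ?case unfolding X_def by (simp add: field_simps)
  qed
  have Xlim: "(X \<longlongrightarrow> leading_quad w - quad_form M0 \<zeta>0) (at_right 0)"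
  proof -
    have "(X \<longlongrightarrow> leading_quad w - quad_form M0 \<zeta>0 + 2 / \<gamma> * (\<Sum>s\<in>S. 0\<^sup>2)) (at_right 0)"
      unfolding X_def by (intro tendsto_add tendsto_diff Ylim2 Q1 tendsto_mult tendsto_const tendsto_sum tendsto_power \<delta>lim)
    then show ?thesis by simp
  qed
  have "0 \<le> leading_quad w - quad_form M0 \<zeta>0"
  proof (rule tendsto_lowerbound[OF Xlim _ trivial_limit_at_right_real])
    show "eventually (\<lambda>\<epsilon>. 0 \<le> X \<epsilon>) (at_right 0)"
      using key
    proof eventually_elim
      case (elim \<epsilon>)
      have "0 \<le> \<gamma> / 2 * (\<Sum>s\<in>S. (r \<epsilon> s)\<^sup>2)" using \<gamma> by (intro mult_nonneg_nonneg sum_nonneg) auto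
      then show ?case using elim by linarith
    qed
  qed
  then show "schur_quad (\<lambda>t. ip n (p t) w) \<le> leading_quad w" unfolding schur_quad_eq \<zeta>0_def by simp
  show "ip n (p s) w = 0" if s: "s \<in> S" for s
  proof -
    have j: "j - d s > 0" using dS[OF s] by simp
    have "((\<lambda>\<epsilon>. (\<epsilon> ^ (j - d s))\<^sup>2 * (2 / \<gamma> * X \<epsilon>)) \<longlongrightarrow> (0 ^ (j - d s))\<^sup>2 * (2 / \<gamma> * (leading_quad w - quad_form M0 \<zeta>0))) (at_right 0)"
      by (intro tendsto_mult tendsto_const Xlim tendsto_power tendsto_ident_at)
    moreover have z: "0 ^ (j - d s) = (0::real)" using j by (simp add: power_0_left)
    ultimately have up: "((\<lambda>\<epsilon>. (\<epsilon> ^ (j - d s))\<^sup>2 * (2 / \<gamma> * X \<epsilon>)) \<longlongrightarrow> 0) (at_right 0)"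
      unfolding z by simp
    \<comment> \<open>The quantity squared here is \<epsilon>^(j - d s) times r. Since r is bounded
      and d s < j, it tends to 0, and it also tends to \<open>ip n (p s) w\<close>.\<close>
    have lo: "((\<lambda>\<epsilon>. (ip n (p s) (Y \<epsilon>) - \<epsilon> ^ (j - d s) * \<zeta>0 s)\<^sup>2) \<longlongrightarrow> (ip n (p s) w - 0 ^ (j - d s) * \<zeta>0 s)\<^sup>2) (at_right 0)"
      by (intro tendsto_intros pY)
    have "eventually (\<lambda>\<epsilon>. (ip n (p s) (Y \<epsilon>) - \<epsilon> ^ (j - d s) * \<zeta>0 s)\<^sup>2 \<le> (\<epsilon> ^ (j - d s))\<^sup>2 * (2 / \<gamma> * X \<epsilon>)) (at_right 0)"
      using key ev_pos
    proof eventually_elim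
      case (elim \<epsilon>)
      have "(r \<epsilon> s)\<^sup>2 \<le> (\<Sum>s\<in>S. (r \<epsilon> s)\<^sup>2)" using member_le_sum[of s S "\<lambda>s. (r \<epsilon> s)\<^sup>2"] s finS by auto
      then have "\<gamma> / 2 * (r \<epsilon> s)\<^sup>2 \<le> X \<epsilon>" using elim(1) \<gamma> by (smt (verit) divide_pos_pos mult_left_mono)
      then have rs: "(r \<epsilon> s)\<^sup>2 \<le> 2 / \<gamma> * X \<epsilon>" using \<gamma> by (simp add: field_simps)
      have e: "\<epsilon> ^ j = \<epsilon> ^ (j - d s) * \<epsilon> ^ d s" using j by (simp flip: power_add)
      have eqn: "ip n (p s) (Y \<epsilon>) - \<epsilon> ^ (j - d s) * \<zeta>0 s = \<epsilon> ^ (j - d s) * r \<epsilon> s"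
        unfolding r_def \<zeta>_def \<zeta>1_def e using s elim(2) by (simp add: field_simps)
      show ?case unfolding eqn power_mult_distrib using rs by (intro mult_left_mono) auto
    qed
    from tendsto_le[OF trivial_limit_at_right_real up lo this] show ?thesis unfolding z by simp
  qed
qed

lemma leading_eigenvector_orthogonal:
  assumes k: "k < n" "2 * j \<le> a k" and s: "s \<in> S"
  shows "ip n (u0 k) (g s) = 0"
proof -
  have "ip n (u0 l) (u0 k) = 0" if "l < n" "a l < 2 * j" for l
    using u0orth[OF that(1) k(1)] that k by auto
  from schur_quad_le(2)[OF this s] show ?thesis unfolding pS[OF s] by (simp add: ip_commute)
qed

text \<open>The two bounds combine only after a change of coordinates: the vectors g t outside S may
  be dependent, so the coordinates \<omega> obtained from p need not be \<zeta>. Both represent w,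
  and \<open>schur_quad\<close> depends on w alone.\<close>

lemma leading_form:
  "leading_quad (\<lambda>l. \<Sum>t\<in>T - S. \<zeta> t * g t l) = schur_quad \<zeta>"
proof -
  define w where "w l = (\<Sum>t\<in>T - S. \<zeta> t * g t l)" for l
  define \<omega> where "\<omega> t = ip n (p t) w" for t
  have w: "w l = (\<Sum>t\<in>T - S. \<zeta> t * g t l)" for l unfolding w_def ..
  have "leading_quad w \<le> quad_form M0 (schur_extension \<zeta>)" by (rule leading_quad_le(1)[OF w]) (simp add: schur_extension_def)
  then have le: "leading_quad w \<le> schur_quad \<zeta>" unfolding schur_quad_eq .
  have orth: "ip n (u0 k) w = 0" if "k < n" "a k < 2 * j" for k
    by (rule leading_quad_le(2)[OF w refl that])
  have "schur_quad \<omega> \<le> leading_quad w" unfolding \<omega>_def by (rule schur_quad_le(1)[OF orth])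
  moreover have "schur_quad \<omega> = schur_quad \<zeta>"
  proof -
    have wS: "ip n (p s) w = 0" if "s \<in> S" for s by (rule schur_quad_le(2)[OF orth that])
    have w2: "w l = (\<Sum>t\<in>T - S. \<omega> t * g t l)" if "l < n" for l
      unfolding coord[OF that, of w] sum_split_S using wS by (simp add: \<omega>_def)
    \<comment> \<open>Before the limit both sides are the same Gram pairing of w with g x;
      uniqueness of limits transfers the equality to \<open>M0\<close>.\<close>
    have same: "(\<Sum>t\<in>T - S. \<omega> t * M0 t x) = (\<Sum>t\<in>T - S. \<zeta> t * M0 t x)" if x: "x \<in> T" for x
    proof (rule tendsto_unique[OF trivial_limit_at_right_real])
      show "((\<lambda>\<epsilon>. \<Sum>t\<in>T - S. \<omega> t * scaled_gram \<epsilon> t x) \<longlongrightarrow> (\<Sum>t\<in>T - S. \<omega> t * M0 t x)) (at_right 0)"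
        by (intro tendsto_sum tendsto_mult tendsto_const scaled_gram_lim) (use x in auto)
      have "(\<Sum>t\<in>T - S. \<omega> t * scaled_gram \<epsilon> t x) = (\<Sum>t\<in>T - S. \<zeta> t * scaled_gram \<epsilon> t x)" for \<epsilon>
      proof -
        have r: "(\<Sum>t\<in>T - S. f t * scaled_gram \<epsilon> t x) = bform n (\<kappa> \<epsilon>) (\<lambda>l. \<Sum>t\<in>T - S. f t * g t l) (g x) / \<epsilon> ^ (j + d x)" for f
          unfolding bform_sum_left scaled_gram_def sum_divide_distrib by (intro sum.cong) (auto simp: dU)
        show ?thesis unfolding r
          by (intro arg_cong2[where f = "(/)"] refl bform_cong) (use w2 in \<open>auto simp: w_def\<close>)
      qed
      then show "((\<lambda>\<epsilon>. \<Sum>t\<in>T - S. \<omega> t * scaled_gram \<epsilon> t x) \<longlongrightarrow> (\<Sum>t\<in>T - S. \<zeta> t * M0 t x)) (at_right 0)"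
        by (simp only:) (intro tendsto_sum tendsto_mult tendsto_const scaled_gram_lim, use x in auto)
    qed
    have same': "(\<Sum>t\<in>T - S. M0 x t * \<omega> t) = (\<Sum>t\<in>T - S. M0 x t * \<zeta> t)" if x: "x \<in> T" for x
    proof -
      have "(\<Sum>t\<in>T - S. M0 x t * f t) = (\<Sum>t\<in>T - S. f t * M0 t x)" for f
        using M0_sym[OF x] by (intro sum.cong) auto
      then show ?thesis using same[OF x] by simp
    qed
    have S1: "schur_quad f = (\<Sum>t\<in>T - S. f t * (\<Sum>t'\<in>T - S. M0 t t' * f t'))
        - (\<Sum>s\<in>S. \<Sum>s'\<in>S. (\<Sum>t\<in>T - S. f t * M0 t s) * G s s' * (\<Sum>t'\<in>T - S. M0 s' t' * f t'))" for f
    proof -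
      have "(\<Sum>t\<in>T - S. \<Sum>s\<in>S. \<Sum>s'\<in>S. \<Sum>t'\<in>T - S. f t * M0 t s * G s s' * M0 s' t' * f t')
          = (\<Sum>s\<in>S. \<Sum>t\<in>T - S. \<Sum>s'\<in>S. \<Sum>t'\<in>T - S. f t * M0 t s * G s s' * M0 s' t' * f t')" by (rule sum.swap)
      also have "\<dots> = (\<Sum>s\<in>S. \<Sum>s'\<in>S. \<Sum>t\<in>T - S. \<Sum>t'\<in>T - S. f t * M0 t s * G s s' * M0 s' t' * f t')"
        by (intro sum.cong refl sum.swap)
      also have "\<dots> = (\<Sum>s\<in>S. \<Sum>s'\<in>S. (\<Sum>t\<in>T - S. f t * M0 t s) * G s s' * (\<Sum>t'\<in>T - S. M0 s' t' * f t'))"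
        by (intro sum.cong refl) (simp add: sum_distrib_left sum_distrib_right mult.assoc, rule sum.swap)
      finally show ?thesis unfolding schur_quad_def by (simp add: sum_distrib_left mult.assoc)
    qed
    have "(\<Sum>t\<in>T - S. \<omega> t * (\<Sum>t'\<in>T - S. M0 t t' * \<omega> t')) = (\<Sum>t\<in>T - S. \<omega> t * (\<Sum>t'\<in>T - S. M0 t t' * \<zeta> t'))"
      using same' by (intro sum.cong) auto
    also have "\<dots> = (\<Sum>t'\<in>T - S. (\<Sum>t\<in>T - S. \<omega> t * M0 t t') * \<zeta> t')"
      unfolding sum_distrib_left sum_distrib_right by (subst sum.swap) (simp add: mult.assoc)
    also have "\<dots> = (\<Sum>t'\<in>T - S. (\<Sum>t\<in>T - S. \<zeta> t * M0 t t') * \<zeta> t')"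
      using same by (intro sum.cong) auto
    also have "\<dots> = (\<Sum>t\<in>T - S. \<zeta> t * (\<Sum>t'\<in>T - S. M0 t t' * \<zeta> t'))"
      unfolding sum_distrib_left sum_distrib_right by (subst sum.swap) (simp add: mult.assoc)
    finally have "(\<Sum>t\<in>T - S. \<omega> t * (\<Sum>t'\<in>T - S. M0 t t' * \<omega> t')) = (\<Sum>t\<in>T - S. \<zeta> t * (\<Sum>t'\<in>T - S. M0 t t' * \<zeta> t'))" .
    moreover have "(\<Sum>s\<in>S. \<Sum>s'\<in>S. (\<Sum>t\<in>T - S. \<omega> t * M0 t s) * G s s' * (\<Sum>t'\<in>T - S. M0 s' t' * \<omega> t'))
       = (\<Sum>s\<in>S. \<Sum>s'\<in>S. (\<Sum>t\<in>T - S. \<zeta> t * M0 t s) * G s s' * (\<Sum>t'\<in>T - S. M0 s' t' * \<zeta> t'))"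
    proof (intro sum.cong refl)
      fix s s' assume s: "s \<in> S" "s' \<in> S"
      then have "s \<in> T" "s' \<in> T" using T by auto
      then show "(\<Sum>t\<in>T - S. \<omega> t * M0 t s) * G s s' * (\<Sum>t'\<in>T - S. M0 s' t' * \<omega> t')
        = (\<Sum>t\<in>T - S. \<zeta> t * M0 t s) * G s s' * (\<Sum>t'\<in>T - S. M0 s' t' * \<zeta> t')"
        by (simp only: same same')
    qed
    ultimately show ?thesis unfolding S1 by simp
  qed
  ultimately show ?thesis using le unfolding w_def by simp
qed

end

section \<open>The block QR factorisation\<close>

lemma underdetermined_system:
  fixes M :: "'e \<Rightarrow> 's \<Rightarrow> real"
  assumes "finite E" "finite J" "card E < card J"
  shows "\<exists>d. (\<exists>s\<in>J. d s \<noteq> 0) \<and> (\<forall>e\<in>E. (\<Sum>s\<in>J. d s * M e s) = 0)"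
  using assms
proof (induction E arbitrary: J M rule: finite_induct)
  case empty
  then obtain s where "s \<in> J" by fastforce
  then show ?case by (intro exI[of _ "\<lambda>_. 1"]) auto
next
  case (insert e E)
  show ?case
  proof (cases "\<forall>s\<in>J. M e s = 0")
    case True
    have "card E < card J" using insert by simp
    from insert.IH[OF insert.prems(1) this, of M] True show ?thesis by auto
  next
    case False
    then obtain s0 where s0: "s0 \<in> J" "M e s0 \<noteq> 0" by blast
    define J' where "J' = J - {s0}"
    have J: "J = insert s0 J'" "s0 \<notin> J'" "finite J'" using s0 insert.prems unfolding J'_def by auto
    have "card E < card J'" using insert J by simp
    from insert.IH[OF J(3) this, of "\<lambda>e' s. M e' s - M e' s0 * M e s / M e s0"]
    obtain d where d: "\<exists>s\<in>J'. d s \<noteq> 0" "\<And>e'. e' \<in> E \<Longrightarrow> (\<Sum>s\<in>J'. d s * (M e' s - M e' s0 * M e s / M e s0)) = 0"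
      by blast
    define d' where "d' s = (if s = s0 then - (\<Sum>s\<in>J'. d s * M e s) / M e s0 else d s)" for s
    have sum: "(\<Sum>s\<in>J. d' s * M e' s) = - (\<Sum>s\<in>J'. d s * M e s) / M e s0 * M e' s0 + (\<Sum>s\<in>J'. d s * M e' s)" for e'
    proof -
      have "(\<Sum>s\<in>J'. d' s * M e' s) = (\<Sum>s\<in>J'. d s * M e' s)"
        using J(2) by (intro sum.cong) (auto simp: d'_def)
      then show ?thesis unfolding J(1) using J(2,3) by (simp add: d'_def)
    qed
    have "(\<Sum>s\<in>J. d' s * M e' s) = 0" if "e' \<in> insert e E" for e'
    proof (cases "e' = e")
      case True
      then show ?thesis unfolding sum using s0 by simp
    next
      case False
      then have "(\<Sum>s\<in>J'. d s * (M e' s - M e' s0 * M e s / M e s0)) = 0" using d(2) that by blast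
      also have "(\<Sum>s\<in>J'. d s * (M e' s - M e' s0 * M e s / M e s0)) = (\<Sum>s\<in>J'. d s * M e' s) - M e' s0 / M e s0 * (\<Sum>s\<in>J'. d s * M e s)"
        by (simp add: sum_subtractf right_diff_distrib sum_distrib_left mult_ac)
      finally show ?thesis unfolding sum by (simp add: mult_ac)
    qed
    moreover have "\<exists>s\<in>J. d' s \<noteq> 0" using d(1) J by (auto simp: d'_def)
    ultimately show ?thesis by blast
  qed
qed

text \<open>The rank counts a maximal independent set of column vectors. A choice of one index per
  vector turns it into a set of indices, which is not disturbed by repeated columns.\<close>

lemma rank_independent_columns:
  fixes A :: "real mat"
  assumes A: "A \<in> carrier_mat n nc"
  shows "\<exists>J\<subseteq>{..<nc}. card J = vec_space.rank n A \<and>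
    (\<forall>d. (\<forall>r<n. (\<Sum>t\<in>J. d t * A $$ (r, t)) = 0) \<longrightarrow> (\<forall>t\<in>J. d t = 0))"
proof -
  interpret vec_space "TYPE(real)" n .
  have "\<exists>S. finite S \<and> maximal S (\<lambda>T. T \<subseteq> set (cols A) \<and> lin_indpt T) \<and> {} \<subseteq> S"
  proof (rule maximal_exists_superset[of "set (cols A)"])
    show "{} \<subseteq> set (cols A) \<and> lin_indpt {}" unfolding lin_dep_def by auto
  qed auto
  then obtain S where S: "finite S" "maximal S (\<lambda>T. T \<subseteq> set (cols A) \<and> lin_indpt T)" by blast
  have rk: "rank A = card S" by (rule rank_card_indpt[OF A S(2)])
  have SA: "S \<subseteq> set (cols A)" and ind: "lin_indpt S" using S(2) unfolding maximal_def by auto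
  have cA: "set (cols A) \<subseteq> carrier_vec n" using A cols_dim by blast
  have "\<forall>v\<in>S. \<exists>t. t < nc \<and> col A t = v"
  proof
    fix v assume "v \<in> S"
    then have "v \<in> set (cols A)" using SA by blast
    then show "\<exists>t. t < nc \<and> col A t = v" using A by (auto simp: cols_def)
  qed
  from bchoice[OF this] obtain \<tau> where \<tau>: "\<forall>v\<in>S. \<tau> v < nc \<and> col A (\<tau> v) = v" by (rule exE)
  have inj: "inj_on \<tau> S" using \<tau> by (metis inj_onI)
  show ?thesis
  proof (intro exI[of _ "\<tau> ` S"] conjI allI impI ballI)
    show "\<tau> ` S \<subseteq> {..<nc}" using \<tau> by auto
    show "card (\<tau> ` S) = rank A" using rk inj by (simp add: card_image)
    fix d t assume d': "\<forall>r<n. (\<Sum>t\<in>\<tau> ` S. d t * A $$ (r, t)) = 0" and t: "t \<in> \<tau> ` S"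
    have d: "\<And>r. r < n \<Longrightarrow> (\<Sum>t\<in>\<tau> ` S. d t * A $$ (r, t)) = 0" using d' by blast
    have SC: "S \<subseteq> carrier_vec n" using SA cA by blast
    have "lincomb (\<lambda>v. d (\<tau> v)) S = 0\<^sub>v n"
    proof (rule eq_vecI)
      fix r assume "r < dim_vec (0\<^sub>v n :: real vec)"
      then have r: "r < n" by simp
      have "vec_index (lincomb (\<lambda>v. d (\<tau> v)) S) r = (\<Sum>v\<in>S. d (\<tau> v) * vec_index v r)"
        by (rule lincomb_index[OF r SC])
      also have "\<dots> = (\<Sum>v\<in>S. d (\<tau> v) * A $$ (r, \<tau> v))"
      proof (intro sum.cong refl arg_cong2[where f = "(*)"])
        fix v assume "v \<in> S"
        then have "\<tau> v < nc" "col A (\<tau> v) = v" using \<tau> by auto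
        then show "vec_index v r = A $$ (r, \<tau> v)" using A r by (metis carrier_matD index_col)
      qed
      also have "\<dots> = 0" using d[OF r] inj by (simp add: sum.reindex)
      finally show "vec_index (lincomb (\<lambda>v. d (\<tau> v)) S) r = vec_index (0\<^sub>v n) r" using r by simp
    next
      show "dim_vec (lincomb (\<lambda>v. d (\<tau> v)) S) = dim_vec (0\<^sub>v n :: real vec)" using lincomb_dim[OF S(1) SC] by simp
    qed
    then have "\<forall>v\<in>S. d (\<tau> v) = 0" using ind S(1) unfolding lin_dep_def by auto
    then show "d t = 0" using t by auto
  qed
qed

lemma rank_mono_columns:
  fixes A B :: "real mat"
  assumes A: "A \<in> carrier_mat n nc" and B: "B \<in> carrier_mat n nc'" and sub: "set (cols A) \<subseteq> set (cols B)"
  shows "vec_space.rank n A \<le> vec_space.rank n B"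
proof -
  interpret vec_space "TYPE(real)" n .
  have "\<exists>S. finite S \<and> maximal S (\<lambda>T. T \<subseteq> set (cols A) \<and> lin_indpt T) \<and> {} \<subseteq> S"
  proof (rule maximal_exists_superset[of "set (cols A)"])
    show "{} \<subseteq> set (cols A) \<and> lin_indpt {}" unfolding lin_dep_def by auto
  qed auto
  then obtain S where S: "maximal S (\<lambda>T. T \<subseteq> set (cols A) \<and> lin_indpt T)" by blast
  then have "S \<subseteq> set (cols B)" "lin_indpt S" using sub unfolding maximal_def by auto
  from rank_ge_card_indpt[OF B this] show ?thesis using rank_card_indpt[OF A S] by simp
qed

section \<open>Block indices and dimensions of polynomial spaces\<close>

lemma set_block_indices: "set (block_indices s [0..<m]) = {(i, p). i < m \<and> p < s i}"
  unfolding block_indices_def by auto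

lemma distinct_block_indices: "distinct (block_indices s [0..<m])"
  unfolding block_indices_def
proof (induction m)
  case (Suc m)
  then show ?case by (auto simp: distinct_map inj_on_def)
qed simp

lemma sum_block_indices:
  fixes f :: "nat \<times> nat \<Rightarrow> 'b::comm_monoid_add"
  shows "(\<Sum>a<length (block_indices s [0..<m]). f (block_indices s [0..<m] ! a)) = (\<Sum>i<m. \<Sum>p<s i. f (i, p))"
proof -
  have "(\<Sum>a<length xs. f (xs ! a)) = sum f (set xs)" if "distinct xs" for xs
    using that by (simp add: sum_list_distinct_conv_sum_set[symmetric] sum_list_sum_nth atLeast0LessThan)
  then have "(\<Sum>a<length (block_indices s [0..<m]). f (block_indices s [0..<m] ! a)) = sum f {(i, p). i < m \<and> p < s i}"
    using distinct_block_indices set_block_indices by metis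
  also have "{(i, p). i < m \<and> p < s i} = Sigma {..<m} (\<lambda>i. {..<s i})" by auto
  also have "sum f \<dots> = (\<Sum>i<m. \<Sum>p<s i. f (i, p))" by (simp add: sum.Sigma)
  finally show ?thesis .
qed

lemma block_index_bounds:
  assumes "a < length (block_indices s [0..<m])" "block_indices s [0..<m] ! a = (i, p)"
  shows "i < m" "p < s i"
  using nth_mem[OF assms(1)] assms(2) set_block_indices by auto

lemma block_index_exists:
  assumes "i < m" "p < s i"
  obtains a where "a < length (block_indices s [0..<m])" "block_indices s [0..<m] ! a = (i, p)"
proof -
  have "(i, p) \<in> set (block_indices s [0..<m])" using assms set_block_indices by auto
  then show ?thesis using that by (auto simp: in_set_conv_nth)
qed

lemma block_indices_single: "block_indices (\<lambda>_. n) [0] = map (Pair 0) [0..<n]"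
  unfolding block_indices_def by simp

lemma block_row_index:
  assumes "r < n" "a < length (block_indices c [0..<m])" "block_indices c [0..<m] ! a = (l, t)"
  shows "block_row n c [0..<m] A $$ (r, a) = A l $$ (r, t)"
  using assms unfolding block_row_def block_mat_def block_indices_single by (simp add: Let_def)

lemma block_row_carrier: "block_row n c [0..<m] A \<in> carrier_mat n (length (block_indices c [0..<m]))"
  unfolding block_row_def block_mat_def block_indices_single by (simp add: Let_def)

lemma card_multi_indices:
  "card {\<alpha> :: 'd::finite \<Rightarrow> nat. (\<Sum>i\<in>UNIV. \<alpha> i) = s} = (s + CARD('d) - 1) choose s"
proof -
  let ?A = "{\<alpha> :: 'd \<Rightarrow> nat. (\<Sum>i\<in>UNIV. \<alpha> i) = s}"
  let ?B = "{l :: nat list. length l = CARD('d) \<and> sum_list l = s}"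
  let ?c = "coordinates :: 'd list"
  have len: "length ?c = CARD('d)" using coordinates[where ?'d = 'd] distinct_card by metis
  have sl: "sum_list (map \<alpha> ?c) = (\<Sum>i\<in>UNIV. \<alpha> i)" for \<alpha> :: "'d \<Rightarrow> nat"
    using sum_list_distinct_conv_sum_set[OF coordinates(1)[where ?'d = 'd], of \<alpha>] unfolding coordinates(2)[where ?'d = 'd] .
  have "bij_betw (\<lambda>\<alpha>. map \<alpha> ?c) ?A ?B"
  proof (rule bij_betwI')
    fix \<alpha> \<beta> :: "'d \<Rightarrow> nat"
    show "(map \<alpha> ?c = map \<beta> ?c) = (\<alpha> = \<beta>)"
      using coordinates(2)[where ?'d = 'd] by (auto simp: map_eq_conv fun_eq_iff)
  next
    fix \<alpha> assume "\<alpha> \<in> ?A"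
    then show "map \<alpha> ?c \<in> ?B" by (simp add: len sl)
  next
    fix l assume l: "l \<in> ?B"
    define \<alpha> where "\<alpha> i = the (map_of (zip ?c l) i)" for i
    have "map \<alpha> ?c = l"
    proof (rule nth_equalityI)
      show "length (map \<alpha> ?c) = length l" using l len by simp
      fix a assume "a < length (map \<alpha> ?c)"
      then have a: "a < length ?c" by simp
      have "map_of (zip ?c l) (?c ! a) = Some (l ! a)"
        by (rule map_of_zip_nth) (use l len a coordinates in auto)
      then show "map \<alpha> ?c ! a = l ! a" using a by (simp add: \<alpha>_def)
    qed
    then show "\<exists>\<alpha>\<in>?A. l = map \<alpha> ?c" using l sl[of \<alpha>] by (intro bexI[of _ \<alpha>]) auto
  qed
  then have "card ?A = card ?B" by (rule bij_betw_same_card)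
  then show ?thesis using card_length_sum_list[of "CARD('d)" s] by simp
qed

lemma sum_monomials_poly_dim:
  fixes mons :: "nat \<Rightarrow> ('d::finite \<Rightarrow> nat) list"
  assumes "monomial_ordering mons"
  shows "(\<Sum>l\<le>s. length (mons l)) = poly_dim TYPE('d) s"
proof -
  have "length (mons l) = ((CARD('d) - 1) + l) choose l" for l
  proof -
    have "length (mons l) = card (set (mons l))" using assms unfolding monomial_ordering_def by (metis distinct_card)
    also have "\<dots> = (l + CARD('d) - 1) choose l" using assms card_multi_indices[where ?'d = 'd, of l] unfolding monomial_ordering_def by simp
    also have "l + CARD('d) - 1 = (CARD('d) - 1) + l" using zero_less_card_finite[where ?'a = 'd] by linarith
    finally show ?thesis .
  qed
  then have "(\<Sum>l\<le>s. length (mons l)) = Suc (CARD('d) - 1 + s) choose s" by (simp only: sum_choose_lower)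
  also have "\<dots> = (s + CARD('d)) choose s" using zero_less_card_finite[where ?'a = 'd] by (simp add: add.commute)
  also have "\<dots> = poly_dim TYPE('d) s" unfolding poly_dim_def using binomial_symmetric[of s "s + CARD('d)"] by simp
  finally show ?thesis .
qed

lemma vandermonde_le_carrier:
  "vandermonde_le mons n x s \<in> carrier_mat n (length (block_indices (\<lambda>l. length (mons l)) [0..<Suc s]))"
  unfolding vandermonde_le_def by (rule block_row_carrier)

lemma vandermonde_le_index:
  assumes "r < n" "a < length (block_indices (\<lambda>l. length (mons l)) [0..<Suc s])" "block_indices (\<lambda>l. length (mons l)) [0..<Suc s] ! a = (l, t)"
  shows "vandermonde_le mons n x s $$ (r, a) = vandermonde mons n x l $$ (r, t)"
  unfolding vandermonde_le_def by (rule block_row_index[OF assms])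

lemma cols_vandermonde_le_mono:
  assumes "s \<le> s'"
  shows "set (cols (vandermonde_le mons n x s)) \<subseteq> set (cols (vandermonde_le mons n x s'))"
proof
  let ?h = "\<lambda>l. length (mons l)"
  let ?A = "vandermonde_le mons n x s" and ?B = "vandermonde_le mons n x s'"
  note cA = vandermonde_le_carrier[of mons n x s] and cB = vandermonde_le_carrier[of mons n x s']
  fix v assume "v \<in> set (cols ?A)"
  then obtain a where a: "a < length (block_indices ?h [0..<Suc s])" "v = col ?A a"
    using cA by (auto simp: cols_def)
  obtain l t where lt: "block_indices ?h [0..<Suc s] ! a = (l, t)" by fastforce
  from block_index_bounds[OF a(1) lt] assms have "l < Suc s'" "t < ?h l" by auto
  then obtain a' where a': "a' < length (block_indices ?h [0..<Suc s'])" "block_indices ?h [0..<Suc s'] ! a' = (l, t)"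
    by (rule block_index_exists)
  have "col ?A a = col ?B a'"
  proof (rule eq_vecI)
    fix r assume "r < dim_vec (col ?B a')"
    then have r: "r < n" using cB by simp
    show "vec_index (col ?A a) r = vec_index (col ?B a') r"
      using vandermonde_le_index[OF r a(1) lt] vandermonde_le_index[OF r a'] r a a' cA cB by simp
  qed (use cA cB in simp)
  then show "v \<in> set (cols ?B)" using a a' cB by (auto simp: cols_def)
qed

lemma vrank_mono: "s \<le> s' \<Longrightarrow> vrank mons n x s \<le> vrank mons n x s'"
  unfolding vrank_def
  by (rule rank_mono_columns[OF vandermonde_le_carrier vandermonde_le_carrier cols_vandermonde_le_mono])

lemma sum_rank_jump: "(\<Sum>i\<le>s. rank_jump mons n x i) = vrank mons n x s"
proof (induction s)
  case (Suc s)
  then show ?case using vrank_mono[of s "Suc s" mons n x] by (simp add: rank_jump_def)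
qed (simp add: rank_jump_def)

section \<open>Consequences of the block QR factorisation\<close>

locale vandermonde_qr =
  fixes mons :: "nat \<Rightarrow> ('d::finite \<Rightarrow> nat) list" and n m :: nat and x :: "nat \<Rightarrow> real ^ 'd"
    and Q :: "nat \<Rightarrow> real mat" and R :: "nat \<Rightarrow> nat \<Rightarrow> real mat" and b h :: "nat \<Rightarrow> nat"
  assumes QR: "block_QR mons n x m Q R"
    and b: "b = rank_jump mons n x" and h: "h = (\<lambda>l. length (mons l))"
begin

abbreviation V where "V \<equiv> vandermonde mons n x"

lemma Q_carrier: "i \<le> m \<Longrightarrow> Q i \<in> carrier_mat n (b i)"
  and R_carrier: "i \<le> m \<Longrightarrow> l \<le> m \<Longrightarrow> R i l \<in> carrier_mat (b i) (h l)"
  and R_lower: "i \<le> m \<Longrightarrow> l < i \<Longrightarrow> R i l = 0\<^sub>m (b i) (h l)"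
  using QR unfolding block_QR_def b h Let_def by auto

lemma R_lower_index: "i \<le> m \<Longrightarrow> l < i \<Longrightarrow> p < b i \<Longrightarrow> t < h l \<Longrightarrow> R i l $$ (p, t) = 0"
  by (simp add: R_lower)

lemma V_carrier: "V l \<in> carrier_mat n (h l)"
  unfolding vandermonde_def h by simp

lemma Q_orth:
  assumes i: "i \<le> m" "p < b i" and i': "i' \<le> m" "p' < b i'"
  shows "(\<Sum>r<n. Q i $$ (r, p) * Q i' $$ (r, p')) = (if i = i' \<and> p = p' then 1 else 0)"
proof -
  let ?bs = "block_indices b [0..<Suc m]"
  let ?Q = "block_row n b [0..<Suc m] Q"
  have c: "?Q \<in> carrier_mat n (length ?bs)" by (rule block_row_carrier)
  have o: "transpose_mat ?Q * ?Q = 1\<^sub>m (dim_col ?Q)"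
    using QR unfolding block_QR_def b Let_def by auto
  obtain a where a: "a < length ?bs" "?bs ! a = (i, p)" using i block_index_exists[of i "Suc m" p b] by auto
  obtain a' where a': "a' < length ?bs" "?bs ! a' = (i', p')" using i' block_index_exists[of i' "Suc m" p' b] by auto
  have "(transpose_mat ?Q * ?Q) $$ (a, a') = (\<Sum>r<n. ?Q $$ (r, a) * ?Q $$ (r, a'))"
    using c a a' by (simp add: scalar_prod_def atLeast0LessThan)
  also have "\<dots> = (\<Sum>r<n. Q i $$ (r, p) * Q i' $$ (r, p'))"
    using block_row_index[OF _ a, of _ n Q] block_row_index[OF _ a', of _ n Q] by (intro sum.cong) auto
  finally have "(\<Sum>r<n. Q i $$ (r, p) * Q i' $$ (r, p')) = (if a = a' then 1 else 0)"
    unfolding o using c a a' by simp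
  moreover have "a = a' \<longleftrightarrow> i = i' \<and> p = p'"
    using a a' nth_eq_iff_index_eq[OF distinct_block_indices, of a b "Suc m" a'] by auto
  ultimately show ?thesis by simp
qed

lemma V_decomp:
  assumes l: "l \<le> m" "t < h l" and r: "r < n"
  shows "V l $$ (r, t) = (\<Sum>i\<le>l. \<Sum>p<b i. Q i $$ (r, p) * R i l $$ (p, t))"
proof -
  let ?bs = "block_indices b [0..<Suc m]" and ?hs = "block_indices h [0..<Suc m]"
  let ?Q = "block_row n b [0..<Suc m] Q" and ?R = "block_mat b h [0..<Suc m] [0..<Suc m] R"
  have c: "?Q \<in> carrier_mat n (length ?bs)" by (rule block_row_carrier)
  have cR: "?R \<in> carrier_mat (length ?bs) (length ?hs)" unfolding block_mat_def Let_def by simp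
  have e: "vandermonde_le mons n x m = ?Q * ?R"
    using QR unfolding block_QR_def b h Let_def by auto
  obtain a where a: "a < length ?hs" "?hs ! a = (l, t)" using l block_index_exists[of l "Suc m" t h] by auto
  have "V l $$ (r, t) = (?Q * ?R) $$ (r, a)"
    using vandermonde_le_index[OF r a[unfolded h], of x] unfolding e by simp
  also have "\<dots> = (\<Sum>s<length ?bs. ?Q $$ (r, s) * ?R $$ (s, a))"
    using c cR r a by (simp add: scalar_prod_def atLeast0LessThan)
  also have "\<dots> = (\<Sum>s<length ?bs. (\<lambda>(i, p). Q i $$ (r, p) * R i l $$ (p, t)) (?bs ! s))"
  proof (rule sum.cong[OF refl])
    fix s assume "s \<in> {..<length ?bs}"
    then have s: "s < length ?bs" by simp
    obtain i p where ip: "?bs ! s = (i, p)" by fastforce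
    have "?R $$ (s, a) = R i l $$ (p, t)" using s a ip unfolding block_mat_def Let_def by simp
    then show "?Q $$ (r, s) * ?R $$ (s, a) = (\<lambda>(i, p). Q i $$ (r, p) * R i l $$ (p, t)) (?bs ! s)"
      using block_row_index[OF r s ip, of Q] ip by simp
  qed
  also have "\<dots> = (\<Sum>i<Suc m. \<Sum>p<b i. Q i $$ (r, p) * R i l $$ (p, t))"
    by (subst sum_block_indices) simp
  also have "\<dots> = (\<Sum>i\<le>l. \<Sum>p<b i. Q i $$ (r, p) * R i l $$ (p, t))"
  proof (rule sum.mono_neutral_right)
    show "\<forall>i\<in>{..<Suc m} - {..l}. (\<Sum>p<b i. Q i $$ (r, p) * R i l $$ (p, t)) = 0"
      using R_lower_index l by (intro ballI sum.neutral) auto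
  qed (use l in auto)
  finally show ?thesis .
qed

lemma Q_V:
  assumes l: "l \<le> m" "t < h l" and i: "i \<le> m" "p < b i"
  shows "(\<Sum>r<n. Q i $$ (r, p) * V l $$ (r, t)) = (if i \<le> l then R i l $$ (p, t) else 0)"
proof -
  have "(\<Sum>r<n. Q i $$ (r, p) * V l $$ (r, t)) = (\<Sum>r<n. \<Sum>i'\<le>l. \<Sum>p'<b i'. Q i $$ (r, p) * Q i' $$ (r, p') * R i' l $$ (p', t))"
    by (rule sum.cong[OF refl]) (simp add: V_decomp[OF l] sum_distrib_left mult.assoc)
  also have "\<dots> = (\<Sum>i'\<le>l. \<Sum>r<n. \<Sum>p'<b i'. Q i $$ (r, p) * Q i' $$ (r, p') * R i' l $$ (p', t))"
    by (rule sum.swap)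
  also have "\<dots> = (\<Sum>i'\<le>l. \<Sum>p'<b i'. \<Sum>r<n. Q i $$ (r, p) * Q i' $$ (r, p') * R i' l $$ (p', t))"
    by (intro sum.cong refl sum.swap)
  also have "\<dots> = (\<Sum>i'\<le>l. \<Sum>p'<b i'. (if i' = i then (if p' = p then R i l $$ (p, t) else 0) else 0))"
  proof (intro sum.cong refl)
    fix i' p' assume "i' \<in> {..l}" "p' \<in> {..<b i'}"
    then have "i' \<le> m" "p' < b i'" using l by auto
    from Q_orth[OF i this] show "(\<Sum>r<n. Q i $$ (r, p) * Q i' $$ (r, p') * R i' l $$ (p', t)) = (if i' = i then (if p' = p then R i l $$ (p, t) else 0) else 0)"
      unfolding sum_distrib_right[symmetric] by auto
  qed
  also have "\<dots> = (\<Sum>i'\<le>l. (if i' = i then R i l $$ (p, t) else 0))"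
    using i by (intro sum.cong refl) auto
  also have "\<dots> = (if i \<le> l then R i l $$ (p, t) else 0)" by simp
  finally show ?thesis .
qed

lemma R_diag_left_kernel:
  assumes D: "D \<le> m" and c: "\<And>t. t < h D \<Longrightarrow> (\<Sum>p<b D. c p * R D D $$ (p, t)) = 0" and p: "p < b D"
  shows "c p = 0"
proof (rule ccontr)
  assume cp: "c p \<noteq> 0"
  let ?hs = "block_indices h [0..<Suc D]"
  have carr: "vandermonde_le mons n x D \<in> carrier_mat n (length ?hs)"
    unfolding h by (rule vandermonde_le_carrier)
  obtain J where J: "J \<subseteq> {..<length ?hs}" "card J = vrank mons n x D"
    and ind: "\<forall>d. (\<forall>r<n. (\<Sum>t\<in>J. d t * vandermonde_le mons n x D $$ (r, t)) = 0) \<longrightarrow> (\<forall>t\<in>J. d t = 0)"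
    using rank_independent_columns[OF carr] unfolding vrank_def by (elim exE conjE)
  have finJ: "finite J" using J(1) finite_subset by blast
  define I where "I = Sigma {..D} (\<lambda>i. {..<b i})"
  have finI: "finite I" unfolding I_def by simp
  have cardI: "card I = vrank mons n x D"
    unfolding I_def sum_rank_jump[symmetric] b[symmetric] by simp
  have pI: "(D, p) \<in> I" using p by (simp add: I_def)
  \<comment> \<open>One equation is omitted, so there are fewer equations than independent columns
    and a nontrivial d solves the rest.\<close>
  define E where "E = I - {(D, p)}"
  have "card E < card J" unfolding E_def J(2) cardI[symmetric] by (rule card_Diff1_less[OF finI pI])
  define M where "M e s = R (fst e) (fst (?hs ! s)) $$ (snd e, snd (?hs ! s))" for e s
  have finE: "finite E" unfolding E_def using finI by simp
  obtain d where d: "\<exists>s\<in>J. d s \<noteq> 0" "\<And>e. e \<in> E \<Longrightarrow> (\<Sum>s\<in>J. d s * M e s) = 0"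
    using underdetermined_system[OF finE finJ \<open>card E < card J\<close>, of M] by blast
  \<comment> \<open>The omitted equation follows from the others: the combination of all rows of
    block D with weights c is zero, and its weight at p is not.\<close>
  have Dp: "(\<Sum>s\<in>J. d s * M (D, p) s) = 0"
  proof -
    have zero: "(\<Sum>q<b D. c q * M (D, q) s) = 0" if s: "s \<in> J" for s
    proof -
      obtain l t where lt: "?hs ! s = (l, t)" by fastforce
      have "s < length ?hs" using J s by auto
      from block_index_bounds[OF this lt] have "l \<le> D" "t < h l" by auto
      then have lt': "l = D \<and> t < h D \<or> l < D \<and> t < h l" by auto
      have M: "M (D, q) s = R D l $$ (q, t)" for q unfolding M_def fst_conv snd_conv lt ..
      show ?thesis
        unfolding M using lt' c[of t] R_lower_index[OF D, of l] by auto
    qed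
    have "0 = (\<Sum>s\<in>J. d s * (\<Sum>q<b D. c q * M (D, q) s))" using zero by simp
    also have "\<dots> = (\<Sum>q<b D. c q * (\<Sum>s\<in>J. d s * M (D, q) s))"
      unfolding sum_distrib_left by (subst sum.swap) (simp add: mult.left_commute)
    also have "\<dots> = (\<Sum>q<b D. if q = p then c p * (\<Sum>s\<in>J. d s * M (D, p) s) else 0)"
    proof (rule sum.cong[OF refl])
      fix q assume "q \<in> {..<b D}"
      then have "q \<noteq> p \<Longrightarrow> (D, q) \<in> E" unfolding E_def I_def by auto
      then show "c q * (\<Sum>s\<in>J. d s * M (D, q) s) = (if q = p then c p * (\<Sum>s\<in>J. d s * M (D, p) s) else 0)"
        using d(2)[of "(D, q)"] by auto
    qed
    also have "\<dots> = c p * (\<Sum>s\<in>J. d s * M (D, p) s)" using p by simp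
    finally show ?thesis using cp by simp
  qed
  have all: "(\<Sum>s\<in>J. d s * M e s) = 0" if "e \<in> I" for e
    using that Dp d(2) by (cases "e = (D, p)") (auto simp: E_def)
  have "(\<Sum>s\<in>J. d s * vandermonde_le mons n x D $$ (r, s)) = 0" if r: "r < n" for r
  proof -
    have "(\<Sum>s\<in>J. d s * vandermonde_le mons n x D $$ (r, s)) = (\<Sum>s\<in>J. d s * (\<Sum>e\<in>I. Q (fst e) $$ (r, snd e) * M e s))"
    proof (intro sum.cong refl arg_cong2[where f = "(*)"])
      fix s assume "s \<in> J"
      then have s: "s < length ?hs" using J by auto
      obtain l t where lt: "?hs ! s = (l, t)" by fastforce
      from block_index_bounds[OF s lt] have l: "l \<le> D" "t < h l" by auto
      have "vandermonde_le mons n x D $$ (r, s) = V l $$ (r, t)"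
        using vandermonde_le_index[OF r s[unfolded h] lt[unfolded h]] .
      also have "\<dots> = (\<Sum>i\<le>l. \<Sum>p<b i. Q i $$ (r, p) * R i l $$ (p, t))"
        using V_decomp[OF _ l(2) r] l D by simp
      also have "\<dots> = (\<Sum>i\<le>D. \<Sum>p<b i. Q i $$ (r, p) * R i l $$ (p, t))"
        by (rule sum.mono_neutral_left) (use l D R_lower_index in \<open>auto intro!: sum.neutral\<close>)
      also have "\<dots> = (\<Sum>e\<in>I. Q (fst e) $$ (r, snd e) * M e s)"
        unfolding I_def M_def lt by (simp add: sum.Sigma split_def)
      finally show "vandermonde_le mons n x D $$ (r, s) = (\<Sum>e\<in>I. Q (fst e) $$ (r, snd e) * M e s)" .
    qed
    also have "\<dots> = (\<Sum>e\<in>I. Q (fst e) $$ (r, snd e) * (\<Sum>s\<in>J. d s * M e s))"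
      unfolding sum_distrib_left by (subst sum.swap) (simp add: mult.left_commute)
    also have "\<dots> = 0" using all by simp
    finally show ?thesis .
  qed
  then have "\<forall>r<n. (\<Sum>s\<in>J. d s * vandermonde_le mons n x D $$ (r, s)) = 0" by blast
  with ind have "\<forall>t\<in>J. d t = 0" by blast
  with d(1) show False by blast
qed

text \<open>The b i rows of R_ii have length h i and are independent.\<close>

lemma b_le_h: assumes "i \<le> m" shows "b i \<le> h i"
proof (rule ccontr)
  assume "\<not> b i \<le> h i"
  then have "card {..<h i} < card {..<b i}" by simp
  from underdetermined_system[OF finite_lessThan finite_lessThan this, of "\<lambda>t p. R i i $$ (p, t)"]
  obtain c where "\<exists>p\<in>{..<b i}. c p \<noteq> 0" "\<And>t. t < h i \<Longrightarrow> (\<Sum>p<b i. c p * R i i $$ (p, t)) = 0" by auto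
  then show False using R_diag_left_kernel[OF assms, of c] by blast
qed

text \<open>The entries of y^T V_i.\<close>

definition moments :: "(nat \<Rightarrow> real) \<Rightarrow> nat \<Rightarrow> nat \<Rightarrow> real" where
  "moments y i t = (\<Sum>r<n. y r * V i $$ (r, t))"

lemma moments_orth:
  assumes l: "l \<le> m" "t < h l"
  shows "moments y l t = (\<Sum>i\<le>l. \<Sum>p<b i. (\<Sum>r<n. y r * Q i $$ (r, p)) * R i l $$ (p, t))"
proof -
  have "moments y l t = (\<Sum>r<n. \<Sum>i\<le>l. \<Sum>p<b i. y r * Q i $$ (r, p) * R i l $$ (p, t))"
    unfolding moments_def by (intro sum.cong refl) (simp add: V_decomp[OF l] sum_distrib_left mult.assoc)
  also have "\<dots> = (\<Sum>i\<le>l. \<Sum>r<n. \<Sum>p<b i. y r * Q i $$ (r, p) * R i l $$ (p, t))" by (rule sum.swap)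
  also have "\<dots> = (\<Sum>i\<le>l. \<Sum>p<b i. \<Sum>r<n. y r * Q i $$ (r, p) * R i l $$ (p, t))"
    by (intro sum.cong refl sum.swap)
  finally show ?thesis by (simp add: sum_distrib_right)
qed

lemma sum_mons:
  assumes "monomial_ordering mons"
  shows "(\<Sum>\<alpha> | (\<Sum>r\<in>UNIV. \<alpha> r) = i. f \<alpha>) = (\<Sum>t<h i. f (mons i ! t))"
proof -
  have "{\<alpha>. (\<Sum>r\<in>UNIV. \<alpha> r) = i} = set (mons i)" "distinct (mons i)"
    using assms unfolding monomial_ordering_def by auto
  then show ?thesis
    unfolding h by (simp add: sum_list_distinct_conv_sum_set[symmetric] sum_list_sum_nth atLeast0LessThan)
qed

lemma moments_monomial: "t < h i \<Longrightarrow> moments y i t = (\<Sum>a<n. y a * monomial (mons i ! t) (x a))"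
  unfolding moments_def vandermonde_def h by (intro sum.cong) auto

text \<open>The columns of V_l with l < i lie in the span of the columns of Q_0, ..., Q_l.\<close>

lemma annihilates_orth:
  assumes mo: "monomial_ordering mons" and i: "i \<le> Suc m"
    and orth: "\<And>l p. l < i \<Longrightarrow> p < b l \<Longrightarrow> (\<Sum>r<n. y r * Q l $$ (r, p)) = 0"
  shows "annihilates n x y i"
  unfolding annihilates_def
proof (intro allI impI)
  fix \<alpha> :: "'d \<Rightarrow> nat" assume l: "(\<Sum>j\<in>UNIV. \<alpha> j) < i"
  define l where "l = (\<Sum>j\<in>UNIV. \<alpha> j)"
  have "\<alpha> \<in> set (mons l)" using mo unfolding monomial_ordering_def l_def by auto
  then obtain t where t: "t < h l" "\<alpha> = mons l ! t" unfolding h by (auto simp: in_set_conv_nth)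
  have "moments y l t = 0"
    using moments_orth[OF _ t(1), of y] orth l i unfolding l_def[symmetric] by simp
  then show "(\<Sum>a<n. y a * monomial \<alpha> (x a)) = 0" using moments_monomial[OF t(1), of y] t(2) by simp
qed

lemma gram_limit:
  assumes mo: "monomial_ordering mons" and k: "kernel_C m k" and il: "i \<le> m" "l \<le> m"
    and y: "annihilates n x y i" and y': "annihilates n x y' l"
  shows "((\<lambda>\<epsilon>. (\<Sum>a<n. \<Sum>a'<n. y a * y' a' * k (\<epsilon> *\<^sub>R x a) (\<epsilon> *\<^sub>R x a')) / \<epsilon> ^ (i + l)) \<longlongrightarrow>
     (\<Sum>t<h i. \<Sum>t'<h l. moments y i t * wronskian mons k i l $$ (t, t') * moments y' l t')) (at_right 0)"
proof -
  have "(\<Sum>\<alpha> | (\<Sum>r\<in>UNIV. \<alpha> r) = i. \<Sum>\<beta> | (\<Sum>r\<in>UNIV. \<beta> r) = l.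
       (\<Sum>a<n. y a * monomial \<alpha> (x a)) * kernel_coeff k \<alpha> \<beta> * (\<Sum>a<n. y' a * monomial \<beta> (x a)))
     = (\<Sum>t<h i. \<Sum>t'<h l. moments y i t * wronskian mons k i l $$ (t, t') * moments y' l t')"
    unfolding sum_mons[OF mo]
  proof (intro sum.cong refl)
    fix t t' assume "t \<in> {..<h i}" "t' \<in> {..<h l}"
    then have t: "t < h i" "t' < h l" by auto
    have "wronskian mons k i l $$ (t, t') = kernel_coeff k (mons i ! t) (mons l ! t')"
      using t unfolding wronskian_def kernel_coeff_def h by (simp add: Let_def)
    then show "(\<Sum>a<n. y a * monomial (mons i ! t) (x a)) * kernel_coeff k (mons i ! t) (mons l ! t') * (\<Sum>a<n. y' a * monomial (mons l ! t') (x a))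
        = moments y i t * wronskian mons k i l $$ (t, t') * moments y' l t'"
      by (simp add: moments_monomial t)
  qed
  then show ?thesis using kernel_limit[OF k il y y'] by simp
qed

lemma moments_Q:
  assumes "i \<le> m" "p < b i" "t < h i"
  shows "moments (\<lambda>r. Q i $$ (r, p)) i t = R i i $$ (p, t)"
  using Q_V[OF assms(1,3,1,2)] unfolding moments_def by simp

lemma annihilates_Q:
  assumes mo: "monomial_ordering mons" and i: "i \<le> m" "p < b i"
  shows "annihilates n x (\<lambda>r. Q i $$ (r, p)) i"
proof (rule annihilates_orth[OF mo])
  fix l p' assume "l < i" "p' < b l"
  then show "(\<Sum>r<n. Q i $$ (r, p) * Q l $$ (r, p')) = 0"
    using Q_orth[OF i, of l p'] i by simp
qed (use i in simp)

lemma RWR_index: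
  assumes il: "i \<le> m" "l \<le> m" and p: "p < b i" "p' < b l"
  shows "RWR R (wronskian mons k) i l $$ (p, p') =
    (\<Sum>t<h i. \<Sum>t'<h l. R i i $$ (p, t) * wronskian mons k i l $$ (t, t') * R l l $$ (p', t'))"
proof -
  have c: "R i i \<in> carrier_mat (b i) (h i)" "R l l \<in> carrier_mat (b l) (h l)" "wronskian mons k i l \<in> carrier_mat (h i) (h l)"
    using R_carrier il by (auto simp: wronskian_def h)
  have "(R i i * wronskian mons k i l * transpose_mat (R l l)) $$ (p, p')
     = (\<Sum>t<h i. R i i $$ (p, t) * (\<Sum>t'<h l. wronskian mons k i l $$ (t, t') * R l l $$ (p', t')))"
    using c p by (simp add: scalar_prod_def atLeast0LessThan)
  also have "\<dots> = (\<Sum>t<h i. \<Sum>t'<h l. R i i $$ (p, t) * wronskian mons k i l $$ (t, t') * R l l $$ (p', t'))"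
    by (simp add: sum_distrib_left mult.assoc)
  finally show ?thesis unfolding RWR_def .
qed

lemma RWR_carrier:
  assumes "i \<le> m" "l \<le> m"
  shows "RWR R (wronskian mons k) i l \<in> carrier_mat (b i) (b l)"
  using R_carrier assms unfolding RWR_def by (metis carrier_matD(1) carrier_matI index_mult_mat(2,3) index_transpose_mat(3) order_refl)

end

section \<open>Leading terms of analytic functions\<close>

lemma power_series_isCont:
  assumes "power_series_at_0 f c"
  shows "isCont f 0"
proof -
  obtain \<delta> where \<delta>: "\<delta> > 0" "\<And>s. \<bar>s\<bar> < \<delta> \<Longrightarrow> (\<lambda>m. c m * s ^ m) sums f s"
    using assms unfolding power_series_at_0_def by blast
  show ?thesis by (rule DERIV_isCont[OF power_series_derivative(1)[OF \<delta>(2)]]) (use \<delta>(1) in auto)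
qed

text \<open>The leading term comes from the first nonzero Taylor coefficient. The remainder divided
  by s^(a + 1) is again a power series, hence bounded near 0.\<close>

lemma analytic_leading_term:
  assumes f: "analytic_at_0 f" and nz: "\<not> eventually (\<lambda>\<epsilon>. f \<epsilon> = 0) (nhds 0)"
  shows "\<exists>a c. has_leading_term f a c"
proof -
  obtain c \<delta> where \<delta>: "\<delta> > 0" and ps: "\<And>s. \<bar>s\<bar> < \<delta> \<Longrightarrow> (\<lambda>m. c m * s ^ m) sums f s"
    using f unfolding analytic_at_0_def power_series_at_0_def by blast
  have ex: "\<exists>a. c a \<noteq> 0"
  proof (rule ccontr)
    assume "\<not> (\<exists>a. c a \<noteq> 0)"
    then have "f s = 0" if "\<bar>s\<bar> < \<delta>" for s using sums_unique2[OF ps[OF that]] by simp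
    then have "eventually (\<lambda>\<epsilon>. f \<epsilon> = 0) (nhds 0)"
      unfolding eventually_nhds_metric using \<delta> by (intro exI[of _ \<delta>]) simp
    with nz show False by blast
  qed
  define a where "a = (LEAST a. c a \<noteq> 0)"
  have ca: "c a \<noteq> 0" unfolding a_def by (rule LeastI_ex[OF ex])
  have below: "c i = 0" if "i < a" for i using not_less_Least[of i "\<lambda>a. c a \<noteq> 0"] that unfolding a_def by blast
  define \<Lambda> where "\<Lambda> s = (if s = 0 then c (a + 1) else (f s - c a * s ^ a) / s ^ (a + 1))" for s
  have "(\<lambda>m. c (m + (a + 1)) * s ^ m) sums \<Lambda> s" if s: "\<bar>s\<bar> < \<delta>" for s
  proof (cases "s = 0")
    case True
    then show ?thesis using powser_sums_zero[of "\<lambda>m. c (m + (a + 1))"] by (simp add: \<Lambda>_def)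
  next
    case False
    have "(\<lambda>m. c (m + (a + 1)) * s ^ (m + (a + 1))) sums (f s - (\<Sum>i<a + 1. c i * s ^ i))"
      by (rule sums_split_initial_segment[OF ps[OF s]])
    also have "(\<Sum>i<a + 1. c i * s ^ i) = c a * s ^ a" using below by simp
    finally have "(\<lambda>m. c (m + (a + 1)) * s ^ (m + (a + 1)) / s ^ (a + 1)) sums ((f s - c a * s ^ a) / s ^ (a + 1))"
      by (rule sums_divide)
    then show ?thesis using False by (simp add: \<Lambda>_def power_add)
  qed
  then have "power_series_at_0 \<Lambda> (\<lambda>m. c (m + (a + 1)))" unfolding power_series_at_0_def using \<delta> by blast
  then have "isCont \<Lambda> 0" by (rule power_series_isCont)
  then have "((\<lambda>\<epsilon>. norm (\<Lambda> \<epsilon>)) \<longlongrightarrow> norm (\<Lambda> 0)) (at 0)" unfolding isCont_def by (rule tendsto_norm)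
  then have "eventually (\<lambda>\<epsilon>. norm (\<Lambda> \<epsilon>) < norm (\<Lambda> 0) + 1) (at 0)" by (rule order_tendstoD(2)) simp
  moreover have "eventually (\<lambda>\<epsilon>::real. \<epsilon> \<noteq> 0) (at 0)" by (simp add: eventually_at_filter)
  ultimately have "eventually (\<lambda>\<epsilon>. norm (f \<epsilon> - c a * \<epsilon> ^ a) \<le> (norm (\<Lambda> 0) + 1) * norm (\<epsilon> ^ (a + 1))) (at 0)"
  proof eventually_elim
    case (elim \<epsilon>)
    then have "f \<epsilon> - c a * \<epsilon> ^ a = \<Lambda> \<epsilon> * \<epsilon> ^ (a + 1)" by (simp add: \<Lambda>_def)
    then have "norm (f \<epsilon> - c a * \<epsilon> ^ a) = norm (\<Lambda> \<epsilon>) * norm (\<epsilon> ^ (a + 1))" by (simp only: norm_mult)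
    then show ?case using elim(1) by (simp add: mult_right_mono)
  qed
  then have "(\<lambda>\<epsilon>. f \<epsilon> - c a * \<epsilon> ^ a) \<in> O[at 0](\<lambda>\<epsilon>. \<epsilon> ^ (a + 1))" by (rule bigoI)
  then show ?thesis unfolding has_leading_term_def using ca by blast
qed

lemma leading_term_limit:
  assumes "has_leading_term f a c"
  shows "((\<lambda>\<epsilon>. f \<epsilon> / \<epsilon> ^ a) \<longlongrightarrow> c) (at 0)"
proof -
  obtain C where C: "eventually (\<lambda>\<epsilon>. norm (f \<epsilon> - c * \<epsilon> ^ a) \<le> C * norm (\<epsilon> ^ (a + 1))) (at 0)"
    using assms unfolding has_leading_term_def by (auto elim: landau_o.bigE)
  have nz: "eventually (\<lambda>\<epsilon>::real. \<epsilon> \<noteq> 0) (at 0)" by (simp add: eventually_at_filter)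
  have "((\<lambda>\<epsilon>. f \<epsilon> / \<epsilon> ^ a - c) \<longlongrightarrow> 0) (at 0)"
  proof (rule Lim_null_comparison[where g = "\<lambda>\<epsilon>. C * \<bar>\<epsilon>\<bar>"])
    show "eventually (\<lambda>\<epsilon>. norm (f \<epsilon> / \<epsilon> ^ a - c) \<le> C * \<bar>\<epsilon>\<bar>) (at 0)"
      using C nz
    proof eventually_elim
      case (elim \<epsilon>)
      have "f \<epsilon> / \<epsilon> ^ a - c = (f \<epsilon> - c * \<epsilon> ^ a) / \<epsilon> ^ a" using elim(2) by (simp add: field_simps)
      then have "norm (f \<epsilon> / \<epsilon> ^ a - c) = norm (f \<epsilon> - c * \<epsilon> ^ a) / norm (\<epsilon> ^ a)" by (simp only: norm_divide)
      also have "\<dots> \<le> C * norm (\<epsilon> ^ (a + 1)) / norm (\<epsilon> ^ a)" by (rule divide_right_mono[OF elim(1)]) simp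
      also have "\<dots> = C * \<bar>\<epsilon>\<bar>" using elim(2) by (simp add: abs_mult)
      finally show ?case .
    qed
    show "((\<lambda>\<epsilon>::real. C * \<bar>\<epsilon>\<bar>) \<longlongrightarrow> 0) (at 0)" by (auto intro!: tendsto_eq_intros)
  qed
  then show ?thesis by (rule LIM_zero_cancel)
qed

lemma leading_term_unique:
  assumes "has_leading_term f a c" "has_leading_term f a' c'"
  shows "a = a' \<and> c = c'"
proof -
  have aux: "a' \<le> a" if 1: "has_leading_term f a c" and 2: "has_leading_term f a' c'" for a c a' c'
  proof (rule ccontr)
    assume "\<not> a' \<le> a"
    then have "a' - a > 0" "a' = (a' - a) + a" by auto
    then obtain i where i: "i > 0" "a' = i + a" by blast
    have "((\<lambda>\<epsilon>. f \<epsilon> / \<epsilon> ^ a' * \<epsilon> ^ i) \<longlongrightarrow> c' * 0 ^ i) (at 0)"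
      by (intro tendsto_mult leading_term_limit[OF 2] tendsto_power tendsto_ident_at)
    moreover have "eventually (\<lambda>\<epsilon>. f \<epsilon> / \<epsilon> ^ a' * \<epsilon> ^ i = f \<epsilon> / \<epsilon> ^ a) (at 0)"
    proof -
      have "eventually (\<lambda>\<epsilon>::real. \<epsilon> \<noteq> 0) (at 0)" by (simp add: eventually_at_filter)
      then show ?thesis by eventually_elim (simp add: i power_add)
    qed
    ultimately have "((\<lambda>\<epsilon>. f \<epsilon> / \<epsilon> ^ a) \<longlongrightarrow> c' * 0 ^ i) (at 0)" by (rule Lim_transform_eventually)
    with leading_term_limit[OF 1] have "c = c' * 0 ^ i" by (rule LIM_unique)
    then show False using i(1) 1 by (simp add: has_leading_term_def)
  qed
  have "a = a'" using aux[OF assms] aux[OF assms(2,1)] by simp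
  moreover have "c = c'" using leading_term_limit[OF assms(1)] leading_term_limit[OF assms(2)] LIM_unique unfolding \<open>a = a'\<close> by blast
  ultimately show ?thesis ..
qed

lemma lt_leading_term:
  assumes "has_leading_term f a c"
  shows "lt f = Polynomial.monom c a"
proof -
  have "\<not> eventually (\<lambda>\<epsilon>. f \<epsilon> = 0) (nhds 0)"
  proof
    assume "eventually (\<lambda>\<epsilon>. f \<epsilon> = 0) (nhds 0)"
    then have "eventually (\<lambda>\<epsilon>. f \<epsilon> = 0) (at 0)" by (simp add: eventually_nhds_conv_at)
    then have "eventually (\<lambda>\<epsilon>. 0 = f \<epsilon> / \<epsilon> ^ a) (at 0)" by eventually_elim simp
    then have "((\<lambda>\<epsilon>. f \<epsilon> / \<epsilon> ^ a) \<longlongrightarrow> 0) (at 0)" by (rule Lim_transform_eventually[OF tendsto_const])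
    from LIM_unique[OF this leading_term_limit[OF assms]] show False using assms by (simp add: has_leading_term_def)
  qed
  moreover have "(THE q. \<exists>a c. has_leading_term f a c \<and> q = Polynomial.monom c a) = Polynomial.monom c a"
    by (rule the_equality) (use assms leading_term_unique in blast)+
  ultimately show ?thesis unfolding lt_def by simp
qed

section \<open>The spectral equivalent of a kernel matrix\<close>

lemma sum_lessThan_add: "(\<Sum>t<N + n. f t) = (\<Sum>t<N. f t) + (\<Sum>i<n. f (N + i))" for f :: "nat \<Rightarrow> 'a::comm_monoid_add"
  by (induction n) (simp_all add: add.assoc)

lemma sum_upper_index: "(\<Sum>t\<in>{..<N + n} - {..<N}. f t) = (\<Sum>i<n. f (N + i))" for f :: "nat \<Rightarrow> real"
proof -
  have "(\<Sum>t<N + n. f t) = (\<Sum>t\<in>{..<N + n} - {..<N}. f t) + (\<Sum>t<N. f t)"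
    by (rule sum.subset_diff) auto
  then show ?thesis by (simp add: sum_lessThan_add)
qed

text \<open>Invertibility excludes the result None of \<open>mat_inverse\<close>, for which
  \<open>inv_mat\<close> would be unspecified.\<close>

lemma inv_mat_props:
  fixes A :: "real mat"
  assumes A: "A \<in> carrier_mat n n" and inv: "invertible_mat A"
  shows "inv_mat A \<in> carrier_mat n n" "A * inv_mat A = 1\<^sub>m n" "inv_mat A * A = 1\<^sub>m n"
proof -
  obtain B where B: "A * B = 1\<^sub>m n" "B * A = 1\<^sub>m (dim_row B)"
    using inv A unfolding invertible_mat_def inverts_mat_def by auto
  have "dim_col B = n" using B(1) by (metis index_mult_mat(3) index_one_mat(3))
  moreover have "dim_row B = n" using B(2) A by (metis carrier_matD(2) index_mult_mat(3) index_one_mat(3))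
  ultimately have Bc: "B \<in> carrier_mat n n" by auto
  have "mat_inverse A \<noteq> None"
  proof
    assume "mat_inverse A = None"
    then have "A \<notin> Units (ring_mat TYPE(real) n ())" by (rule mat_inverse(1)[OF A])
    moreover have "A \<in> Units (ring_mat TYPE(real) n ())"
      unfolding Units_def using A Bc B by (auto simp: ring_mat_simps intro!: bexI[of _ B])
    ultimately show False by blast
  qed
  then obtain C where C: "mat_inverse A = Some C" by blast
  from mat_inverse(2)[OF A C] show "inv_mat A \<in> carrier_mat n n" "A * inv_mat A = 1\<^sub>m n" "inv_mat A * A = 1\<^sub>m n"
    unfolding inv_mat_def C by auto
qed

lemma mat_mult_index_sum:
  fixes A B :: "real mat"
  assumes "A \<in> carrier_mat n k" "B \<in> carrier_mat k m" "i < n" "l < m"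
  shows "(A * B) $$ (i, l) = (\<Sum>s<k. A $$ (i, s) * B $$ (s, l))"
  using assms by (simp add: scalar_prod_def atLeast0LessThan)

section \<open>Kernel matrices as an instance of the abstract flat limit\<close>

locale kernel_flat_limit = vandermonde_qr mons n m x Q R b h
  for mons :: "nat \<Rightarrow> ('d::finite \<Rightarrow> nat) list" and n m x Q R b h +
  fixes k :: "real ^ 'd \<Rightarrow> real ^ 'd \<Rightarrow> real" and K :: "real \<Rightarrow> real mat"
    and W H :: "nat \<Rightarrow> nat \<Rightarrow> real mat" and lam :: "nat \<Rightarrow> real \<Rightarrow> real" and u :: "nat \<Rightarrow> real \<Rightarrow> real vec" and j :: nat
  assumes mo: "monomial_ordering mons" and kernel: "positive_definite_kernel k" and points: "inj_on x {..<n}"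
    and W: "W = wronskian mons k" and H: "H = RWR R W"
    and kC: "kernel_C m k" and K_carrier: "\<And>\<epsilon>. K \<epsilon> \<in> carrier_mat n n"
    and K_index: "\<And>\<epsilon> i l. 0 < \<epsilon> \<Longrightarrow> i < n \<Longrightarrow> l < n \<Longrightarrow> K \<epsilon> $$ (i, l) = k (\<epsilon> *\<^sub>R x i) (\<epsilon> *\<^sub>R x l)"
    and j: "j \<le> m" and eigen: "analytic_eigendecomposition n K lam u"
begin

definition \<kappa> :: "real \<Rightarrow> nat \<Rightarrow> nat \<Rightarrow> real" where "\<kappa> \<epsilon> i l = K \<epsilon> $$ (i, l)"
definition eigvec :: "nat \<Rightarrow> real \<Rightarrow> nat \<Rightarrow> real" where "eigvec q \<epsilon> i = vec_index (u q \<epsilon>) i"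
text \<open>The eigenvalues are positive for small \<open>\<epsilon> > 0\<close>, so that all of them have a leading term.\<close>

definition eig_order :: "nat \<Rightarrow> nat" where "eig_order q = (SOME a. \<exists>c. has_leading_term (lam q) a c)"
definition eig_coeff :: "nat \<Rightarrow> real" where "eig_coeff q = (SOME c. has_leading_term (lam q) (eig_order q) c)"

lemma ev_pos: "eventually (\<lambda>\<epsilon>::real. 0 < \<epsilon>) (at_right 0)"
  by (rule eventually_at_right_less)

lemma bform_kernel:
  assumes "0 < \<epsilon>"
  shows "bform n (\<kappa> \<epsilon>) y y' = (\<Sum>a<n. \<Sum>a'<n. y a * y' a' * k (\<epsilon> *\<^sub>R x a) (\<epsilon> *\<^sub>R x a'))"
  unfolding bform_def \<kappa>_def using K_index[OF assms] by (intro sum.cong refl) (simp add: mult_ac)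

lemma bform_limit:
  assumes "i \<le> m" "l \<le> m" "annihilates n x y i" "annihilates n x y' l"
  shows "((\<lambda>\<epsilon>. bform n (\<kappa> \<epsilon>) y y' / \<epsilon> ^ (i + l)) \<longlongrightarrow> (\<Sum>t<h i. \<Sum>t'<h l. moments y i t * W i l $$ (t, t') * moments y' l t')) (at_right 0)"
proof -
  have "eventually (\<lambda>\<epsilon>. (\<Sum>a<n. \<Sum>a'<n. y a * y' a' * k (\<epsilon> *\<^sub>R x a) (\<epsilon> *\<^sub>R x a')) / \<epsilon> ^ (i + l) = bform n (\<kappa> \<epsilon>) y y' / \<epsilon> ^ (i + l)) (at_right 0)"
    using ev_pos by eventually_elim (simp add: bform_kernel)
  from Lim_transform_eventually[OF gram_limit[OF mo kC assms] this] show ?thesis unfolding W .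
qed

lemma scaled_inj: "0 < \<epsilon> \<Longrightarrow> inj_on (\<lambda>a. \<epsilon> *\<^sub>R x a) {..<n}"
  using points by (auto simp: inj_on_def)

lemma eigen_near:
  obtains \<delta> where "\<delta> > 0" "\<And>\<epsilon> k. \<bar>\<epsilon>\<bar> < \<delta> \<Longrightarrow> k < n \<Longrightarrow> u k \<epsilon> \<in> carrier_vec n \<and> K \<epsilon> *\<^sub>v u k \<epsilon> = lam k \<epsilon> \<cdot>\<^sub>v u k \<epsilon>"
    "\<And>\<epsilon> k l. \<bar>\<epsilon>\<bar> < \<delta> \<Longrightarrow> k < n \<Longrightarrow> l < n \<Longrightarrow> ip n (eigvec k \<epsilon>) (eigvec l \<epsilon>) = (if k = l then 1 else 0)"
proof -
  obtain \<delta> where \<delta>: "\<delta> > 0" "\<And>\<epsilon>. \<bar>\<epsilon>\<bar> < \<delta> \<Longrightarrow>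
        (\<forall>k<n. u k \<epsilon> \<in> carrier_vec n \<and> K \<epsilon> *\<^sub>v u k \<epsilon> = lam k \<epsilon> \<cdot>\<^sub>v u k \<epsilon>) \<and>
        (\<forall>k<n. \<forall>l<n. u k \<epsilon> \<bullet> u l \<epsilon> = (if k = l then 1 else 0))"
    using eigen unfolding analytic_eigendecomposition_def by blast
  show ?thesis
  proof (rule that[OF \<delta>(1)])
    fix \<epsilon> k assume "\<bar>\<epsilon>\<bar> < \<delta>" "k < n"
    then show "u k \<epsilon> \<in> carrier_vec n \<and> K \<epsilon> *\<^sub>v u k \<epsilon> = lam k \<epsilon> \<cdot>\<^sub>v u k \<epsilon>" using \<delta>(2) by blast
  next
    fix \<epsilon> k l assume e: "\<bar>\<epsilon>\<bar> < \<delta>" "k < n" "l < n"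
    then have "u l \<epsilon> \<in> carrier_vec n" "u k \<epsilon> \<bullet> u l \<epsilon> = (if k = l then 1 else 0)" using \<delta>(2) by blast+
    then show "ip n (eigvec k \<epsilon>) (eigvec l \<epsilon>) = (if k = l then 1 else 0)"
      unfolding ip_def eigvec_def by (simp add: scalar_prod_def atLeast0LessThan)
  qed
qed

text \<open>A square matrix with orthonormal rows has orthonormal columns, because a right inverse
  is a left inverse.\<close>

lemma orthonormal_complete:
  assumes o: "\<And>k l. k < n \<Longrightarrow> l < n \<Longrightarrow> ip n (v k) (v l) = (if k = l then 1 else 0)"
    and il: "i < n" "l < n"
  shows "(\<Sum>k<n. v k i * v k l) = (if i = l then 1 else 0)"
proof -
  define U where "U = Matrix.mat n n (\<lambda>(k, i). v k i)"
  have U: "U \<in> carrier_mat n n" unfolding U_def by simp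
  have UT: "transpose_mat U \<in> carrier_mat n n" using U by simp
  have "U * transpose_mat U = 1\<^sub>m n"
  proof (rule eq_matI)
    fix k l assume "k < dim_row (1\<^sub>m n :: real mat)" "l < dim_col (1\<^sub>m n :: real mat)"
    then have kl: "k < n" "l < n" by auto
    have "(U * transpose_mat U) $$ (k, l) = (\<Sum>s<n. U $$ (k, s) * transpose_mat U $$ (s, l))"
      by (rule mat_mult_index_sum[OF U UT kl])
    also have "\<dots> = ip n (v k) (v l)" unfolding ip_def U_def using kl by (intro sum.cong) auto
    finally show "(U * transpose_mat U) $$ (k, l) = 1\<^sub>m n $$ (k, l)" using o[OF kl] kl by simp
  qed (use U in simp_all)
  from mat_mult_left_right_inverse[OF U UT this] have e: "transpose_mat U * U = 1\<^sub>m n" .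
  have "(transpose_mat U * U) $$ (i, l) = (\<Sum>s<n. transpose_mat U $$ (i, s) * U $$ (s, l))"
    by (rule mat_mult_index_sum[OF UT U il])
  also have "\<dots> = (\<Sum>k<n. v k i * v k l)" unfolding U_def using il by (intro sum.cong) auto
  finally show ?thesis unfolding e using il by simp
qed

lemma spectral_near:
  "eventually (\<lambda>\<epsilon>. \<forall>v w. bform n (\<kappa> \<epsilon>) v w = (\<Sum>k<n. lam k \<epsilon> * ip n (eigvec k \<epsilon>) v * ip n (eigvec k \<epsilon>) w)) (at_right 0)"
proof -
  obtain \<delta> where \<delta>: "\<delta> > 0" "\<And>\<epsilon> k. \<bar>\<epsilon>\<bar> < \<delta> \<Longrightarrow> k < n \<Longrightarrow> u k \<epsilon> \<in> carrier_vec n \<and> K \<epsilon> *\<^sub>v u k \<epsilon> = lam k \<epsilon> \<cdot>\<^sub>v u k \<epsilon>"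
    "\<And>\<epsilon> k l. \<bar>\<epsilon>\<bar> < \<delta> \<Longrightarrow> k < n \<Longrightarrow> l < n \<Longrightarrow> ip n (eigvec k \<epsilon>) (eigvec l \<epsilon>) = (if k = l then 1 else 0)"
    using eigen_near by blast
  have "eventually (\<lambda>\<epsilon>. 0 < \<epsilon> \<and> \<epsilon> < \<delta>) (at_right (0::real))"
    using \<delta>(1) by (auto simp: eventually_at_right_field intro: exI[of _ \<delta>])
  then show ?thesis
  proof eventually_elim
    case (elim \<epsilon>)
    then have e: "\<bar>\<epsilon>\<bar> < \<delta>" by simp
    have Ku: "(\<Sum>s<n. \<kappa> \<epsilon> i s * eigvec k \<epsilon> s) = lam k \<epsilon> * eigvec k \<epsilon> i" if "k < n" "i < n" for k i
    proof -
      have "vec_index (K \<epsilon> *\<^sub>v u k \<epsilon>) i = vec_index (lam k \<epsilon> \<cdot>\<^sub>v u k \<epsilon>) i" using \<delta>(2)[OF e that(1)] by simp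
      moreover have "dim_vec (u k \<epsilon>) = n" using \<delta>(2)[OF e that(1)] carrier_vecD by blast
      moreover have "dim_row (K \<epsilon>) = n" "dim_col (K \<epsilon>) = n" using K_carrier[of \<epsilon>] by auto
      ultimately show ?thesis
        using that(2) unfolding \<kappa>_def eigvec_def by (simp add: scalar_prod_def atLeast0LessThan)
    qed
    have \<kappa>e: "\<kappa> \<epsilon> i l = (\<Sum>k<n. lam k \<epsilon> * eigvec k \<epsilon> i * eigvec k \<epsilon> l)" if il: "i < n" "l < n" for i l
    proof -
      have "(\<Sum>k<n. lam k \<epsilon> * eigvec k \<epsilon> i * eigvec k \<epsilon> l) = (\<Sum>k<n. (\<Sum>s<n. \<kappa> \<epsilon> i s * eigvec k \<epsilon> s) * eigvec k \<epsilon> l)"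
        using Ku il by (intro sum.cong) auto
      also have "\<dots> = (\<Sum>s<n. \<kappa> \<epsilon> i s * (\<Sum>k<n. eigvec k \<epsilon> s * eigvec k \<epsilon> l))"
        unfolding sum_distrib_left sum_distrib_right by (subst sum.swap) (simp add: mult.assoc)
      also have "\<dots> = (\<Sum>s<n. \<kappa> \<epsilon> i s * (if s = l then 1 else 0))"
        using orthonormal_complete[of "\<lambda>k. eigvec k \<epsilon>", OF \<delta>(3)[OF e]] il by (intro sum.cong refl) auto
      also have "\<dots> = \<kappa> \<epsilon> i l" using il by (simp add: if_distrib cong: if_cong)
      finally show ?thesis by simp
    qed
    show ?case
    proof (intro allI)
      fix v w
      have "bform n (\<kappa> \<epsilon>) v w = (\<Sum>i<n. \<Sum>l<n. \<Sum>k<n. lam k \<epsilon> * (eigvec k \<epsilon> i * v i) * (eigvec k \<epsilon> l * w l))"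
        unfolding bform_def using \<kappa>e by (intro sum.cong refl) (simp add: sum_distrib_left sum_distrib_right mult_ac)
      also have "\<dots> = (\<Sum>i<n. \<Sum>k<n. \<Sum>l<n. lam k \<epsilon> * (eigvec k \<epsilon> i * v i) * (eigvec k \<epsilon> l * w l))"
        by (intro sum.cong refl sum.swap)
      also have "\<dots> = (\<Sum>k<n. \<Sum>i<n. \<Sum>l<n. lam k \<epsilon> * (eigvec k \<epsilon> i * v i) * (eigvec k \<epsilon> l * w l))"
        by (rule sum.swap)
      also have "\<dots> = (\<Sum>k<n. lam k \<epsilon> * ip n (eigvec k \<epsilon>) v * ip n (eigvec k \<epsilon>) w)"
        unfolding ip_def by (intro sum.cong refl) (simp add: sum_distrib_left sum_distrib_right mult.assoc, rule sum.swap)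
      finally show "bform n (\<kappa> \<epsilon>) v w = (\<Sum>k<n. lam k \<epsilon> * ip n (eigvec k \<epsilon>) v * ip n (eigvec k \<epsilon>) w)" .
    qed
  qed
qed

lemma uorth_near: "eventually (\<lambda>\<epsilon>. \<forall>k<n. \<forall>l<n. ip n (eigvec k \<epsilon>) (eigvec l \<epsilon>) = (if k = l then 1 else 0)) (at_right 0)"
proof (rule eigen_near)
  fix \<delta> :: real
  assume \<delta>: "\<delta> > 0" "\<And>\<epsilon> k l. \<bar>\<epsilon>\<bar> < \<delta> \<Longrightarrow> k < n \<Longrightarrow> l < n \<Longrightarrow> ip n (eigvec k \<epsilon>) (eigvec l \<epsilon>) = (if k = l then 1 else 0)"
  have "eventually (\<lambda>\<epsilon>. 0 < \<epsilon> \<and> \<epsilon> < \<delta>) (at_right (0::real))"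
    using \<delta>(1) by (auto simp: eventually_at_right_field intro: exI[of _ \<delta>])
  then show ?thesis by eventually_elim (intro allI impI \<delta>(2), auto)
qed

lemma u0_orth:
  assumes ql: "q < n" "l < n"
  shows "ip n (eigvec q 0) (eigvec l 0) = (if q = l then 1 else 0)"
proof (rule eigen_near)
  fix \<delta> :: real
  assume \<delta>: "\<delta> > 0" "\<And>\<epsilon> k l. \<bar>\<epsilon>\<bar> < \<delta> \<Longrightarrow> k < n \<Longrightarrow> l < n \<Longrightarrow> ip n (eigvec k \<epsilon>) (eigvec l \<epsilon>) = (if k = l then 1 else 0)"
  from \<delta>(1) have "\<bar>0\<bar> < \<delta>" by simp
  from \<delta>(2)[OF this ql] show ?thesis .
qed

lemma lam_pos: "eventually (\<lambda>\<epsilon>. \<forall>k<n. lam k \<epsilon> > 0) (at_right 0)"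
  using spectral_near uorth_near ev_pos
proof eventually_elim
  case (elim \<epsilon>)
  show ?case
  proof (intro allI impI)
    fix k' assume k': "k' < n"
    have "bform n (\<kappa> \<epsilon>) (eigvec k' \<epsilon>) (eigvec k' \<epsilon>) = (\<Sum>s<n. lam s \<epsilon> * ip n (eigvec s \<epsilon>) (eigvec k' \<epsilon>) * ip n (eigvec s \<epsilon>) (eigvec k' \<epsilon>))"
      using elim(1) by blast
    also have "\<dots> = (\<Sum>s<n. if s = k' then lam k' \<epsilon> else 0)"
      using elim(2) k' by (intro sum.cong refl) auto
    also have "\<dots> = lam k' \<epsilon>" using k' by simp
    finally have e: "bform n (\<kappa> \<epsilon>) (eigvec k' \<epsilon>) (eigvec k' \<epsilon>) = lam k' \<epsilon>" .
    have "ip n (eigvec k' \<epsilon>) (eigvec k' \<epsilon>) = 1" using elim(2) k' by auto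
    then have "\<exists>a<n. eigvec k' \<epsilon> a \<noteq> 0" unfolding ip_def by (metis (no_types, lifting) lessThan_iff mult_zero_left sum.neutral zero_neq_one)
    then obtain a where "a < n" "eigvec k' \<epsilon> a \<noteq> 0" by blast
    from kernel_form_pos(2)[OF kernel scaled_inj[OF elim(3)], of a "eigvec k' \<epsilon>"] this
    show "lam k' \<epsilon> > 0" unfolding e[symmetric] bform_kernel[OF elim(3)] by blast
  qed
qed

lemma lam_leading:
  assumes k': "k' < n"
  shows "has_leading_term (lam k') (eig_order k') (eig_coeff k')"
proof -
  have an: "analytic_at_0 (lam k')" using eigen k' unfolding analytic_eigendecomposition_def by blast
  have "\<not> eventually (\<lambda>\<epsilon>. lam k' \<epsilon> = 0) (nhds 0)"
  proof
    assume "eventually (\<lambda>\<epsilon>. lam k' \<epsilon> = 0) (nhds 0)"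
    then have "eventually (\<lambda>\<epsilon>. lam k' \<epsilon> = 0) (at_right 0)"
      by (simp add: eventually_nhds_conv_at eventually_at_split)
    with lam_pos have "eventually (\<lambda>\<epsilon>::real. False) (at_right 0)"
      by eventually_elim (use k' in force)
    then show False by simp
  qed
  from analytic_leading_term[OF an this] have "\<exists>c. has_leading_term (lam k') (eig_order k') c"
    unfolding eig_order_def by (rule someI_ex)
  then show ?thesis unfolding eig_coeff_def by (rule someI_ex)
qed

lemma of_order_iff: "k' < n \<Longrightarrow> of_order (lam k') a \<longleftrightarrow> eig_order k' = a"
  using lam_leading leading_term_unique unfolding of_order_def by blast

definition leading_entry :: "nat \<Rightarrow> nat \<Rightarrow> real" where
  "leading_entry i l = (\<Sum>k<n. (if eig_order k = 2 * j then eig_coeff k else 0) * (eigvec k 0 i * eigvec k 0 l))"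

lemma coeff_mat_index:
  assumes "i < n" "l < n"
  shows "coeff_mat (spectral_equivalent n lam u) (2 * j) $$ (i, l) = leading_entry i l"
proof -
  have "coeff_mat (spectral_equivalent n lam u) (2 * j) $$ (i, l)
      = (\<Sum>k<n. vec_index (u k 0) i * vec_index (u k 0) l * Polynomial.coeff (lt (lam k)) (2 * j))"
    using assms unfolding coeff_mat_def spectral_equivalent_def by (simp add: coeff_sum)
  also have "\<dots> = leading_entry i l"
    unfolding leading_entry_def eigvec_def using lt_leading_term[OF lam_leading] by (intro sum.cong refl) auto
  finally show ?thesis .
qed

lemma coeff_mat_carrier: "coeff_mat (spectral_equivalent n lam u) (2 * j) \<in> carrier_mat n n"
  unfolding coeff_mat_def spectral_equivalent_def by simp

text \<open>
  The index \<open>s < N\<close> stands for row \<open>row_of s\<close> of block \<open>block_of s\<close> in \<open>lead_blocks b H j\<close>. The vectors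
  \<open>basis_vec t\<close> are the columns of \<open>Q\<^sub>0, \<dots>, Q\<^sub>j\<^sub>-\<^sub>1\<close> for \<open>t < N\<close>, followed by the \<open>n\<close> unit vectors projected to
  the orthogonal complement of these columns; the latter are redundant, so that \<open>coord_vec\<close> gives only
  one possible choice of coordinates.
\<close>

definition N :: nat where "N = length (block_indices b [0..<j])"
definition block_of :: "nat \<Rightarrow> nat" where "block_of s = fst (block_indices b [0..<j] ! s)"
definition row_of :: "nat \<Rightarrow> nat" where "row_of s = snd (block_indices b [0..<j] ! s)"
definition basis_vec :: "nat \<Rightarrow> nat \<Rightarrow> real" where
  "basis_vec t r = (if t < N then Q (block_of t) $$ (r, row_of t)
     else (if r = t - N then 1 else 0) - (\<Sum>s<N. Q (block_of s) $$ (t - N, row_of s) * Q (block_of s) $$ (r, row_of s)))"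
definition coord_vec :: "nat \<Rightarrow> nat \<Rightarrow> real" where
  "coord_vec t r = (if t < N then Q (block_of t) $$ (r, row_of t) else if r = t - N then 1 else 0)"
definition basis_deg :: "nat \<Rightarrow> nat" where "basis_deg t = (if t < N then block_of t else j)"
text \<open>The limit supplied by \<open>bform_limit\<close> for two basis vectors in their
  degrees.\<close>

definition M0 :: "nat \<Rightarrow> nat \<Rightarrow> real" where
  "M0 t t' = (\<Sum>\<tau><h (basis_deg t). \<Sum>\<tau>'<h (basis_deg t'). moments (basis_vec t) (basis_deg t) \<tau> * W (basis_deg t) (basis_deg t') $$ (\<tau>, \<tau>') * moments (basis_vec t') (basis_deg t') \<tau>')"

lemma q_index: "s < N \<Longrightarrow> block_of s < j" "s < N \<Longrightarrow> row_of s < b (block_of s)"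
  using block_index_bounds[of s b j "block_of s" "row_of s"] unfolding N_def block_of_def row_of_def by auto

lemma q_index_le: "s < N \<Longrightarrow> block_of s \<le> m"
  using q_index(1) j by force

lemma q_surj: "i < j \<Longrightarrow> p < b i \<Longrightarrow> \<exists>s<N. block_of s = i \<and> row_of s = p"
  using block_index_exists[of i j p b] unfolding N_def block_of_def row_of_def by (metis fst_conv snd_conv)

lemma basis_vec_orth:
  assumes "s < N" "s' < N"
  shows "ip n (basis_vec s) (basis_vec s') = (if s = s' then 1 else 0)"
proof -
  have "ip n (basis_vec s) (basis_vec s') = (if block_of s = block_of s' \<and> row_of s = row_of s' then 1 else 0)"
    unfolding ip_def basis_vec_def using Q_orth[OF q_index_le[OF assms(1)] q_index(2)[OF assms(1)] q_index_le[OF assms(2)] q_index(2)[OF assms(2)]] assms by simp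
  moreover have "block_of s = block_of s' \<and> row_of s = row_of s' \<longleftrightarrow> s = s'"
    using assms nth_eq_iff_index_eq[OF distinct_block_indices, of s b j s'] unfolding N_def block_of_def row_of_def by (auto simp: prod_eq_iff)
  ultimately show ?thesis by simp
qed

lemma basis_vec_upper_expand: "basis_vec (N + i) = (\<lambda>r. (if r = i then 1 else 0) - (\<Sum>s<N. basis_vec s i * basis_vec s r))"
  unfolding basis_vec_def by (rule ext) simp

lemma ip_unit: "i < n \<Longrightarrow> ip n y (\<lambda>r. if r = i then 1 else 0) = y i"
  unfolding ip_def by (simp add: if_distrib cong: if_cong)

lemma basis_vec_lower_upper:
  assumes s: "s < N" and i: "i < n"
  shows "ip n (basis_vec s) (basis_vec (N + i)) = 0"
proof -
  have "ip n (basis_vec s) (basis_vec (N + i)) = basis_vec s i - (\<Sum>s'<N. basis_vec s' i * ip n (basis_vec s) (basis_vec s'))"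
    unfolding basis_vec_upper_expand ip_diff_right ip_sum_right ip_unit[OF i] ..
  also have "(\<Sum>s'<N. basis_vec s' i * ip n (basis_vec s) (basis_vec s')) = (\<Sum>s'<N. if s' = s then basis_vec s i else 0)"
    using basis_vec_orth[OF s] by (intro sum.cong refl) auto
  also have "\<dots> = basis_vec s i" using s by simp
  finally show ?thesis by simp
qed

lemma basis_vec_annihilates: "t < N + n \<Longrightarrow> annihilates n x (basis_vec t) (basis_deg t)"
proof (cases "t < N")
  case True
  then have "basis_vec t = (\<lambda>r. Q (block_of t) $$ (r, row_of t))" "basis_deg t = block_of t" by (auto simp: basis_vec_def basis_deg_def)
  then show ?thesis using annihilates_Q[OF mo q_index_le[OF True] q_index(2)[OF True]] by simp
next
  case False
  assume t: "t < N + n"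
  define i where "i = t - N"
  have i: "i < n" "t = N + i" using t False unfolding i_def by auto
  have "annihilates n x (basis_vec t) j"
  proof (rule annihilates_orth[OF mo])
    fix l p assume "l < j" "p < b l"
    then obtain s where s: "s < N" "block_of s = l" "row_of s = p" using q_surj by blast
    have "(\<Sum>r<n. basis_vec t r * Q l $$ (r, p)) = ip n (basis_vec s) (basis_vec t)"
      unfolding ip_def using s by (intro sum.cong refl) (simp add: basis_vec_def[of s] mult.commute)
    then show "(\<Sum>r<n. basis_vec t r * Q l $$ (r, p)) = 0" using basis_vec_lower_upper[OF s(1) i(1)] i(2) by simp
  qed (use j in simp)
  then show ?thesis using False by (simp add: basis_deg_def)
qed

lemma basis_deg_le: "basis_deg t \<le> m"
  using q_index_le j by (auto simp: basis_deg_def)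

lemma moments_lower: "s < N \<Longrightarrow> \<tau> < h (block_of s) \<Longrightarrow> moments (basis_vec s) (block_of s) \<tau> = R (block_of s) (block_of s) $$ (row_of s, \<tau>)"
  using moments_Q[OF q_index_le q_index(2), of s \<tau>] unfolding moments_def basis_vec_def by simp

text \<open>The projected unit vector is orthogonal to all columns of Q_i with i < j, and pairs with
  the columns of Q_j like the unit vector itself. So its moments of degree j form row i of Q_j R_jj,
  which puts Q_j on the outside of the Schur complement.\<close>

lemma moments_upper:
  assumes i: "i < n" and \<tau>: "\<tau> < h j"
  shows "moments (basis_vec (N + i)) j \<tau> = (\<Sum>p<b j. Q j $$ (i, p) * R j j $$ (p, \<tau>))"
proof -
  let ?y = "basis_vec (N + i)"
  have low: "(\<Sum>r<n. ?y r * Q l $$ (r, p)) = 0" if lp: "l < j" "p < b l" for l p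
  proof -
    obtain s where s: "s < N" "block_of s = l" "row_of s = p" using q_surj[OF lp] by blast
    have "(\<Sum>r<n. ?y r * Q l $$ (r, p)) = ip n (basis_vec s) ?y"
      unfolding ip_def using s by (intro sum.cong refl) (simp add: basis_vec_def[of s] mult.commute)
    then show ?thesis using basis_vec_lower_upper[OF s(1) i] by simp
  qed
  have top: "(\<Sum>r<n. ?y r * Q j $$ (r, p)) = Q j $$ (i, p)" if p: "p < b j" for p
  proof -
    let ?z = "\<lambda>r. Q j $$ (r, p)"
    have z: "ip n ?z (basis_vec s) = 0" if s: "s < N" for s
    proof -
      have "ip n ?z (basis_vec s) = (\<Sum>r<n. Q j $$ (r, p) * Q (block_of s) $$ (r, row_of s))"
        unfolding ip_def using s by (simp add: basis_vec_def)
      then show ?thesis using Q_orth[OF j p q_index_le[OF s] q_index(2)[OF s]] q_index(1)[OF s] by simp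
    qed
    have "(\<Sum>r<n. ?y r * Q j $$ (r, p)) = ip n ?z ?y" unfolding ip_def by (simp add: mult.commute)
    also have "\<dots> = Q j $$ (i, p) - (\<Sum>s<N. basis_vec s i * ip n ?z (basis_vec s))"
      unfolding basis_vec_upper_expand ip_diff_right ip_sum_right ip_unit[OF i] ..
    also have "(\<Sum>s<N. basis_vec s i * ip n ?z (basis_vec s)) = 0" using z by simp
    finally show ?thesis by simp
  qed
  have "moments ?y j \<tau> = (\<Sum>l\<le>j. if l = j then (\<Sum>p<b j. Q j $$ (i, p) * R j j $$ (p, \<tau>)) else 0)"
    unfolding moments_orth[OF j \<tau>] using low top by (intro sum.cong refl) auto
  then show ?thesis by simp
qed

lemma lead_carrier: "lead_blocks b H j \<in> carrier_mat N N"
  unfolding lead_blocks_def block_mat_def N_def by (simp add: Let_def)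

lemma lead_index:
  assumes "s < N" "s' < N"
  shows "lead_blocks b H j $$ (s, s') = H (block_of s) (block_of s') $$ (row_of s, row_of s')"
  using assms unfolding lead_blocks_def block_mat_def N_def block_of_def row_of_def by (simp add: Let_def)

lemma left_carrier: "left_blocks b H j \<in> carrier_mat (b j) N"
  unfolding left_blocks_def block_mat_def N_def by (simp add: Let_def block_indices_def)

lemma left_index:
  assumes "p < b j" "s < N"
  shows "left_blocks b H j $$ (p, s) = H j (block_of s) $$ (p, row_of s)"
  using assms unfolding left_blocks_def block_mat_def N_def block_of_def row_of_def
  by (simp add: Let_def block_indices_def[of b "[j]"])

lemma H_index:
  assumes "i \<le> m" "l \<le> m" "p < b i" "p' < b l"
  shows "H i l $$ (p, p') = (\<Sum>t<h i. \<Sum>t'<h l. R i i $$ (p, t) * W i l $$ (t, t') * R l l $$ (p', t'))"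
  unfolding H W by (rule RWR_index[OF assms])

lemma H_carrier: "i \<le> m \<Longrightarrow> l \<le> m \<Longrightarrow> H i l \<in> carrier_mat (b i) (b l)"
  unfolding H W by (rule RWR_carrier)

lemma M0_lower: "s < N \<Longrightarrow> s' < N \<Longrightarrow> M0 s s' = lead_blocks b H j $$ (s, s')"
  unfolding lead_index H_index[OF q_index_le q_index_le q_index(2) q_index(2)] M0_def
  by (intro sum.cong) (auto simp: basis_deg_def moments_lower)

lemma M0_mixed:
  assumes i: "i < n" and s: "s < N"
  shows "M0 (N + i) s = (\<Sum>p<b j. Q j $$ (i, p) * left_blocks b H j $$ (p, s))"
proof -
  let ?w = "\<lambda>p \<tau> \<tau>'. R j j $$ (p, \<tau>) * W j (block_of s) $$ (\<tau>, \<tau>') * R (block_of s) (block_of s) $$ (row_of s, \<tau>')"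
  have "M0 (N + i) s = (\<Sum>\<tau><h j. \<Sum>\<tau>'<h (block_of s). \<Sum>p<b j. Q j $$ (i, p) * ?w p \<tau> \<tau>')"
    unfolding M0_def using s i by (intro sum.cong) (auto simp: basis_deg_def moments_lower moments_upper sum_distrib_right mult.assoc)
  also have "\<dots> = (\<Sum>\<tau><h j. \<Sum>p<b j. \<Sum>\<tau>'<h (block_of s). Q j $$ (i, p) * ?w p \<tau> \<tau>')"
    by (intro sum.cong refl sum.swap)
  also have "\<dots> = (\<Sum>p<b j. \<Sum>\<tau><h j. \<Sum>\<tau>'<h (block_of s). Q j $$ (i, p) * ?w p \<tau> \<tau>')" by (rule sum.swap)
  also have "\<dots> = (\<Sum>p<b j. Q j $$ (i, p) * left_blocks b H j $$ (p, s))"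
    using s by (intro sum.cong refl) (simp add: left_index H_index[OF j q_index_le _ q_index(2)] sum_distrib_left)
  finally show ?thesis .
qed

lemma M0_upper:
  assumes i: "i < n" and l: "l < n"
  shows "M0 (N + i) (N + l) = (\<Sum>p<b j. \<Sum>p'<b j. Q j $$ (i, p) * H j j $$ (p, p') * Q j $$ (l, p'))"
proof -
  let ?w = "\<lambda>p p' \<tau> \<tau>'. R j j $$ (p, \<tau>) * W j j $$ (\<tau>, \<tau>') * R j j $$ (p', \<tau>')"
  let ?f = "\<lambda>p p' \<tau> \<tau>'. Q j $$ (i, p) * (?w p p' \<tau> \<tau>' * Q j $$ (l, p'))"
  have "M0 (N + i) (N + l) = (\<Sum>\<tau><h j. \<Sum>\<tau>'<h j. (\<Sum>p<b j. Q j $$ (i, p) * R j j $$ (p, \<tau>)) * W j j $$ (\<tau>, \<tau>') * (\<Sum>p'<b j. Q j $$ (l, p') * R j j $$ (p', \<tau>')))"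
    unfolding M0_def using i l by (intro sum.cong) (auto simp: basis_deg_def moments_upper)
  also have "\<dots> = (\<Sum>\<tau><h j. \<Sum>\<tau>'<h j. \<Sum>p<b j. \<Sum>p'<b j. ?f p p' \<tau> \<tau>')"
    by (intro sum.cong refl) (simp add: sum_distrib_left sum_distrib_right sum_product mult_ac)
  also have "\<dots> = (\<Sum>\<tau><h j. \<Sum>p<b j. \<Sum>\<tau>'<h j. \<Sum>p'<b j. ?f p p' \<tau> \<tau>')"
    by (intro sum.cong refl sum.swap)
  also have "\<dots> = (\<Sum>p<b j. \<Sum>\<tau><h j. \<Sum>\<tau>'<h j. \<Sum>p'<b j. ?f p p' \<tau> \<tau>')" by (rule sum.swap)
  also have "\<dots> = (\<Sum>p<b j. \<Sum>\<tau><h j. \<Sum>p'<b j. \<Sum>\<tau>'<h j. ?f p p' \<tau> \<tau>')"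
    by (intro sum.cong refl sum.swap)
  also have "\<dots> = (\<Sum>p<b j. \<Sum>p'<b j. \<Sum>\<tau><h j. \<Sum>\<tau>'<h j. ?f p p' \<tau> \<tau>')"
    by (intro sum.cong refl sum.swap)
  also have "\<dots> = (\<Sum>p<b j. \<Sum>p'<b j. Q j $$ (i, p) * H j j $$ (p, p') * Q j $$ (l, p'))"
    by (intro sum.cong refl) (simp add: H_index[OF j j] sum_distrib_left sum_distrib_right mult.assoc)
  finally show ?thesis .
qed

text \<open>The lower columns reproduce the projection of w, and the projected unit vectors with
  weights w i reproduce w minus this projection.\<close>

lemma basis_vec_coord:
  assumes "l < n"
  shows "w l = (\<Sum>t<N + n. ip n (coord_vec t) w * basis_vec t l)"
proof -
  have p1: "ip n (coord_vec s) w = ip n (basis_vec s) w" if "s < N" for s using that unfolding ip_def coord_vec_def basis_vec_def by simp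
  have p2: "ip n (coord_vec (N + i)) w = w i" if "i < n" for i
    using ip_unit[OF that, of w] unfolding ip_def coord_vec_def by (simp add: mult.commute)
  have "(\<Sum>i<n. ip n (coord_vec (N + i)) w * basis_vec (N + i) l) = (\<Sum>i<n. w i * ((if l = i then 1 else 0) - (\<Sum>s<N. basis_vec s i * basis_vec s l)))"
    unfolding basis_vec_upper_expand using p2 by (intro sum.cong) auto
  also have "\<dots> = (\<Sum>i<n. if l = i then w i else 0) - (\<Sum>i<n. \<Sum>s<N. w i * basis_vec s i * basis_vec s l)"
    unfolding sum_subtractf[symmetric] by (intro sum.cong refl) (auto simp: right_diff_distrib sum_distrib_left mult.assoc)
  also have "(\<Sum>i<n. \<Sum>s<N. w i * basis_vec s i * basis_vec s l) = (\<Sum>s<N. ip n (basis_vec s) w * basis_vec s l)"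
    unfolding ip_def sum_distrib_right by (subst sum.swap) (simp add: mult_ac)
  finally show ?thesis unfolding sum_lessThan_add using assms p1 by simp
qed

lemma flat_spectrum_kernel:
  assumes inv: "invertible_mat (lead_blocks b H j)"
  shows "flat_spectrum n j \<kappa> lam eigvec (\<lambda>k. eigvec k 0) eig_order eig_coeff {..<N} {..<N + n} basis_vec coord_vec basis_deg M0 (\<lambda>s t. inv_mat (lead_blocks b H j) $$ (s, t))"
proof
  note I = inv_mat_props[OF lead_carrier inv]
  show "finite {..<N + n}" "{..<N} \<subseteq> {..<N + n}" by auto
  show "basis_deg s < j" if "s \<in> {..<N}" for s using that q_index(1) by (simp add: basis_deg_def)
  show "basis_deg t = j" if "t \<in> {..<N + n} - {..<N}" for t using that by (simp add: basis_deg_def)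
  show "coord_vec s = basis_vec s" if "s \<in> {..<N}" for s using that by (auto simp: coord_vec_def basis_vec_def)
  show "w l = (\<Sum>t\<in>{..<N + n}. ip n (coord_vec t) w * basis_vec t l)" if "l < n" for w l by (rule basis_vec_coord[OF that])
  show "ip n (basis_vec s) (basis_vec t) = 0" if "s \<in> {..<N}" "t \<in> {..<N + n} - {..<N}" for s t
    using basis_vec_lower_upper[of s "t - N"] that by auto
  show "eventually (\<lambda>\<epsilon>. \<forall>v w. bform n (\<kappa> \<epsilon>) v w = (\<Sum>k<n. lam k \<epsilon> * ip n (eigvec k \<epsilon>) v * ip n (eigvec k \<epsilon>) w)) (at_right 0)"
    by (rule spectral_near)
  show "eventually (\<lambda>\<epsilon>. \<forall>k<n. \<forall>l<n. ip n (eigvec k \<epsilon>) (eigvec l \<epsilon>) = (if k = l then 1 else 0)) (at_right 0)"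
    by (rule uorth_near)
  show "ip n (eigvec q 0) (eigvec l 0) = (if q = l then 1 else 0)" if "q < n" "l < n" for q l by (rule u0_orth[OF that])
  show "eventually (\<lambda>\<epsilon>. \<forall>k<n. lam k \<epsilon> > 0) (at_right 0)" by (rule lam_pos)
  show "((\<lambda>\<epsilon>. lam q \<epsilon> / \<epsilon> ^ eig_order q) \<longlongrightarrow> eig_coeff q) (at_right 0)" if "q < n" for q
    using leading_term_limit[OF lam_leading[OF that]] by (simp add: filterlim_at_split)
  show "eig_coeff q \<noteq> 0" if "q < n" for q using lam_leading[OF that] by (simp add: has_leading_term_def)
  show "((\<lambda>\<epsilon>. eigvec q \<epsilon> i) \<longlongrightarrow> eigvec q 0 i) (at_right 0)" if "q < n" "i < n" for q i
  proof -
    have "analytic_at_0 (\<lambda>\<epsilon>. vec_index (u q \<epsilon>) i)" using eigen that unfolding analytic_eigendecomposition_def by blast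
    then have "isCont (\<lambda>\<epsilon>. eigvec q \<epsilon> i) 0" unfolding eigvec_def analytic_at_0_def using power_series_isCont by blast
    then show ?thesis unfolding isCont_def by (simp add: filterlim_at_split)
  qed
  show "((\<lambda>\<epsilon>. bform n (\<kappa> \<epsilon>) (basis_vec t) (basis_vec t') / \<epsilon> ^ (basis_deg t + basis_deg t')) \<longlongrightarrow> M0 t t') (at_right 0)"
    if "t \<in> {..<N + n}" "t' \<in> {..<N + n}" for t t'
    unfolding M0_def by (rule bform_limit[OF basis_deg_le basis_deg_le]) (use that basis_vec_annihilates in auto)
  have e: "(A * B) $$ (s, t) = (\<Sum>r<N. A $$ (s, r) * B $$ (r, t))" if "A \<in> carrier_mat N N" "B \<in> carrier_mat N N" "s < N" "t < N" for A B :: "real mat" and s t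
    by (rule mat_mult_index_sum[OF that])
  show "(\<Sum>r\<in>{..<N}. inv_mat (lead_blocks b H j) $$ (s, r) * M0 r t) = (if s = t then 1 else 0)" if "s \<in> {..<N}" "t \<in> {..<N}" for s t
    using e[OF I(1) lead_carrier, of s t] that unfolding I(3) by (simp add: M0_lower)
  show "(\<Sum>r\<in>{..<N}. M0 s r * inv_mat (lead_blocks b H j) $$ (r, t)) = (if s = t then 1 else 0)" if "s \<in> {..<N}" "t \<in> {..<N}" for s t
    using e[OF lead_carrier I(1), of s t] that unfolding I(2) by (simp add: M0_lower)
qed

end

section \<open>The coefficient of the spectral equivalent and the number of eigenvalues\<close>

text \<open>More vectors u than v would leave a nontrivial combination of the u whose coordinates
  with respect to the v all vanish, against orthonormality.\<close>

lemma orthonormal_card_le: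
  assumes I: "finite I" "finite J"
    and u: "\<And>k l. k \<in> I \<Longrightarrow> l \<in> I \<Longrightarrow> ip n (u k) (u l) = (if k = l then 1 else 0)"
    and v: "\<And>k l. k \<in> J \<Longrightarrow> l \<in> J \<Longrightarrow> ip n (v k) (v l) = (if k = l then 1 else 0)"
    and span: "\<And>k r. k \<in> I \<Longrightarrow> r < n \<Longrightarrow> u k r = (\<Sum>l\<in>J. d k l * v l r)"
  shows "card I \<le> card J"
proof (rule ccontr)
  assume "\<not> card I \<le> card J"
  then have "card J < card I" by simp
  from underdetermined_system[OF I(2,1) this, of "\<lambda>l k. d k l"]
  obtain e where e: "\<exists>k\<in>I. e k \<noteq> 0" "\<And>l. l \<in> J \<Longrightarrow> (\<Sum>k\<in>I. e k * d k l) = 0" by blast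
  have zero: "(\<Sum>k\<in>I. e k * u k r) = 0" if "r < n" for r
  proof -
    have "(\<Sum>k\<in>I. e k * u k r) = (\<Sum>k\<in>I. \<Sum>l\<in>J. e k * d k l * v l r)"
      using span[OF _ that] by (intro sum.cong refl) (simp add: sum_distrib_left mult.assoc)
    also have "\<dots> = (\<Sum>l\<in>J. (\<Sum>k\<in>I. e k * d k l) * v l r)"
      unfolding sum_distrib_right by (rule sum.swap)
    finally show ?thesis using e(2) by simp
  qed
  have "e k = 0" if k: "k \<in> I" for k
  proof -
    have "0 = ip n (u k) (\<lambda>r. \<Sum>l\<in>I. e l * u l r)" unfolding ip_def using zero by simp
    also have "\<dots> = (\<Sum>l\<in>I. if l = k then e k else 0)"
      unfolding ip_sum_right using u[OF k] by (intro sum.cong refl) auto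
    also have "\<dots> = e k" using I(1) k by simp
    finally show ?thesis by simp
  qed
  with e(1) show False by blast
qed

lemma invertible_mat_trivial_kernel:
  fixes A :: "real mat"
  assumes A: "A \<in> carrier_mat N N"
    and ker: "\<And>v. (\<And>s. s < N \<Longrightarrow> (\<Sum>t<N. A $$ (s, t) * v t) = 0) \<Longrightarrow> (\<And>t. t < N \<Longrightarrow> v t = 0)"
  shows "invertible_mat A"
proof -
  have "det A \<noteq> 0"
  proof
    assume "det A = 0"
    then obtain v where v: "v \<in> carrier_vec N" "v \<noteq> 0\<^sub>v N" "A *\<^sub>v v = 0\<^sub>v N"
      using det_0_iff_vec_prod_zero_field[OF A] by blast
    have "(\<Sum>t<N. A $$ (s, t) * vec_index v t) = 0" if s: "s < N" for s
    proof -
      have "vec_index (A *\<^sub>v v) s = vec_index (0\<^sub>v N) s" using v(3) by simp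
      then show ?thesis using A v(1) s by (simp add: scalar_prod_def atLeast0LessThan)
    qed
    from ker[of "vec_index v", OF this] have "v = 0\<^sub>v N" using v(1) by (intro eq_vecI) auto
    with v(2) show False by blast
  qed
  then have "A \<in> Units (ring_mat TYPE(real) N ())" by (rule det_non_zero_imp_unit[OF A])
  then obtain B where "B \<in> carrier_mat N N" "B * A = 1\<^sub>m N" "A * B = 1\<^sub>m N"
    unfolding Units_def by (auto simp: ring_mat_simps)
  then show ?thesis using A unfolding invertible_mat_def inverts_mat_def by auto
qed

context kernel_flat_limit
begin

abbreviation S where "S \<equiv> schur_complement b H j"

lemma S_carrier: "invertible_mat (lead_blocks b H j) \<Longrightarrow> S \<in> carrier_mat (b j) (b j)"
  unfolding schur_complement_def upper_blocks_def
  using left_carrier inv_mat_props(1)[OF lead_carrier] H_carrier[OF j j]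
  by (intro minus_carrier_mat mult_carrier_mat transpose_carrier_mat[THEN iffD2])

lemma S_index:
  assumes inv: "invertible_mat (lead_blocks b H j)" and p: "p < b j" "p' < b j"
  shows "S $$ (p, p') = H j j $$ (p, p') -
    (\<Sum>s<N. \<Sum>s'<N. left_blocks b H j $$ (p, s) * inv_mat (lead_blocks b H j) $$ (s, s') * left_blocks b H j $$ (p', s'))"
proof -
  let ?L = "left_blocks b H j" and ?G = "inv_mat (lead_blocks b H j)"
  note G = inv_mat_props(1)[OF lead_carrier inv]
  have LT: "transpose_mat ?L \<in> carrier_mat N (b j)" using left_carrier by simp
  have LG: "?L * ?G \<in> carrier_mat (b j) N" using left_carrier G by simp
  have "(?L * ?G * transpose_mat ?L) $$ (p, p') = (\<Sum>s'<N. (?L * ?G) $$ (p, s') * transpose_mat ?L $$ (s', p'))"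
    by (rule mat_mult_index_sum[OF LG LT p])
  also have "\<dots> = (\<Sum>s'<N. (\<Sum>s<N. ?L $$ (p, s) * ?G $$ (s, s')) * ?L $$ (p', s'))"
  proof (intro sum.cong refl arg_cong2[where f = "(*)"])
    fix s' assume "s' \<in> {..<N}"
    then have s': "s' < N" by simp
    show "(?L * ?G) $$ (p, s') = (\<Sum>s<N. ?L $$ (p, s) * ?G $$ (s, s'))" by (rule mat_mult_index_sum[OF left_carrier G p(1) s'])
    show "transpose_mat ?L $$ (s', p') = ?L $$ (p', s')" using left_carrier s' p by simp
  qed
  also have "\<dots> = (\<Sum>s<N. \<Sum>s'<N. ?L $$ (p, s) * ?G $$ (s, s') * ?L $$ (p', s'))"
    unfolding sum_distrib_right by (rule sum.swap)
  finally have e: "(?L * ?G * transpose_mat ?L) $$ (p, p') = \<dots>" .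
  have "?L * ?G * transpose_mat ?L \<in> carrier_mat (b j) (b j)" by (rule mult_carrier_mat[OF LG LT])
  then have "p < dim_row (?L * ?G * transpose_mat ?L)" "p' < dim_col (?L * ?G * transpose_mat ?L)"
    using p by (simp_all only: carrier_matD)
  then show ?thesis
    unfolding schur_complement_def upper_blocks_def by (simp only: index_minus_mat(1) e)
qed

lemma QSQ_index:
  assumes inv: "invertible_mat (lead_blocks b H j)" and il: "i < n" "l < n"
  shows "(Q j * S * transpose_mat (Q j)) $$ (i, l) = (\<Sum>p<b j. \<Sum>p'<b j. Q j $$ (i, p) * S $$ (p, p') * Q j $$ (l, p'))"
proof -
  note Qc = Q_carrier[OF j] and Sc = S_carrier[OF inv]
  have QT: "transpose_mat (Q j) \<in> carrier_mat (b j) n" using Qc by simp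
  have QS: "Q j * S \<in> carrier_mat n (b j)" using Qc Sc by simp
  have "(Q j * S * transpose_mat (Q j)) $$ (i, l) = (\<Sum>p'<b j. (Q j * S) $$ (i, p') * transpose_mat (Q j) $$ (p', l))"
    by (rule mat_mult_index_sum[OF QS QT il])
  also have "\<dots> = (\<Sum>p'<b j. (\<Sum>p<b j. Q j $$ (i, p) * S $$ (p, p')) * Q j $$ (l, p'))"
  proof (intro sum.cong refl arg_cong2[where f = "(*)"])
    fix p' assume "p' \<in> {..<b j}"
    then have p': "p' < b j" by simp
    show "(Q j * S) $$ (i, p') = (\<Sum>p<b j. Q j $$ (i, p) * S $$ (p, p'))" by (rule mat_mult_index_sum[OF Qc Sc il(1) p'])
    show "transpose_mat (Q j) $$ (p', l) = Q j $$ (l, p')" using Qc il p' by simp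
  qed
  also have "\<dots> = (\<Sum>p<b j. \<Sum>p'<b j. Q j $$ (i, p) * S $$ (p, p') * Q j $$ (l, p'))"
    unfolding sum_distrib_right by (rule sum.swap)
  finally show ?thesis .
qed

text \<open>\<open>leading_form\<close> equates two quadratic forms on coefficient vectors of the
  projected unit vectors. Leading eigenvectors do not see the projection, so these are forms on all
  of R^n; both matrices are symmetric, and polarisation compares their entries.\<close>

lemma coeff_mat_eq:
  assumes inv: "invertible_mat (lead_blocks b H j)"
  shows "coeff_mat (spectral_equivalent n lam u) (2 * j) = Q j * S * transpose_mat (Q j)"
proof -
  let ?G = "\<lambda>s t. inv_mat (lead_blocks b H j) $$ (s, t)"
  interpret F: flat_spectrum n j \<kappa> lam eigvec "\<lambda>k. eigvec k 0" eig_order eig_coeff "{..<N}" "{..<N + n}" basis_vec coord_vec basis_deg M0 ?G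
    by (rule flat_spectrum_kernel[OF inv])
  define X where "X i l = M0 (N + i) (N + l) - (\<Sum>s<N. \<Sum>s'<N. M0 (N + i) s * ?G s s' * M0 s' (N + l))" for i l
  have G_sym: "?G s t = ?G t s" if st: "s < N" "t < N" for s t
  proof -
    \<comment> \<open>Inserting the identity G M0 = 1 twice, with M0 symmetric, shows that G is
      symmetric.\<close>
    have "?G t s = (\<Sum>q<N. (if s = q then 1 else 0) * ?G t q)" using st by (simp add: if_distrib[of "\<lambda>r. r * _"] cong: if_cong)
    also have "\<dots> = (\<Sum>q<N. (\<Sum>r<N. ?G s r * M0 r q) * ?G t q)" using F.inv(1)[of s] st by (intro sum.cong refl) auto
    also have "\<dots> = (\<Sum>r<N. ?G s r * (\<Sum>q<N. ?G t q * M0 q r))"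
    proof -
      have "(\<Sum>q<N. (\<Sum>r<N. ?G s r * M0 r q) * ?G t q) = (\<Sum>r<N. \<Sum>q<N. ?G s r * M0 r q * ?G t q)"
        unfolding sum_distrib_right by (rule sum.swap)
      also have "\<dots> = (\<Sum>r<N. ?G s r * (\<Sum>q<N. ?G t q * M0 q r))"
        unfolding sum_distrib_left using F.M0_sym by (intro sum.cong refl) (simp add: mult_ac)
      finally show ?thesis .
    qed
    also have "\<dots> = (\<Sum>r<N. ?G s r * (if t = r then 1 else 0))" using F.inv(1)[of t] st by (intro sum.cong refl) auto
    also have "\<dots> = ?G s t" using st by (simp add: if_distrib cong: if_cong)
    finally show ?thesis by simp
  qed
  have X_sym: "X i l = X l i" if il: "i < n" "l < n" for i l
  proof -
    have "(\<Sum>s<N. \<Sum>s'<N. M0 (N + i) s * ?G s s' * M0 s' (N + l)) = (\<Sum>s'<N. \<Sum>s<N. M0 (N + i) s * ?G s s' * M0 s' (N + l))" by (rule sum.swap)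
    also have "\<dots> = (\<Sum>s'<N. \<Sum>s<N. M0 (N + l) s' * ?G s' s * M0 s (N + i))"
    proof (intro sum.cong refl)
      fix s s' assume "s \<in> {..<N}" "s' \<in> {..<N}"
      then have s: "s < N" "s' < N" by auto
      have "M0 (N + i) s = M0 s (N + i)" "M0 s' (N + l) = M0 (N + l) s'" using F.M0_sym s il by auto
      then show "M0 (N + i) s * ?G s s' * M0 s' (N + l) = M0 (N + l) s' * ?G s' s * M0 s (N + i)"
        using G_sym[OF s] by simp
    qed
    finally show ?thesis unfolding X_def using F.M0_sym[of "N + i" "N + l"] il by simp
  qed
  have form: "(\<Sum>i<n. \<Sum>l<n. z i * z l * leading_entry i l) = (\<Sum>i<n. \<Sum>l<n. z i * z l * X i l)" for z
  proof -
    \<comment> \<open>The coefficient z i belongs to the projected i-th unit vector, which has index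
      N + i.\<close>
    let ?\<zeta> = "\<lambda>t. z (t - N)"
    let ?c = "\<lambda>k. if eig_order k = 2 * j then eig_coeff k else 0"
    have "F.leading_quad (\<lambda>l. \<Sum>t\<in>{..<N + n} - {..<N}. ?\<zeta> t * basis_vec t l) = F.schur_quad ?\<zeta>" by (rule F.leading_form)
    moreover have "F.leading_quad (\<lambda>l. \<Sum>t\<in>{..<N + n} - {..<N}. ?\<zeta> t * basis_vec t l) = (\<Sum>i<n. \<Sum>l<n. z i * z l * leading_entry i l)"
    proof -
      have "F.leading_quad (\<lambda>l. \<Sum>t\<in>{..<N + n} - {..<N}. ?\<zeta> t * basis_vec t l) = (\<Sum>k<n. ?c k * (\<Sum>i<n. z i * eigvec k 0 i)\<^sup>2)"
        unfolding F.leading_quad_def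
      proof (intro sum.cong refl)
        fix q assume "q \<in> {..<n}"
        then have q: "q < n" by simp
        show "?c q * (ip n (eigvec q 0) (\<lambda>l. \<Sum>t\<in>{..<N + n} - {..<N}. ?\<zeta> t * basis_vec t l))\<^sup>2 = ?c q * (\<Sum>i<n. z i * eigvec q 0 i)\<^sup>2"
        proof (cases "eig_order q = 2 * j")
          case True
          \<comment> \<open>Eigenvectors of order 2 j are orthogonal in the limit to the lower
            columns, so the correction terms in the projected unit vectors drop out.\<close>
          have z: "ip n (eigvec q 0) (basis_vec s) = 0" if "s < N" for s
            by (rule F.leading_eigenvector_orthogonal) (use q True that in auto)
          have "ip n (eigvec q 0) (basis_vec (N + i)) = eigvec q 0 i" if i: "i < n" for i
            unfolding basis_vec_upper_expand ip_diff_right ip_sum_right ip_unit[OF i] using z by simp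
          then have "ip n (eigvec q 0) (\<lambda>l. \<Sum>t\<in>{..<N + n} - {..<N}. ?\<zeta> t * basis_vec t l) = (\<Sum>i<n. z i * eigvec q 0 i)"
            unfolding ip_sum_right sum_upper_index by simp
          then show ?thesis by simp
        qed simp
      qed
      also have "\<dots> = (\<Sum>k<n. \<Sum>i<n. \<Sum>l<n. z i * z l * (?c k * (eigvec k 0 i * eigvec k 0 l)))"
      proof (rule sum.cong[OF refl])
        fix k
        have "(\<Sum>i<n. z i * eigvec k 0 i)\<^sup>2 = (\<Sum>i<n. \<Sum>l<n. (z i * eigvec k 0 i) * (z l * eigvec k 0 l))"
          by (simp only: power2_eq_square sum_product)
        then show "?c k * (\<Sum>i<n. z i * eigvec k 0 i)\<^sup>2 = (\<Sum>i<n. \<Sum>l<n. z i * z l * (?c k * (eigvec k 0 i * eigvec k 0 l)))"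
          by (simp only: sum_distrib_left mult_ac)
      qed
      also have "\<dots> = (\<Sum>i<n. \<Sum>k<n. \<Sum>l<n. z i * z l * (?c k * (eigvec k 0 i * eigvec k 0 l)))" by (rule sum.swap)
      also have "\<dots> = (\<Sum>i<n. \<Sum>l<n. \<Sum>k<n. z i * z l * (?c k * (eigvec k 0 i * eigvec k 0 l)))"
        by (intro sum.cong refl sum.swap)
      also have "\<dots> = (\<Sum>i<n. \<Sum>l<n. z i * z l * leading_entry i l)" unfolding leading_entry_def sum_distrib_left ..
      finally show ?thesis .
    qed
    moreover have "F.schur_quad ?\<zeta> = (\<Sum>i<n. \<Sum>l<n. z i * z l * X i l)"
    proof -
      have s4: "(\<Sum>s<N. \<Sum>s'<N. \<Sum>l<n. z i * M0 (N + i) s * ?G s s' * M0 s' (N + l) * z l)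
          = (\<Sum>l<n. z i * z l * (\<Sum>s<N. \<Sum>s'<N. M0 (N + i) s * ?G s s' * M0 s' (N + l)))" for i
      proof -
        have "(\<Sum>s<N. \<Sum>s'<N. \<Sum>l<n. z i * M0 (N + i) s * ?G s s' * M0 s' (N + l) * z l)
           = (\<Sum>s<N. \<Sum>l<n. \<Sum>s'<N. z i * M0 (N + i) s * ?G s s' * M0 s' (N + l) * z l)"
          by (intro sum.cong refl sum.swap)
        also have "\<dots> = (\<Sum>l<n. \<Sum>s<N. \<Sum>s'<N. z i * M0 (N + i) s * ?G s s' * M0 s' (N + l) * z l)"
          by (rule sum.swap)
        finally show ?thesis by (simp add: sum_distrib_left mult_ac)
      qed
      have "F.schur_quad ?\<zeta> = (\<Sum>i<n. \<Sum>l<n. z i * M0 (N + i) (N + l) * z l)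
          - (\<Sum>i<n. \<Sum>s<N. \<Sum>s'<N. \<Sum>l<n. z i * M0 (N + i) s * ?G s s' * M0 s' (N + l) * z l)"
        unfolding F.schur_quad_def sum_upper_index by simp
      then show ?thesis unfolding s4 X_def
        by (simp add: sum_subtractf[symmetric] right_diff_distrib mult_ac)
    qed
    ultimately show ?thesis by simp
  qed
  have pol: "leading_entry i l = X i l" if il: "i < n" "l < n" for i l
  proof -
    have ev: "(\<Sum>a<n. \<Sum>a'<n. ((if a = i then 1 else 0) + s * (if a = l then 1 else 0)) * ((if a' = i then 1 else 0) + s * (if a' = l then 1 else 0)) * Y a a')
        = Y i i + s * Y i l + s * Y l i + s * s * Y l l" for Y :: "nat \<Rightarrow> nat \<Rightarrow> real" and s
    proof -
      have 1: "(\<Sum>a'<n. ((if a' = i then 1 else 0) + s * (if a' = l then 1 else 0)) * f a') = f i + s * f l" for f :: "nat \<Rightarrow> real"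
        using il by (simp add: distrib_right sum.distrib if_distrib[of "\<lambda>r. r * _"] if_distrib[of "\<lambda>r. s * r"] cong: if_cong)
      have "(\<Sum>a<n. \<Sum>a'<n. ((if a = i then 1 else 0) + s * (if a = l then 1 else 0)) * ((if a' = i then 1 else 0) + s * (if a' = l then 1 else 0)) * Y a a')
        = (\<Sum>a<n. ((if a = i then 1 else 0) + s * (if a = l then 1 else 0)) * (\<Sum>a'<n. ((if a' = i then 1 else 0) + s * (if a' = l then 1 else 0)) * Y a a'))"
        by (simp only: sum_distrib_left mult.assoc)
      also have "\<dots> = (Y i i + s * Y i l) + s * (Y l i + s * Y l l)" unfolding 1 ..
      finally show ?thesis by (simp add: algebra_simps)
    qed
    have c: "leading_entry i l = leading_entry l i" unfolding leading_entry_def by (simp add: mult.commute)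
    have "leading_entry i i + s * leading_entry i l + s * leading_entry l i + s * s * leading_entry l l = X i i + s * X i l + s * X l i + s * s * X l l" for s
      \<comment> \<open>The vector is the i-th unit vector plus s times the l-th; the difference of
        the identities for s = 1 and s = -1 isolates the mixed terms.\<close>
      using form[of "\<lambda>a. (if a = i then 1 else 0) + s * (if a = l then 1 else 0)"] unfolding ev .
    from this[of 1] this[of "-1"] show ?thesis using c X_sym[OF il] by simp
  qed
  have XS: "X i l = (Q j * S * transpose_mat (Q j)) $$ (i, l)" if il: "i < n" "l < n" for i l
  proof -
    let ?L = "left_blocks b H j"
    have "X i l = (\<Sum>p<b j. \<Sum>p'<b j. Q j $$ (i, p) * H j j $$ (p, p') * Q j $$ (l, p'))
       - (\<Sum>s<N. \<Sum>s'<N. (\<Sum>p<b j. Q j $$ (i, p) * ?L $$ (p, s)) * ?G s s' * (\<Sum>p'<b j. Q j $$ (l, p') * ?L $$ (p', s')))"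
      unfolding X_def M0_upper[OF il] using F.M0_sym[of _ "N + l"] il M0_mixed
      by (intro arg_cong2[where f = "(-)"] sum.cong refl arg_cong2[where f = "(*)"]) auto
    also have "(\<Sum>s<N. \<Sum>s'<N. (\<Sum>p<b j. Q j $$ (i, p) * ?L $$ (p, s)) * ?G s s' * (\<Sum>p'<b j. Q j $$ (l, p') * ?L $$ (p', s')))
       = (\<Sum>p<b j. \<Sum>p'<b j. Q j $$ (i, p) * (\<Sum>s<N. \<Sum>s'<N. ?L $$ (p, s) * ?G s s' * ?L $$ (p', s')) * Q j $$ (l, p'))"
    proof -
      let ?f = "\<lambda>p p' s s'. Q j $$ (i, p) * (?L $$ (p, s) * (?G s s' * (?L $$ (p', s') * Q j $$ (l, p'))))"
      have "(\<Sum>s<N. \<Sum>s'<N. (\<Sum>p<b j. Q j $$ (i, p) * ?L $$ (p, s)) * ?G s s' * (\<Sum>p'<b j. Q j $$ (l, p') * ?L $$ (p', s')))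
        = (\<Sum>s<N. \<Sum>s'<N. \<Sum>p<b j. \<Sum>p'<b j. ?f p p' s s')"
        by (intro sum.cong refl) (simp add: sum_distrib_left sum_distrib_right sum_product mult_ac)
      also have "\<dots> = (\<Sum>s<N. \<Sum>p<b j. \<Sum>s'<N. \<Sum>p'<b j. ?f p p' s s')" by (intro sum.cong refl sum.swap)
      also have "\<dots> = (\<Sum>p<b j. \<Sum>s<N. \<Sum>s'<N. \<Sum>p'<b j. ?f p p' s s')" by (rule sum.swap)
      also have "\<dots> = (\<Sum>p<b j. \<Sum>s<N. \<Sum>p'<b j. \<Sum>s'<N. ?f p p' s s')" by (intro sum.cong refl sum.swap)
      also have "\<dots> = (\<Sum>p<b j. \<Sum>p'<b j. \<Sum>s<N. \<Sum>s'<N. ?f p p' s s')" by (intro sum.cong refl sum.swap)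
      finally show ?thesis by (simp add: sum_distrib_left sum_distrib_right mult.assoc)
    qed
    also have "(\<Sum>p<b j. \<Sum>p'<b j. Q j $$ (i, p) * H j j $$ (p, p') * Q j $$ (l, p'))
       - (\<Sum>p<b j. \<Sum>p'<b j. Q j $$ (i, p) * (\<Sum>s<N. \<Sum>s'<N. ?L $$ (p, s) * ?G s s' * ?L $$ (p', s')) * Q j $$ (l, p'))
       = (\<Sum>p<b j. \<Sum>p'<b j. Q j $$ (i, p) * S $$ (p, p') * Q j $$ (l, p'))"
      unfolding sum_subtractf[symmetric] by (intro sum.cong refl) (simp add: S_index[OF inv] algebra_simps)
    finally show ?thesis unfolding QSQ_index[OF inv il] .
  qed
  show ?thesis
  proof (rule eq_matI)
    have c: "Q j * S * transpose_mat (Q j) \<in> carrier_mat n n" using Q_carrier[OF j] S_carrier[OF inv] by simp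
    show "dim_row (coeff_mat (spectral_equivalent n lam u) (2 * j)) = dim_row (Q j * S * transpose_mat (Q j))"
      "dim_col (coeff_mat (spectral_equivalent n lam u) (2 * j)) = dim_col (Q j * S * transpose_mat (Q j))"
      using c coeff_mat_carrier by auto
    fix i l assume "i < dim_row (Q j * S * transpose_mat (Q j))" "l < dim_col (Q j * S * transpose_mat (Q j))"
    then have il: "i < n" "l < n" using c by auto
    show "coeff_mat (spectral_equivalent n lam u) (2 * j) $$ (i, l) = (Q j * S * transpose_mat (Q j)) $$ (i, l)"
      unfolding coeff_mat_index[OF il] pol[OF il] XS[OF il] ..
  qed
qed

lemma leading_entry_QSQ:
  assumes inv: "invertible_mat (lead_blocks b H j)" and il: "i < n" "l < n"
  shows "leading_entry i l = (\<Sum>p<b j. \<Sum>p'<b j. Q j $$ (i, p) * S $$ (p, p') * Q j $$ (l, p'))"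
  using coeff_mat_index[OF il] QSQ_index[OF inv il] unfolding coeff_mat_eq[OF inv] by simp

lemma leading_entry_apply:
  assumes inv: "invertible_mat (lead_blocks b H j)" and i: "i < n"
  shows "(\<Sum>l<n. leading_entry i l * v l) = (\<Sum>p<b j. (\<Sum>p'<b j. S $$ (p, p') * (\<Sum>l<n. Q j $$ (l, p') * v l)) * Q j $$ (i, p))"
proof -
  have "(\<Sum>l<n. leading_entry i l * v l) = (\<Sum>l<n. \<Sum>p<b j. \<Sum>p'<b j. S $$ (p, p') * (Q j $$ (l, p') * v l) * Q j $$ (i, p))"
    using leading_entry_QSQ[OF inv i] by (intro sum.cong refl) (simp add: sum_distrib_left sum_distrib_right mult_ac)
  also have "\<dots> = (\<Sum>p<b j. \<Sum>l<n. \<Sum>p'<b j. S $$ (p, p') * (Q j $$ (l, p') * v l) * Q j $$ (i, p))" by (rule sum.swap)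
  also have "\<dots> = (\<Sum>p<b j. \<Sum>p'<b j. \<Sum>l<n. S $$ (p, p') * (Q j $$ (l, p') * v l) * Q j $$ (i, p))"
    by (intro sum.cong refl sum.swap)
  finally show ?thesis by (simp add: sum_distrib_left sum_distrib_right)
qed

lemma leading_entry_spectral:
  "(\<Sum>l<n. leading_entry i l * v l) = (\<Sum>q | q < n \<and> eig_order q = 2 * j. eig_coeff q * ip n (eigvec q 0) v * eigvec q 0 i)"
proof -
  have "(\<Sum>l<n. leading_entry i l * v l) = (\<Sum>l<n. \<Sum>q<n. (if eig_order q = 2 * j then eig_coeff q else 0) * (eigvec q 0 l * v l) * eigvec q 0 i)"
    unfolding leading_entry_def by (intro sum.cong refl) (simp add: sum_distrib_left sum_distrib_right mult_ac)
  also have "\<dots> = (\<Sum>q<n. \<Sum>l<n. (if eig_order q = 2 * j then eig_coeff q else 0) * (eigvec q 0 l * v l) * eigvec q 0 i)" by (rule sum.swap)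
  also have "\<dots> = (\<Sum>q<n. (if eig_order q = 2 * j then eig_coeff q else 0) * ip n (eigvec q 0) v * eigvec q 0 i)"
    unfolding ip_def by (simp add: sum_distrib_left sum_distrib_right)
  also have "\<dots> = (\<Sum>q | q < n \<and> eig_order q = 2 * j. eig_coeff q * ip n (eigvec q 0) v * eigvec q 0 i)"
    by (rule sum.mono_neutral_cong_right) auto
  finally show ?thesis .
qed

text \<open>The limiting eigenvectors of order 2 j and the columns of Q_j are two orthonormal bases
  of the range of the coefficient matrix. The former lie in the span of the latter since their
  eigenvalue coefficients are nonzero, the converse since S is invertible.\<close>

lemma card_of_order:
  assumes inv: "invertible_mat (lead_blocks b H j)" and S: "invertible_mat S"
  shows "card {i. i < n \<and> of_order (lam i) (2 * j)} = b j"
proof -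
  define J where "J = {q. q < n \<and> eig_order q = 2 * j}"
  have J: "{i. i < n \<and> of_order (lam i) (2 * j)} = J" unfolding J_def using of_order_iff by blast
  have finJ: "finite J" unfolding J_def by simp
  have uo: "ip n (eigvec q 0) (eigvec l 0) = (if q = l then 1 else 0)" if "q \<in> J" "l \<in> J" for q l
    using u0_orth that unfolding J_def by simp
  have qo: "ip n (\<lambda>r. Q j $$ (r, p)) (\<lambda>r. Q j $$ (r, p')) = (if p = p' then 1 else 0)" if "p \<in> {..<b j}" "p' \<in> {..<b j}" for p p'
    using Q_orth[OF j _ j, of p p'] that unfolding ip_def by simp
  have "card J \<le> card {..<b j}"
  proof (rule orthonormal_card_le[OF finJ _ uo qo])
    fix q r assume q: "q \<in> J" and r: "r < n"
    define e where "e p = (\<Sum>p'<b j. S $$ (p, p') * (\<Sum>l<n. Q j $$ (l, p') * eigvec q 0 l))" for p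
    have eig_coeff: "eig_coeff q \<noteq> 0" using lam_leading[of q] q unfolding J_def has_leading_term_def by auto
    have "(\<Sum>l<n. leading_entry r l * eigvec q 0 l) = (\<Sum>s\<in>J. eig_coeff s * ip n (eigvec s 0) (eigvec q 0) * eigvec s 0 r)"
      unfolding leading_entry_spectral J_def ..
    also have "\<dots> = (\<Sum>s\<in>J. if s = q then eig_coeff q * eigvec q 0 r else 0)"
      using uo[OF _ q] by (intro sum.cong refl) auto
    also have "\<dots> = eig_coeff q * eigvec q 0 r" using q finJ by simp
    finally have "eig_coeff q * eigvec q 0 r = (\<Sum>p<b j. e p * Q j $$ (r, p))"
      unfolding leading_entry_apply[OF inv r] e_def by simp
    then have "eigvec q 0 r = (\<Sum>p<b j. e p * Q j $$ (r, p)) / eig_coeff q" using eig_coeff by (simp add: field_simps)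
    then have "eigvec q 0 r = (\<Sum>p<b j. e p / eig_coeff q * Q j $$ (r, p))" by (simp add: sum_divide_distrib)
    then show "eigvec q 0 r = (\<Sum>p<b j. (\<Sum>p'<b j. S $$ (p, p') * (\<Sum>l<n. Q j $$ (l, p') * eigvec q 0 l)) / eig_coeff q * Q j $$ (r, p))"
      unfolding e_def .
  qed simp
  moreover have "card {..<b j} \<le> card J"
  proof -
    note Sc = S_carrier[OF inv]
    note B = inv_mat_props[OF Sc S]
    \<comment> \<open>Column p of Q_j S^(-1), which Q_j S Q_j^T maps to column p of Q_j.\<close>
    define v where "v p l = (\<Sum>p'<b j. inv_mat S $$ (p', p) * Q j $$ (l, p'))" for p l
    show ?thesis
    proof (rule orthonormal_card_le[OF _ finJ qo uo])
      fix p r assume p': "p \<in> {..<b j}" and r: "r < n"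
      then have p: "p < b j" by simp
      have Qv: "(\<Sum>l<n. Q j $$ (l, q) * v p l) = inv_mat S $$ (q, p)" if q: "q < b j" for q
      proof -
        have "(\<Sum>l<n. Q j $$ (l, q) * v p l) = ip n (\<lambda>r. Q j $$ (r, q)) (\<lambda>l. \<Sum>p'<b j. inv_mat S $$ (p', p) * Q j $$ (l, p'))"
          unfolding ip_def v_def ..
        also have "\<dots> = (\<Sum>p'<b j. if p' = q then inv_mat S $$ (q, p) else 0)"
          unfolding ip_sum_right using qo[of q] q by (intro sum.cong refl) auto
        also have "\<dots> = inv_mat S $$ (q, p)" using q by simp
        finally show ?thesis .
      qed
      have "(\<Sum>q\<in>J. eig_coeff q * ip n (eigvec q 0) (v p) * eigvec q 0 r) = (\<Sum>l<n. leading_entry r l * v p l)"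
        unfolding leading_entry_spectral J_def ..
      also have "\<dots> = (\<Sum>s<b j. (\<Sum>p'<b j. S $$ (s, p') * inv_mat S $$ (p', p)) * Q j $$ (r, s))"
        unfolding leading_entry_apply[OF inv r] using Qv by simp
      also have "\<dots> = (\<Sum>s<b j. if s = p then Q j $$ (r, p) else 0)"
      proof (rule sum.cong[OF refl])
        fix s assume "s \<in> {..<b j}"
        then have s: "s < b j" by simp
        have "(\<Sum>p'<b j. S $$ (s, p') * inv_mat S $$ (p', p)) = (S * inv_mat S) $$ (s, p)"
          by (rule mat_mult_index_sum[OF Sc B(1) s p, symmetric])
        then show "(\<Sum>p'<b j. S $$ (s, p') * inv_mat S $$ (p', p)) * Q j $$ (r, s) = (if s = p then Q j $$ (r, p) else 0)"
          unfolding B(2) using s p by simp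
      qed
      also have "\<dots> = Q j $$ (r, p)" using p by simp
      finally show "Q j $$ (r, p) = (\<Sum>q\<in>J. eig_coeff q * ip n (eigvec q 0) (v p) * eigvec q 0 r)" by simp
    qed simp
  qed
  ultimately show ?thesis unfolding J by simp
qed

section \<open>Definiteness of H in the finitely smooth case\<close>

lemma H_form:
  assumes il: "i \<le> m" "l \<le> m"
  shows "(\<Sum>t<h i. \<Sum>t'<h l. (\<Sum>p<b i. f p * R i i $$ (p, t)) * W i l $$ (t, t') * (\<Sum>p'<b l. g p' * R l l $$ (p', t')))
    = (\<Sum>p<b i. \<Sum>p'<b l. f p * H i l $$ (p, p') * g p')"
proof -
  let ?w = "\<lambda>p p' t t'. f p * (R i i $$ (p, t) * (W i l $$ (t, t') * (R l l $$ (p', t') * g p')))"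
  have "(\<Sum>t<h i. \<Sum>t'<h l. (\<Sum>p<b i. f p * R i i $$ (p, t)) * W i l $$ (t, t') * (\<Sum>p'<b l. g p' * R l l $$ (p', t')))
    = (\<Sum>t<h i. \<Sum>t'<h l. \<Sum>p<b i. \<Sum>p'<b l. ?w p p' t t')"
    by (intro sum.cong refl) (simp add: sum_distrib_left sum_distrib_right sum_product mult_ac)
  also have "\<dots> = (\<Sum>t<h i. \<Sum>p<b i. \<Sum>t'<h l. \<Sum>p'<b l. ?w p p' t t')" by (intro sum.cong refl sum.swap)
  also have "\<dots> = (\<Sum>p<b i. \<Sum>t<h i. \<Sum>t'<h l. \<Sum>p'<b l. ?w p p' t t')" by (rule sum.swap)
  also have "\<dots> = (\<Sum>p<b i. \<Sum>t<h i. \<Sum>p'<b l. \<Sum>t'<h l. ?w p p' t t')" by (intro sum.cong refl sum.swap)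
  also have "\<dots> = (\<Sum>p<b i. \<Sum>p'<b l. \<Sum>t<h i. \<Sum>t'<h l. ?w p p' t t')" by (intro sum.cong refl sum.swap)
  also have "\<dots> = (\<Sum>p<b i. \<Sum>p'<b l. f p * H i l $$ (p, p') * g p')"
    by (intro sum.cong refl) (simp add: H_index[OF il] sum_distrib_left sum_distrib_right mult.assoc)
  finally show ?thesis .
qed

text \<open>Both entries are limits of the same Gram entry of the symmetric kernel.\<close>

lemma H_sym:
  assumes il: "i \<le> m" "l \<le> m" and p: "p < b i" "p' < b l"
  shows "H i l $$ (p, p') = H l i $$ (p', p)"
proof (rule tendsto_unique[OF trivial_limit_at_right_real])
  let ?q = "\<lambda>i p r. Q i $$ (r, p)"
  have lim: "((\<lambda>\<epsilon>. bform n (\<kappa> \<epsilon>) (?q i p) (?q l p') / \<epsilon> ^ (i + l)) \<longlongrightarrow> H i l $$ (p, p')) (at_right 0)"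
    if "i \<le> m" "l \<le> m" "p < b i" "p' < b l" for i l p p'
  proof -
    have "(\<Sum>t<h i. \<Sum>t'<h l. moments (?q i p) i t * W i l $$ (t, t') * moments (?q l p') l t') = H i l $$ (p, p')"
      unfolding H_index[OF that] using moments_Q that by (intro sum.cong) auto
    then show ?thesis using bform_limit[OF that(1,2) annihilates_Q[OF mo that(1,3)] annihilates_Q[OF mo that(2,4)]] by simp
  qed
  show "((\<lambda>\<epsilon>. bform n (\<kappa> \<epsilon>) (?q i p) (?q l p') / \<epsilon> ^ (i + l)) \<longlongrightarrow> H i l $$ (p, p')) (at_right 0)"
    by (rule lim[OF il p])
  have ks: "k a a' = k a' a" for a a' using kernel unfolding positive_definite_kernel_def by blast
  have "eventually (\<lambda>\<epsilon>. bform n (\<kappa> \<epsilon>) (?q l p') (?q i p) / \<epsilon> ^ (l + i) = bform n (\<kappa> \<epsilon>) (?q i p) (?q l p') / \<epsilon> ^ (i + l)) (at_right 0)"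
    using ev_pos
  proof eventually_elim
    case (elim \<epsilon>)
    have "bform n (\<kappa> \<epsilon>) (?q l p') (?q i p) = bform n (\<kappa> \<epsilon>) (?q i p) (?q l p')"
      unfolding bform_kernel[OF elim] by (subst sum.swap) (simp add: ks mult.commute)
    then show ?case by (simp add: add.commute)
  qed
  then show "((\<lambda>\<epsilon>. bform n (\<kappa> \<epsilon>) (?q i p) (?q l p') / \<epsilon> ^ (i + l)) \<longlongrightarrow> H l i $$ (p', p)) (at_right 0)"
    by (rule Lim_transform_eventually[OF lim[OF il(2,1) p(2,1)]])
qed

text \<open>The vectors Q_l c_l, scaled by \<epsilon>^-l, have a kernel form that tends to c^T H c =
  0. \<open>finitely_smooth_annihilates\<close> then kills their moments of degree l, the entries of
  c_l^T R_ll, and the full row rank of R_ll gives c_l = 0.\<close>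

lemma finitely_smooth_H_definite:
  assumes fin: "finitely_smooth_case mons n x k K m"
    and zero: "(\<Sum>i\<le>m. \<Sum>l\<le>m. \<Sum>p<b i. \<Sum>p'<b l. c i p * H i l $$ (p, p') * c l p') = 0"
    and i: "i \<le> m" "p < b i"
  shows "c i p = 0"
proof -
  obtain \<psi> c0 where radial: "radial_kernel k \<psi> c0" and reg: "regularity_index c0 = enat (m + 1)"
    using fin unfolding finitely_smooth_case_def by blast
  define \<nu> where "\<nu> l a = (\<Sum>p<b l. c l p * Q l $$ (a, p))" for l a
  have ann: "annihilates n x (\<nu> l) l" if l: "l \<le> m" for l
  proof (rule annihilates_orth[OF mo])
    fix l' p' assume l': "l' < l" "p' < b l'"
    have "(\<Sum>r<n. \<nu> l r * Q l' $$ (r, p')) = ip n (\<lambda>r. Q l' $$ (r, p')) (\<lambda>a. \<Sum>p<b l. c l p * Q l $$ (a, p))"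
      unfolding ip_def \<nu>_def by (simp add: mult.commute)
    also have "\<dots> = (\<Sum>p<b l. c l p * ip n (\<lambda>r. Q l' $$ (r, p')) (\<lambda>a. Q l $$ (a, p)))"
      by (rule ip_sum_right)
    also have "\<dots> = 0"
      using Q_orth[of l' p' l] l l' unfolding ip_def by (intro sum.neutral) auto
    finally show "(\<Sum>r<n. \<nu> l r * Q l' $$ (r, p')) = 0" .
  qed (use l in simp)
  have moments\<nu>: "moments (\<nu> l) l t = (\<Sum>p<b l. c l p * R l l $$ (p, t))" if l: "l \<le> m" "t < h l" for l t
  proof -
    have "moments (\<nu> l) l t = ip n (\<lambda>r. V l $$ (r, t)) (\<lambda>a. \<Sum>p<b l. c l p * Q l $$ (a, p))"
      unfolding moments_def ip_def \<nu>_def by (simp add: mult.commute)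
    also have "\<dots> = (\<Sum>p<b l. c l p * ip n (\<lambda>r. V l $$ (r, t)) (\<lambda>a. Q l $$ (a, p)))" by (rule ip_sum_right)
    also have "\<dots> = (\<Sum>p<b l. c l p * R l l $$ (p, t))"
      using Q_V[OF l l(1)] unfolding ip_def by (intro sum.cong refl) (simp add: mult.commute)
    finally show ?thesis .
  qed
  have "((\<lambda>\<epsilon>. \<Sum>l\<le>m. \<Sum>l'\<le>m. bform n (\<kappa> \<epsilon>) (\<nu> l) (\<nu> l') / \<epsilon> ^ (l + l')) \<longlongrightarrow>
      (\<Sum>l\<le>m. \<Sum>l'\<le>m. \<Sum>t<h l. \<Sum>t'<h l'. moments (\<nu> l) l t * W l l' $$ (t, t') * moments (\<nu> l') l' t')) (at_right 0)"
    by (intro tendsto_sum bform_limit ann) auto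
  also have "(\<Sum>l\<le>m. \<Sum>l'\<le>m. \<Sum>t<h l. \<Sum>t'<h l'. moments (\<nu> l) l t * W l l' $$ (t, t') * moments (\<nu> l') l' t')
      = (\<Sum>i\<le>m. \<Sum>l\<le>m. \<Sum>p<b i. \<Sum>p'<b l. c i p * H i l $$ (p, p') * c l p')"
  proof (rule sum.cong[OF refl], rule sum.cong[OF refl])
    fix l l' assume "l \<in> {..m}" "l' \<in> {..m}"
    then have l: "l \<le> m" "l' \<le> m" by auto
    show "(\<Sum>t<h l. \<Sum>t'<h l'. moments (\<nu> l) l t * W l l' $$ (t, t') * moments (\<nu> l') l' t') = (\<Sum>p<b l. \<Sum>p'<b l'. c l p * H l l' $$ (p, p') * c l' p')"
      unfolding H_form[OF l, symmetric] using moments\<nu> l by (intro sum.cong) auto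
  qed
  also have "\<dots> = 0" by (rule zero)
  finally have lim0: "((\<lambda>\<epsilon>. \<Sum>l\<le>m. \<Sum>l'\<le>m. bform n (\<kappa> \<epsilon>) (\<nu> l) (\<nu> l') / \<epsilon> ^ (l + l')) \<longlongrightarrow> 0) (at_right 0)" .
  have "eventually (\<lambda>\<epsilon>. (\<Sum>l\<le>m. \<Sum>l'\<le>m. bform n (\<kappa> \<epsilon>) (\<nu> l) (\<nu> l') / \<epsilon> ^ (l + l')) =
     (\<Sum>a<n. \<Sum>a'<n. (\<Sum>l\<le>m. \<nu> l a / \<epsilon> ^ l) * (\<Sum>l\<le>m. \<nu> l a' / \<epsilon> ^ l) * k (\<epsilon> *\<^sub>R x a) (\<epsilon> *\<^sub>R x a'))) (at_right 0)"
    using ev_pos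
  proof eventually_elim
    case (elim \<epsilon>)
    have "(\<Sum>a<n. \<Sum>a'<n. (\<Sum>l\<le>m. \<nu> l a / \<epsilon> ^ l) * (\<Sum>l\<le>m. \<nu> l a' / \<epsilon> ^ l) * k (\<epsilon> *\<^sub>R x a) (\<epsilon> *\<^sub>R x a'))
      = bform n (\<kappa> \<epsilon>) (\<lambda>a. \<Sum>l\<le>m. 1 / \<epsilon> ^ l * \<nu> l a) (\<lambda>a. \<Sum>l\<le>m. 1 / \<epsilon> ^ l * \<nu> l a)"
      unfolding bform_kernel[OF elim] by simp
    also have "\<dots> = (\<Sum>l\<le>m. \<Sum>l'\<le>m. bform n (\<kappa> \<epsilon>) (\<nu> l) (\<nu> l') / \<epsilon> ^ (l + l'))"
      unfolding bform_expand by (intro sum.cong refl) (simp add: power_add)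
    finally show ?case by simp
  qed
  then have lim: "((\<lambda>\<epsilon>. \<Sum>a<n. \<Sum>a'<n. (\<Sum>l\<le>m. \<nu> l a / \<epsilon> ^ l) * (\<Sum>l\<le>m. \<nu> l a' / \<epsilon> ^ l) * k (\<epsilon> *\<^sub>R x a) (\<epsilon> *\<^sub>R x a')) \<longlongrightarrow> 0) (at_right 0)"
    by (rule Lim_transform_eventually[OF lim0])
  have odd: "c0 (2 * i + 1) = 0" if "i < m" for i by (rule regularity_index_ge[OF _ that]) (simp add: reg)
  have top: "annihilates n x (\<nu> i) (Suc i)"
    by (rule finitely_smooth_annihilates[OF kernel points radial _ regularity_index_eq[OF reg] ann lim i(1)])
      (auto simp only: odd)
  have "(\<Sum>p<b i. c i p * R i i $$ (p, t)) = 0" if t: "t < h i" for t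
  proof -
    have "mons i ! t \<in> set (mons i)" using t unfolding h by simp
    then have "(\<Sum>r\<in>UNIV. (mons i ! t) r) < Suc i" using mo unfolding monomial_ordering_def by auto
    then have "moments (\<nu> i) i t = 0" using top moments_monomial[OF t] unfolding annihilates_def by simp
    then show ?thesis using moments\<nu>[OF i(1) t] by simp
  qed
  from R_diag_left_kernel[OF i(1) this i(2)] show ?thesis .
qed

text \<open>A common source for two invertibility claims. The factor \<open>w p\<close> in the
  second premise makes it void for w = 0, which gives the leading blocks; a general w gives the
  Schur complement.\<close>

lemma finitely_smooth_block_kernel:
  assumes fin: "finitely_smooth_case mons n x k K m"
    and low: "\<And>s. s < N \<Longrightarrow> (\<Sum>s'<N. lead_blocks b H j $$ (s, s') * v s') + (\<Sum>p<b j. left_blocks b H j $$ (p, s) * w p) = 0"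
    and top: "\<And>p. p < b j \<Longrightarrow> ((\<Sum>s<N. left_blocks b H j $$ (p, s) * v s) + (\<Sum>p'<b j. H j j $$ (p, p') * w p')) * w p = 0"
  shows "s < N \<Longrightarrow> v s = 0" "p < b j \<Longrightarrow> w p = 0"
proof -
  \<comment> \<open>The flat index s is translated back to block and row; blocks beyond j receive
    zeros, so that definiteness of all of H up to m applies.\<close>
  define c where "c i p = (if i < j then v (THE s. s < N \<and> block_of s = i \<and> row_of s = p) else if i = j then w p else 0)" for i p
  have cq: "c (block_of s) (row_of s) = v s" if s: "s < N" for s
  proof -
    have "(THE s'. s' < N \<and> block_of s' = block_of s \<and> row_of s' = row_of s) = s"
    proof (rule the_equality)
      fix s' assume s': "s' < N \<and> block_of s' = block_of s \<and> row_of s' = row_of s"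
      then show "s' = s" using s nth_eq_iff_index_eq[OF distinct_block_indices, of s' b j s]
        unfolding N_def block_of_def row_of_def by (auto simp: prod_eq_iff)
    qed (use s in simp)
    then show ?thesis using q_index(1)[OF s] by (simp add: c_def)
  qed
  have conv: "(\<Sum>l\<le>m. \<Sum>p<b l. F l p * c l p) = (\<Sum>s<N. F (block_of s) (row_of s) * v s) + (\<Sum>p<b j. F j p * w p)" for F :: "nat \<Rightarrow> nat \<Rightarrow> real"
  proof -
    have "(\<Sum>l\<le>m. \<Sum>p<b l. F l p * c l p) = (\<Sum>l\<le>j. \<Sum>p<b l. F l p * c l p)"
      by (rule sum.mono_neutral_right) (use j in \<open>auto simp: c_def\<close>)
    also have "\<dots> = (\<Sum>l<j. \<Sum>p<b l. F l p * c l p) + (\<Sum>p<b j. F j p * w p)"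
      by (simp add: lessThan_Suc_atMost[symmetric] c_def)
    also have "(\<Sum>l<j. \<Sum>p<b l. F l p * c l p) = (\<Sum>s<N. F (block_of s) (row_of s) * v s)"
    proof -
      have "(\<Sum>l<j. \<Sum>p<b l. F l p * c l p) = (\<Sum>s<N. (\<lambda>(l, p). F l p * c l p) (block_indices b [0..<j] ! s))"
        unfolding N_def by (subst sum_block_indices) simp
      also have "\<dots> = (\<Sum>s<N. F (block_of s) (row_of s) * c (block_of s) (row_of s))" by (simp add: split_def block_of_def row_of_def)
      also have "\<dots> = (\<Sum>s<N. F (block_of s) (row_of s) * v s)" using cq by simp
      finally show ?thesis .
    qed
    finally show ?thesis .
  qed
  define A where "A i p = (\<Sum>l\<le>m. \<Sum>p'<b l. H i l $$ (p, p') * c l p')" for i p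
  have A: "A i p = (\<Sum>s<N. H i (block_of s) $$ (p, row_of s) * v s) + (\<Sum>p'<b j. H i j $$ (p, p') * w p')" for i p
    unfolding A_def by (rule conv)
  have Aj: "A j p * w p = 0" if p: "p < b j" for p
    using top[OF p] left_index[OF p] unfolding A by simp
  have Al: "A (block_of s) (row_of s) = 0" if s: "s < N" for s
  proof -
    have "H (block_of s) j $$ (row_of s, p') = left_blocks b H j $$ (p', s)" if "p' < b j" for p'
      using H_sym[OF q_index_le[OF s] j q_index(2)[OF s] that] left_index[OF that s] by simp
    then show ?thesis using low[OF s] lead_index[OF s] unfolding A by simp
  qed
  have "(\<Sum>i\<le>m. \<Sum>l\<le>m. \<Sum>p<b i. \<Sum>p'<b l. c i p * H i l $$ (p, p') * c l p') = (\<Sum>i\<le>m. \<Sum>p<b i. A i p * c i p)"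
  proof (rule sum.cong[OF refl])
    fix i
    have "(\<Sum>l\<le>m. \<Sum>p<b i. \<Sum>p'<b l. c i p * H i l $$ (p, p') * c l p') = (\<Sum>p<b i. \<Sum>l\<le>m. \<Sum>p'<b l. c i p * H i l $$ (p, p') * c l p')"
      by (rule sum.swap)
    then show "(\<Sum>l\<le>m. \<Sum>p<b i. \<Sum>p'<b l. c i p * H i l $$ (p, p') * c l p') = (\<Sum>p<b i. A i p * c i p)"
      unfolding A_def by (simp add: sum_distrib_left sum_distrib_right mult_ac)
  qed
  also have "\<dots> = (\<Sum>p<b j. A j p * w p)" unfolding conv using Al by simp
  also have "\<dots> = 0" by (rule sum.neutral) (use Aj in blast)
  finally have z: "(\<Sum>i\<le>m. \<Sum>l\<le>m. \<Sum>p<b i. \<Sum>p'<b l. c i p * H i l $$ (p, p') * c l p') = 0" .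
  note all = finitely_smooth_H_definite[OF fin z]
  show "v s = 0" if s: "s < N" using all[OF q_index_le[OF s] q_index(2)[OF s]] cq[OF s] by simp
  show "w p = 0" if p: "p < b j" using all[OF j p] by (simp add: c_def)
qed

lemma finitely_smooth_lead_invertible:
  assumes fin: "finitely_smooth_case mons n x k K m"
  shows "invertible_mat (lead_blocks b H j)"
proof (rule invertible_mat_trivial_kernel[OF lead_carrier])
  fix v t assume v: "\<And>s. s < N \<Longrightarrow> (\<Sum>t<N. lead_blocks b H j $$ (s, t) * v t) = 0" and t: "t < N"
  show "v t = 0"
    by (rule finitely_smooth_block_kernel(1)[OF fin, where w = "\<lambda>_. 0", OF _ _ t]) (use v in auto)
qed

text \<open>A null vector w of S extends to a null vector of the blocks up to j, with the
  coordinates v below j obtained by solving the lower equations for given w.\<close>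

lemma finitely_smooth_S_invertible:
  assumes fin: "finitely_smooth_case mons n x k K m"
  shows "invertible_mat S"
proof (rule invertible_mat_trivial_kernel[OF S_carrier])
  show inv: "invertible_mat (lead_blocks b H j)" by (rule finitely_smooth_lead_invertible[OF fin])
  let ?L = "left_blocks b H j" and ?A = "lead_blocks b H j"
  let ?G = "inv_mat ?A"
  note G = inv_mat_props[OF lead_carrier inv]
  fix w p assume w: "\<And>p. p < b j \<Longrightarrow> (\<Sum>p'<b j. S $$ (p, p') * w p') = 0" and p: "p < b j"
  define y where "y s = (\<Sum>p<b j. ?L $$ (p, s) * w p)" for s
  define v where "v s = - (\<Sum>s'<N. ?G $$ (s, s') * y s')" for s
  show "w p = 0"
  proof (rule finitely_smooth_block_kernel(2)[OF fin, where v = v, OF _ _ p])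
    fix s assume s: "s < N"
    have "(\<Sum>s'<N. ?A $$ (s, s') * (\<Sum>t<N. ?G $$ (s', t) * y t)) = (\<Sum>s'<N. \<Sum>t<N. ?A $$ (s, s') * ?G $$ (s', t) * y t)"
      by (simp add: sum_distrib_left mult.assoc)
    also have "\<dots> = (\<Sum>t<N. \<Sum>s'<N. ?A $$ (s, s') * ?G $$ (s', t) * y t)" by (rule sum.swap)
    also have "\<dots> = (\<Sum>t<N. (?A * ?G) $$ (s, t) * y t)"
      using mat_mult_index_sum[OF lead_carrier G(1) s] by (intro sum.cong refl) (simp add: sum_distrib_right)
    also have "\<dots> = (\<Sum>t<N. if t = s then y s else 0)" unfolding G(2) using s by (intro sum.cong refl) auto
    also have "\<dots> = y s" using s by simp
    finally show "(\<Sum>s'<N. ?A $$ (s, s') * v s') + (\<Sum>p<b j. ?L $$ (p, s) * w p) = 0"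
      unfolding v_def by (simp add: sum_negf y_def)
  next
    fix p assume p: "p < b j"
    have "(\<Sum>s<N. ?L $$ (p, s) * (\<Sum>t<N. ?G $$ (s, t) * y t))
      = (\<Sum>s<N. \<Sum>t<N. \<Sum>p'<b j. ?L $$ (p, s) * ?G $$ (s, t) * ?L $$ (p', t) * w p')"
      unfolding y_def by (simp add: sum_distrib_left mult.assoc)
    also have "\<dots> = (\<Sum>s<N. \<Sum>p'<b j. \<Sum>t<N. ?L $$ (p, s) * ?G $$ (s, t) * ?L $$ (p', t) * w p')"
      by (intro sum.cong refl sum.swap)
    also have "\<dots> = (\<Sum>p'<b j. \<Sum>s<N. \<Sum>t<N. ?L $$ (p, s) * ?G $$ (s, t) * ?L $$ (p', t) * w p')" by (rule sum.swap)
    also have "\<dots> = (\<Sum>p'<b j. (\<Sum>s<N. \<Sum>t<N. ?L $$ (p, s) * ?G $$ (s, t) * ?L $$ (p', t)) * w p')"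
      by (simp add: sum_distrib_right)
    finally have "(\<Sum>s<N. ?L $$ (p, s) * v s) = - (\<Sum>p'<b j. (\<Sum>s<N. \<Sum>t<N. ?L $$ (p, s) * ?G $$ (s, t) * ?L $$ (p', t)) * w p')"
      unfolding v_def by (simp add: sum_negf)
    then have "(\<Sum>s<N. ?L $$ (p, s) * v s) + (\<Sum>p'<b j. H j j $$ (p, p') * w p') = (\<Sum>p'<b j. S $$ (p, p') * w p')"
      by (simp add: S_index[OF inv p] left_diff_distrib sum_subtractf)
    then show "((\<Sum>s<N. ?L $$ (p, s) * v s) + (\<Sum>p'<b j. H j j $$ (p, p') * w p')) * w p = 0"
      using w[OF p] by simp
  qed
qed

end

section \<open>Full column rank: from H to the Wronskian\<close>

lemma mat_mult_assoc_dim: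
  fixes A B C :: "'a :: semiring_0 mat"
  shows "dim_col A = dim_row B \<Longrightarrow> dim_col B = dim_row C \<Longrightarrow> A * B * C = A * (B * C)"
  by (rule assoc_mult_mat[of A "dim_row A" "dim_col A" B "dim_col B" C "dim_col C"]) auto

lemma congruence_transpose_assoc:
  fixes R w D G :: "'a :: comm_semiring_0 mat"
  assumes "R \<in> carrier_mat b h" "w \<in> carrier_mat h N" "D \<in> carrier_mat N N" "G \<in> carrier_mat N N"
  shows "R * (w * (transpose_mat D * G * D) * transpose_mat w) * transpose_mat R
    = R * w * transpose_mat D * G * transpose_mat (R * w * transpose_mat D)"
proof -
  have "transpose_mat (R * w * transpose_mat D) = transpose_mat (transpose_mat D) * transpose_mat (R * w)"
    by (rule transpose_mult[of _ b N _ N]) (use assms in auto)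
  also have "\<dots> = D * (transpose_mat w * transpose_mat R)"
    using transpose_mult[OF assms(1,2)] by simp
  finally show ?thesis
    using assms[THEN carrier_matD(1)] assms[THEN carrier_matD(2)] by (simp add: mat_mult_assoc_dim)
qed

context kernel_flat_limit
begin

text \<open>The block diagonal matrix of R_ii for i < j, provided these blocks are square; rows and
  columns share one list of indices, so the lemmas on its entries assume b i = h i below j.\<close>

definition R_diag where "R_diag = Matrix.mat N N (\<lambda>(s, t). if block_of s = block_of t then R (block_of s) (block_of s) $$ (row_of s, row_of t) else 0)"

lemma R_diag_carrier: "R_diag \<in> carrier_mat N N"
  unfolding R_diag_def by simp

lemma R_diag_sum:
  assumes full: "\<forall>i<j. b i = h i" and s: "s < N"
  shows "(\<Sum>t<N. R_diag $$ (s, t) * f (block_of t) (row_of t)) = (\<Sum>p<h (block_of s). R (block_of s) (block_of s) $$ (row_of s, p) * f (block_of s) p)"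
proof -
  have "(\<Sum>t<N. R_diag $$ (s, t) * f (block_of t) (row_of t))
    = (\<Sum>t<N. (\<lambda>(l, p). if l = block_of s then R (block_of s) (block_of s) $$ (row_of s, p) * f (block_of s) p else 0) (block_indices b [0..<j] ! t))"
    using s by (intro sum.cong refl) (simp add: R_diag_def split_def block_of_def row_of_def)
  also have "\<dots> = (\<Sum>l<j. \<Sum>p<b l. if l = block_of s then R (block_of s) (block_of s) $$ (row_of s, p) * f (block_of s) p else 0)"
    unfolding N_def by (subst sum_block_indices) simp
  also have "\<dots> = (\<Sum>l<j. if l = block_of s then \<Sum>p<h (block_of s). R (block_of s) (block_of s) $$ (row_of s, p) * f (block_of s) p else 0)"
    using full by (intro sum.cong refl) auto
  also have "\<dots> = (\<Sum>p<h (block_of s). R (block_of s) (block_of s) $$ (row_of s, p) * f (block_of s) p)" using q_index(1)[OF s] by simp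
  finally show ?thesis .
qed

lemma block_indices_full:
  assumes "\<forall>i<j. b i = h i"
  shows "block_indices h [0..<j] = block_indices b [0..<j]"
  unfolding block_indices_def using assms by (intro arg_cong[where f = concat] map_cong) auto

lemma W_blocks:
  assumes full: "\<forall>i<j. b i = h i"
  shows "lead_blocks h W j \<in> carrier_mat N N" "left_blocks h W j \<in> carrier_mat (h j) N"
    "s < N \<Longrightarrow> t < N \<Longrightarrow> lead_blocks h W j $$ (s, t) = W (block_of s) (block_of t) $$ (row_of s, row_of t)"
    "p < h j \<Longrightarrow> t < N \<Longrightarrow> left_blocks h W j $$ (p, t) = W j (block_of t) $$ (p, row_of t)"
  unfolding lead_blocks_def left_blocks_def block_mat_def block_indices_full[OF full] N_def block_of_def row_of_def
  by (simp_all add: Let_def block_indices_def[of h "[j]"])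

lemma lead_factor:
  assumes full: "\<forall>i<j. b i = h i"
  shows "lead_blocks b H j = R_diag * lead_blocks h W j * transpose_mat R_diag"
proof (rule eq_matI)
  note Wc = W_blocks[OF full] and Dc = R_diag_carrier
  show "dim_row (lead_blocks b H j) = dim_row (R_diag * lead_blocks h W j * transpose_mat R_diag)"
    "dim_col (lead_blocks b H j) = dim_col (R_diag * lead_blocks h W j * transpose_mat R_diag)"
    using lead_carrier Dc by auto
  fix s s' assume "s < dim_row (R_diag * lead_blocks h W j * transpose_mat R_diag)" "s' < dim_col (R_diag * lead_blocks h W j * transpose_mat R_diag)"
  then have s: "s < N" "s' < N" using Dc by auto
  have DW: "R_diag * lead_blocks h W j \<in> carrier_mat N N" "transpose_mat R_diag \<in> carrier_mat N N" using Dc Wc(1) by auto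
  have "(R_diag * lead_blocks h W j * transpose_mat R_diag) $$ (s, s') = (\<Sum>t'<N. (\<Sum>t<N. R_diag $$ (s, t) * W (block_of t) (block_of t') $$ (row_of t, row_of t')) * R_diag $$ (s', t'))"
    unfolding mat_mult_index_sum[OF DW s]
    using mat_mult_index_sum[OF Dc Wc(1) s(1)] Wc(3) s Dc by (intro sum.cong refl) simp
  also have "\<dots> = (\<Sum>t'<N. R_diag $$ (s', t') * (\<Sum>t<N. R_diag $$ (s, t) * W (block_of t) (block_of t') $$ (row_of t, row_of t')))"
    by (simp only: mult.commute)
  also have "\<dots> = (\<Sum>q<h (block_of s'). R (block_of s') (block_of s') $$ (row_of s', q) * (\<Sum>t<N. R_diag $$ (s, t) * W (block_of t) (block_of s') $$ (row_of t, q)))"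
    by (rule R_diag_sum[OF full s(2)])
  also have "\<dots> = (\<Sum>q<h (block_of s'). R (block_of s') (block_of s') $$ (row_of s', q) * (\<Sum>p<h (block_of s). R (block_of s) (block_of s) $$ (row_of s, p) * W (block_of s) (block_of s') $$ (p, q)))"
  proof (rule sum.cong[OF refl])
    fix q
    show "R (block_of s') (block_of s') $$ (row_of s', q) * (\<Sum>t<N. R_diag $$ (s, t) * W (block_of t) (block_of s') $$ (row_of t, q))
      = R (block_of s') (block_of s') $$ (row_of s', q) * (\<Sum>p<h (block_of s). R (block_of s) (block_of s) $$ (row_of s, p) * W (block_of s) (block_of s') $$ (p, q))"
      unfolding R_diag_sum[OF full s(1), of "\<lambda>l r. W l (block_of s') $$ (r, q)"] ..
  qed
  also have "\<dots> = (\<Sum>q<h (block_of s'). \<Sum>p<h (block_of s). R (block_of s) (block_of s) $$ (row_of s, p) * W (block_of s) (block_of s') $$ (p, q) * R (block_of s') (block_of s') $$ (row_of s', q))"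
    by (simp add: sum_distrib_left mult_ac)
  also have "\<dots> = lead_blocks b H j $$ (s, s')"
    unfolding lead_index[OF s] H_index[OF q_index_le[OF s(1)] q_index_le[OF s(2)] q_index(2)[OF s(1)] q_index(2)[OF s(2)]]
    by (rule sum.swap)
  finally show "lead_blocks b H j $$ (s, s') = (R_diag * lead_blocks h W j * transpose_mat R_diag) $$ (s, s')" by simp
qed

lemma left_factor:
  assumes full: "\<forall>i<j. b i = h i"
  shows "left_blocks b H j = R j j * left_blocks h W j * transpose_mat R_diag"
proof (rule eq_matI)
  note Wc = W_blocks[OF full] and Dc = R_diag_carrier and Rc = R_carrier[OF j j]
  show "dim_row (left_blocks b H j) = dim_row (R j j * left_blocks h W j * transpose_mat R_diag)"
    "dim_col (left_blocks b H j) = dim_col (R j j * left_blocks h W j * transpose_mat R_diag)"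
    using left_carrier Dc Rc by auto
  fix p s' assume "p < dim_row (R j j * left_blocks h W j * transpose_mat R_diag)" "s' < dim_col (R j j * left_blocks h W j * transpose_mat R_diag)"
  then have p: "p < b j" and s: "s' < N" using Dc Rc by auto
  have DW: "R j j * left_blocks h W j \<in> carrier_mat (b j) N" "transpose_mat R_diag \<in> carrier_mat N N" using Dc Rc Wc(2) by auto
  have "(R j j * left_blocks h W j * transpose_mat R_diag) $$ (p, s') = (\<Sum>t'<N. (\<Sum>t<h j. R j j $$ (p, t) * W j (block_of t') $$ (t, row_of t')) * R_diag $$ (s', t'))"
    unfolding mat_mult_index_sum[OF DW p s]
    using mat_mult_index_sum[OF Rc Wc(2) p] Wc(4) s Dc by (intro sum.cong refl) simp
  also have "\<dots> = (\<Sum>t'<N. R_diag $$ (s', t') * (\<Sum>t<h j. R j j $$ (p, t) * W j (block_of t') $$ (t, row_of t')))"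
    by (simp only: mult.commute)
  also have "\<dots> = (\<Sum>q<h (block_of s'). R (block_of s') (block_of s') $$ (row_of s', q) * (\<Sum>t<h j. R j j $$ (p, t) * W j (block_of s') $$ (t, q)))"
    by (rule R_diag_sum[OF full s])
  also have "\<dots> = (\<Sum>q<h (block_of s'). \<Sum>t<h j. R j j $$ (p, t) * W j (block_of s') $$ (t, q) * R (block_of s') (block_of s') $$ (row_of s', q))"
    by (simp add: sum_distrib_left mult_ac)
  also have "\<dots> = left_blocks b H j $$ (p, s')"
    unfolding left_index[OF p s] H_index[OF j q_index_le[OF s] p q_index(2)[OF s]]
    by (rule sum.swap)
  finally show "left_blocks b H j $$ (p, s') = (R j j * left_blocks h W j * transpose_mat R_diag) $$ (p, s')" by simp
qed

lemma Q_transpose_V: "transpose_mat (Q j) * V j = R j j"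
proof (rule eq_matI)
  note c = Q_carrier[OF j] R_carrier[OF j j] V_carrier[of j]
  show "dim_row (transpose_mat (Q j) * V j) = dim_row (R j j)" "dim_col (transpose_mat (Q j) * V j) = dim_col (R j j)"
    using c by auto
  fix p t assume "p < dim_row (R j j)" "t < dim_col (R j j)"
  then have p: "p < b j" and t: "t < h j" using c by auto
  have QT: "transpose_mat (Q j) \<in> carrier_mat (b j) n" using c by simp
  show "(transpose_mat (Q j) * V j) $$ (p, t) = R j j $$ (p, t)"
    unfolding mat_mult_index_sum[OF QT c(3) p t] using Q_V[OF j t j p] c p by simp
qed

text \<open>With D = \<open>R_diag\<close>, the leading blocks of H are D A D^T with A the leading
  blocks of W. Invertibility of the product of square matrices passes to the factors, A^(-1) = D^T G
  D, and the factors D cancel in the Schur complement. The outer R_jj is Q_j^T V_j.\<close>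

lemma full_rank_blocks:
  assumes full: "\<forall>i<j. b i = h i" and inv: "invertible_mat (lead_blocks b H j)"
  shows "invertible_mat (lead_blocks h W j)"
    and "Q j * S * transpose_mat (Q j) =
      Q j * transpose_mat (Q j) * V j *
      (W j j - left_blocks h W j * inv_mat (lead_blocks h W j) * upper_blocks h W j) *
      transpose_mat (V j) * Q j * transpose_mat (Q j)"
proof -
  let ?A = "lead_blocks h W j" and ?L = "lead_blocks b H j" and ?w = "left_blocks h W j"
  let ?G = "inv_mat ?L" and ?R = "R j j" and ?R_diag = R_diag
  note G = inv_mat_props[OF lead_carrier inv]
  note Ac = W_blocks(1,2)[OF full]
  have Wc: "W j j \<in> carrier_mat (h j) (h j)" unfolding W wronskian_def h by simp
  note dims = carrier_matD[OF Ac(1)] carrier_matD[OF Ac(2)] carrier_matD[OF R_diag_carrier] carrier_matD[OF G(1)]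
    carrier_matD[OF R_carrier[OF j j]] carrier_matD[OF Q_carrier[OF j]] carrier_matD[OF V_carrier[of j]] carrier_matD[OF Wc]
  let ?Y = "transpose_mat ?R_diag * ?G * ?R_diag"
  have Yc: "?Y \<in> carrier_mat N N" by (rule carrier_matI) (simp_all add: dims)
  have "?R_diag * (?A * transpose_mat ?R_diag * ?G) = 1\<^sub>m N"
  proof -
    have "?R_diag * (?A * transpose_mat ?R_diag * ?G) = ?R_diag * ?A * transpose_mat ?R_diag * ?G" by (simp add: mat_mult_assoc_dim dims)
    then show ?thesis using G(2) lead_factor[OF full] by simp
  qed
  \<comment> \<open>The right inverse of D is also its left inverse, which moves D to the right end
    and exhibits the inverse of A.\<close>
  then have "?A * transpose_mat ?R_diag * ?G * ?R_diag = 1\<^sub>m N"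
    by (rule mat_mult_left_right_inverse[OF R_diag_carrier carrier_matI, rotated -1]) (simp_all add: dims)
  then have AY: "?A * ?Y = 1\<^sub>m N" by (simp add: mat_mult_assoc_dim dims)
  have YA: "?Y * ?A = 1\<^sub>m N" by (rule mat_mult_left_right_inverse[OF Ac(1) Yc AY])
  show invA: "invertible_mat ?A"
    unfolding invertible_mat_def inverts_mat_def square_mat.simps using AY YA dims Yc by auto
  note B = inv_mat_props[OF Ac(1) invA]
  have "inv_mat ?A = inv_mat ?A * (?A * ?Y)" unfolding AY using B(1) by simp
  also have "\<dots> = inv_mat ?A * ?A * ?Y" by (rule assoc_mult_mat[OF B(1) Ac(1) Yc, symmetric])
  also have "\<dots> = ?Y" unfolding B(3) by (rule left_mult_one_mat[OF Yc])
  finally have invY: "inv_mat ?A = ?Y" .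
  let ?M = "W j j - ?w * inv_mat ?A * upper_blocks h W j"
  have "?R * ?M * transpose_mat ?R = S"
  proof -
    have wc: "?w * ?Y * transpose_mat ?w \<in> carrier_mat (h j) (h j)" by (rule carrier_matI) (simp_all add: dims)
    have "?R * ?M * transpose_mat ?R = (?R * W j j - ?R * (?w * ?Y * transpose_mat ?w)) * transpose_mat ?R"
      unfolding invY upper_blocks_def by (subst mult_minus_distrib_mat[OF R_carrier[OF j j] Wc wc]) (rule refl)
    also have "\<dots> = ?R * W j j * transpose_mat ?R - ?R * (?w * ?Y * transpose_mat ?w) * transpose_mat ?R"
      by (rule minus_mult_distrib_mat[of _ "b j" "h j" _ _ "b j"])
        (intro mult_carrier_mat[OF R_carrier[OF j j]] Wc wc transpose_carrier_mat[THEN iffD2] R_carrier[OF j j])+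
    also have "?R * (?w * ?Y * transpose_mat ?w) * transpose_mat ?R = left_blocks b H j * ?G * upper_blocks b H j"
      unfolding upper_blocks_def left_factor[OF full]
      by (rule congruence_transpose_assoc[OF R_carrier[OF j j] Ac(2) R_diag_carrier G(1)])
    also have "?R * W j j * transpose_mat ?R = H j j" unfolding H RWR_def ..
    finally show ?thesis unfolding schur_complement_def .
  qed
  moreover have "transpose_mat (V j) * Q j = transpose_mat ?R"
    unfolding Q_transpose_V[symmetric]
    using transpose_mult[OF transpose_carrier_mat[THEN iffD2, OF Q_carrier[OF j]] V_carrier[of j]] by simp
  moreover have "Q j * transpose_mat (Q j) * V j * M * transpose_mat (V j) * Q j * transpose_mat (Q j)
    = Q j * ((transpose_mat (Q j) * V j) * M * (transpose_mat (V j) * Q j)) * transpose_mat (Q j)"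
    if "M \<in> carrier_mat (h j) (h j)" for M
    by (simp add: mat_mult_assoc_dim dims carrier_matD[OF that])
  moreover have "?M \<in> carrier_mat (h j) (h j)"
    unfolding upper_blocks_def using Ac(2) B(1)
    by (intro minus_carrier_mat mult_carrier_mat transpose_carrier_mat[THEN iffD2])
  ultimately show "Q j * S * transpose_mat (Q j) = Q j * transpose_mat (Q j) * V j * ?M * transpose_mat (V j) * Q j * transpose_mat (Q j)"
    unfolding Q_transpose_V by metis
qed

end

lemma poly_dim_0: "poly_dim TYPE('d::finite) 0 = 1"
  by (simp add: poly_dim_def)

context vandermonde_qr
begin

text \<open>V_0 is a column of ones, so Q_0 cannot be empty.\<close>

lemma vrank_0_pos:
  assumes mo: "monomial_ordering mons" and n: "1 \<le> n"
  shows "0 < vrank mons n x 0"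
proof (rule ccontr)
  assume "\<not> 0 < vrank mons n x 0"
  then have b0: "b 0 = 0" by (simp add: b rank_jump_def)
  have set0: "set (mons 0) = {\<alpha>. (\<Sum>i\<in>UNIV. \<alpha> i) = 0}" using mo unfolding monomial_ordering_def by blast
  then have "(\<lambda>_. 0) \<in> set (mons 0)" by simp
  then have h0: "0 < h 0" unfolding h by (rule length_pos_if_in_set)
  then have "mons 0 ! 0 \<in> set (mons 0)" unfolding h by simp
  then have "monomial (mons 0 ! 0) (x 0) = 1" unfolding set0 monomial_def by simp
  then have "V 0 $$ (0, 0) = 1" using n h0 unfolding vandermonde_def h by simp
  then show False using V_decomp[of 0 0 0] n h0 b0 by simp
qed

text \<open>Each b i is at most h i, and full column rank makes the sums equal, so equality holds in
  every degree.\<close>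

lemma rank_jump_full:
  assumes mo: "monomial_ordering mons" and j: "0 < j" "j \<le> m"
    and full: "vrank mons n x (j - 1) = poly_dim TYPE('d) (j - 1)"
  shows "\<forall>i<j. b i = h i"
proof (intro allI impI)
  fix i assume "i < j"
  then have i: "i \<in> {..j - 1}" by auto
  have "(\<Sum>i\<le>j - 1. b i) = (\<Sum>i\<le>j - 1. h i)"
    unfolding b sum_rank_jump full h sum_monomials_poly_dim[OF mo] ..
  then show "b i = h i"
    by (rule sum_mono_inv[OF _ _ i]) (use b_le_h j in auto)
qed

end

text \<open>In the smooth case H is only a limit of positive definite matrices and may be singular,
  so invertibility of its leading blocks is assumed and the count asks for invertible S. An example:
  exp(x_1^3 y_1^3 + x_2^3 y_2^3) on the plane is positive definite, but at two points of the first
  axis and j = 1 one has W_{1,1} = 0 and S = 0; the second eigenvalue is of order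
  \<epsilon>^6.\<close>

theorem corollary6p18:
  fixes n m j :: nat
    and x :: "nat \<Rightarrow> real ^ 'd :: finite"
    and mons :: "nat \<Rightarrow> ('d \<Rightarrow> nat) list"
    and k :: "real ^ 'd \<Rightarrow> real ^ 'd \<Rightarrow> real"
    and K :: "real \<Rightarrow> real mat"
    and Q :: "nat \<Rightarrow> real mat"
    and R W H :: "nat \<Rightarrow> nat \<Rightarrow> real mat"
    and b h :: "nat \<Rightarrow> nat"
    and S :: "real mat"
    and lam :: "nat \<Rightarrow> real \<Rightarrow> real"
    and u :: "nat \<Rightarrow> real \<Rightarrow> real vec"
  assumes n: "1 \<le> n" and points: "inj_on x {..<n}"
    and mons: "monomial_ordering mons"
    and kernel: "positive_definite_kernel k"
    and QR: "block_QR mons n x m Q R"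
    and b: "b = rank_jump mons n x" and h: "h = (\<lambda>l. length (mons l))"
    and W: "W = wronskian mons k" and H: "H = RWR R W"
    and S: "S = schur_complement b H j"
    and cases: "(smooth_case mons n x k K m \<and> invertible_mat (lead_blocks b H j)) \<or>
                finitely_smooth_case mons n x k K m"
    and j: "j \<le> m"
    and eigen: "analytic_eigendecomposition n K lam u"
  shows
    "(vrank mons n x j < poly_dim TYPE('d) j \<and>
      vrank mons n x (j - 1) = poly_dim TYPE('d) (j - 1) \<longrightarrow>
        (finitely_smooth_case mons n x k K m \<or> invertible_mat S \<longrightarrow>
          card {i. i < n \<and> of_order (lam i) (2 * j)} = vrank mons n x j - poly_dim TYPE('d) (j - 1)) \<and>
        invertible_mat (lead_blocks b H j) \<and> invertible_mat (lead_blocks h W j) \<and>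
        coeff_mat (spectral_equivalent n lam u) (2 * j) = Q j * S * transpose_mat (Q j) \<and>
        Q j * S * transpose_mat (Q j) =
          Q j * transpose_mat (Q j) * vandermonde mons n x j *
          (W j j - left_blocks h W j * inv_mat (lead_blocks h W j) * upper_blocks h W j) *
          transpose_mat (vandermonde mons n x j) * Q j * transpose_mat (Q j)) \<and>
     (vrank mons n x j < poly_dim TYPE('d) j \<and>
      vrank mons n x (j - 1) < poly_dim TYPE('d) (j - 1) \<longrightarrow>
        (finitely_smooth_case mons n x k K m \<or> invertible_mat S \<longrightarrow>
          card {i. i < n \<and> of_order (lam i) (2 * j)} = vrank mons n x j - vrank mons n x (j - 1)) \<and>
        invertible_mat (lead_blocks b H j) \<and>
        coeff_mat (spectral_equivalent n lam u) (2 * j) = Q j * S * transpose_mat (Q j) \<and>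
        S = H j j - left_blocks b H j * inv_mat (lead_blocks b H j) * upper_blocks b H j)"
proof -
  have one: "smooth_case mons n x k K m \<or> finitely_smooth_case mons n x k K m" using cases by blast
  interpret kernel_flat_limit mons n m x Q R b h k K W H lam u j
    by unfold_locales
      (fact QR b h mons kernel points W H j eigen case_kernel_C[OF one] case_kernel_mat[OF one])+
  have lead: "invertible_mat (lead_blocks b H j)"
    using cases finitely_smooth_lead_invertible by blast
  have S_inv: "invertible_mat S" if "finitely_smooth_case mons n x k K m \<or> invertible_mat S"
    using that finitely_smooth_S_invertible unfolding S by blast
  have card: "card {i. i < n \<and> of_order (lam i) (2 * j)} = b j" if "finitely_smooth_case mons n x k K m \<or> invertible_mat S"
    by (rule card_of_order[OF lead]) (use S_inv[OF that] in \<open>simp only: S\<close>)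
  \<comment> \<open>For j = 0 the polynomial space has dimension 1 and the rank is positive, so
    there is no deficiency; hence j - 1 is a true predecessor.\<close>
  have pos: "0 < j" if "vrank mons n x j < poly_dim TYPE('d) j"
    using that vrank_0_pos[OF mons n] poly_dim_0[where ?'d = 'd] by (cases j) auto
  have bj: "b j = vrank mons n x j - vrank mons n x (j - 1)" if "0 < j"
    using that by (simp add: b rank_jump_def)
  have coeff: "coeff_mat (spectral_equivalent n lam u) (2 * j) = Q j * S * transpose_mat (Q j)"
    unfolding S by (rule coeff_mat_eq[OF lead])
  show ?thesis
  proof (rule conjI; rule impI; elim conjE)
    assume "vrank mons n x j < poly_dim TYPE('d) j" and full: "vrank mons n x (j - 1) = poly_dim TYPE('d) (j - 1)"
    then have j0: "0 < j" using pos by blast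
    note fb = full_rank_blocks[OF rank_jump_full[OF mons j0 j full] lead]
    show "(finitely_smooth_case mons n x k K m \<or> invertible_mat S \<longrightarrow>
          card {i. i < n \<and> of_order (lam i) (2 * j)} = vrank mons n x j - poly_dim TYPE('d) (j - 1)) \<and>
        invertible_mat (lead_blocks b H j) \<and> invertible_mat (lead_blocks h W j) \<and>
        coeff_mat (spectral_equivalent n lam u) (2 * j) = Q j * S * transpose_mat (Q j) \<and>
        Q j * S * transpose_mat (Q j) =
          Q j * transpose_mat (Q j) * vandermonde mons n x j *
          (W j j - left_blocks h W j * inv_mat (lead_blocks h W j) * upper_blocks h W j) *
          transpose_mat (vandermonde mons n x j) * Q j * transpose_mat (Q j)"
      using card bj[OF j0] full lead fb(1) coeff fb(2)[folded S] by (intro conjI) auto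
  next
    assume "vrank mons n x j < poly_dim TYPE('d) j"
    then have j0: "0 < j" by (rule pos)
    show "(finitely_smooth_case mons n x k K m \<or> invertible_mat S \<longrightarrow>
          card {i. i < n \<and> of_order (lam i) (2 * j)} = vrank mons n x j - vrank mons n x (j - 1)) \<and>
        invertible_mat (lead_blocks b H j) \<and>
        coeff_mat (spectral_equivalent n lam u) (2 * j) = Q j * S * transpose_mat (Q j) \<and>
        S = H j j - left_blocks b H j * inv_mat (lead_blocks b H j) * upper_blocks b H j"
      using card bj[OF j0] lead coeff S unfolding schur_complement_def by (intro conjI) auto
  qed
qed

end
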